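(* Let $q$ be a prime power, $f_1=t-1$, and $1\le k\le n$. For each $\Phi^*$-colored partition $\tilde{\boldsymbol\lambda}\in\mathcal P_n^{\Phi^*}$, the value of the irreducible character $\chi^{\tilde{\boldsymbol\lambda}}$ of $\mathrm{GL}_n(\mathbb F_q)$ on the unipotent class of hook type $(k,1^{n-k})$ is $$\chi^{\tilde{\boldsymbol\lambda}}_{(k,1^{n-k})(f_1)}=(-1)^{k}q^{n}\sum_{\tilde{\boldsymbol\tau}\subset\underline{\tilde{\boldsymbol\lambda}}}\mathcal B(q;\tilde{\boldsymbol\tau})\sum_{\tilde{\boldsymbol\rho}}d(\tilde{\boldsymbol\rho}').$$ Here the outer sum is over all $\Phi^*$-colored compositions $\tilde{\boldsymbol\tau}$ such that, for each $\phi$, $\tilde{\boldsymbol\tau}(\phi)$ has exactly $l(\tilde{\boldsymbol\lambda}(\phi))$ parts, all positive, and $\tilde{\boldsymbol\tau}(\phi)\subset\underline{\tilde{\boldsymbol\lambda}(\phi)}$; the inner sum is over all $\tilde{\boldsymbol\rho}\in\mathcal P^{\Phi^*}_{\|\tilde{\boldsymbol\tau}\|-k}$ with $l(\tilde{\boldsymbol\rho}(\phi))\le1$ for each $\phi\in\Phi^*$ (empty sum if $\|\tilde{\boldsymbol\tau}\|<k$); $\tilde{\boldsymbol\rho}'$ is the $\Phi^*$-colored integer sequence $\tilde{\boldsymbol\rho}'(\phi)=[\tilde{\boldsymbol\lambda}(\phi)-\tilde{\boldsymbol\tau}(\phi),\tilde{\boldsymbol\rho}(\phi)]$ (concatenation);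 $$\mathcal B(q;\tilde{\boldsymbol\tau})=\prod_{\phi\in\Phi^*}\prod_{i=1}^{l(\tilde{\boldsymbol\tau}(\phi))}B(q^{|\phi|};\tilde{\boldsymbol\tau}(\phi)_i),\qquad B(q^{|\phi|};j)=\begin{cases}-1,& j=1,\\ q^{-|\phi|}-1,& j>1;\end{cases}$$ and $d(\cdot)$ is the degree function, given for a colored partition $\tilde{\boldsymbol\nu}$ of weight $N$ by $$d(\tilde{\boldsymbol\nu})=\prod_{i=1}^N(q^i-1)\prod_{\phi\in\Phi^*}\frac{q_\phi^{\,n(\tilde{\boldsymbol\nu}(\phi)')}}{\prod_{x\in\tilde{\boldsymbol\nu}(\phi)}(q_\phi^{h(x)}-1)},\qquad q_\phi=q^{|\phi|},$$ and extended to colored integer sequences by straightening as explained in the context.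
   Context: $M_n=\mathbb F_{q^n}^\times\subset M=\overline{\mathbb F}_q^\times$; $M_n^*$ is the group of complex characters of $M_n$, with $M_m^*\subset M_n^*$ for $m\mid n$ (via the norm map); $M^*=\bigcup_n M_n^*$. The Frobenius $x\mapsto x^q$ acts on $M$ and $M^*$; $\Phi$ and $\Phi^*$ are the sets of its orbits in $M$ and $M^*$. Elements of $\Phi$ are identified with monic irreducible polynomials $f\ne t$ over $\mathbb F_q$, $|f|=\deg f$; $|\phi|$ is the size of $\phi\in\Phi^*$. $\mathcal F_G=\bigotimes_{\phi\in\Phi^*}\mathbb C[p_n(\phi):n\ge1]$ is the polynomial algebra on independent generators $p_n(\phi)$, with inner product in which the monomials $p_{\tilde{\boldsymbol\lambda}}=\prod_\phi p_{\tilde{\boldsymbol\lambda}(\phi)}(\phi)$ are orthogonal with $\langle p_{\tilde{\boldsymbol\lambda}},p_{\tilde{\boldsymbol\lambda}}\rangle=\prod_\phi z_{\tilde{\boldsymbol\lambda}(\phi)}$ ($z_\lambda=\prod_i i^{m_i}m_i!$ for $\lambda=(1^{m_1}2^{m_2}\cdots)$). For $f\in\Phi$ with root $x$, $$p_n(f)=\frac{(-1)^{n|f|-1}}{q^{n|f|}-1}\sum_{\xi\in M^*_{n|f|}}\overline{\xi(x)}\,p_{n|f|/|\phi_\xi|}(\phi_\xi),$$ where $\phi_\xi$ is the orbit of $\xi$; the $p_n(f)$ ($n\ge1$, $f\in\Phi$) are also algebraically independent generators of $\mathcal F_G$. In particular $p_n(f_1)=\frac{(-1)^{n-1}}{q^n-1}\sum_{|\phi|\,\mid\,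 n}|\phi|\,p_{n/|\phi|}(\phi)$. Here $\partial/\partial p_n(\phi)$ is taken with respect to the generators indexed by $\Phi^*$ and $\partial/\partial p_n(f)$ with respect to those indexed by $\Phi$. The operators $S_n(\phi)$, $Q_n(f_1)\in\mathrm{End}(\mathcal F_G)$, $n\in\mathbb Z$, are defined by $$\sum_{n\in\mathbb Z}S_n(\phi)z^n=\exp\Big(\sum_{n\ge1}\tfrac1n p_n(\phi)z^n\Big)\exp\Big(-\sum_{n\ge1}\tfrac{\partial}{\partial p_n(\phi)}z^{-n}\Big),$$ $$\sum_{n\in\mathbb Z}Q_n(f_1)z^{n}=\exp\Big(\sum_{n\ge1}\tfrac{q^{n}-1}{n}p_n(f_1)z^n\Big)\exp\Big(-\sum_{n\ge1}q^{-n}\tfrac{\partial}{\partial p_n(f_1)}z^{-n}\Big).$$ For an integer sequence $\alpha=(\alpha_1,\dots,\alpha_l)$, $S_\alpha(\phi)=S_{\alpha_1}(\phi)\cdots S_{\alpha_l}(\phi)$ (identity if $l=0$); operators of different colors commute; "$X.1$" is the operator $X$ applied to $1\in\mathcal F_G$. Colored partitions/compositions: maps from $\Phi^*$ to partitions/compositions with finite weight $\|\tilde{\boldsymbol\lambda}\|=\sum_\phi|\phi||\tilde{\boldsymbol\lambda}(\phi)|$; $\mathcal P_n^{\Phi^*}$ is the set of colored partitions of weight $n$. $l(\lambda)$ is the number of nonzero parts, $\lambda'$ the conjugate partition, $n(\lambda)=\sum_i(i-1)\lambda_i$, and $h(x)=\lambda_i+\lambda'_j-i-j+1$ is the hook length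 of the node $x=(i,j)$ of the Young diagram of $\lambda$. For $\lambda=(\lambda_1,\dots,\lambda_l)$, $l=l(\lambda)$, $\underline\lambda=(\lambda_1+l,\lambda_2+l-1,\dots,\lambda_l+1)$ and $\underline{\tilde{\boldsymbol\lambda}}(\phi)=\underline{\tilde{\boldsymbol\lambda}(\phi)}$; $\tau\subset\mu$ means $\tau_i\le\mu_i$ for all $i$. Characters: the irreducible characters of $\mathrm{GL}_n(\mathbb F_q)$ are parametrized (Green) by $\tilde{\boldsymbol\lambda}\in\mathcal P_n^{\Phi^*}$, unipotent classes by partitions $\mu\vdash n$ (Jordan type), denoted $\mu(f_1)$, and the character values on them are given by the known formula $$\chi^{\tilde{\boldsymbol\lambda}}_{\mu(f_1)}=q^{n(\mu)}\Big\langle\prod_{\phi\in\Phi^*}S_{\tilde{\boldsymbol\lambda}(\phi)}(\phi).1,\ Q_{\mu_1}(f_1)\cdots Q_{\mu_r}(f_1).1\Big\rangle,$$ which may be taken as the definition. By Green's theorem, $d(\tilde{\boldsymbol\nu})$ is the degree of $\chi^{\tilde{\boldsymbol\nu}}$, i.e. its value at the identity class $\mu=(1^N)$. Straightening: the relations $S_m(\phi)S_n(\phi)=-S_{n-1}(\phi)S_{m+1}(\phi)$ and $S_{-n}(\phi).1=\delta_{n,0}$ ($n\ge0$) show that for a colored integer sequence $\tilde{\boldsymbol\alpha}$ either $\prod_\phi S_{\tilde{\boldsymbol\alpha}(\phi)}(\phi).1=0$, in which case $d(\tilde{\boldsymbol\alpha})=0$, or $\prod_\phi S_{\tilde{\boldsymbol\alpha}(\phi)}(\phi).1=\varepsilon\prod_\phi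 S_{\tilde{\boldsymbol\nu}(\phi)}(\phi).1$ for a unique sign $\varepsilon=\pm1$ and colored partition $\tilde{\boldsymbol\nu}$, in which case $d(\tilde{\boldsymbol\alpha})=\varepsilon\, d(\tilde{\boldsymbol\nu})$. *)

theory Defs
  imports
    Complex_Main
    "HOL-Library.Cardinality"
    "HOL-Library.Poly_Mapping"
    "HOL-Algebra.Algebraic_Closure_Type"
begin

text \<open>
  The finite field $F_q$ is a type \<open>'a :: {field, finite}\<close>, so that
  \<open>q = CARD('a)\<close>, and its algebraic closure is \<open>'a alg_closure\<close>.
\<close>

section \<open>The groups \<open>M\<close> and \<open>M\<^sup>*\<close> and their Frobenius orbits\<close>

definition M_units :: "nat \<Rightarrow> 'a :: {field, finite} alg_closure set" where
  "M_units n = {x. x \<noteq> 0 \<and> x ^ (CARD('a) ^ n) = x}"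

text \<open>Characters are extended by \<open>0\<close> outside their group, so that they are determined
  by their values on it.\<close>

definition M_chars :: "nat \<Rightarrow> ('a :: {field, finite} alg_closure \<Rightarrow> complex) set" where
  "M_chars n = {\<chi>. (\<forall>x\<in>M_units n. \<forall>y\<in>M_units n. \<chi> (x * y) = \<chi> x * \<chi> y) \<and>
     (\<forall>x\<in>M_units n. \<chi> x \<noteq> 0) \<and> (\<forall>x. x \<notin> M_units n \<longrightarrow> \<chi> x = 0)}"

definition M_norm :: "nat \<Rightarrow> nat \<Rightarrow> 'a :: {field, finite} alg_closure \<Rightarrow> 'a alg_closure" where
  "M_norm m n x = (\<Prod>i<n div m. x ^ (CARD('a) ^ (m * i)))"

definition lift_char :: "nat \<Rightarrow> nat \<Rightarrow> ('a :: {field, finite} alg_closure \<Rightarrow> complex) \<Rightarrow>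
    'a alg_closure \<Rightarrow> complex" where
  "lift_char m n \<chi> x = (if x \<in> M_units n then \<chi> (M_norm m n x) else 0)"

text \<open>\<open>M\<^sup>*\<close>, the union of the \<open>M\<^sub>n\<^sup>*\<close> along the embeddings \<^const>\<open>lift_char\<close>, is a
  direct limit: pairs \<open>(n, \<chi>)\<close> with \<open>\<chi> \<in> M\<^sub>n\<^sup>*\<close>, identified when they have a common lift.\<close>

definition level_chars :: "(nat \<times> ('a :: {field, finite} alg_closure \<Rightarrow> complex)) set" where
  "level_chars = (SIGMA n:{1..}. M_chars n)"

definition same_char :: "((nat \<times> ('a :: {field, finite} alg_closure \<Rightarrow> complex)) \<times>
    (nat \<times> ('a alg_closure \<Rightarrow> complex))) set" where
  "same_char = {((m, \<chi>), (n, \<psi>)). (m, \<chi>) \<in> level_chars \<and> (n, \<psi>) \<in> level_chars \<and>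
     (\<exists>N\<ge>1. m dvd N \<and> n dvd N \<and> lift_char m N \<chi> = lift_char n N \<psi>)}"

definition Mstar :: "(nat \<times> ('a :: {field, finite} alg_closure \<Rightarrow> complex)) set set" where
  "Mstar = level_chars // same_char"

definition frob_Mstar :: "(nat \<times> ('a :: {field, finite} alg_closure \<Rightarrow> complex)) set \<Rightarrow>
    (nat \<times> ('a alg_closure \<Rightarrow> complex)) set" where
  "frob_Mstar \<xi> = (\<lambda>(n, \<chi>). (n, \<lambda>x. \<chi> x ^ CARD('a))) ` \<xi>"

definition Mstar_orbit :: "(nat \<times> ('a :: {field, finite} alg_closure \<Rightarrow> complex)) set \<Rightarrow>
    (nat \<times> ('a alg_closure \<Rightarrow> complex)) set set" where
  "Mstar_orbit \<xi> = {(frob_Mstar ^^ i) \<xi> | i. True}"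

text \<open>The set \<open>\<Phi>\<^sup>*\<close>.\<close>

typedef (overloaded) ('a :: "{field, finite}") phistar =
  "Mstar_orbit ` (Mstar :: (nat \<times> ('a alg_closure \<Rightarrow> complex)) set set)"
proof -
  let ?\<chi> = "\<lambda>x :: 'a alg_closure. if x \<in> M_units 1 then 1 else (0 :: complex)"
  have "x * y \<in> M_units 1" if "x \<in> M_units 1" "y \<in> M_units 1" for x y :: "'a alg_closure"
    using that by (auto simp: M_units_def power_mult_distrib)
  then have "?\<chi> \<in> M_chars 1"
    by (simp add: M_chars_def)
  then have "(1, ?\<chi>) \<in> level_chars"
    by (simp add: level_chars_def)
  then have "same_char `` {(1, ?\<chi>)} \<in> Mstar"
    unfolding Mstar_def by (rule quotientI)
  then show ?thesis
    by blast
qed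

definition phistar_size :: "'a :: {field, finite} phistar \<Rightarrow> nat" where
  "phistar_size \<phi> = card (Rep_phistar \<phi>)"

definition orbit_of_char :: "nat \<Rightarrow> ('a :: {field, finite} alg_closure \<Rightarrow> complex) \<Rightarrow> 'a phistar" where
  "orbit_of_char n \<chi> = Abs_phistar (Mstar_orbit (same_char `` {(n, \<chi>)}))"

definition Phi :: "'a :: {field, finite} alg_closure set set" where
  "Phi = {{x ^ (CARD('a) ^ i) | i. True} | x. x \<noteq> 0}"

text \<open>The Frobenius orbit corresponding to a monic irreducible polynomial over $F_q$ is its set of
  roots; its cardinality is the degree of the polynomial.\<close>

definition poly_orbit :: "'a :: {field, finite} poly \<Rightarrow> 'a alg_closure set" where
  "poly_orbit f = {x. poly (map_poly to_ac f) x = 0}"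

definition f1 :: "'a :: {field, finite} alg_closure set" where
  "f1 = poly_orbit [:-1, 1:]"


section \<open>The polynomial algebra\<close>

text \<open>Polynomials with complex coefficients in the variables \<open>(\<phi>, i)\<close>, where \<open>(\<phi>, i)\<close> stands for
  \<open>p\<^sub>i\<^sub>+\<^sub>1(\<phi>)\<close>; the shift avoids a superfluous generator \<open>p\<^sub>0(\<phi>)\<close>. A monomial is the finitely
  supported function of its exponents, i.e. of the multiplicities of the parts of a coloured
  partition.\<close>

type_synonym 'a FG = "(('a phistar \<times> nat) \<Rightarrow>\<^sub>0 nat) \<Rightarrow>\<^sub>0 complex"

definition scalar :: "complex \<Rightarrow> 'a :: {field, finite} FG" where
  "scalar c = Poly_Mapping.single 0 c"

definition p_gen :: "nat \<Rightarrow> 'a :: {field, finite} phistar \<Rightarrow> 'a FG" where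
  "p_gen n \<phi> = Poly_Mapping.single (Poly_Mapping.single (\<phi>, n - 1) 1) 1"

definition z_monom :: "(('a :: {field, finite} phistar \<times> nat) \<Rightarrow>\<^sub>0 nat) \<Rightarrow> nat" where
  "z_monom m = (\<Prod>(\<phi>, i)\<in>Poly_Mapping.keys m.
     (i + 1) ^ Poly_Mapping.lookup m (\<phi>, i) * fact (Poly_Mapping.lookup m (\<phi>, i)))"

definition inner_FG :: "'a :: {field, finite} FG \<Rightarrow> 'a FG \<Rightarrow> complex" where
  "inner_FG u v = (\<Sum>m\<in>Poly_Mapping.keys u.
     Poly_Mapping.lookup u m * cnj (Poly_Mapping.lookup v m) * of_nat (z_monom m))"

definition p_class :: "nat \<Rightarrow> 'a :: {field, finite} alg_closure set \<Rightarrow> 'a FG" where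
  "p_class n f = (let N = n * card f; x = (SOME x. x \<in> f) in
     scalar ((-1) ^ (N - 1) / (of_nat CARD('a) ^ N - 1)) *
     (\<Sum>\<xi>\<in>M_chars N. scalar (cnj (\<xi> x)) *
        p_gen (N div phistar_size (orbit_of_char N \<xi>)) (orbit_of_char N \<xi>)))"

definition derivation_FG :: "('a :: {field, finite} FG \<Rightarrow> 'a FG) \<Rightarrow> bool" where
  "derivation_FG D \<longleftrightarrow> (\<forall>u v. D (u + v) = D u + D v) \<and> (\<forall>c u. D (scalar c * u) = scalar c * D u) \<and>
     (\<forall>u v. D (u * v) = D u * v + u * D v)"

text \<open>The partial derivative with respect to \<open>g n i\<close> for a system of algebraically independent
  generators \<open>g m j\<close> (\<open>m \<ge> 1\<close>, \<open>j \<in> I\<close>) of the algebra.\<close>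

definition partial :: "'i set \<Rightarrow> (nat \<Rightarrow> 'i \<Rightarrow> 'a :: {field, finite} FG) \<Rightarrow> nat \<Rightarrow> 'i \<Rightarrow>
    'a FG \<Rightarrow> 'a FG" where
  "partial I g n i = (THE D. derivation_FG D \<and>
     (\<forall>m\<ge>1. \<forall>j\<in>I. D (g m j) = (if m = n \<and> j = i then 1 else 0)))"


section \<open>Vertex operators\<close>

text \<open>\<open>op_power A r m\<close> and \<open>op_exp A m\<close> are the coefficients of \<open>t\<^sup>m\<close> in the \<open>r\<close>-th power and in
  the exponential of the operator series \<open>\<Sum>n\<ge>1. A n t\<^sup>n\<close>.\<close>

fun op_power :: "(nat \<Rightarrow> 'a :: {field, finite} FG \<Rightarrow> 'a FG) \<Rightarrow> nat \<Rightarrow> nat \<Rightarrow> 'a FG \<Rightarrow> 'a FG" where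
  "op_power A 0 m v = (if m = 0 then v else 0)"
| "op_power A (Suc r) m v = (\<Sum>i=1..m. A i (op_power A r (m - i) v))"

definition op_exp :: "(nat \<Rightarrow> 'a :: {field, finite} FG \<Rightarrow> 'a FG) \<Rightarrow> nat \<Rightarrow> 'a FG \<Rightarrow> 'a FG" where
  "op_exp A m v = (\<Sum>r\<le>m. scalar (1 / fact r) * op_power A r m v)"

text \<open>The coefficient of \<open>z\<^sup>n\<close> in \<open>exp (\<Sum>n\<ge>1. A n z\<^sup>n) exp (\<Sum>n\<ge>1. B n z\<^sup>-\<^sup>n)\<close>. For the operators
  below, only finitely many terms of the sum are nonzero on a given argument.\<close>

definition vertex_op :: "(nat \<Rightarrow> 'a :: {field, finite} FG \<Rightarrow> 'a FG) \<Rightarrow> (nat \<Rightarrow> 'a FG \<Rightarrow> 'a FG) \<Rightarrow>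
    int \<Rightarrow> 'a FG \<Rightarrow> 'a FG" where
  "vertex_op A B n v = Sum_any (\<lambda>j :: nat.
     if n + int j \<ge> 0 then op_exp A (nat (n + int j)) (op_exp B j v) else 0)"

definition S_op :: "'a :: {field, finite} phistar \<Rightarrow> int \<Rightarrow> 'a FG \<Rightarrow> 'a FG" where
  "S_op \<phi> = vertex_op
     (\<lambda>n v. scalar (1 / of_nat n) * p_gen n \<phi> * v)
     (\<lambda>n v. - partial UNIV p_gen n \<phi> v)"

definition Q_op :: "int \<Rightarrow> 'a :: {field, finite} FG \<Rightarrow> 'a FG" where
  "Q_op = vertex_op
     (\<lambda>n v. scalar ((of_nat CARD('a) ^ n - 1) / of_nat n) * p_class n f1 * v)
     (\<lambda>n v. - (scalar (1 / of_nat CARD('a) ^ n) * partial Phi p_class n f1 v))"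

text \<open>\<open>\<Prod>\<^sub>\<phi> S\<^bsub>\<alpha>(\<phi>)\<^esub>(\<phi>).1\<close>; the order of the colours is irrelevant because operators of different
  colours commute.\<close>

definition S_vec :: "('a :: {field, finite} phistar \<Rightarrow> int list) \<Rightarrow> 'a FG" where
  "S_vec \<alpha> = Finite_Set.fold (\<lambda>\<phi>. foldr (S_op \<phi>) (\<alpha> \<phi>)) 1 {\<phi>. \<alpha> \<phi> \<noteq> []}"

definition Q_vec :: "nat list \<Rightarrow> 'a :: {field, finite} FG" where
  "Q_vec \<mu> = foldr (\<lambda>i. Q_op (int i)) \<mu> 1"


section \<open>Partitions, characters and degrees\<close>

definition is_partition :: "nat list \<Rightarrow> bool" where
  "is_partition xs \<longleftrightarrow> sorted_wrt (\<ge>) xs \<and> 0 \<notin> set xs"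

definition n_part :: "nat list \<Rightarrow> nat" where
  "n_part xs = (\<Sum>i<length xs. i * xs ! i)"

definition conj_part :: "nat list \<Rightarrow> nat list" where
  "conj_part xs = map (\<lambda>j. length (filter (\<lambda>x. j < x) xs)) [0..<(if xs = [] then 0 else hd xs)]"

text \<open>Rows and columns of nodes are numbered from \<open>0\<close>.\<close>

definition nodes :: "nat list \<Rightarrow> (nat \<times> nat) set" where
  "nodes xs = {(i, j). i < length xs \<and> j < xs ! i}"

definition hook :: "nat list \<Rightarrow> nat \<times> nat \<Rightarrow> nat" where
  "hook xs = (\<lambda>(i, j). xs ! i + conj_part xs ! j - i - j - 1)"

definition underline :: "nat list \<Rightarrow> nat list" where
  "underline xs = map (\<lambda>i. xs ! i + (length xs - i)) [0..<length xs]"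

definition cweight :: "('a :: {field, finite} phistar \<Rightarrow> nat list) \<Rightarrow> nat" where
  "cweight la = (\<Sum>\<phi> | la \<phi> \<noteq> []. phistar_size \<phi> * sum_list (la \<phi>))"

definition cpartition :: "('a :: {field, finite} phistar \<Rightarrow> nat list) \<Rightarrow> bool" where
  "cpartition la \<longleftrightarrow> finite {\<phi>. la \<phi> \<noteq> []} \<and> (\<forall>\<phi>. is_partition (la \<phi>))"

definition cpartitions :: "nat \<Rightarrow> ('a :: {field, finite} phistar \<Rightarrow> nat list) set" where
  "cpartitions n = {la. cpartition la \<and> cweight la = n}"

definition unipotent_char :: "('a :: {field, finite} phistar \<Rightarrow> nat list) \<Rightarrow> nat list \<Rightarrow> complex" where
  "unipotent_char la \<mu> = of_nat CARD('a) ^ n_part \<mu> * inner_FG (S_vec (\<lambda>\<phi>. map int (la \<phi>))) (Q_vec \<mu>)"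

definition degree_part :: "('a :: {field, finite} phistar \<Rightarrow> nat list) \<Rightarrow> complex" where
  "degree_part \<nu> = (\<Prod>i=1..cweight \<nu>. of_nat CARD('a) ^ i - 1) *
     (\<Prod>\<phi> | \<nu> \<phi> \<noteq> []. let q\<phi> = of_nat CARD('a) ^ phistar_size \<phi> in
        q\<phi> ^ n_part (conj_part (\<nu> \<phi>)) / (\<Prod>x\<in>nodes (\<nu> \<phi>). q\<phi> ^ hook (\<nu> \<phi>) x - 1))"

text \<open>The extension of \<^const>\<open>degree_part\<close> to coloured integer sequences by straightening.\<close>

definition degree_seq :: "('a :: {field, finite} phistar \<Rightarrow> int list) \<Rightarrow> complex" where
  "degree_seq \<alpha> = (if S_vec \<alpha> = 0 then 0 else
     (THE d. \<exists>\<epsilon>\<in>{1, -1}. \<exists>\<nu>. cpartition \<nu> \<and>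
        S_vec \<alpha> = scalar \<epsilon> * S_vec (\<lambda>\<phi>. map int (\<nu> \<phi>)) \<and> d = \<epsilon> * degree_part \<nu>))"

definition subcompositions :: "('a :: {field, finite} phistar \<Rightarrow> nat list) \<Rightarrow>
    ('a phistar \<Rightarrow> nat list) set" where
  "subcompositions la = {\<tau>. \<forall>\<phi>. length (\<tau> \<phi>) = length (la \<phi>) \<and> 0 \<notin> set (\<tau> \<phi>) \<and>
     list_all2 (\<le>) (\<tau> \<phi>) (underline (la \<phi>))}"

definition B_factor :: "complex \<Rightarrow> nat \<Rightarrow> complex" where
  "B_factor a j = (if j = 1 then -1 else inverse a - 1)"

definition B_coeff :: "('a :: {field, finite} phistar \<Rightarrow> nat list) \<Rightarrow> complex" where
  "B_coeff \<tau> = (\<Prod>\<phi> | \<tau> \<phi> \<noteq> []. \<Prod>i<length (\<tau> \<phi>).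
     B_factor (of_nat CARD('a) ^ phistar_size \<phi>) (\<tau> \<phi> ! i))"

definition rho_prime :: "('a :: {field, finite} phistar \<Rightarrow> nat list) \<Rightarrow> ('a phistar \<Rightarrow> nat list) \<Rightarrow>
    ('a phistar \<Rightarrow> nat list) \<Rightarrow> 'a phistar \<Rightarrow> int list" where
  "rho_prime la \<tau> \<rho> \<phi> = map2 (\<lambda>a b. int a - int b) (la \<phi>) (\<tau> \<phi>) @ map int (\<rho> \<phi>)"

end

theory Submission
  imports Defs "HOL-Computational_Algebra.Formal_Power_Series"
begin

text \<open>
  The functions \<open>Q\<^sub>1\<dots>Q\<^sub>1.1\<close> are multiples of the elementary symmetric functions \<open>e\<^sub>N\<close> in the
  variables \<open>p\<^sub>n(f\<^sub>1)\<close>, so \<open>Q\<^sub>k\<close> turns them into a sum of products \<open>q\<^sub>a e\<^sub>b\<close>. The generating function of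
  these products is the exponential of a linear form in the \<open>p\<^sub>n(\<phi>)\<close>; pairing with it is therefore a ring
  homomorphism, and it factors over the colours. On the Schur function of one colour it is a
  specialization of \<open>\<Sum>\<^sub>k c\<^sup>k h\<^sub>k\<^sub>-\<^sub>m h\<^sub>k\<^sup>\<bottom>\<close>, an operator whose commutation with the Bernstein
  operators produces the sum over the compositions \<open>\<tau>\<close> with the coefficients \<open>B\<close>. The remaining
  factors are principal specializations of Schur functions, which are the degrees up to the factor
  \<open>\<Prod>\<^sub>i(q\<^sup>i - 1)\<close> by the hook formula, and this also holds for integer sequences since straightening is
  linear.
\<close>

section \<open>Bernstein operators\<close>

text \<open>Multiplication by p_n(\<phi>) is adjoint to n d/dp_n(\<phi>), so pairing with the
  exponential of a linear form is an evaluation of the p_n(\<phi>). As the degree is known, one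
  variable X marking the index of e_b suffices. The action of Q_k on e_N produces weights (-1/q)^j,
  the coefficients of 1/(1 + X/q). This series seems to tie the colours together; it splits into one
  factor per colour because the orbits with |\<phi>| dividing i have total size q^i - 1, the number
  of characters of M_i. In each colour the factor supplies h_j with weight q_\<phi>^-j up to sign,
  and this is where the constant c = q^-|\<phi>| of \<open>B\<close> comes from: passing the
  operator over a letter of a Schur function leaves -1 from the first step and c - 1 from each later
  one. The letter appended at the end becomes the one-row part of \<rho>. A remaining obstacle is
  the grading: the coefficient sought is that of X^(n-k), whereas the parts of \<rho> have total
  weight ||\<tau>|| - k; comparing powers of X for the two indexings settles this and produces the
  factor (-1)^k q^n.\<close>

lemma sum_atMost_Suc_shift_zero:
  fixes f :: "nat \<Rightarrow> 'b :: comm_monoid_add"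
  assumes "f 0 = 0"
  shows "(\<Sum>i\<le>Suc N. f i) = (\<Sum>i\<le>N. f (Suc i))"
  using assms by (subst sum.atMost_Suc_shift) simp

text \<open>In the intended model \<open>h m\<close> is the complete symmetric function and
  \<open>T k\<close> is (-1)^k times skewing by the elementary function e_k, that is, a coefficient
  of exp(- sum of d/dp_n z^-n). \<open>T_h\<close> has only two terms because skewing h_m by e_j
  gives 0 for j > 1. \<open>T_finite\<close> turns every series in the \<open>T k\<close> into a
  finite sum, and \<open>two_torsion_free\<close> makes x = -x force x = 0.\<close>

locale bernstein =
  fixes h :: "int \<Rightarrow> 'r :: comm_ring_1" and T :: "nat \<Rightarrow> 'r \<Rightarrow> 'r"
  assumes h_neg: "m < 0 \<Longrightarrow> h m = 0" and h_0: "h 0 = 1"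
    and T_add: "T k (u + v) = T k u + T k v"
    and T_commute: "T i (T j v) = T j (T i v)"
    and T_0: "T 0 v = v"
    and T_one: "k > 0 \<Longrightarrow> T k 1 = 0"
    and T_h: "T k (h m * v) = h m * T k v - (if k = 0 then 0 else h (m - 1) * T (k - 1) v)"
    and T_finite: "\<exists>N. \<forall>k>N. T k v = 0"
    and two_torsion_free: "(x :: 'r) + x = 0 \<Longrightarrow> x = 0"
begin

lemma T_zero [simp]: "T k 0 = 0"
  using T_add[of k 0 0] by simp

lemma T_minus: "T k (- v) = - T k v"
  using T_add[of k v "- v"] by (simp add: eq_neg_iff_add_eq_0 add.commute)

lemma T_sum: "T k (sum f A) = (\<Sum>x\<in>A. T k (f x))"
  by (induction A rule: infinite_finite_induct) (auto simp: T_add)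

text \<open>The constants for this family of operators. In the coloured algebra they include the
  complex scalars and all elements of the other colours, which is how several colours can be treated
  one at a time.\<close>

definition T_const :: "'r \<Rightarrow> bool" where
  "T_const c \<longleftrightarrow> (\<forall>k v. T k (c * v) = c * T k v)"

lemma T_constD: "T_const c \<Longrightarrow> T k (c * v) = c * T k v"
  by (simp add: T_const_def)

lemma T_const_1: "T_const 1"
  by (simp add: T_const_def)

lemma T_const_minus: "T_const c \<Longrightarrow> T_const (- c)"
  by (simp add: T_const_def T_minus)

lemma T_const_add: "T_const c \<Longrightarrow> T_const d \<Longrightarrow> T_const (c + d)"
  by (simp add: T_const_def T_add distrib_right)

lemma T_const_mult: "T_const c \<Longrightarrow> T_const d \<Longrightarrow> T_const (c * d)"
  by (simp add: T_const_def mult.assoc)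

lemma T_const_power: "T_const c \<Longrightarrow> T_const (c ^ n)"
  by (induction n) (auto intro: T_const_mult T_const_1)

lemma T_const_prod_list: "\<forall>c\<in>set cs. T_const c \<Longrightarrow> T_const (prod_list cs)"
  by (induction cs) (auto intro: T_const_mult T_const_1)

text \<open>The common shape of the Bernstein operators and of the operator \<open>XO\<close>. The
  sum runs over the finitely many nonzero \<open>T i v\<close>, so no truncation enters the
  definition.\<close>

definition W :: "(nat \<Rightarrow> 'r) \<Rightarrow> 'r \<Rightarrow> 'r" where
  "W c v = (\<Sum>i | T i v \<noteq> 0. c i * T i v)"

lemma W_eq:
  assumes "\<And>k. k > N \<Longrightarrow> T k v = 0"
  shows "W c v = (\<Sum>i\<le>N. c i * T i v)"
  unfolding W_def by (rule sum.mono_neutral_left) (use assms in \<open>auto simp: not_less[symmetric]\<close>)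

lemma W_one: "W c 1 = c 0"
  using W_eq[of 0 1 c] by (simp add: T_one T_0)

lemma W_zero [simp]: "W c 0 = 0"
  by (simp add: W_def)

lemma T_finite2: "\<exists>N. \<forall>i j. i > N \<or> j > N \<longrightarrow> T i (T j v) = 0"
proof -
  obtain N where "\<forall>k>N. T k v = 0" using T_finite by blast
  then have "T i (T j v) = 0" if "i > N \<or> j > N" for i j
    using that T_commute[of i j v] by (cases "j > N") auto
  then show ?thesis by blast
qed

lemma W_add: "W c (u + v) = W c u + W c v"
proof -
  obtain N M where N: "\<forall>k>N. T k u = 0" and M: "\<forall>k>M. T k v = 0"
    using T_finite by meson
  show ?thesis
    by (subst (1 2 3) W_eq[where N = "max N M"])
      (use N M in \<open>auto simp: T_add algebra_simps sum.distrib\<close>)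
qed

lemma W_const: "T_const a \<Longrightarrow> W c (a * v) = a * W c v"
proof -
  assume a: "T_const a"
  obtain N where N: "\<forall>k>N. T k v = 0" using T_finite by meson
  show ?thesis
    by (subst (1 2) W_eq[where N = N])
      (use N a in \<open>auto simp: T_constD sum_distrib_left mult_ac\<close>)
qed

lemma W_minus: "W c (- v) = - W c v"
  using W_const[OF T_const_minus[OF T_const_1]] by simp

lemma W_sum: "W c (sum f A) = (\<Sum>x\<in>A. W c (f x))"
  by (induction A rule: infinite_finite_induct) (auto simp: W_add)

definition bound2 :: "nat \<Rightarrow> 'r \<Rightarrow> bool" where
  "bound2 N v \<longleftrightarrow> (\<forall>i j. i > N \<or> j > N \<longrightarrow> T i (T j v) = 0)"

lemma bound2_ex: "\<exists>N. bound2 N v"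
  using T_finite2 unfolding bound2_def .

text \<open>The normally ordered product of two such series: all multiplications stand to the left
  of all \<open>T i\<close>. It is symmetric in the two coefficient sequences, and exchange
  relations are read off by bringing both sides into this form.\<close>

definition P :: "nat \<Rightarrow> 'r \<Rightarrow> (nat \<Rightarrow> 'r) \<Rightarrow> (nat \<Rightarrow> 'r) \<Rightarrow> 'r" where
  "P N v c d = (\<Sum>i\<le>N. \<Sum>j\<le>N. c i * d j * T i (T j v))"

lemma P_sym: "P N v c d = P N v d c"
  unfolding P_def by (subst sum.swap) (simp add: T_commute mult_ac)

text \<open>Normal ordering: moving \<open>T i\<close> past \<open>h (m j)\<close> by
  \<open>T_h\<close> leaves a second term in which i and m j both drop by one; shifting the
  summation over i turns that into the sequence \<open>c (Suc i)\<close>.\<close>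

lemma W_W:
  assumes N: "bound2 N v" and e: "\<And>j. T_const (e j)"
  shows "W c (W (\<lambda>j. e j * h (m j)) v) =
    P N v c (\<lambda>j. e j * h (m j)) - P N v (\<lambda>i. c (Suc i)) (\<lambda>j. e j * h (m j - 1))"
proof -
  have N1: "T k v = 0" if "k > N" for k
    using N that T_0[of v] unfolding bound2_def by metis
  have *: "T i (W (\<lambda>j. e j * h (m j)) v) = (\<Sum>j\<le>N. e j * h (m j) * T i (T j v)) -
      (if i = 0 then 0 else \<Sum>j\<le>N. e j * h (m j - 1) * T (i - 1) (T j v))" for i
    by (cases "i = 0"; subst W_eq[OF N1])
      (simp_all add: T_sum T_constD[OF e] T_h mult.assoc right_diff_distrib sum_subtractf)
  have "W c (W (\<lambda>j. e j * h (m j)) v) = (\<Sum>i\<le>Suc N. c i * T i (W (\<lambda>j. e j * h (m j)) v))"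
  proof (rule W_eq)
    fix k assume "k > Suc N"
    then have "k > N" "k - 1 > N" by auto
    then show "T k (W (\<lambda>j. e j * h (m j)) v) = 0"
      unfolding * using N[unfolded bound2_def] by simp
  qed
  also have "\<dots> = (\<Sum>i\<le>Suc N. c i * (\<Sum>j\<le>N. e j * h (m j) * T i (T j v))) -
      (\<Sum>i\<le>Suc N. c i * (if i = 0 then 0 else \<Sum>j\<le>N. e j * h (m j - 1) * T (i - 1) (T j v)))"
    unfolding * by (simp only: right_diff_distrib sum_subtractf)
  also have "(\<Sum>i\<le>Suc N. c i * (\<Sum>j\<le>N. e j * h (m j) * T i (T j v))) =
      (\<Sum>i\<le>N. c i * (\<Sum>j\<le>N. e j * h (m j) * T i (T j v)))"
    using N[unfolded bound2_def] by simp
  also have "(\<Sum>i\<le>Suc N. c i * (if i = 0 then 0 else \<Sum>j\<le>N. e j * h (m j - 1) * T (i - 1) (T j v))) =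
      (\<Sum>i\<le>N. c (Suc i) * (\<Sum>j\<le>N. e j * h (m j - 1) * T i (T j v)))"
    by (subst sum_atMost_Suc_shift_zero) auto
  finally show ?thesis
    by (simp add: P_def sum_distrib_left mult.assoc)
qed

section \<open>Exchange relations of the Bernstein operators and the operator
  \<open>XO\<close>\<close>

definition S :: "int \<Rightarrow> 'r \<Rightarrow> 'r" where
  "S a = W (\<lambda>i. h (a + int i))"

text \<open>At c = 1 this is the Bernstein operator \<open>S (- k)\<close>; the powers of c deform
  it. It is applied with c = q_\<phi>^-1.\<close>

definition XO :: "'r \<Rightarrow> int \<Rightarrow> 'r \<Rightarrow> 'r" where
  "XO c k = W (\<lambda>i. c ^ i * h (int i - k))"

lemma S_S:
  assumes "bound2 N v"
  shows "S a (S b v) = P N v (\<lambda>i. h (a + int i)) (\<lambda>i. h (b + int i)) -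
    P N v (\<lambda>i. h (a + 1 + int i)) (\<lambda>i. h (b - 1 + int i))"
  using W_W[OF assms, of "\<lambda>_. 1" "\<lambda>i. h (a + int i)" "\<lambda>j. b + int j"]
  by (simp add: S_def T_const_1 algebra_simps)

lemma S_swap: "S a (S b v) = - S (b - 1) (S (a + 1) v)"
proof -
  obtain N where N: "bound2 N v" using bound2_ex by blast
  show ?thesis
    unfolding S_S[OF N]
    by (simp add: P_sym[of N v "\<lambda>i. h (a + 1 + int i)"] P_sym[of N v "\<lambda>i. h (a + int i)"])
qed

lemma S_consecutive: "S (b - 1) (S b v) = 0"
  by (rule two_torsion_free) (use S_swap[of "b - 1" b v] in \<open>simp add: eq_neg_iff_add_eq_0\<close>)

text \<open>In normal order, \<open>XO c k\<close> after \<open>S a\<close> is M k a - c M (k-1)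
  (a-1), while \<open>S a\<close> after \<open>XO c k\<close> is M k a - M (k+1) (a+1); the relation
  eliminates M. On the right, only the first term still has \<open>XO\<close> on the outside, and
  its indices are lowered, so it can be expanded again.\<close>

lemma XO_S:
  assumes c: "T_const c"
  shows "XO c k (S a v) = XO c (k - 1) (S (a - 1) v) - S (a - 1) (XO c (k - 1) v)
    + c * S (a - 2) (XO c (k - 2) v)"
proof -
  obtain N where N: "bound2 N v" using bound2_ex by blast
  define M where "M k a = P N v (\<lambda>i. c ^ i * h (int i - k)) (\<lambda>i. h (a + int i))" for k a
  have XS: "XO c k (S a v) = M k a - c * M (k - 1) (a - 1)" for k a
    using W_W[OF N, of "\<lambda>_. 1" "\<lambda>i. c ^ i * h (int i - k)" "\<lambda>j. a + int j"]
    by (simp add: XO_def S_def T_const_1 M_def P_def sum_distrib_left algebra_simps)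
  have SX: "S a (XO c k v) = M k a - M (k + 1) (a + 1)" for k a
    using W_W[OF N, of "\<lambda>j. c ^ j" "\<lambda>i. h (a + int i)" "\<lambda>j. int j - k"] c
    unfolding M_def P_sym[of N v _ "\<lambda>i. h (_ + int i)"]
    by (simp add: XO_def S_def T_const_power algebra_simps)
  show ?thesis
    unfolding XS SX by (simp add: algebra_simps)
qed

lemmas S_const = W_const[of _ "\<lambda>i. h (a + int i)" for a, folded S_def]
  and S_minus = W_minus[of "\<lambda>i. h (a + int i)" for a, folded S_def]
  and S_sum = W_sum[of "\<lambda>i. h (a + int i)" for a, folded S_def]
  and S_zero [simp] = W_zero[of "\<lambda>i. h (a + int i)" for a, folded S_def]

lemma S_one: "S a 1 = h a"
  by (simp add: S_def W_one)

definition s :: "int list \<Rightarrow> 'r" where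
  "s \<alpha> = foldr S \<alpha> 1"

lemma s_Nil [simp]: "s [] = 1" and s_Cons: "s (a # \<alpha>) = S a (s \<alpha>)"
  by (simp_all add: s_def)

lemma foldr_S_zero: "foldr S \<alpha> 0 = 0"
  by (induction \<alpha>) auto

text \<open>Each exchange by \<open>S_swap\<close> raises the travelling index by one, lowers the
  letter passed by one and changes the sign.\<close>

lemma S_foldr:
  "S a (foldr S \<alpha> v) = (-1) ^ length \<alpha> * foldr S (map (\<lambda>x. x - 1) \<alpha>) (S (a + int (length \<alpha>)) v)"
proof (induction \<alpha> arbitrary: a)
  case (Cons b \<alpha>)
  have "S a (foldr S (b # \<alpha>) v) = - S (b - 1) (S (a + 1) (foldr S \<alpha> v))"
    using S_swap[of a b] by simp
  also have "\<dots> = - S (b - 1) ((-1) ^ length \<alpha> *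
      foldr S (map (\<lambda>x. x - 1) \<alpha>) (S (a + 1 + int (length \<alpha>)) v))"
    by (simp only: Cons.IH)
  also have "\<dots> = - ((-1) ^ length \<alpha> * S (b - 1)
      (foldr S (map (\<lambda>x. x - 1) \<alpha>) (S (a + 1 + int (length \<alpha>)) v)))"
    by (subst S_const) (auto intro!: T_const_power T_const_minus T_const_1)
  finally show ?case
    by (simp add: algebra_simps)
qed auto

text \<open>Carried to the right end, the letter acts on 1 with the negative index a + length
  \<alpha>.\<close>

lemma S_s_vanish: "a < - int (length \<alpha>) \<Longrightarrow> S a (s \<alpha>) = 0"
  unfolding s_def by (subst S_foldr) (simp add: S_one h_neg foldr_S_zero)

text \<open>The analogue of a determinant with two equal rows: after passing the first i letters, a
  has become one less than the next letter, where \<open>S_consecutive\<close> applies.\<close>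

lemma s_repeated:
  assumes "i < length \<alpha>" "a = \<alpha> ! i - int i - 1"
  shows "s (a # \<alpha>) = 0"
proof -
  have \<alpha>: "\<alpha> = take i \<alpha> @ \<alpha> ! i # drop (Suc i) \<alpha>"
    using assms(1) by (simp add: id_take_nth_drop)
  have len: "length (take i \<alpha>) = i" using assms(1) by simp
  have "s (a # \<alpha>) = S a (foldr S (take i \<alpha>) (S (\<alpha> ! i) (s (drop (Suc i) \<alpha>))))"
    by (subst \<alpha>) (simp add: s_def)
  also have "\<dots> = 0"
    unfolding S_foldr len using S_consecutive[of "\<alpha> ! i" "s (drop (Suc i) \<alpha>)"]
    by (simp add: assms(2) foldr_S_zero)
  finally show ?thesis .
qed

lemma T_S: "T k (S b v) = S b (T k v) - (if k = 0 then 0 else S (b - 1) (T (k - 1) v))"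
proof -
  obtain N where N: "bound2 N v" using bound2_ex by blast
  have 2: "T j (T i v) = 0" if "j > N" for i j
    using N that unfolding bound2_def by simp
  have 1: "T j v = 0" if "j > N" for j
    using 2[OF that, of 0] by (simp add: T_0)
  have "T k (S b v) = (\<Sum>j\<le>N. T k (h (b + int j) * T j v))"
    unfolding S_def by (subst W_eq[OF 1]) (simp_all add: T_sum)
  also have "\<dots> = (\<Sum>j\<le>N. h (b + int j) * T j (T k v)) -
      (if k = 0 then 0 else \<Sum>j\<le>N. h (b - 1 + int j) * T j (T (k - 1) v))"
    by (cases "k = 0")
      (simp_all add: T_h sum_subtractf T_commute[of k] T_commute[of "k - Suc 0"] add_diff_eq diff_add_eq T_0)
  also have "\<dots> = S b (T k v) - (if k = 0 then 0 else S (b - 1) (T (k - 1) v))"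
    unfolding S_def by (simp add: W_eq[OF 2])
  finally show ?thesis .
qed

text \<open>By \<open>T_S\<close> each letter lowers the index of \<open>T\<close> by at most one,
  and a positive index kills 1. This is the bound on the height of a vertical strip removable from
  length \<alpha> rows.\<close>

lemma T_s_vanish: "k > length \<alpha> \<Longrightarrow> T k (s \<alpha>) = 0"
  by (induction \<alpha> arbitrary: k) (auto simp: s_Cons T_S T_one)

lemma s_snoc_zero: "s (\<alpha> @ [0]) = s \<alpha>" and s_snoc_neg: "a < 0 \<Longrightarrow> s (\<alpha> @ [a]) = 0"
  by (simp_all add: s_def S_one h_0 h_neg foldr_S_zero)

end

text \<open>The compositions contained in the shifted shape, for integer sequences. With i counted
  from 0 the bound is \<alpha>_i + length \<alpha> - i: the lowered letter acts on length \<alpha> -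
  i further letters, the appended last one included, and beyond the bound its index is so negative
  that \<open>S_s_vanish\<close> gives 0.\<close>

definition lowerings :: "int list \<Rightarrow> nat list set" where
  "lowerings \<alpha> = {\<tau>. length \<tau> = length \<alpha> \<and>
    (\<forall>i<length \<alpha>. 1 \<le> \<tau> ! i \<and> int (\<tau> ! i) \<le> \<alpha> ! i + int (length \<alpha> - i))}"

lemma lowerings_Nil: "lowerings [] = {[]}"
  by (auto simp: lowerings_def)

lemma lowerings_Cons:
  "lowerings (a # \<alpha>) = (\<lambda>(t, \<tau>). t # \<tau>) ` ({1..nat (a + 1 + int (length \<alpha>))} \<times> lowerings \<alpha>)"
proof -
  have "\<tau> \<in> lowerings (a # \<alpha>) \<longleftrightarrow>
      (\<exists>t \<tau>'. \<tau> = t # \<tau>' \<and> t \<in> {1..nat (a + 1 + int (length \<alpha>))} \<and> \<tau>' \<in> lowerings \<alpha>)" for \<tau>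
    by (cases \<tau>) (auto simp: lowerings_def All_less_Suc2)
  then show ?thesis by (auto simp: image_iff)
qed

lemma finite_lowerings: "finite (lowerings \<alpha>)"
  by (induction \<alpha>) (auto simp: lowerings_Nil lowerings_Cons)

context bernstein
begin

definition B :: "'r \<Rightarrow> nat \<Rightarrow> 'r" where
  "B c t = (if t = 1 then - 1 else c - 1)"

lemma T_const_B: "T_const c \<Longrightarrow> T_const (B c t)"
  unfolding B_def by (auto intro: T_const_minus T_const_1
      T_const_add[of c "- 1", simplified])

text \<open>Origin of the two values of \<open>B\<close>: step t of the expansion contributes -Y t +
  c Y (t+1), so Y 1 has coefficient -1 and each later Y t has coefficient c - 1. The two vanishing
  hypotheses remove the remainder after N steps.\<close>

lemma XO_S_iterate:
  assumes c: "T_const c" and N: "N \<ge> 1"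
    and last: "S (a - int N - 1) (XO c (k - int N - 1) v) = 0"
    and rest: "S (a - int N) v = 0"
  shows "XO c k (S a v) = (\<Sum>t=1..N. B c t * S (a - int t) (XO c (k - int t) v))"
proof -
  define Y where "Y t = S (a - int t) (XO c (k - int t) v)" for t
  have "XO c k (S a v) = XO c (k - int M) (S (a - int M) v) +
      (\<Sum>t=1..M. B c t * Y t) + c * Y (Suc M)" if "M \<ge> 1" for M
    using that
  proof (induction M rule: nat_induct_at_least)
    case base
    show ?case
      using XO_S[OF c, of k a v] by (simp add: B_def Y_def)
  next
    case (Suc M)
    have "XO c (k - int M) (S (a - int M) v) =
        XO c (k - int (Suc M)) (S (a - int (Suc M)) v) - Y (Suc M) + c * Y (Suc (Suc M))"
      using XO_S[OF c, of "k - int M" "a - int M" v] by (simp add: Y_def algebra_simps)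
    then show ?case
      using Suc by (simp add: B_def algebra_simps)
  qed
  from this[OF N] show ?thesis
    using last rest by (simp add: Y_def XO_def algebra_simps)
qed

text \<open>Expanding letter by letter lowers the index k of \<open>XO\<close> by the total of
  \<tau>, and on 1 the operator \<open>XO\<close> yields \<open>h\<close> at the negative of what is
  left: this is the extra letter |\<tau>| - k at the end.\<close>

lemma XO_s:
  assumes c: "T_const c" and "\<forall>a\<in>set \<alpha>. a \<ge> 0"
  shows "XO c k (s \<alpha>) = (\<Sum>\<tau>\<in>lowerings \<alpha>. prod_list (map (B c) \<tau>) *
    s (map2 (\<lambda>a t. a - int t) \<alpha> \<tau> @ [int (sum_list \<tau>) - k]))"
  using assms(2)
proof (induction \<alpha> arbitrary: k)
  case Nil
  show ?case by (simp add: lowerings_Nil XO_def W_one s_Cons S_one)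
next
  case (Cons a \<alpha>)
  \<comment> \<open>The largest t for which a - t is not below minus the number of letters to its
    right in the final sequence, which are length \<alpha> + 1 in number; at t = N + 1 the term is
    0.\<close>
  define N where "N = nat (a + 1 + int (length \<alpha>))"
  have N: "N \<ge> 1" "int N = a + 1 + int (length \<alpha>)"
    using Cons.prems by (auto simp: N_def)
  have IH: "XO c k (s \<alpha>) = (\<Sum>\<tau>\<in>lowerings \<alpha>. prod_list (map (B c) \<tau>) *
      s (map2 (\<lambda>a t. a - int t) \<alpha> \<tau> @ [int (sum_list \<tau>) - k]))" for k
    by (rule Cons.IH) (use Cons.prems in auto)
  have const: "T_const (prod_list (map (B c) \<tau>))" for \<tau>
    by (intro T_const_prod_list) (auto intro: T_const_B c)
  have SX: "S b (XO c k (s \<alpha>)) = (\<Sum>\<tau>\<in>lowerings \<alpha>. prod_list (map (B c) \<tau>) *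
      s (b # map2 (\<lambda>a t. a - int t) \<alpha> \<tau> @ [int (sum_list \<tau>) - k]))" for b k
    by (simp add: IH S_sum S_const[OF const] s_Cons)
  have "XO c k (s (a # \<alpha>)) = (\<Sum>t=1..N. B c t * S (a - int t) (XO c (k - int t) (s \<alpha>)))"
    unfolding s_Cons
  proof (rule XO_S_iterate[OF c N(1)])
    show "S (a - int N) (s \<alpha>) = 0"
      by (rule S_s_vanish) (use N in auto)
    show "S (a - int N - 1) (XO c (k - int N - 1) (s \<alpha>)) = 0"
      unfolding SX s_Cons by (intro sum.neutral ballI)
        (subst S_s_vanish, use N in \<open>auto simp: lowerings_def\<close>)
  qed
  also have "\<dots> = (\<Sum>(t, \<tau>)\<in>{1..N} \<times> lowerings \<alpha>. B c t * (prod_list (map (B c) \<tau>) *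
      s ((a - int t) # map2 (\<lambda>a t. a - int t) \<alpha> \<tau> @ [int (sum_list \<tau>) - (k - int t)])))"
    unfolding SX by (simp add: sum_distrib_left sum.cartesian_product)
  also have "\<dots> = (\<Sum>\<tau>\<in>lowerings (a # \<alpha>). prod_list (map (B c) \<tau>) *
    s (map2 (\<lambda>a t. a - int t) (a # \<alpha>) \<tau> @ [int (sum_list \<tau>) - k]))"
    unfolding lowerings_Cons
    by (subst sum.reindex) (auto simp: N_def inj_on_def algebra_simps intro!: sum.cong)
  finally show ?case .
qed

text \<open>The letter a is exchanged with the first part until it fits. The bound on the first part
  of the result carries the induction: when a + 1 < b, it shows that b - 1 may be put in front of
  the straightened rest.\<close>

lemma straighten_Cons:
  assumes "is_partition \<nu>"
  shows "s (a # map int \<nu>) = 0 \<or> (\<exists>\<epsilon>\<in>{1, -1}. \<exists>\<nu>'. is_partition \<nu>' \<and>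
    s (a # map int \<nu>) = \<epsilon> * s (map int \<nu>') \<and>
    (\<nu>' = [] \<or> int (hd \<nu>') \<le> max a (if \<nu> = [] then a else int (hd \<nu>) - 1)))"
  using assms
proof (induction \<nu> arbitrary: a)
  case Nil
  consider "a < 0" | "a = 0" | "a > 0" by linarith
  then show ?case
  proof cases
    case 3
    then show ?thesis
      by (intro disjI2 bexI[of _ 1] exI[of _ "[nat a]"]) (auto simp: is_partition_def)
  qed (auto simp: s_Cons S_one h_neg h_0 is_partition_def intro!: exI[of _ "[]"])
next
  case (Cons b \<nu>)
  show ?case
  proof (cases "a \<ge> int b")
    case True
    with Cons.prems show ?thesis
      by (intro disjI2 bexI[of _ 1] exI[of _ "nat a # b # \<nu>"]) (auto simp: is_partition_def)
  next
    case False
    have \<nu>: "is_partition \<nu>" and b: "b > 0" "\<nu> = [] \<or> hd \<nu> \<le> b"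
      using Cons.prems by (cases \<nu>; auto simp: is_partition_def)+
    have swap: "s (a # map int (b # \<nu>)) = - S (int b - 1) (s ((a + 1) # map int \<nu>))"
      using S_swap[of a "int b"] by (simp add: s_Cons)
    show ?thesis
    proof (cases "a + 1 = int b \<or> s ((a + 1) # map int \<nu>) = 0")
      case True
      then have "s (a # map int (b # \<nu>)) = 0"
        using S_consecutive[of "int b" "s (map int \<nu>)"] swap
        by (auto simp: s_Cons algebra_simps)
      then show ?thesis ..
    next
      case ab: False
      with Cons.IH[OF \<nu>, of "a + 1"] obtain \<epsilon> \<nu>' where
        \<epsilon>: "\<epsilon> \<in> {1, -1}" and \<nu>': "is_partition \<nu>'"
        and eq: "s ((a + 1) # map int \<nu>) = \<epsilon> * s (map int \<nu>')"
        and le: "\<nu>' = [] \<or> int (hd \<nu>') \<le> max (a + 1) (if \<nu> = [] then a + 1 else int (hd \<nu>) - 1)"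
        by blast
      have le': "\<nu>' = [] \<or> int (hd \<nu>') \<le> int b - 1"
        using le b ab False by (auto split: if_splits)
      have *: "s (a # map int (b # \<nu>)) = (- \<epsilon>) * s ((int b - 1) # map int \<nu>')"
        unfolding swap using \<epsilon> eq by (auto simp: s_Cons S_minus)
      show ?thesis
      \<comment> \<open>For b = 1 the new letter b - 1 = 0 is not a part; the bound leaves no
        further parts, and S_0 fixes 1, so the letter disappears.\<close>
      proof (cases "b = 1")
        case True
        then have "\<nu>' = []"
          using le' \<nu>' by (cases \<nu>') (auto simp: is_partition_def)
        with * True \<epsilon> show ?thesis
          by (intro disjI2 bexI[of _ "- \<epsilon>"] exI[of _ "[]"])
            (auto simp: s_Cons S_one h_0 is_partition_def)
      next
        case False
        then have "is_partition ((b - 1) # \<nu>')"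
          using le' \<nu>' b by (cases \<nu>') (auto simp: is_partition_def)
        with * \<epsilon> b show ?thesis
          by (intro disjI2 bexI[of _ "- \<epsilon>"] exI[of _ "(b - 1) # \<nu>'"]) (auto simp: of_nat_diff)
      qed
    qed
  qed
qed

lemma straighten:
  "s \<alpha> = 0 \<or> (\<exists>\<epsilon>\<in>{1, -1}. \<exists>\<nu>. is_partition \<nu> \<and> s \<alpha> = \<epsilon> * s (map int \<nu>))"
proof (induction \<alpha>)
  case Nil
  show ?case by (auto simp: is_partition_def intro!: exI[of _ "[]"])
next
  case (Cons a \<alpha>)
  show ?case
  proof (cases "s \<alpha> = 0")
    case False
    then obtain \<epsilon> \<nu> where *: "\<epsilon> \<in> {1, -1}" "is_partition \<nu>" "s \<alpha> = \<epsilon> * s (map int \<nu>)"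
      using Cons.IH by blast
    have eq: "s (a # \<alpha>) = \<epsilon> * s (a # map int \<nu>)"
      unfolding s_Cons *(3) using *(1) by (auto simp: S_minus)
    consider "s (a # map int \<nu>) = 0"
      | \<epsilon>' \<nu>' where "\<epsilon>' \<in> {1, -1}" "is_partition \<nu>'" "s (a # map int \<nu>) = \<epsilon>' * s (map int \<nu>')"
      using straighten_Cons[OF *(2), of a] by blast
    then show ?thesis
    proof cases
      case 2
      then have "s (a # \<alpha>) = (\<epsilon> * \<epsilon>') * s (map int \<nu>')" "\<epsilon> * \<epsilon>' \<in> {1, -1}"
        using *(1) eq by auto
      with 2(2) show ?thesis by blast
    qed (simp add: eq)
  qed (simp add: s_Cons)
qed

end

section \<open>Finite fields and characters\<close>

lemma CARD_ge_2: "CARD('a :: {field, finite}) \<ge> 2"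
proof -
  have "card {0, 1 :: 'a} \<le> CARD('a)" by (rule card_mono) auto
  then show ?thesis by simp
qed

text \<open>For nonzero x, multiplication by x permutes the nonzero elements, so their product
  acquires the factor x^(q-1).\<close>

lemma finite_field_power_CARD: "(x :: 'a :: {field, finite}) ^ CARD('a) = x"
proof (cases "x = 0")
  case False
  have "x ^ (CARD('a) - 1) * \<Prod>(UNIV - {0}) = (\<Prod>y\<in>UNIV - {0 :: 'a}. x * y)"
    by (simp add: prod.distrib)
  also have "\<dots> = \<Prod>(UNIV - {0})"
    by (rule prod.reindex_bij_witness[of _ "\<lambda>y. y / x" "\<lambda>y. x * y"]) (use False in auto)
  finally have "x ^ (CARD('a) - 1) = 1" by simp
  then have "x ^ Suc (CARD('a) - 1) = x" by (simp only: power_Suc mult_1_right)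
  then show ?thesis using CARD_ge_2[where 'a = 'a] by simp
qed (use CARD_ge_2[where 'a = 'a] in auto)

text \<open>The polynomial \<open>(X + 1)\<^sup>q - X\<^sup>q - 1\<close> of degree less than \<open>q\<close> vanishes at all \<open>q\<close> points.\<close>

lemma of_nat_CARD_choose:
  assumes "0 < i" "i < CARD('a)"
  shows "of_nat (CARD('a :: {field, finite}) choose i) = (0 :: 'a)"
proof -
  let ?q = "CARD('a)"
  define P where "P = (\<Sum>i\<in>{0<..<?q}. monom (of_nat (?q choose i)) i :: 'a poly)"
  have coeff: "coeff P i = (if 0 < i \<and> i < ?q then of_nat (?q choose i) else 0)" for i
    by (simp add: P_def coeff_sum sum.delta')
  have "poly P x = 0" for x
  proof -
    have "(x + 1) ^ ?q = (\<Sum>i\<le>?q. of_nat (?q choose i) * x ^ i)"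
      by (simp add: binomial_ring)
    also have "{..?q} = insert 0 (insert ?q {0<..<?q})"
      by auto
    finally have "(x + 1) ^ ?q = 1 + x ^ ?q + poly P x"
      using CARD_ge_2[where 'a = 'a] by (simp add: P_def poly_sum poly_monom add_ac)
    then show ?thesis
      by (simp add: finite_field_power_CARD)
  qed
  then have "{x. poly P x = 0} = UNIV" by auto
  moreover have "degree P < ?q"
    using CARD_ge_2[where 'a = 'a] by (intro degree_lessI) (auto simp: coeff)
  ultimately have "P = 0"
    using card_poly_roots_bound[of P] by (metis not_less)
  then show ?thesis
    using coeff[of i] assms by simp
qed

lemma of_nat_CARD_alg_closure_choose:
  assumes "0 < i" "i < CARD('a)"
  shows "of_nat (CARD('a :: {field, finite}) choose i) = (0 :: 'a alg_closure)"
  using of_nat_CARD_choose[OF assms] by (metis to_ac_0 to_ac_of_nat)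

lemma of_nat_CARD_alg_closure: "of_nat CARD('a) = (0 :: 'a :: {field, finite} alg_closure)"
  using of_nat_CARD_alg_closure_choose[where 'a = 'a, of 1] CARD_ge_2[where 'a = 'a] by simp

lemma frobenius_add:
  fixes x y :: "'a :: {field, finite} alg_closure"
  shows "(x + y) ^ CARD('a) = x ^ CARD('a) + y ^ CARD('a)"
proof -
  let ?q = "CARD('a)"
  have "(x + y) ^ ?q = (\<Sum>i\<le>?q. of_nat (?q choose i) * x ^ i * y ^ (?q - i))"
    by (rule binomial_ring)
  also have "\<dots> = (\<Sum>i\<in>{0, ?q}. of_nat (?q choose i) * x ^ i * y ^ (?q - i))"
    by (rule sum.mono_neutral_right) (auto simp: of_nat_CARD_alg_closure_choose)
  also have "\<dots> = x ^ ?q + y ^ ?q"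
    using CARD_ge_2[where 'a = 'a] by simp
  finally show ?thesis .
qed

lemma frobenius_inj:
  fixes x y :: "'a :: {field, finite} alg_closure"
  assumes "x ^ CARD('a) = y ^ CARD('a)"
  shows "x = y"
  using frobenius_add[of "x - y" y] assms by simp

lemma funpow_power: "((\<lambda>x :: 'x :: monoid_mult. x ^ m) ^^ i) x = x ^ (m ^ i)"
  by (induction i) (simp_all add: power_mult[symmetric] mult.commute)

lemma funpow_inj: "inj (f :: 'x \<Rightarrow> 'x) \<Longrightarrow> (f ^^ i) x = (f ^^ i) y \<Longrightarrow> x = y"
  by (induction i) (simp_all add: inj_eq)

lemma Suc_M_order: "Suc (CARD('a :: {field, finite}) ^ n - 1) = CARD('a) ^ n"
  using CARD_ge_2[where 'a = 'a] by simp

lemma M_order_pos: "n \<ge> 1 \<Longrightarrow> CARD('a :: {field, finite}) ^ n - 1 > 0"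
  using CARD_ge_2[where 'a = 'a] one_less_power[of "CARD('a)" n] by simp

lemma M_units_iff: "(x :: 'a :: {field, finite} alg_closure) \<in> M_units n \<longleftrightarrow> x ^ (CARD('a) ^ n - 1) = 1"
  if "n \<ge> 1" for x
proof (cases "x = 0")
  case True
  with M_order_pos[OF that, where 'a = 'a] show ?thesis
    by (simp add: M_units_def power_0_left del: One_nat_def)
next
  case False
  have "x ^ (CARD('a) ^ n) = x ^ (CARD('a) ^ n - 1) * x"
    by (metis Suc_M_order power_Suc2)
  with False show ?thesis by (simp add: M_units_def)
qed

lemma M_units_1: "1 \<in> M_units n"
  by (simp add: M_units_def)

lemma M_units_mult: "x \<in> M_units n \<Longrightarrow> y \<in> M_units n \<Longrightarrow> x * y \<in> M_units n"
  by (simp add: M_units_def power_mult_distrib)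

lemma M_units_divide: "x \<in> M_units n \<Longrightarrow> y \<in> M_units n \<Longrightarrow> x / y \<in> M_units n"
  by (simp add: M_units_def power_divide)

lemma M_units_power: "x \<in> M_units n \<Longrightarrow> x ^ i \<in> M_units n"
  by (induction i) (auto intro: M_units_1 M_units_mult)

text \<open>The group consists of the roots of X^m - 1 with m = q^n - 1. In this characteristic m +
  1 = 0, so m is nonzero and the derivative m X^(m-1) vanishes at no root: there are m distinct
  roots.\<close>

lemma finite_card_M_units:
  assumes n: "n \<ge> 1"
  shows "finite (M_units n :: 'a :: {field, finite} alg_closure set)"
    and "card (M_units n :: 'a alg_closure set) = CARD('a) ^ n - 1"
proof -
  define m where "m = CARD('a) ^ n - 1"
  have m: "m > 0" unfolding m_def by (rule M_order_pos) fact
  have "of_nat (Suc m) = (0 :: 'a alg_closure)"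
    unfolding m_def Suc_M_order using n by (simp add: of_nat_CARD_alg_closure)
  then have m0: "of_nat m \<noteq> (0 :: 'a alg_closure)" by auto
  define p where "p = (monom 1 m - 1 :: 'a alg_closure poly)"
  have deg: "degree p = m"
    using degree_add_eq_left[of "- 1" "monom 1 m :: 'a alg_closure poly"] m
    by (simp add: p_def degree_monom_eq)
  have lc: "lead_coeff p = 1"
    unfolding deg using m by (simp add: p_def)
  have roots: "poly p x = 0 \<longleftrightarrow> x \<in> M_units n" for x
    by (simp add: p_def poly_monom M_units_iff[OF n] m_def)
  have "p \<noteq> 0" using deg m by auto
  then obtain A where A: "size A = m" "p = (\<Prod>x\<in>#A. [:- x, 1:])"
    using alg_closed_imp_factorization[of p] deg lc by auto
  have set: "set_mset A = M_units n"
    using roots unfolding A(2) by (force simp: poly_prod_mset prod_mset_zero_iff image_iff)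
  have "count A x = 1" if "x \<in># A" for x
  proof (rule ccontr)
    assume "count A x \<noteq> 1"
    moreover have "count A x > 0" using that by simp
    ultimately have "count A x > 1" by linarith
    then have "x \<in># A - {#x#}" by (simp add: in_diff_count)
    with that obtain A' where A': "A = add_mset x (add_mset x A')"
      by (metis insert_DiffM)
    have "poly (pderiv p) x = 0"
      unfolding A(2) A' by (simp add: pderiv_mult pderiv_pCons del: mult_pCons_left)
    moreover have "poly (pderiv p) x = of_nat m * x ^ (m - 1)"
      by (simp add: p_def pderiv_diff pderiv_monom poly_monom)
    moreover have "x \<noteq> 0"
      using that set by (auto simp: M_units_def)
    ultimately show False using m0 by simp
  qed
  then have "size A = card (set_mset A)"
    by (simp add: size_multiset_overloaded_eq)
  with A(1) set show "card (M_units n :: 'a alg_closure set) = CARD('a) ^ n - 1"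
    by (simp add: m_def)
  show "finite (M_units n :: 'a alg_closure set)"
    using set by (metis finite_set_mset)
qed

lemma frobenius_power_add:
  fixes x y :: "'a :: {field, finite} alg_closure"
  shows "(x + y) ^ (CARD('a) ^ n) = x ^ (CARD('a) ^ n) + y ^ (CARD('a) ^ n)"
  by (induction n) (simp_all add: power_mult frobenius_add mult.commute[of "CARD('a)"])

lemma frobenius_uminus:
  fixes x :: "'a :: {field, finite} alg_closure"
  shows "(- x) ^ (CARD('a) ^ n) = - (x ^ (CARD('a) ^ n))"
  using frobenius_power_add[of "- x" x n] by (simp add: eq_neg_iff_add_eq_0 zero_power)

text \<open>Together with 0 the group is the fixed set of the n-th iterate of Frobenius, a finite
  subfield. It is packaged as a ring record so that the cyclicity of the multiplicative group of a
  finite field applies.\<close>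

lemma M_units_cyclic:
  assumes n: "n \<ge> 1"
  shows "\<exists>g :: 'a :: {field, finite} alg_closure. M_units n = range (\<lambda>i :: nat. g ^ i)"
proof -
  define F where "F = {x :: 'a alg_closure. x ^ (CARD('a) ^ n) = x}"
  define R :: "'a alg_closure ring" where
    "R = \<lparr>carrier = F, monoid.mult = (*), one = 1, ring.zero = 0, add = (+)\<rparr>"
  have R: "carrier R = F" "monoid.mult R = (*)" "one R = 1" "zero R = 0" "add R = (+)"
    by (simp_all add: R_def)
  have F: "0 \<in> F" "1 \<in> F" "\<And>x y. x \<in> F \<Longrightarrow> y \<in> F \<Longrightarrow> x + y \<in> F"
    "\<And>x y. x \<in> F \<Longrightarrow> y \<in> F \<Longrightarrow> x * y \<in> F" "\<And>x. x \<in> F \<Longrightarrow> - x \<in> F" "\<And>x. x \<in> F \<Longrightarrow> inverse x \<in> F"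
    by (auto simp: F_def frobenius_power_add power_mult_distrib frobenius_uminus power_inverse zero_power)
  have "cring R"
  proof (rule cringI)
    show "abelian_group R"
      by (rule abelian_groupI) (auto simp: R F intro!: bexI[of _ "- _"])
    show "Group.comm_monoid R"
      by (rule comm_monoidI) (auto simp: R F)
  qed (auto simp: R algebra_simps)
  then interpret R: cring R .
  have "field R"
    by (rule R.cring_fieldI2) (auto simp: R intro!: bexI[of _ "inverse _"] F)
  then interpret R: field R .
  have F_eq: "F = insert 0 (M_units n)"
    using CARD_ge_2[where 'a = 'a] by (auto simp: F_def M_units_def zero_power)
  have "finite F"
    using finite_card_M_units(1)[OF n] by (simp add: F_eq)
  then obtain g where g: "g \<in> F - {0}" "F - {0} = {g [^]\<^bsub>R\<^esub> i | i :: nat. i \<in> UNIV}"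
    using R.finite_field_mult_group_has_gen by (auto simp: R)
  have pow: "g [^]\<^bsub>R\<^esub> i = g ^ i" for i :: nat
    by (induction i) (simp_all add: R mult.commute)
  have "M_units n = F - {0}" by (auto simp: F_eq M_units_def)
  also have "\<dots> = range (\<lambda>i :: nat. g ^ i)"
    using g(2) by (auto simp: pow)
  finally show ?thesis by blast
qed

section \<open>Characters of the finite groups and their orthogonality\<close>

lemma M_chars_mult: "\<chi> \<in> M_chars n \<Longrightarrow> x \<in> M_units n \<Longrightarrow> y \<in> M_units n \<Longrightarrow> \<chi> (x * y) = \<chi> x * \<chi> y"
  and M_chars_nonzero: "\<chi> \<in> M_chars n \<Longrightarrow> x \<in> M_units n \<Longrightarrow> \<chi> x \<noteq> 0"
  and M_chars_outside: "\<chi> \<in> M_chars n \<Longrightarrow> x \<notin> M_units n \<Longrightarrow> \<chi> x = 0"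
  by (simp_all add: M_chars_def)

lemma M_chars_one: "\<chi> \<in> M_chars n \<Longrightarrow> \<chi> 1 = 1"
  using M_chars_mult[of \<chi> n 1 1] M_chars_nonzero[of \<chi> n 1] by (simp add: M_units_1)

lemma M_chars_power_arg: "\<chi> \<in> M_chars n \<Longrightarrow> x \<in> M_units n \<Longrightarrow> \<chi> (x ^ i) = \<chi> x ^ i"
  by (induction i) (simp_all add: M_chars_one M_chars_mult M_units_power)

lemma M_chars_root_unity:
  assumes "n \<ge> 1" "\<chi> \<in> M_chars n" "x \<in> M_units n"
  shows "\<chi> (x :: 'a :: {field, finite} alg_closure) ^ (CARD('a) ^ n - 1) = 1"
  using assms M_chars_power_arg[OF assms(2,3), of "CARD('a) ^ n - 1"]
  by (simp add: M_units_iff M_chars_one)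

lemma M_chars_cnj:
  assumes "n \<ge> 1" "\<chi> \<in> M_chars n" "x \<in> M_units n"
  shows "cnj (\<chi> (x :: 'a :: {field, finite} alg_closure)) = inverse (\<chi> x)"
proof -
  have "norm (\<chi> x) ^ (CARD('a) ^ n - 1) = 1"
    using M_chars_root_unity[OF assms] by (metis norm_one norm_power)
  then have "norm (\<chi> x) = 1"
    using M_order_pos[OF assms(1), where 'a = 'a] power_eq_imp_eq_base[of "norm (\<chi> x)" _ 1] by simp
  then have "\<chi> x * cnj (\<chi> x) = 1"
    using complex_norm_square[of "\<chi> x"] by simp
  then show ?thesis by (metis inverse_unique)
qed

lemma M_chars_times:
  "\<chi> \<in> M_chars n \<Longrightarrow> \<psi> \<in> M_chars n \<Longrightarrow> (\<lambda>x. \<chi> x * \<psi> x) \<in> M_chars n"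
  by (auto simp: M_chars_def)

lemma M_chars_power: "\<chi> \<in> M_chars n \<Longrightarrow> i \<ge> 1 \<Longrightarrow> (\<lambda>x. \<chi> x ^ i) \<in> M_chars n"
  by (auto simp: M_chars_def power_mult_distrib)

lemma M_chars_inverse: "\<chi> \<in> M_chars n \<Longrightarrow> (\<lambda>x. inverse (\<chi> x)) \<in> M_chars n"
  by (auto simp: M_chars_def)

lemma M_chars_frobenius_periodic:
  assumes "n \<ge> 1" "\<chi> \<in> M_chars n"
  shows "\<chi> (x :: 'a :: {field, finite} alg_closure) ^ (CARD('a) ^ n) = \<chi> x"
proof (cases "x \<in> M_units n")
  case True
  have "\<chi> x ^ Suc (CARD('a) ^ n - 1) = \<chi> x"
    unfolding power_Suc M_chars_root_unity[OF assms True] by simp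
  then show ?thesis unfolding Suc_M_order .
next
  case False
  then show ?thesis
    using M_chars_outside[OF assms(2)] CARD_ge_2[where 'a = 'a] by simp
qed

definition M_gen :: "nat \<Rightarrow> 'a :: {field, finite} alg_closure" where
  "M_gen n = (SOME g. M_units n = range (\<lambda>i. g ^ i))"

lemma M_units_eq_range:
  "n \<ge> 1 \<Longrightarrow> M_units n = range (\<lambda>i. (M_gen n :: 'a :: {field, finite} alg_closure) ^ i)"
  unfolding M_gen_def by (rule someI_ex) (rule M_units_cyclic)

lemma M_gen_in: "n \<ge> 1 \<Longrightarrow> M_gen n \<in> M_units n"
  by (subst M_units_eq_range) (auto intro!: image_eqI[of _ _ 1])

text \<open>Counting: the powers with exponent below m = q^n - 1 already exhaust the group, which
  has m elements, so they are distinct.\<close>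

lemma M_gen_power_eq_1_iff:
  assumes n: "n \<ge> 1"
  shows "(M_gen n :: 'a :: {field, finite} alg_closure) ^ i = 1 \<longleftrightarrow> CARD('a) ^ n - 1 dvd i"
proof -
  let ?g = "M_gen n :: 'a alg_closure"
  define m where "m = CARD('a) ^ n - 1"
  have m: "m > 0" and g: "?g ^ m = 1"
    using M_order_pos[OF n, where 'a = 'a] M_gen_in[OF n] by (simp_all add: m_def M_units_iff[OF n])
  have red: "?g ^ j = ?g ^ (j mod m)" for j
  proof -
    have "?g ^ j = ?g ^ (m * (j div m) + j mod m)" by simp
    also have "\<dots> = ?g ^ (j mod m)" by (simp only: power_add power_mult g power_one mult_1)
    finally show ?thesis .
  qed
  have "M_units n = (\<lambda>j. ?g ^ j) ` {..<m}"
  proof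
    show "M_units n \<subseteq> (\<lambda>j. ?g ^ j) ` {..<m}"
    proof
      fix x :: "'a alg_closure" assume "x \<in> M_units n"
      then obtain j where "x = ?g ^ j" unfolding M_units_eq_range[OF n] by auto
      then have "x = ?g ^ (j mod m)" using red[of j] by simp
      then show "x \<in> (\<lambda>j. ?g ^ j) ` {..<m}" using m by auto
    qed
    show "(\<lambda>j. ?g ^ j) ` {..<m} \<subseteq> M_units n"
      using M_units_eq_range[OF n, where 'a = 'a] by auto
  qed
  then have "inj_on (\<lambda>j. ?g ^ j) {..<m}"
    using finite_card_M_units(2)[OF n, where 'a = 'a] by (intro eq_card_imp_inj_on) (auto simp: m_def)
  then have "?g ^ (i mod m) = ?g ^ 0 \<longleftrightarrow> i mod m = 0"
    using m by (subst inj_on_eq_iff[of _ "{..<m}"]) auto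
  then show ?thesis
    unfolding m_def[symmetric] using red[of i] by (simp add: dvd_eq_mod_eq_0)
qed

lemma M_chars_eqI:
  assumes "n \<ge> 1" "\<chi> \<in> M_chars n" "\<psi> \<in> M_chars n" "\<chi> (M_gen n) = \<psi> (M_gen n)"
  shows "\<chi> = \<psi>"
proof
  fix x
  show "\<chi> x = \<psi> x"
  proof (cases "x \<in> M_units n")
    case True
    then obtain i where "x = M_gen n ^ i"
      unfolding M_units_eq_range[OF assms(1)] by auto
    with assms show ?thesis by (simp add: M_chars_power_arg M_gen_in)
  qed (use assms in \<open>auto simp: M_chars_outside\<close>)
qed

text \<open>Sending g^i to c^i is well defined because g^i = g^j forces i and j to agree modulo m =
  q^n - 1, and c^m = 1.\<close>

lemma M_chars_exists:
  assumes n: "n \<ge> 1" and c: "c ^ (CARD('a) ^ n - 1) = 1"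
  shows "\<exists>\<chi>\<in>M_chars n. \<chi> (M_gen n :: 'a :: {field, finite} alg_closure) = c"
proof -
  let ?g = "M_gen n :: 'a alg_closure"
  define m where "m = CARD('a) ^ n - 1"
  have m: "m > 0" using M_order_pos[OF n, where 'a = 'a] by (simp add: m_def)
  have c0: "c \<noteq> 0" using c m by (auto simp: m_def power_0_left)
  have g0: "?g \<noteq> 0" using M_gen_in[OF n, where 'a = 'a] by (simp add: M_units_def)
  have le: "c ^ i = c ^ j" if "?g ^ i = ?g ^ j" "i \<le> j" for i j
  proof -
    have "?g ^ (j - i) = 1"
      using that g0 by (simp add: power_diff)
    then obtain k where "j - i = m * k"
      unfolding M_gen_power_eq_1_iff[OF n] m_def by (elim dvdE)
    then have "j = m * k + i" using that(2) by linarith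
    moreover have "c ^ m = 1" using c by (simp only: m_def)
    ultimately show ?thesis by (simp add: power_add power_mult)
  qed
  have eq: "c ^ i = c ^ j" if "?g ^ i = ?g ^ j" for i j
  proof (cases "i \<le> j")
    case True
    then show ?thesis using le that by blast
  next
    case False
    then show ?thesis using le[of j i] that by simp
  qed
  define \<chi> where "\<chi> x = (if x \<in> M_units n then c ^ (SOME i. ?g ^ i = x) else 0)" for x
  have \<chi>: "\<chi> (?g ^ i) = c ^ i" for i
  proof -
    have "?g ^ (SOME j. ?g ^ j = ?g ^ i) = ?g ^ i"
      by (rule someI[of _ i]) simp
    from eq[OF this] show ?thesis
      using M_units_power[OF M_gen_in[OF n, where 'a = 'a]] by (simp add: \<chi>_def)
  qed
  have "\<chi> \<in> M_chars n"
  proof -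
    have "\<chi> (x * y) = \<chi> x * \<chi> y" if "x \<in> M_units n" "y \<in> M_units n" for x y
    proof -
      from that obtain i j where "x = ?g ^ i" "y = ?g ^ j"
        unfolding M_units_eq_range[OF n] by auto
      then show ?thesis using \<chi>[of "i + j"] by (simp add: \<chi> power_add)
    qed
    with c0 show ?thesis by (simp add: M_chars_def \<chi>_def)
  qed
  moreover have "\<chi> ?g = c" using \<chi>[of 1] by simp
  ultimately show ?thesis by blast
qed

lemma M_chars_bij:
  assumes n: "n \<ge> 1"
  shows "bij_betw (\<lambda>\<chi>. \<chi> (M_gen n :: 'a :: {field, finite} alg_closure)) (M_chars n)
    {c. c ^ (CARD('a) ^ n - 1) = 1}"
  unfolding bij_betw_def
proof
  show "inj_on (\<lambda>\<chi>. \<chi> (M_gen n :: 'a alg_closure)) (M_chars n)"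
    by (rule inj_onI) (rule M_chars_eqI[OF n])
  show "(\<lambda>\<chi>. \<chi> (M_gen n :: 'a alg_closure)) ` M_chars n = {c. c ^ (CARD('a) ^ n - 1) = 1}"
    (is "?f ` _ = ?C")
  proof
    show "?f ` M_chars n \<subseteq> ?C"
      using M_chars_root_unity[OF n _ M_gen_in[OF n]] by auto
    show "?C \<subseteq> ?f ` M_chars n"
      using M_chars_exists[OF n, where 'a = 'a] by force
  qed
qed

lemma finite_card_M_chars:
  assumes n: "n \<ge> 1"
  shows "finite (M_chars n :: ('a :: {field, finite} alg_closure \<Rightarrow> complex) set)"
    and "card (M_chars n :: ('a alg_closure \<Rightarrow> complex) set) = CARD('a) ^ n - 1"
proof -
  have "finite {c :: complex. c ^ (CARD('a) ^ n - 1) = 1}"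
    by (rule finite_roots_unity) (use M_order_pos[OF n, where 'a = 'a] in linarith)
  then show "finite (M_chars n :: ('a alg_closure \<Rightarrow> complex) set)"
    using bij_betw_finite[OF M_chars_bij[OF n, where 'a = 'a]] by blast
  show "card (M_chars n :: ('a alg_closure \<Rightarrow> complex) set) = CARD('a) ^ n - 1"
    unfolding bij_betw_same_card[OF M_chars_bij[OF n, where 'a = 'a]]
    by (rule card_roots_unity_eq) (rule M_order_pos[OF n])
qed

lemma of_nat_M_order: "of_nat (CARD('a :: {field, finite}) ^ n - 1) = (of_nat CARD('a) ^ n - 1 :: complex)"
  using CARD_ge_2[where 'a = 'a] by (simp add: of_nat_diff)

text \<open>Multiplying all characters by one \<psi> with \<psi> x different from 1 permutes them
  and scales the sum by a factor other than 1.\<close>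

lemma sum_M_chars:
  assumes n: "n \<ge> 1" and x: "x \<in> M_units n"
  shows "(\<Sum>\<chi>\<in>M_chars n. cnj (\<chi> (x :: 'a :: {field, finite} alg_closure))) =
    (if x = 1 then of_nat CARD('a) ^ n - 1 else 0)"
proof (cases "x = 1")
  case True
  then show ?thesis
    using finite_card_M_chars[OF n, where 'a = 'a] by (simp add: M_chars_one of_nat_M_order)
next
  case False
  define m where "m = CARD('a) ^ n - 1"
  have m: "m > 0" using M_order_pos[OF n, where 'a = 'a] by (simp add: m_def)
  from x obtain i where i: "x = M_gen n ^ i"
    unfolding M_units_eq_range[OF n] by auto
  \<comment> \<open>A primitive m-th root of unity makes \<psi> faithful, so \<psi> x differs from 1
    whenever x does.\<close>
  define \<omega> where "\<omega> = cis (2 * pi / real m)"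
  have \<omega>: "\<omega> ^ m = 1" using m by (simp add: \<omega>_def DeMoivre)
  then obtain \<psi> where \<psi>: "\<psi> \<in> M_chars n" "\<psi> (M_gen n :: 'a alg_closure) = \<omega>"
    using M_chars_exists[OF n, of \<omega>, where 'a = 'a] by (auto simp: m_def)
  have \<psi>x: "\<psi> x = \<omega> ^ i"
    using \<psi> by (simp add: i M_chars_power_arg M_gen_in[OF n])
  have "\<omega> ^ i \<noteq> 1"
  proof
    assume "\<omega> ^ i = 1"
    then have "cis (2 * pi * real i / real m) = 1"
      by (simp add: \<omega>_def DeMoivre mult_ac)
    then obtain k :: int where "2 * pi * real i / real m = 2 * pi * of_int k"
      by (metis Re_complex_of_real cis.sel(1) cos_one_2pi_int mult.commute mult.left_commute of_real_1)
    then have "real i = real_of_int k * real m"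
      using m by (simp add: field_simps)
    then have "int i = k * int m"
      by (metis (mono_tags) of_int_eq_iff of_int_mult of_int_of_nat_eq)
    then have "m dvd i" by (metis dvd_triv_right int_dvd_int_iff)
    then show False
      using False i M_gen_power_eq_1_iff[OF n, where 'a = 'a] by (simp add: m_def)
  qed
  then have \<psi>1: "\<psi> x \<noteq> 1" using \<psi>x by simp
  have nz: "\<psi> y \<noteq> 0" if "y \<in> M_units n" for y
    using M_chars_nonzero[OF \<psi>(1) that] .
  have cancel: "\<psi> y * (inverse (\<psi> y) * \<chi> y) = \<chi> y" "inverse (\<psi> y) * (\<psi> y * \<chi> y) = \<chi> y"
    if "\<chi> \<in> M_chars n" for \<chi> y
    using nz[of y] M_chars_outside[OF that, of y] by (cases "y \<in> M_units n"; simp)+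
  have "(\<Sum>\<chi>\<in>M_chars n. cnj (\<chi> x)) = (\<Sum>\<chi>\<in>M_chars n. cnj (\<psi> x * \<chi> x))"
    by (rule sum.reindex_bij_witness[of _ "\<lambda>\<chi> y. \<psi> y * \<chi> y" "\<lambda>\<chi> y. inverse (\<psi> y) * \<chi> y"])
      (simp_all add: cancel M_chars_times M_chars_inverse \<psi>(1))
  also have "\<dots> = cnj (\<psi> x) * (\<Sum>\<chi>\<in>M_chars n. cnj (\<chi> x))"
    by (simp add: sum_distrib_left)
  finally have "(1 - cnj (\<psi> x)) * (\<Sum>\<chi>\<in>M_chars n. cnj (\<chi> x)) = 0"
    by (simp add: algebra_simps)
  moreover have "1 - cnj (\<psi> x) \<noteq> 0"
    using \<psi>1 by (metis complex_cnj_cancel_iff complex_cnj_one eq_iff_diff_eq_0)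
  ultimately show ?thesis using False by simp
qed

text \<open>The dual orthogonality: \<chi> \<psi>^-1 is a character, different from 1 at the
  generator unless \<chi> = \<psi>, and translation by the generator scales the sum.\<close>

lemma sum_M_units:
  assumes n: "n \<ge> 1" and \<chi>: "\<chi> \<in> M_chars n" and \<psi>: "\<psi> \<in> M_chars n"
  shows "(\<Sum>x\<in>(M_units n :: 'a :: {field, finite} alg_closure set). \<chi> x * cnj (\<psi> x)) =
    (if \<chi> = \<psi> then of_nat CARD('a) ^ n - 1 else 0)"
proof -
  have *: "(\<Sum>x\<in>M_units n. \<chi> x * cnj (\<psi> x)) = (\<Sum>x\<in>M_units n. \<chi> x * inverse (\<psi> x))"
    by (intro sum.cong) (auto simp: M_chars_cnj[OF n \<psi>])
  show ?thesis
  proof (cases "\<chi> = \<psi>")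
    case True
    then show ?thesis
      unfolding * using finite_card_M_units(2)[OF n, where 'a = 'a] M_chars_nonzero[OF \<psi>]
      by (simp add: of_nat_M_order)
  next
    case False
    let ?g = "M_gen n :: 'a alg_closure"
    define \<theta> where "\<theta> = (\<lambda>x. \<chi> x * inverse (\<psi> x))"
    have \<theta>: "\<theta> \<in> M_chars n"
      unfolding \<theta>_def by (intro M_chars_times M_chars_inverse \<chi> \<psi>)
    have g: "?g \<in> M_units n" by (rule M_gen_in[OF n])
    have "\<chi> ?g \<noteq> \<psi> ?g"
      using M_chars_eqI[OF n \<chi> \<psi>] False by blast
    then have ne: "\<theta> ?g \<noteq> 1"
      using M_chars_nonzero[OF \<psi> g] by (simp add: \<theta>_def field_simps)
    have g0: "?g \<noteq> 0" using g by (simp add: M_units_def)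
    have "(\<Sum>x\<in>M_units n. \<theta> x) = (\<Sum>x\<in>M_units n. \<theta> (?g * x))"
      by (rule sum.reindex_bij_witness[of _ "\<lambda>x. ?g * x" "\<lambda>x. x / ?g"])
        (use g g0 in \<open>auto intro: M_units_mult M_units_divide\<close>)
    also have "\<dots> = \<theta> ?g * (\<Sum>x\<in>M_units n. \<theta> x)"
      by (simp add: sum_distrib_left M_chars_mult[OF \<theta> g])
    finally have "(1 - \<theta> ?g) * (\<Sum>x\<in>M_units n. \<theta> x) = 0"
      by (simp add: algebra_simps)
    with ne False show ?thesis unfolding * by (simp add: \<theta>_def)
  qed
qed

text \<open>For m dividing n this is (q^n - 1)/(q^m - 1); the norm is a power map, and its
  properties become statements about exponents.\<close>

definition norm_exp :: "nat \<Rightarrow> nat \<Rightarrow> nat \<Rightarrow> nat" where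
  "norm_exp q m n = (\<Sum>i<n div m. q ^ (m * i))"

lemma norm_exp_mult: "m dvd n \<Longrightarrow> q \<ge> 1 \<Longrightarrow> norm_exp q m n * (q ^ m - 1) = q ^ n - 1"
proof -
  assume "m dvd n" and q: "q \<ge> 1"
  then obtain k where n: "n = m * k" by (elim dvdE)
  have *: "(q ^ m - 1) * (\<Sum>i<k. (q ^ m) ^ i) = (q ^ m) ^ k - 1" for k
  proof (induction k)
    case (Suc k)
    have "(q ^ m) ^ k \<ge> 1" using q by simp
    with Suc show ?case
      by (simp add: distrib_left diff_mult_distrib algebra_simps)
        (use q in \<open>simp add: le_diff_conv2\<close>)
  qed simp
  show ?thesis
  proof (cases "m = 0")
    case False
    then show ?thesis
      using *[of k] by (simp add: norm_exp_def n mult.commute flip: power_mult)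
  qed (simp add: n)
qed

lemma norm_exp_trans:
  assumes "m dvd n" "n dvd k" "q \<ge> 2" "m \<ge> 1"
  shows "norm_exp q n k * norm_exp q m n = norm_exp q m k"
proof -
  have "norm_exp q n k * norm_exp q m n * (q ^ m - 1) = norm_exp q m k * (q ^ m - 1)"
    using norm_exp_mult[of m n q] norm_exp_mult[of n k q] norm_exp_mult[of m k q] assms dvd_trans[of m n k]
    by (simp add: mult.assoc)
  moreover have "q ^ m - 1 > 0"
    using assms one_less_power[of q m] by simp
  ultimately show ?thesis by simp
qed

lemma norm_exp_pos: "m dvd n \<Longrightarrow> n \<ge> 1 \<Longrightarrow> q \<ge> 1 \<Longrightarrow> norm_exp q m n \<ge> 1"
proof -
  assume *: "m dvd n" "n \<ge> 1" "q \<ge> 1"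
  then have "m > 0" by (intro Nat.gr0I) auto
  with * have "0 < n div m" by (auto simp: div_greater_zero_iff dvd_imp_le)
  then have "0 < (\<Sum>i<n div m. q ^ (m * i))"
    using * by (intro sum_pos) (auto simp: lessThan_empty_iff)
  then show ?thesis by (simp add: norm_exp_def)
qed

lemma M_norm_eq: "M_norm m n (x :: 'a :: {field, finite} alg_closure) = x ^ norm_exp CARD('a) m n"
  by (simp add: M_norm_def norm_exp_def power_sum)

lemma M_norm_trans:
  assumes "m dvd n" "n dvd k" "m \<ge> 1"
  shows "M_norm m n (M_norm n k (x :: 'a :: {field, finite} alg_closure)) = M_norm m k x"
  using norm_exp_trans[OF assms(1,2) CARD_ge_2[where 'a = 'a] assms(3)]
  by (simp add: M_norm_eq power_mult[symmetric])

lemma M_norm_mult: "M_norm m n (x * y) = M_norm m n x * M_norm m n y"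
  by (simp add: M_norm_eq power_mult_distrib)

lemma M_norm_in:
  assumes "m dvd n" "m \<ge> 1" "n \<ge> 1" "x \<in> M_units n"
  shows "M_norm m n (x :: 'a :: {field, finite} alg_closure) \<in> M_units m"
  using assms norm_exp_mult[OF assms(1), of "CARD('a)"] CARD_ge_2[where 'a = 'a]
  by (simp add: M_units_iff M_norm_eq power_mult[symmetric])

text \<open>The algebraic closure contains a root of the required order, and such a root lies in M_n
  automatically: its (q^n - 1)-th power is the (q^m - 1)-th power of y.\<close>

lemma M_norm_surj:
  assumes "m dvd n" "m \<ge> 1" "n \<ge> 1" "y \<in> M_units m"
  shows "\<exists>x\<in>M_units n. M_norm m n x = (y :: 'a :: {field, finite} alg_closure)"
proof -
  obtain x where x: "x ^ norm_exp CARD('a) m n = y"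
    using nth_root_exists[of "norm_exp CARD('a) m n" y]
      norm_exp_pos[OF assms(1,3), of "CARD('a)"] CARD_ge_2[where 'a = 'a] by auto
  have "x ^ (CARD('a) ^ n - 1) = y ^ (CARD('a) ^ m - 1)"
    using norm_exp_mult[OF assms(1), of "CARD('a)"] CARD_ge_2[where 'a = 'a]
    by (simp add: x[symmetric] power_mult[symmetric])
  with assms x show ?thesis by (auto simp: M_units_iff M_norm_eq)
qed

lemma lift_char_in:
  assumes "m dvd n" "m \<ge> 1" "n \<ge> 1" "\<chi> \<in> M_chars m"
  shows "lift_char m n \<chi> \<in> (M_chars n :: ('a :: {field, finite} alg_closure \<Rightarrow> complex) set)"
  unfolding M_chars_def lift_char_def
  using assms by (auto simp: M_norm_mult M_chars_mult M_chars_nonzero M_norm_in M_units_mult)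

lemma lift_char_inj:
  assumes "m dvd n" "m \<ge> 1" "n \<ge> 1" "\<chi> \<in> M_chars m" "\<psi> \<in> M_chars m"
    and eq: "lift_char m n \<chi> = lift_char m n \<psi>"
  shows "\<chi> = (\<psi> :: 'a :: {field, finite} alg_closure \<Rightarrow> complex)"
proof
  fix y
  show "\<chi> y = \<psi> y"
  proof (cases "y \<in> M_units m")
    case True
    then obtain x where "x \<in> M_units n" "M_norm m n x = y"
      using M_norm_surj[OF assms(1-3)] by blast
    then show ?thesis using fun_cong[OF eq, of x] by (simp add: lift_char_def)
  qed (use assms in \<open>simp add: M_chars_outside\<close>)
qed

lemma lift_char_trans:
  assumes "m dvd n" "n dvd k" "m \<ge> 1" "n \<ge> 1" "k \<ge> 1"
  shows "lift_char n k (lift_char m n \<chi>) =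
    (lift_char m k \<chi> :: 'a :: {field, finite} alg_closure \<Rightarrow> complex)"
  using assms by (auto simp: lift_char_def fun_eq_iff M_norm_in M_norm_trans)

lemma lift_char_refl:
  assumes "n \<ge> 1" "\<chi> \<in> M_chars n"
  shows "lift_char n n \<chi> = (\<chi> :: 'a :: {field, finite} alg_closure \<Rightarrow> complex)"
  using assms by (auto simp: lift_char_def fun_eq_iff M_norm_def M_chars_outside)

lemma lift_char_power:
  "i \<ge> 1 \<Longrightarrow> lift_char m n (\<lambda>x. \<chi> x ^ i) = (\<lambda>x. lift_char m n \<chi> x ^ i)"
  by (auto simp: lift_char_def fun_eq_iff)

section \<open>The direct limit of the character groups and its Frobenius orbits\<close>

type_synonym 'a level_char = "nat \<times> ('a alg_closure \<Rightarrow> complex)"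

lemma same_char_iff:
  "((m, \<chi>), (n, \<psi>)) \<in> same_char \<longleftrightarrow> m \<ge> 1 \<and> n \<ge> 1 \<and> \<chi> \<in> M_chars m \<and> \<psi> \<in> M_chars n \<and>
    (\<exists>N\<ge>1. m dvd N \<and> n dvd N \<and> lift_char m N \<chi> = lift_char n N \<psi>)"
  by (auto simp: same_char_def level_chars_def)

text \<open>Agreement at one common level L implies agreement at every common level N: both lifts
  agree at level L N, and lifting from N to L N is injective. Transitivity of
  \<open>same_char\<close> rests on this.\<close>

lemma same_char_lift_eq:
  assumes "((m, \<chi>), (n, \<psi> :: 'a :: {field, finite} alg_closure \<Rightarrow> complex)) \<in> same_char"
    "m dvd N" "n dvd N" "N \<ge> 1"
  shows "lift_char m N \<chi> = lift_char n N \<psi>"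
proof -
  from assms(1) obtain L where *: "m \<ge> 1" "n \<ge> 1" "\<chi> \<in> M_chars m" "\<psi> \<in> M_chars n"
    and L: "L \<ge> 1" "m dvd L" "n dvd L" "lift_char m L \<chi> = lift_char n L \<psi>"
    by (auto simp: same_char_iff)
  have d: "L dvd L * N" "N dvd L * N" "L * N \<ge> 1"
    using L(1) assms(4) by auto
  have "lift_char N (L * N) (lift_char m N \<chi>) = lift_char L (L * N) (lift_char m L \<chi>)"
    using * L(1-3) assms d by (simp add: lift_char_trans)
  also have "\<dots> = lift_char N (L * N) (lift_char n N \<psi>)"
    unfolding L(4) using * L(1-3) assms d by (simp add: lift_char_trans)
  finally show ?thesis
    by (rule lift_char_inj[rotated -1]) (use * assms d in \<open>auto intro: lift_char_in\<close>)
qed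

lemma equiv_same_char: "equiv level_chars (same_char :: ('a :: {field, finite} level_char \<times> _) set)"
proof (rule equivI)
  show "same_char \<subseteq> level_chars \<times> (level_chars :: 'a level_char set)"
    by (auto simp: same_char_def)
  show "refl_on level_chars (same_char :: ('a level_char \<times> _) set)"
    by (auto simp: refl_on_def same_char_def level_chars_def)
  show "sym (same_char :: ('a level_char \<times> _) set)"
    by (auto simp: sym_def same_char_iff)
  show "trans (same_char :: ('a level_char \<times> _) set)"
  proof (rule transI, clarify)
    fix m n k and \<chi> \<psi> \<theta> :: "'a alg_closure \<Rightarrow> complex"
    assume 1: "((m, \<chi>), (n, \<psi>)) \<in> same_char" and 2: "((n, \<psi>), (k, \<theta>)) \<in> same_char"
    then have pos: "m \<ge> 1" "n \<ge> 1" "k \<ge> 1" "\<chi> \<in> M_chars m" "\<theta> \<in> M_chars k"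
      by (auto simp: same_char_iff)
    define N where "N = m * n * k"
    have N: "N \<ge> 1" "m dvd N" "n dvd N" "k dvd N"
      using pos by (auto simp: N_def)
    have "lift_char m N \<chi> = lift_char k N \<theta>"
      using same_char_lift_eq[OF 1 N(2,3,1)] same_char_lift_eq[OF 2 N(3,4,1)] by simp
    with pos N show "((m, \<chi>), (k, \<theta>)) \<in> same_char"
      unfolding same_char_iff by blast
  qed
qed

definition char_class :: "nat \<Rightarrow> ('a :: {field, finite} alg_closure \<Rightarrow> complex) \<Rightarrow> 'a level_char set" where
  "char_class n \<chi> = same_char `` {(n, \<chi>)}"

lemma char_class_eq_iff:
  assumes "m \<ge> 1" "n \<ge> 1" "\<chi> \<in> M_chars m" "\<psi> \<in> M_chars n"
  shows "char_class m \<chi> = char_class n \<psi> \<longleftrightarrow> ((m, \<chi>), (n, \<psi>)) \<in> same_char"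
  unfolding char_class_def using assms
  by (intro eq_equiv_class_iff[OF equiv_same_char]) (auto simp: level_chars_def)

lemma char_class_inj:
  assumes "n \<ge> 1" "\<chi> \<in> M_chars n" "\<psi> \<in> M_chars n" "char_class n \<chi> = char_class n \<psi>"
  shows "\<chi> = (\<psi> :: 'a :: {field, finite} alg_closure \<Rightarrow> complex)"
  using same_char_lift_eq[of n \<chi> n \<psi> n] assms by (simp add: char_class_eq_iff lift_char_refl)

lemma char_class_lift:
  assumes "m dvd n" "m \<ge> 1" "n \<ge> 1" "\<chi> \<in> M_chars m"
  shows "char_class n (lift_char m n \<chi>) = char_class m (\<chi> :: 'a :: {field, finite} alg_closure \<Rightarrow> complex)"
  using assms lift_char_in[OF assms]
  by (subst char_class_eq_iff) (auto simp: same_char_iff lift_char_refl intro!: exI[of _ n])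

lemma Mstar_eq: "Mstar = {char_class n \<chi> | n \<chi>. n \<ge> 1 \<and> \<chi> \<in> M_chars n}"
  by (auto simp: Mstar_def quotient_def char_class_def level_chars_def)

text \<open>\<open>frob_Mstar\<close> acts on all representatives at once, so its image must be
  shown to be a full class. The inclusion from right to left needs a preimage under Frobenius at the
  level of an arbitrary representative.\<close>

lemma frob_char_class:
  assumes n: "n \<ge> 1" and \<chi>: "\<chi> \<in> M_chars n"
  shows "frob_Mstar (char_class n \<chi>) =
    char_class n (\<lambda>x :: 'a :: {field, finite} alg_closure. \<chi> x ^ CARD('a))"
proof (intro equalityI subsetI)
  have q: "CARD('a) \<ge> 1" using CARD_ge_2[where 'a = 'a] by simp
  fix z
  {
    assume "z \<in> frob_Mstar (char_class n \<chi>)"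
    then obtain m \<psi> where z: "z = (m, \<lambda>x. \<psi> x ^ CARD('a))" and "((n, \<chi>), (m, \<psi>)) \<in> same_char"
      by (auto simp: frob_Mstar_def char_class_def)
    then show "z \<in> char_class n (\<lambda>x. \<chi> x ^ CARD('a))"
      by (auto simp: char_class_def same_char_iff M_chars_power lift_char_power[OF q] Suc_le_eq)
  }
  {
    assume "z \<in> char_class n (\<lambda>x. \<chi> x ^ CARD('a))"
    then obtain m \<psi> where z: "z = (m, \<psi>)" and *: "((n, \<lambda>x. \<chi> x ^ CARD('a)), (m, \<psi>)) \<in> same_char"
      by (cases z) (auto simp: char_class_def)
    from * have m: "m \<ge> 1" "\<psi> \<in> M_chars m" by (auto simp: same_char_iff)
    \<comment> \<open>Frobenius has order dividing m on the characters of M_m, so the power q^(m-1)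
      is its inverse.\<close>
    define r where "r = CARD('a) ^ (m - 1)"
    have r: "r \<ge> 1" using q by (simp add: r_def)
    define \<psi>' where "\<psi>' = (\<lambda>x. \<psi> x ^ r)"
    have \<psi>': "\<psi>' \<in> M_chars m" unfolding \<psi>'_def by (rule M_chars_power) fact+
    define N where "N = n * m"
    have N: "N \<ge> 1" "n dvd N" "m dvd N" using n m by (auto simp: N_def)
    have lift: "(\<lambda>x. lift_char n N \<chi> x ^ CARD('a)) = lift_char m N \<psi>"
      using same_char_lift_eq[OF * N(2,3,1)] by (simp add: lift_char_power[OF q])
    have "lift_char n N \<chi> = lift_char m N \<psi>'"
    proof
      fix x
      define c where "c = lift_char n N \<chi> x"
      have \<chi>N: "lift_char n N \<chi> \<in> M_chars N" by (rule lift_char_in) (use N n \<chi> in auto)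
      have \<psi>N: "lift_char m N \<psi> \<in> M_chars N" by (rule lift_char_in) (use N m in auto)
      have per: "c ^ (CARD('a) ^ N) = c"
        unfolding c_def by (rule M_chars_frobenius_periodic[OF N(1) \<chi>N])
      have b: "lift_char m N \<psi> x = c ^ CARD('a)"
        using fun_cong[OF lift, of x] by (simp add: c_def)
      have perb: "lift_char m N \<psi> x ^ (CARD('a) ^ m) = lift_char m N \<psi> x"
        using M_chars_frobenius_periodic[OF m(1) m(2)] fun_cong[OF lift_char_power[of "CARD('a) ^ m" m N \<psi>], of x] q
        by (simp add: lift_char_def)
      have itp: "d ^ (CARD('a) ^ (m * j)) = d" if "d ^ (CARD('a) ^ m) = d" for d :: complex and j
        by (induction j) (simp_all add: that power_add power_mult)
      have "c = c ^ (CARD('a) ^ N)" using per by simp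
      also have "\<dots> = (c ^ CARD('a)) ^ (CARD('a) ^ (N - 1))"
        unfolding power_mult[symmetric] power_Suc[symmetric] using N(1) by simp
      also have "N - 1 = m * (n - 1) + (m - 1)"
        using n m by (cases n; cases m) (auto simp: N_def)
      also have "(c ^ CARD('a)) ^ (CARD('a) ^ (m * (n - 1) + (m - 1))) =
          ((c ^ CARD('a)) ^ (CARD('a) ^ (m * (n - 1)))) ^ r"
        by (simp add: power_add power_mult r_def)
      also have "(c ^ CARD('a)) ^ (CARD('a) ^ (m * (n - 1))) = c ^ CARD('a)"
        by (rule itp) (use perb b in simp)
      also have "(c ^ CARD('a)) ^ r = lift_char m N \<psi>' x"
        using b lift_char_power[OF r, of m N \<psi>] by (simp add: \<psi>'_def)
      finally show "lift_char n N \<chi> x = lift_char m N \<psi>' x" by (simp add: c_def)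
    qed
    then have "(m, \<psi>') \<in> char_class n \<chi>"
      using n \<chi> m \<psi>' N by (auto simp: char_class_def same_char_iff)
    moreover have "\<psi>' x ^ CARD('a) = \<psi> x" for x
    proof -
      have "r * CARD('a) = CARD('a) ^ m"
        unfolding r_def power_Suc2[symmetric] using m by simp
      then show ?thesis
        using M_chars_frobenius_periodic[OF m] by (simp add: \<psi>'_def power_mult[symmetric])
    qed
    ultimately show "z \<in> frob_Mstar (char_class n \<chi>)"
      unfolding frob_Mstar_def z by (intro image_eqI[of _ _ "(m, \<psi>')"]) simp_all
  }
qed

lemma frob_funpow_char_class:
  assumes n: "n \<ge> 1" and \<chi>: "\<chi> \<in> M_chars n"
  shows "(frob_Mstar ^^ i) (char_class n \<chi>) =
    char_class n (\<lambda>x :: 'a :: {field, finite} alg_closure. \<chi> x ^ (CARD('a) ^ i))"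
proof (induction i)
  case (Suc i)
  have "(\<lambda>x. \<chi> x ^ (CARD('a) ^ i)) \<in> M_chars n"
    using CARD_ge_2[where 'a = 'a] by (intro M_chars_power \<chi>) simp
  with Suc show ?case
    by (simp add: frob_char_class[OF n] power_mult[symmetric] mult.commute)
qed simp

text \<open>The orbit size is the least period d, which divides every period; going d steps from any
  point of the orbit returns to that point.\<close>

lemma orbit_periodic:
  fixes f :: "'x \<Rightarrow> 'x"
  assumes per: "(f ^^ N) x = x" and N: "N \<ge> 1"
  defines "orb \<equiv> {(f ^^ i) x | i. True}"
  shows "finite orb" "card orb \<ge> 1" "card orb dvd N" "\<And>y. y \<in> orb \<Longrightarrow> (f ^^ card orb) y = y"
    and "\<And>y. y \<in> orb \<Longrightarrow> {(f ^^ i) y | i. True} = orb"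
proof -
  define d where "d = (LEAST d. d \<ge> 1 \<and> (f ^^ d) x = x)"
  have d: "d \<ge> 1" "(f ^^ d) x = x"
    using LeastI[of "\<lambda>d. d \<ge> 1 \<and> (f ^^ d) x = x" N] per N by (auto simp: d_def)
  have least: "d \<le> i" if "i \<ge> 1" "(f ^^ i) x = x" for i
    unfolding d_def by (rule Least_le) (use that in simp)
  have md: "(f ^^ (i mod d)) x = (f ^^ i) x" for i
    by (rule funpow_mod_eq[OF d(2)])
  have orb: "orb = (\<lambda>i. (f ^^ i) x) ` {..<d}"
  proof
    show "orb \<subseteq> (\<lambda>i. (f ^^ i) x) ` {..<d}"
    proof
      fix y assume "y \<in> orb"
      then obtain i where "y = (f ^^ i) x" by (auto simp: orb_def)
      then have "y = (f ^^ (i mod d)) x" using md[of i] by simp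
      moreover have "i mod d \<in> {..<d}" using d(1) by simp
      ultimately show "y \<in> (\<lambda>i. (f ^^ i) x) ` {..<d}" by blast
    qed
  qed (auto simp: orb_def)
  have "inj_on (\<lambda>i. (f ^^ i) x) {..<d}"
  proof (rule linorder_inj_onI)
    fix i j assume ij: "i < j" "i \<in> {..<d}" "j \<in> {..<d}"
    show "(f ^^ i) x \<noteq> (f ^^ j) x"
    proof
      assume "(f ^^ i) x = (f ^^ j) x"
      then have "(f ^^ (d - j)) ((f ^^ i) x) = (f ^^ (d - j)) ((f ^^ j) x)" by simp
      then have "(f ^^ (d - j + i)) x = (f ^^ (d - j + j)) x" by (simp only: funpow_add o_def)
      then have "(f ^^ (d - j + i)) x = x" using ij d by simp
      moreover have "d - j + i \<ge> 1" "d - j + i < d" using ij by auto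
      ultimately show False using least[of "d - j + i"] by linarith
    qed
  qed auto
  then have card: "card orb = d" by (simp add: orb card_image)
  show "finite orb" unfolding orb by simp
  show "card orb \<ge> 1" using d(1) by (simp add: card)
  have "(f ^^ (N mod d)) x = x" using md[of N] per by simp
  moreover have "N mod d < d" using d(1) by simp
  ultimately have "N mod d = 0" using least[of "N mod d"] by linarith
  then show "card orb dvd N" by (simp add: card dvd_eq_mod_eq_0)
  fix y assume "y \<in> orb"
  then obtain i where y: "y = (f ^^ i) x" by (auto simp: orb_def)
  have comm: "(f ^^ a) ((f ^^ b) z) = (f ^^ b) ((f ^^ a) z)" for a b z
    by (metis add.commute comp_apply funpow_add)
  show yd: "(f ^^ card orb) y = y"
    unfolding y card by (subst comm) (simp add: d)
  show "{(f ^^ i) y | i. True} = orb"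
  proof (intro equalityI subsetI)
    fix z assume "z \<in> {(f ^^ i) y | i. True}"
    then obtain j where "z = (f ^^ (j + i)) x" by (auto simp: y funpow_add)
    then show "z \<in> orb" by (auto simp: orb_def)
  next
    fix z assume "z \<in> orb"
    then obtain j where z: "z = (f ^^ j) x" by (auto simp: orb_def)
    have "(f ^^ (d * i)) x = x" for i
      using md[of "d * i"] by simp
    then have "z = (f ^^ j) ((f ^^ (d * i)) x)" using z by simp
    also have "\<dots> = (f ^^ (j + d * i)) x" by (simp add: funpow_add)
    \<comment> \<open>Adding d i leaves the point unchanged and makes the exponent at least i, so
      that z is reached from y by further applications.\<close>
    also have "j + d * i = (j + (d * i - i)) + i" using d(1) by (cases d) auto
    also have "(f ^^ \<dots>) x = (f ^^ (j + (d * i - i))) y" by (simp only: funpow_add y o_def)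
    finally show "z \<in> {(f ^^ i) y | i. True}" by blast
  qed
qed

lemma char_class_periodic:
  assumes "n \<ge> 1" "\<chi> \<in> M_chars n"
  shows "(frob_Mstar ^^ n) (char_class n \<chi>) =
    (char_class n \<chi> :: 'a :: {field, finite} level_char set)"
  using M_chars_frobenius_periodic[OF assms] by (simp add: frob_funpow_char_class[OF assms])

lemma Rep_phistar_cases:
  obtains n \<chi> where "n \<ge> 1" "\<chi> \<in> M_chars n"
    "Rep_phistar (\<phi> :: 'a :: {field, finite} phistar) = Mstar_orbit (char_class n \<chi>)"
  using Rep_phistar[of \<phi>] by (auto simp: Mstar_eq)

lemma Rep_orbit_of_char:
  "n \<ge> 1 \<Longrightarrow> \<chi> \<in> M_chars n \<Longrightarrow>
    Rep_phistar (orbit_of_char n \<chi> :: 'a :: {field, finite} phistar) = Mstar_orbit (char_class n \<chi>)"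
  unfolding orbit_of_char_def char_class_def[symmetric]
  by (rule Abs_phistar_inverse) (auto simp: Mstar_eq)

lemma phistar_size_pos: "phistar_size \<phi> \<ge> 1"
proof -
  obtain n \<chi> where *: "n \<ge> 1" "\<chi> \<in> M_chars n" "Rep_phistar \<phi> = Mstar_orbit (char_class n \<chi>)"
    by (rule Rep_phistar_cases)
  show ?thesis
    unfolding phistar_size_def *(3) Mstar_orbit_def
    by (rule orbit_periodic(2)[OF char_class_periodic[OF *(1,2)] *(1)])
qed

lemma phistar_size_dvd:
  assumes "n \<ge> 1" "\<chi> \<in> M_chars n"
  shows "phistar_size (orbit_of_char n \<chi>) dvd n"
  unfolding phistar_size_def Rep_orbit_of_char[OF assms] Mstar_orbit_def
  by (rule orbit_periodic(3)[OF char_class_periodic[OF assms] assms(1)])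

lemma orbit_of_char_eq_iff:
  assumes "n \<ge> 1" "\<chi> \<in> M_chars n"
  shows "orbit_of_char n \<chi> = \<phi> \<longleftrightarrow> char_class n \<chi> \<in> Rep_phistar \<phi>"
proof
  assume "orbit_of_char n \<chi> = \<phi>"
  then have "Rep_phistar \<phi> = Mstar_orbit (char_class n \<chi>)"
    using Rep_orbit_of_char[OF assms] by auto
  then show "char_class n \<chi> \<in> Rep_phistar \<phi>"
    by (auto simp: Mstar_orbit_def intro!: exI[of _ 0])
next
  obtain m \<psi> where *: "m \<ge> 1" "\<psi> \<in> M_chars m" "Rep_phistar \<phi> = Mstar_orbit (char_class m \<psi>)"
    by (rule Rep_phistar_cases)
  assume "char_class n \<chi> \<in> Rep_phistar \<phi>"
  then have "Mstar_orbit (char_class n \<chi>) = Rep_phistar \<phi>"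
    unfolding *(3) Mstar_orbit_def
    by (rule orbit_periodic(5)[OF char_class_periodic[OF *(1,2)] *(1)])
  then show "orbit_of_char n \<chi> = \<phi>"
    by (metis Rep_orbit_of_char[OF assms] Rep_phistar_inject)
qed

text \<open>Descent of Frobenius-fixed characters by counting. Those of M_L fixed by the power q^N
  are determined by their value at the generator, a (q^N - 1)-th root of unity; the lifts from level
  N are fixed and already q^N - 1 in number.\<close>

lemma lift_char_fixed:
  assumes "N dvd L" "N \<ge> 1" "L \<ge> 1" "\<psi> \<in> M_chars L" and per: "\<And>x. \<psi> x ^ (CARD('a) ^ N) = \<psi> x"
  shows "\<psi> \<in> lift_char N L ` (M_chars N :: ('a :: {field, finite} alg_closure \<Rightarrow> complex) set)"
proof -
  define A where "A = {\<psi> \<in> M_chars L. \<forall>x :: 'a alg_closure. \<psi> x ^ (CARD('a) ^ N) = \<psi> x}"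
  have m: "CARD('a) ^ N - 1 \<ge> 1"
    using M_order_pos[OF assms(2), where 'a = 'a] by linarith
  have root: "\<psi> (M_gen L) \<in> {c. c ^ (CARD('a) ^ N - 1) = 1}" if "\<psi> \<in> A" for \<psi>
  proof -
    have "\<psi> (M_gen L) * \<psi> (M_gen L) ^ (CARD('a) ^ N - 1) = \<psi> (M_gen L) * 1"
      using that unfolding power_Suc[symmetric] Suc_M_order by (simp add: A_def)
    moreover have "\<psi> (M_gen L) \<noteq> 0"
      using that M_chars_nonzero[OF _ M_gen_in[OF assms(3)]] by (auto simp: A_def)
    ultimately show ?thesis unfolding mult_cancel_left by blast
  qed
  have fin: "finite {c :: complex. c ^ (CARD('a) ^ N - 1) = 1}"
    by (rule finite_roots_unity[OF m])
  have inj: "inj_on (\<lambda>\<psi>. \<psi> (M_gen L)) A"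
    by (rule inj_onI, rule M_chars_eqI[OF assms(3)]) (simp_all add: A_def)
  have "card A \<le> card {c :: complex. c ^ (CARD('a) ^ N - 1) = 1}"
    by (rule card_inj_on_le[OF inj _ fin]) (use root in auto)
  also have "\<dots> = CARD('a) ^ N - 1"
    by (rule card_roots_unity_eq) (use m in linarith)
  finally have card_A: "card A \<le> CARD('a) ^ N - 1" .
  have finA: "finite A"
    by (rule finite_subset[OF _ finite_card_M_chars(1)[OF assms(3)]]) (auto simp: A_def)
  have "inj_on (lift_char N L) (M_chars N :: ('a alg_closure \<Rightarrow> complex) set)"
    by (rule inj_onI) (rule lift_char_inj[OF assms(1,2,3)])
  then have "card (lift_char N L ` (M_chars N :: ('a alg_closure \<Rightarrow> complex) set)) = CARD('a) ^ N - 1"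
    using finite_card_M_chars(2)[OF assms(2), where 'a = 'a] by (simp add: card_image)
  moreover have "lift_char N L ` (M_chars N :: ('a alg_closure \<Rightarrow> complex) set) \<subseteq> A"
  proof
    fix \<psi>' assume "\<psi>' \<in> lift_char N L ` (M_chars N :: ('a alg_closure \<Rightarrow> complex) set)"
    then obtain \<chi> where \<chi>: "\<chi> \<in> M_chars N" "\<psi>' = lift_char N L \<chi>" by blast
    have "lift_char N L \<chi> x ^ (CARD('a) ^ N) = lift_char N L \<chi> x" for x
      using M_chars_frobenius_periodic[OF assms(2) \<chi>(1), of "M_norm N L x"] CARD_ge_2[where 'a = 'a]
      by (simp add: lift_char_def power_0_left)
    with lift_char_in[OF assms(1,2,3) \<chi>(1)] show "\<psi>' \<in> A"
      unfolding A_def \<chi>(2) by blast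
  qed
  ultimately have "lift_char N L ` (M_chars N :: ('a alg_closure \<Rightarrow> complex) set) = A"
    using card_A finA by (metis card_seteq)
  with assms(4) per show ?thesis by (simp add: A_def)
qed

text \<open>If |\<phi>| divides N, every class in the orbit is fixed by the N-th iterate of
  Frobenius, hence comes from level N by \<open>lift_char_fixed\<close>, in exactly one way by
  \<open>char_class_inj\<close>.\<close>

lemma card_M_chars_orbit:
  assumes N: "N \<ge> 1"
  shows "card {\<chi> \<in> M_chars N. orbit_of_char N \<chi> = (\<phi> :: 'a :: {field, finite} phistar)} =
    (if phistar_size \<phi> dvd N then phistar_size \<phi> else 0)"
proof (cases "phistar_size \<phi> dvd N")
  case False
  then have empty: "{\<chi> \<in> M_chars N. orbit_of_char N \<chi> = \<phi>} = {}"
    using phistar_size_dvd[OF N] by auto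
  show ?thesis unfolding empty using False by simp
next
  case True
  obtain m \<psi> where *: "m \<ge> 1" "\<psi> \<in> M_chars m" "Rep_phistar \<phi> = Mstar_orbit (char_class m \<psi>)"
    by (rule Rep_phistar_cases)
  note orb = orbit_periodic[OF char_class_periodic[OF *(1,2)] *(1),
      folded Mstar_orbit_def, folded *(3), folded phistar_size_def]
  have "Rep_phistar \<phi> \<subseteq> char_class N ` {\<chi> \<in> M_chars N. orbit_of_char N \<chi> = \<phi>}"
  proof
    fix c assume c: "c \<in> Rep_phistar \<phi>"
    then obtain i where i: "c = (frob_Mstar ^^ i) (char_class m \<psi>)"
      unfolding *(3) Mstar_orbit_def by blast
    define \<chi> where "\<chi> = (\<lambda>x. \<psi> x ^ (CARD('a) ^ i))"
    have \<chi>: "\<chi> \<in> M_chars m"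
      unfolding \<chi>_def by (rule M_chars_power[OF *(2)]) (use CARD_ge_2[where 'a = 'a] in simp)
    have c_eq: "c = char_class m \<chi>"
      unfolding \<chi>_def i by (rule frob_funpow_char_class[OF *(1,2)])
    define d where "d = phistar_size \<phi>"
    have "(\<lambda>x. \<chi> x ^ (CARD('a) ^ d)) \<in> M_chars m"
      using CARD_ge_2[where 'a = 'a] by (intro M_chars_power \<chi>) simp
    then have "(\<lambda>x. \<chi> x ^ (CARD('a) ^ d)) = \<chi>"
      by (rule char_class_inj[OF *(1) _ \<chi>])
        (use orb(4)[OF c] in \<open>simp only: d_def c_eq frob_funpow_char_class[OF *(1) \<chi>]\<close>)
    from fun_cong[OF this] have fix_d: "\<chi> x ^ (CARD('a) ^ d) = \<chi> x" for x .
    have "\<chi> x ^ (CARD('a) ^ (d * j)) = \<chi> x" for x j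
    proof (induction j)
      case (Suc j)
      have "\<chi> x ^ (CARD('a) ^ (d * Suc j)) = (\<chi> x ^ (CARD('a) ^ d)) ^ (CARD('a) ^ (d * j))"
        by (simp only: mult_Suc_right power_add power_mult)
      with Suc show ?case by (simp only: fix_d)
    qed simp
    moreover obtain j where "N = d * j" using True unfolding d_def by (elim dvdE)
    ultimately have fix_N: "\<chi> x ^ (CARD('a) ^ N) = \<chi> x" for x by (simp only:)
    \<comment> \<open>The descent to level N starts from a level above both m and N.\<close>
    define L where "L = m * N"
    have L: "L \<ge> 1" "m dvd L" "N dvd L" using *(1) N by (auto simp: L_def)
    have "lift_char m L \<chi> x ^ (CARD('a) ^ N) = lift_char m L \<chi> x" for x
      using fix_N CARD_ge_2[where 'a = 'a] by (simp add: lift_char_def power_0_left)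
    then have "lift_char m L \<chi> \<in> lift_char N L ` M_chars N"
      by (intro lift_char_fixed[OF L(3) N L(1) lift_char_in[OF L(2) *(1) L(1) \<chi>]])
    then obtain \<theta> where \<theta>: "\<theta> \<in> M_chars N" "lift_char m L \<chi> = lift_char N L \<theta>" by auto
    have "char_class N \<theta> = char_class L (lift_char N L \<theta>)"
      using char_class_lift[OF L(3) N L(1) \<theta>(1)] by simp
    also have "\<dots> = c"
      unfolding \<theta>(2)[symmetric] c_eq by (rule char_class_lift[OF L(2) *(1) L(1) \<chi>])
    finally show "c \<in> char_class N ` {\<chi> \<in> M_chars N. orbit_of_char N \<chi> = \<phi>}"
      using c \<theta>(1) orbit_of_char_eq_iff[OF N \<theta>(1), of \<phi>] by (intro image_eqI[of _ _ \<theta>]) simp_all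
  qed
  moreover have "char_class N ` {\<chi> \<in> M_chars N. orbit_of_char N \<chi> = \<phi>} \<subseteq> Rep_phistar \<phi>"
  proof (rule image_subsetI)
    fix \<chi> assume "\<chi> \<in> {\<chi> \<in> M_chars N. orbit_of_char N \<chi> = \<phi>}"
    then have "\<chi> \<in> M_chars N" "orbit_of_char N \<chi> = \<phi>" by simp_all
    then show "char_class N \<chi> \<in> Rep_phistar \<phi>"
      using orbit_of_char_eq_iff[OF N, of \<chi> \<phi>] by simp
  qed
  ultimately have image: "char_class N ` {\<chi> \<in> M_chars N. orbit_of_char N \<chi> = \<phi>} = Rep_phistar \<phi>"
    by (rule equalityI[rotated])
  have "inj_on (char_class N) {\<chi> \<in> M_chars N. orbit_of_char N \<chi> = \<phi>}"
    by (rule inj_onI, rule char_class_inj[OF N]) simp_all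
  from card_image[OF this] show ?thesis
    unfolding image using True by (simp only: phistar_size_def if_True)
qed

lemma finite_phistar_size_dvd:
  assumes N: "N \<ge> 1"
  shows "finite {\<phi> :: 'a :: {field, finite} phistar. phistar_size \<phi> dvd N}"
proof -
  have "{\<phi>. phistar_size \<phi> dvd N} \<subseteq> orbit_of_char N ` (M_chars N :: ('a alg_closure \<Rightarrow> complex) set)"
  proof
    fix \<phi> :: "'a phistar" assume "\<phi> \<in> {\<phi>. phistar_size \<phi> dvd N}"
    then have "card {\<chi> \<in> M_chars N. orbit_of_char N \<chi> = \<phi>} \<noteq> 0"
      using card_M_chars_orbit[OF N, of \<phi>] phistar_size_pos[of \<phi>] by simp
    then have "{\<chi> \<in> M_chars N. orbit_of_char N \<chi> = \<phi>} \<noteq> {}" by (metis card.empty)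
    then show "\<phi> \<in> orbit_of_char N ` M_chars N" by blast
  qed
  then show ?thesis
    by (rule finite_subset) (simp add: finite_card_M_chars(1)[OF N])
qed

text \<open>Every size up to n divides n!, which reduces the claim to a single level.\<close>

lemma finite_phistar_size_le: "finite {\<phi> :: 'a :: {field, finite} phistar. phistar_size \<phi> \<le> n}"
proof -
  have "{\<phi> :: 'a phistar. phistar_size \<phi> \<le> n} \<subseteq> {\<phi>. phistar_size \<phi> dvd fact n}"
    using phistar_size_pos by (auto intro!: dvd_fact simp: Suc_le_eq)
  then show ?thesis
    by (rule finite_subset) (simp add: finite_phistar_size_dvd)
qed

lemma orbit_of_char_exists:
  assumes "N \<ge> 1" "phistar_size \<phi> dvd N"
  shows "\<exists>\<chi>\<in>M_chars N. orbit_of_char N \<chi> = (\<phi> :: 'a :: {field, finite} phistar)"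
proof -
  have "card {\<chi> \<in> M_chars N. orbit_of_char N \<chi> = \<phi>} \<noteq> 0"
    using card_M_chars_orbit[OF assms(1), of \<phi>] assms(2) phistar_size_pos[of \<phi>] by simp
  then have "{\<chi> \<in> M_chars N. orbit_of_char N \<chi> = \<phi>} \<noteq> {}" by (metis card.empty)
  then show ?thesis by blast
qed

lemma sum_orbit_of_char:
  fixes F :: "'a :: {field, finite} phistar \<Rightarrow> 'b :: comm_semiring_1"
  assumes N: "N \<ge> 1"
  shows "(\<Sum>\<chi>\<in>M_chars N. F (orbit_of_char N \<chi>)) =
    (\<Sum>\<phi> | phistar_size \<phi> dvd N. of_nat (phistar_size \<phi>) * F \<phi>)"
proof -
  have "(\<Sum>\<chi>\<in>M_chars N. F (orbit_of_char N \<chi>)) =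
      (\<Sum>\<phi> | phistar_size \<phi> dvd N. \<Sum>\<chi> | \<chi> \<in> M_chars N \<and> orbit_of_char N \<chi> = \<phi>. F (orbit_of_char N \<chi>))"
    by (rule sum.group[symmetric])
      (use phistar_size_dvd[OF N] in \<open>auto simp: finite_card_M_chars(1)[OF N] finite_phistar_size_dvd[OF N]\<close>)
  also have "\<dots> = (\<Sum>\<phi> | phistar_size \<phi> dvd N. of_nat (phistar_size \<phi>) * F \<phi>)"
  proof (rule sum.cong[OF refl])
    fix \<phi> :: "'a phistar" assume "\<phi> \<in> {\<phi>. phistar_size \<phi> dvd N}"
    then show "(\<Sum>\<chi> | \<chi> \<in> M_chars N \<and> orbit_of_char N \<chi> = \<phi>. F (orbit_of_char N \<chi>)) =
        of_nat (phistar_size \<phi>) * F \<phi>"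
      using card_M_chars_orbit[OF N, of \<phi>] by simp
  qed
  finally show ?thesis .
qed

text \<open>Counts the characters of M_N by orbits. This identity is what lets the geometric series
  in -1/q factor over the colours.\<close>

lemma sum_phistar_size:
  assumes N: "N \<ge> 1"
  shows "(\<Sum>\<phi> :: 'a :: {field, finite} phistar | phistar_size \<phi> dvd N. of_nat (phistar_size \<phi>)) =
    (of_nat CARD('a) ^ N - 1 :: complex)"
  using sum_orbit_of_char[OF N, of "\<lambda>_ :: 'a phistar. 1 :: complex"]
    finite_card_M_chars(2)[OF N, where 'a = 'a] by (simp add: of_nat_M_order)

lemma orbit_of_char_frobenius:
  assumes n: "n \<ge> 1" and \<chi>: "\<chi> \<in> M_chars n"
  shows "orbit_of_char n (\<lambda>x :: 'a :: {field, finite} alg_closure. \<chi> x ^ CARD('a)) = orbit_of_char n \<chi>"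
proof -
  have "(\<lambda>x. \<chi> x ^ CARD('a)) \<in> M_chars n"
    using CARD_ge_2[where 'a = 'a] by (intro M_chars_power \<chi>) simp
  then show ?thesis
    by (subst orbit_of_char_eq_iff[OF n])
      (auto simp: Rep_orbit_of_char[OF n \<chi>] Mstar_orbit_def frob_char_class[OF n \<chi>, symmetric] intro!: exI[of _ 1])
qed

section \<open>Evaluation homomorphisms and derivations\<close>

definition mon_eval :: "('v \<Rightarrow> 's :: comm_ring_1) \<Rightarrow> ('v \<Rightarrow>\<^sub>0 nat) \<Rightarrow> 's" where
  "mon_eval f m = (\<Prod>x\<in>Poly_Mapping.keys m. f x ^ Poly_Mapping.lookup m x)"

lemma mon_eval_superset:
  assumes "finite A" "Poly_Mapping.keys m \<subseteq> A"
  shows "mon_eval f m = (\<Prod>x\<in>A. f x ^ Poly_Mapping.lookup m x)"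
  unfolding mon_eval_def by (rule prod.mono_neutral_left) (use assms in \<open>auto simp: in_keys_iff\<close>)

lemma mon_eval_0 [simp]: "mon_eval f 0 = 1"
  by (simp add: mon_eval_def)

lemma mon_eval_single [simp]: "mon_eval f (Poly_Mapping.single x k) = f x ^ k"
  by (subst mon_eval_superset[of "{x}"]) (auto split: if_splits)

lemma mon_eval_add: "mon_eval f (m + m') = mon_eval f m * mon_eval f m'"
proof -
  let ?A = "Poly_Mapping.keys m \<union> Poly_Mapping.keys m'"
  show ?thesis
    using keys_add[of m m']
    by (subst (1 2 3) mon_eval_superset[of ?A])
      (auto simp: lookup_add power_add prod.distrib)
qed

definition ring_hom_fun :: "('r :: comm_ring_1 \<Rightarrow> 's :: comm_ring_1) \<Rightarrow> bool" where
  "ring_hom_fun h \<longleftrightarrow> h 1 = 1 \<and> (\<forall>x y. h (x + y) = h x + h y) \<and> (\<forall>x y. h (x * y) = h x * h y)"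

lemma ring_hom_fun_0: "ring_hom_fun h \<Longrightarrow> h 0 = 0"
  unfolding ring_hom_fun_def by (metis add_cancel_right_left add_0)

lemma ring_hom_fun_sum: "ring_hom_fun h \<Longrightarrow> h (sum f A) = (\<Sum>x\<in>A. h (f x))"
  using ring_hom_fun_0 by (induction A rule: infinite_finite_induct) (auto simp: ring_hom_fun_def)

lemma ring_hom_fun_prod: "ring_hom_fun h \<Longrightarrow> h (prod f A) = (\<Prod>x\<in>A. h (f x))"
  by (induction A rule: infinite_finite_induct) (auto simp: ring_hom_fun_def)

lemma ring_hom_fun_of_nat: "ring_hom_fun h \<Longrightarrow> h (of_nat n) = of_nat n"
  using ring_hom_fun_0 by (induction n) (auto simp: ring_hom_fun_def)

definition poly_eval ::
    "('c :: comm_ring_1 \<Rightarrow> 's :: comm_ring_1) \<Rightarrow> ('v \<Rightarrow> 's) \<Rightarrow> (('v \<Rightarrow>\<^sub>0 nat) \<Rightarrow>\<^sub>0 'c) \<Rightarrow> 's" where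
  "poly_eval \<iota> f u = (\<Sum>m\<in>Poly_Mapping.keys u. \<iota> (Poly_Mapping.lookup u m) * mon_eval f m)"

lemma poly_mapping_sum_single:
  "u = (\<Sum>m\<in>Poly_Mapping.keys u. Poly_Mapping.single m (Poly_Mapping.lookup u m))"
  by (rule poly_mapping_eqI)
    (auto simp: lookup_sum lookup_single when_def sum.delta in_keys_iff)

context
  fixes \<iota> :: "'c :: comm_ring_1 \<Rightarrow> 's :: comm_ring_1" and f :: "'v \<Rightarrow> 's"
  assumes \<iota>: "ring_hom_fun \<iota>"
begin

lemma poly_eval_superset:
  assumes "finite A" "Poly_Mapping.keys u \<subseteq> A"
  shows "poly_eval \<iota> f u = (\<Sum>m\<in>A. \<iota> (Poly_Mapping.lookup u m) * mon_eval f m)"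
  unfolding poly_eval_def
  by (rule sum.mono_neutral_left) (use assms in \<open>auto simp: in_keys_iff ring_hom_fun_0[OF \<iota>]\<close>)

lemma poly_eval_0: "poly_eval \<iota> f 0 = 0"
  by (simp add: poly_eval_def)

lemma poly_eval_add: "poly_eval \<iota> f (u + v) = poly_eval \<iota> f u + poly_eval \<iota> f v"
proof -
  let ?A = "Poly_Mapping.keys u \<union> Poly_Mapping.keys v"
  have "\<iota> (a + b) = \<iota> a + \<iota> b" for a b using \<iota> by (simp add: ring_hom_fun_def)
  then show ?thesis
    using keys_add[of u v]
    by (subst (1 2 3) poly_eval_superset[of ?A])
      (auto simp: lookup_add distrib_right sum.distrib)
qed

lemma poly_eval_sum: "poly_eval \<iota> f (sum g A) = (\<Sum>x\<in>A. poly_eval \<iota> f (g x))"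
  by (induction A rule: infinite_finite_induct) (auto simp: poly_eval_0 poly_eval_add)

lemma poly_eval_single: "poly_eval \<iota> f (Poly_Mapping.single m c) = \<iota> c * mon_eval f m"
  by (subst poly_eval_superset[of "{m}"]) (auto split: if_splits)

lemma poly_eval_mult: "poly_eval \<iota> f (u * v) = poly_eval \<iota> f u * poly_eval \<iota> f v"
proof -
  have *: "\<iota> (a * b) = \<iota> a * \<iota> b" for a b using \<iota> by (simp add: ring_hom_fun_def)
  have "u * v = (\<Sum>m\<in>Poly_Mapping.keys u. Poly_Mapping.single m (Poly_Mapping.lookup u m)) *
      (\<Sum>m\<in>Poly_Mapping.keys v. Poly_Mapping.single m (Poly_Mapping.lookup v m))"
    using poly_mapping_sum_single[of u] poly_mapping_sum_single[of v] by simp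
  also have "poly_eval \<iota> f \<dots> = poly_eval \<iota> f u * poly_eval \<iota> f v"
    by (simp add: poly_eval_sum sum_product mult_single poly_eval_single * mon_eval_add)
      (simp add: poly_eval_def sum_product mult_ac)
  finally show ?thesis .
qed

lemma ring_hom_poly_eval: "ring_hom_fun (poly_eval \<iota> f)"
  using poly_eval_single[of 0 1] \<iota>
  by (simp add: ring_hom_fun_def poly_eval_add poly_eval_mult)

end

section \<open>Scalars and induction in the polynomial algebra\<close>

lemma scalar_0 [simp]: "scalar 0 = 0" and scalar_1 [simp]: "scalar 1 = 1"
  by (simp_all add: scalar_def)

lemma scalar_add: "scalar (c + d) = scalar c + scalar d"
  by (simp add: scalar_def single_add)

lemma scalar_minus: "scalar (- c) = - scalar c"
  by (simp add: scalar_def single_uminus)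

lemma scalar_diff: "scalar (c - d) = scalar c - scalar d"
  by (simp add: scalar_def single_diff)

lemma scalar_mult: "scalar (c * d) = scalar c * scalar d"
  by (simp add: scalar_def mult_single)

lemma scalar_of_nat: "scalar (of_nat n) = of_nat n"
  by (simp add: scalar_def)

lemma scalar_sum: "scalar (sum f A) = (\<Sum>x\<in>A. scalar (f x))"
  by (induction A rule: infinite_finite_induct) (auto simp: scalar_add)

lemma scalar_power: "scalar (c ^ n) = scalar c ^ n"
  by (induction n) (auto simp: scalar_mult)

lemma ring_hom_scalar: "ring_hom_fun scalar"
  by (simp add: ring_hom_fun_def scalar_add scalar_mult)

lemma lookup_scalar_mult: "Poly_Mapping.lookup (scalar c * u) m = c * Poly_Mapping.lookup u m"
  by (simp add: scalar_def flip: mult_map_scale_conv_mult) (simp add: Poly_Mapping.map.rep_eq when_def)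

text \<open>Takes the place of division by n in recursions of the form n h_n = ...; it is checked on
  coefficients.\<close>

lemma of_nat_mult_cancel_FG:
  assumes "n > 0" "of_nat n * u = of_nat n * (v :: 'a :: {field, finite} FG)"
  shows "u = v"
proof (rule poly_mapping_eqI)
  fix m
  have "Poly_Mapping.lookup (scalar (of_nat n) * u) m = Poly_Mapping.lookup (scalar (of_nat n) * v) m"
    using assms(2) by (simp add: scalar_of_nat)
  with assms(1) show "Poly_Mapping.lookup u m = Poly_Mapping.lookup v m"
    by (simp only: lookup_scalar_mult) simp
qed

lemma p_gen_single: "p_gen (Suc i) \<phi> * Poly_Mapping.single m c =
    Poly_Mapping.single (Poly_Mapping.single (\<phi>, i) 1 + m) c"
  by (simp add: p_gen_def mult_single)

lemma monomial_induct [case_names zero plus]: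
  fixes m :: "'v \<Rightarrow>\<^sub>0 nat"
  assumes G0: "G 0" and GS: "\<And>x m. G m \<Longrightarrow> G (Poly_Mapping.single x 1 + m)"
  shows "G m"
proof -
  have Gk: "G (Poly_Mapping.single x k + m)" if "G m" for x k m
  proof (induction k)
    case (Suc k)
    have "Poly_Mapping.single x (Suc k) + m = Poly_Mapping.single x 1 + (Poly_Mapping.single x k + m)"
      by (simp flip: single_add add.assoc)
    then show ?case using GS[OF Suc] by simp
  qed (simp add: that)
  have "finite A \<Longrightarrow> G (\<Sum>x\<in>A. Poly_Mapping.single x (g x))" for A g
    by (induction A rule: finite_induct) (auto simp: G0 Gk)
  then show ?thesis
    using poly_mapping_sum_single[of m] by (metis finite_keys)
qed

text \<open>Only monomials occurring in u have to be treated, which is what statements about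
  homogeneous elements require.\<close>

lemma FG_monomial_induct [case_names zero add monomial]:
  fixes u :: "'a :: {field, finite} FG"
  assumes zero: "Q 0" and add: "\<And>u v. Q u \<Longrightarrow> Q v \<Longrightarrow> Q (u + v)"
    and monomial: "\<And>m c. m \<in> Poly_Mapping.keys u \<Longrightarrow> Q (Poly_Mapping.single m c)"
  shows "Q u"
proof -
  have "finite A \<Longrightarrow> A \<subseteq> Poly_Mapping.keys u \<Longrightarrow> Q (\<Sum>m\<in>A. Poly_Mapping.single m (g m))" for A g
    by (induction A rule: finite_induct) (use zero monomial in \<open>auto intro: add\<close>)
  then show ?thesis
    using poly_mapping_sum_single[of u] by (metis finite_keys order_refl)
qed

lemma FG_induct [case_names scalar add p_gen]:
  fixes u :: "'a :: {field, finite} FG"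
  assumes scalar: "\<And>c. Q (scalar c)"
    and add: "\<And>u v. Q u \<Longrightarrow> Q v \<Longrightarrow> Q (u + v)"
    and p_gen: "\<And>n \<phi> u. n \<ge> 1 \<Longrightarrow> Q u \<Longrightarrow> Q (p_gen n \<phi> * u)"
  shows "Q u"
proof (induction u rule: FG_monomial_induct)
  case (monomial m c)
  show ?case
  proof (induction m arbitrary: c rule: monomial_induct)
    case zero
    show ?case using scalar by (simp add: scalar_def)
  next
    case (plus x m)
    obtain \<phi> i where x: "x = (\<phi>, i)" by (cases x)
    show ?case
      using p_gen[OF _ plus, of "Suc i" \<phi> c] by (simp add: p_gen_single x)
  qed
qed (use scalar[of 0] add in auto)

text \<open>The index shift is undone here: the variable with index i stands for the generator with
  subscript i + 1.\<close>

definition eval_FG :: "(complex \<Rightarrow> 's :: comm_ring_1) \<Rightarrow> (nat \<Rightarrow> 'a phistar \<Rightarrow> 's) \<Rightarrow>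
    'a :: {field, finite} FG \<Rightarrow> 's" where
  "eval_FG \<iota> f = poly_eval \<iota> (\<lambda>(\<phi>, i). f (Suc i) \<phi>)"

lemma ring_hom_eval_FG: "ring_hom_fun \<iota> \<Longrightarrow> ring_hom_fun (eval_FG \<iota> f)"
  unfolding eval_FG_def by (rule ring_hom_poly_eval)

lemma eval_FG_scalar: "ring_hom_fun \<iota> \<Longrightarrow> eval_FG \<iota> f (scalar c) = \<iota> c"
  by (simp add: eval_FG_def scalar_def poly_eval_single)

lemma eval_FG_p_gen: "ring_hom_fun \<iota> \<Longrightarrow> n \<ge> 1 \<Longrightarrow> eval_FG \<iota> f (p_gen n \<phi>) = f n \<phi>"
  by (simp add: eval_FG_def p_gen_def poly_eval_single ring_hom_fun_def)

section \<open>Derivations of the algebra and partial derivatives\<close>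

context
  fixes D :: "'a :: {field, finite} FG \<Rightarrow> 'a FG"
  assumes D: "derivation_FG D"
begin

lemma derivation_add: "D (u + v) = D u + D v"
  and derivation_scalar_mult: "D (scalar c * u) = scalar c * D u"
  and derivation_mult: "D (u * v) = D u * v + u * D v"
  using D unfolding derivation_FG_def by blast+

lemma derivation_0: "D 0 = 0"
  using derivation_add[of 0 0] by simp

lemma derivation_1: "D 1 = 0"
  using derivation_mult[of 1 1] by simp

lemma derivation_scalar: "D (scalar c) = 0"
  using derivation_scalar_mult[of c 1] by (simp add: derivation_1)

lemma derivation_sum: "D (sum f A) = (\<Sum>x\<in>A. D (f x))"
  by (induction A rule: infinite_finite_induct) (auto simp: derivation_add derivation_0)

lemma derivation_of_nat_mult: "D (of_nat n * u) = of_nat n * D u"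
  using derivation_scalar_mult[of "of_nat n" u] by (simp add: scalar_of_nat)

end

lemma derivation_eqI:
  assumes "derivation_FG D" "derivation_FG D'" "\<And>n \<phi>. n \<ge> 1 \<Longrightarrow> D (p_gen n \<phi>) = D' (p_gen n \<phi>)"
  shows "D = D'"
proof
  fix u
  show "D u = D' u"
    by (induction u rule: FG_induct)
      (simp_all add: assms(3) derivation_scalar[OF assms(1)] derivation_scalar[OF assms(2)]
        derivation_add[OF assms(1)] derivation_add[OF assms(2)]
        derivation_mult[OF assms(1)] derivation_mult[OF assms(2)])
qed

text \<open>A derivation is the \<open>t\<close>-coefficient of a homomorphism into the power series in \<open>t\<close> that
  lifts the identity.\<close>

definition der_FG :: "(nat \<Rightarrow> 'a phistar \<Rightarrow> 'a FG) \<Rightarrow> 'a :: {field, finite} FG \<Rightarrow> 'a FG" where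
  "der_FG d u = fps_nth (eval_FG (\<lambda>c. fps_const (scalar c))
     (\<lambda>n \<phi>. fps_const (p_gen n \<phi>) + fps_X * fps_const (d n \<phi>)) u) 1"

lemma
  shows derivation_der_FG: "derivation_FG (der_FG d)"
    and der_FG_p_gen: "n \<ge> 1 \<Longrightarrow> der_FG d (p_gen n \<phi>) = d n \<phi>"
proof -
  let ?\<iota> = "\<lambda>c. fps_const (scalar c :: 'a FG)"
  let ?f = "\<lambda>n \<phi>. fps_const (p_gen n \<phi>) + fps_X * fps_const (d n \<phi>)"
  have \<iota>: "ring_hom_fun ?\<iota>"
    by (simp add: ring_hom_fun_def scalar_add scalar_mult fps_const_add[symmetric] fps_const_mult[symmetric]
        del: fps_const_add fps_const_mult)
  note hom = ring_hom_eval_FG[OF \<iota>, of ?f]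
  have add: "eval_FG ?\<iota> ?f (u + v) = eval_FG ?\<iota> ?f u + eval_FG ?\<iota> ?f v"
    and mult: "eval_FG ?\<iota> ?f (u * v) = eval_FG ?\<iota> ?f u * eval_FG ?\<iota> ?f v" for u v
    using hom by (auto simp: ring_hom_fun_def)
  \<comment> \<open>The zeroth coefficient is u itself, so comparing first coefficients in a product
    is the Leibniz rule.\<close>
  have const: "fps_nth (eval_FG ?\<iota> ?f u) 0 = u" for u
    by (induction u rule: FG_induct)
      (simp_all add: add mult eval_FG_scalar[OF \<iota>] eval_FG_p_gen[OF \<iota>])
  have 1: "fps_nth (F * G) 1 = fps_nth F 1 * fps_nth G 0 + fps_nth F 0 * fps_nth G 1" for F G :: "'a FG fps"
    by (simp add: fps_mult_nth)
  show "derivation_FG (der_FG d)"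
    unfolding derivation_FG_def der_FG_def
    by (simp only: add mult 1 const fps_add_nth eval_FG_scalar[OF \<iota>]) simp
  show "der_FG d (p_gen n \<phi>) = d n \<phi>" if "n \<ge> 1"
    unfolding der_FG_def using that by (simp add: eval_FG_p_gen[OF \<iota>])
qed

text \<open>A concrete d/dp_n(\<phi>), built to resolve the definite description in
  \<open>partial\<close>.\<close>

definition dp :: "nat \<Rightarrow> 'a :: {field, finite} phistar \<Rightarrow> 'a FG \<Rightarrow> 'a FG" where
  "dp n \<phi> = der_FG (\<lambda>m \<psi>. if m = n \<and> \<psi> = \<phi> then 1 else 0)"

lemma derivation_dp: "derivation_FG (dp n \<phi>)"
  unfolding dp_def by (rule derivation_der_FG)

lemma dp_p_gen: "m \<ge> 1 \<Longrightarrow> dp n \<phi> (p_gen m \<psi>) = (if m = n \<and> \<psi> = \<phi> then 1 else 0)"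
  by (simp add: dp_def der_FG_p_gen)

lemma partial_eqI:
  assumes "derivation_FG D" "\<And>m j. m \<ge> 1 \<Longrightarrow> j \<in> I \<Longrightarrow> D (g m j) = (if m = n \<and> j = i then 1 else 0)"
    and "\<And>D'. derivation_FG D' \<Longrightarrow>
      (\<And>m j. m \<ge> 1 \<Longrightarrow> j \<in> I \<Longrightarrow> D' (g m j) = (if m = n \<and> j = i then 1 else 0)) \<Longrightarrow> D' = D"
  shows "partial I g n i = D"
  unfolding partial_def
proof (rule the_equality)
  show "derivation_FG D \<and> (\<forall>m\<ge>1. \<forall>j\<in>I. D (g m j) = (if m = n \<and> j = i then 1 else 0))"
    using assms(1,2) by blast
next
  fix D' assume "derivation_FG D' \<and> (\<forall>m\<ge>1. \<forall>j\<in>I. D' (g m j) = (if m = n \<and> j = i then 1 else 0))"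
  then show "D' = D" by (intro assms(3)) blast+
qed

lemma partial_p_gen: "partial UNIV p_gen n \<phi> = dp n \<phi>"
proof (rule partial_eqI[OF derivation_dp dp_p_gen])
  fix D' :: "'a FG \<Rightarrow> 'a FG"
  assume D': "derivation_FG D'"
    and "\<And>m j. m \<ge> 1 \<Longrightarrow> j \<in> UNIV \<Longrightarrow> D' (p_gen m j) = (if m = n \<and> j = \<phi> then 1 else 0)"
  then show "D' = dp n \<phi>"
    by (intro derivation_eqI[OF D' derivation_dp]) (simp only: dp_p_gen UNIV_I)
qed

text \<open>Both composites vanish on generators, because derivatives of scalars are 0; the mixed
  terms of the Leibniz rule are symmetric, so the composites agree on products as well.\<close>

lemma derivation_commute:
  assumes D: "derivation_FG D" and D': "derivation_FG D'"
    and s: "\<And>n \<phi>. n \<ge> 1 \<Longrightarrow> \<exists>c. D (p_gen n \<phi>) = scalar c" "\<And>n \<phi>. n \<ge> 1 \<Longrightarrow> \<exists>c. D' (p_gen n \<phi>) = scalar c"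
  shows "D (D' u) = D' (D u)"
proof (induction u rule: FG_induct)
  case (p_gen n \<phi> u)
  from s[OF p_gen(1), of \<phi>] obtain c c' where "D (p_gen n \<phi>) = scalar c" "D' (p_gen n \<phi>) = scalar c'"
    by blast
  then show ?case
    using p_gen by (simp add: derivation_mult[OF D] derivation_mult[OF D'] derivation_add[OF D]
        derivation_add[OF D'] derivation_scalar[OF D] derivation_scalar[OF D'])
qed (simp_all add: derivation_scalar[OF D] derivation_scalar[OF D'] derivation_add[OF D]
    derivation_add[OF D'] derivation_0[OF D] derivation_0[OF D'])

lemma derivation_FG_scalar_mult:
  assumes D: "derivation_FG D"
  shows "derivation_FG (\<lambda>v. scalar c * D v)"
  unfolding derivation_FG_def
  by (intro conjI allI) (simp_all add: derivation_add[OF D] derivation_scalar[OF D]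
      derivation_mult[OF D] algebra_simps)

lemma derivation_FG_minus:
  assumes D: "derivation_FG D"
  shows "derivation_FG (\<lambda>v. - D v)"
  unfolding derivation_FG_def
  by (intro conjI allI) (simp_all add: derivation_add[OF D] derivation_scalar[OF D] derivation_mult[OF D])

section \<open>Exponentials of operator series\<close>

lemma sum_triangle_swap:
  fixes f :: "nat \<Rightarrow> nat \<Rightarrow> 'b :: comm_monoid_add"
  shows "(\<Sum>i=1..m. \<Sum>j=1..m - i. f i j) = (\<Sum>j=1..m. \<Sum>i=1..m - j. f i j)"
  unfolding sum.Sigma[OF finite_atLeastAtMost ballI[OF finite_atLeastAtMost]]
  by (rule sum.reindex_bij_witness[of _ "\<lambda>(i, j). (j, i)" "\<lambda>(i, j). (j, i)"]; auto)

lemma sum_triangle_diag: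
  fixes f :: "nat \<Rightarrow> nat \<Rightarrow> 'b :: comm_monoid_add"
  shows "(\<Sum>i=1..k. \<Sum>j=0..k - i. f i j) = (\<Sum>j=0..k. \<Sum>i=1..j. f i (j - i))"
  unfolding sum.Sigma[OF finite_atLeastAtMost ballI[OF finite_atLeastAtMost]]
  by (rule sum.reindex_bij_witness[of _ "\<lambda>(j, i). (i, j - i)" "\<lambda>(i, j). (i + j, i)"]; auto)

lemma sum_triangle_diag':
  fixes f :: "nat \<Rightarrow> nat \<Rightarrow> 'b :: comm_monoid_add"
  shows "(\<Sum>i=1..k. \<Sum>j=0..k - i. f i j) = (\<Sum>j=0..k. \<Sum>i=1..k - j. f i j)"
  unfolding sum.Sigma[OF finite_atLeastAtMost ballI[OF finite_atLeastAtMost]]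
  by (rule sum.reindex_bij_witness[of _ "\<lambda>(j, i). (i, j)" "\<lambda>(i, j). (j, i)"]; auto)

definition linear_FG :: "('a :: {field, finite} FG \<Rightarrow> 'a FG) \<Rightarrow> bool" where
  "linear_FG F \<longleftrightarrow> (\<forall>u v. F (u + v) = F u + F v) \<and> (\<forall>c u. F (scalar c * u) = scalar c * F u)"

lemma linear_FG_add: "linear_FG F \<Longrightarrow> F (u + v) = F u + F v"
  and linear_FG_scalar: "linear_FG F \<Longrightarrow> F (scalar c * u) = scalar c * F u"
  by (simp_all add: linear_FG_def)

lemma linear_FG_0: "linear_FG F \<Longrightarrow> F 0 = 0"
  using linear_FG_scalar[of F 0 0] by simp

lemma linear_FG_sum: "linear_FG F \<Longrightarrow> F (sum f A) = (\<Sum>x\<in>A. F (f x))"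
  by (induction A rule: infinite_finite_induct) (auto simp: linear_FG_add linear_FG_0)

lemma linear_FG_of_nat: "linear_FG F \<Longrightarrow> F (of_nat n * u) = of_nat n * F u"
  using linear_FG_scalar[of F "of_nat n" u] by (simp add: scalar_of_nat)

lemma linear_FG_derivation: "derivation_FG D \<Longrightarrow> linear_FG D"
  using derivation_add derivation_scalar_mult unfolding linear_FG_def by blast

lemma linear_FG_mult: "linear_FG (\<lambda>v. a * v)"
  by (simp add: linear_FG_def algebra_simps)

locale commuting_series =
  fixes A :: "nat \<Rightarrow> 'a :: {field, finite} FG \<Rightarrow> 'a FG"
  assumes lin: "linear_FG (A i)" and commute: "A i (A j v) = A j (A i v)"
begin

text \<open>Coefficient form of t d/dt A^(r+1) = (r+1) (t A') A^r, which holds because the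
  coefficients of A commute.\<close>

lemma op_power_rec:
  "of_nat m * op_power A (Suc r) m v =
    of_nat (Suc r) * (\<Sum>i=1..m. of_nat i * A i (op_power A r (m - i) v))"
proof (induction r arbitrary: m)
  case 0
  have *: "(\<Sum>i=1..m. f i * A i (op_power A 0 (m - i) v)) = (if m = 0 then 0 else f m * A m v)" for f
  proof (cases "m = 0")
    case False
    have "(\<Sum>i=1..m. f i * A i (op_power A 0 (m - i) v)) = (\<Sum>i\<in>{m}. f i * A i (op_power A 0 (m - i) v))"
      by (rule sum.mono_neutral_right) (use False in \<open>auto simp: linear_FG_0[OF lin]\<close>)
    with False show ?thesis by simp
  qed simp
  show ?case
    using *[of "\<lambda>_. 1"] *[of of_nat] by simp
next
  case (Suc r)
  let ?P = "\<lambda>r m. op_power A r m v"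
  have "of_nat m * ?P (Suc (Suc r)) m = (\<Sum>i=1..m. of_nat m * A i (?P (Suc r) (m - i)))"
    by (simp only: op_power.simps sum_distrib_left)
  also have "\<dots> = (\<Sum>i=1..m. of_nat i * A i (?P (Suc r) (m - i)) + A i (of_nat (m - i) * ?P (Suc r) (m - i)))"
  proof (rule sum.cong[OF refl])
    fix i assume "i \<in> {1..m}"
    then have "of_nat m = (of_nat i + of_nat (m - i) :: 'a FG)" by (simp flip: of_nat_add)
    then show "of_nat m * A i (?P (Suc r) (m - i)) =
        of_nat i * A i (?P (Suc r) (m - i)) + A i (of_nat (m - i) * ?P (Suc r) (m - i))"
      by (simp add: linear_FG_of_nat[OF lin] distrib_right del: op_power.simps)
  qed
  also have "\<dots> = (\<Sum>i=1..m. of_nat i * A i (?P (Suc r) (m - i))) +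
      (\<Sum>i=1..m. of_nat (Suc r) * (\<Sum>j=1..m - i. of_nat j * A j (A i (?P r (m - i - j)))))"
    unfolding Suc.IH
    by (simp only: sum.distrib linear_FG_of_nat[OF lin] linear_FG_sum[OF lin] commute)
  also have "(\<Sum>i=1..m. of_nat (Suc r) * (\<Sum>j=1..m - i. of_nat j * A j (A i (?P r (m - i - j))))) =
      of_nat (Suc r) * (\<Sum>j=1..m. \<Sum>i=1..m - j. of_nat j * A j (A i (?P r (m - i - j))))"
    by (simp only: sum_distrib_left[symmetric] sum_triangle_swap)
  also have "(\<Sum>j=1..m. \<Sum>i=1..m - j. of_nat j * A j (A i (?P r (m - i - j)))) =
      (\<Sum>j=1..m. of_nat j * A j (?P (Suc r) (m - j)))"
    by (simp only: op_power.simps linear_FG_sum[OF lin] sum_distrib_left diff_commute[of m])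
  finally show ?case
    by (simp add: algebra_simps del: op_power.simps)
qed

lemma op_power_0_eq: "r > m \<Longrightarrow> op_power A r m v = 0"
proof (induction r arbitrary: m)
  case (Suc r)
  have "op_power A r (m - i) v = 0" if "i \<in> {1..m}" for i
    by (rule Suc.IH) (use that Suc.prems in auto)
  then show ?case by (simp add: linear_FG_0[OF lin])
qed simp

lemma op_exp_eq: "m \<le> N \<Longrightarrow> op_exp A m v = (\<Sum>r\<le>N. scalar (1 / fact r) * op_power A r m v)"
  unfolding op_exp_def by (rule sum.mono_neutral_left) (auto simp: op_power_0_eq)

lemma op_exp_0: "op_exp A 0 v = v"
  by (simp add: op_exp_def)

text \<open>The equation t d/dt exp A = (t A') exp A, the working form of the exponential.\<close>

lemma op_exp_rec: "of_nat m * op_exp A m v = (\<Sum>i=1..m. of_nat i * A i (op_exp A (m - i) v))"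
proof (cases m)
  case (Suc m')
  have sc: "scalar (1 / fact (Suc r)) * (of_nat (Suc r) * u) = scalar (1 / fact r) * u" for r and u :: "'a FG"
    by (simp only: scalar_of_nat[symmetric] mult.assoc[symmetric] scalar_mult[symmetric] fact_Suc)
      (simp add: field_simps del: of_nat_Suc)
  have "of_nat m * op_exp A m v = (\<Sum>r\<le>m. scalar (1 / fact r) * (of_nat m * op_power A r m v))"
    by (simp add: op_exp_def sum_distrib_left mult_ac del: op_power.simps)
  also have "\<dots> = (\<Sum>r\<le>m'. scalar (1 / fact (Suc r)) * (of_nat m * op_power A (Suc r) m v))"
    unfolding Suc by (subst sum.atMost_Suc_shift) simp
  also have "\<dots> = (\<Sum>r\<le>m'. scalar (1 / fact r) * (\<Sum>i=1..m. of_nat i * A i (op_power A r (m - i) v)))"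
    unfolding op_power_rec sc ..
  also have "\<dots> = (\<Sum>i=1..m. of_nat i * A i (\<Sum>r\<le>m'. scalar (1 / fact r) * op_power A r (m - i) v))"
    unfolding sum_distrib_left linear_FG_sum[OF lin] linear_FG_scalar[OF lin]
    by (subst sum.swap) (simp only: mult.left_commute)
  also have "\<dots> = (\<Sum>i=1..m. of_nat i * A i (op_exp A (m - i) v))"
    by (rule sum.cong[OF refl]) (use Suc in \<open>subst op_exp_eq[where N = m'], auto\<close>)
  finally show ?thesis .
qed simp

text \<open>The recursion determines all coefficients because positive integers can be cancelled.
  Identities for exponentials are proved by checking the recursion for the other side.\<close>

lemma op_exp_unique:
  assumes F0: "F 0 = v" and F: "\<And>m. m \<ge> 1 \<Longrightarrow> of_nat m * F m = (\<Sum>i=1..m. of_nat i * A i (F (m - i)))"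
  shows "op_exp A m v = F m"
proof (induction m rule: less_induct)
  case (less m)
  show ?case
  proof (cases "m = 0")
    case False
    have "of_nat m * op_exp A m v = of_nat m * F m"
    proof -
      have "op_exp A (m - i) v = F (m - i)" if "i \<in> {1..m}" for i
        by (rule less) (use that in auto)
      then show ?thesis
        using F[of m] False unfolding op_exp_rec by simp
    qed
    with False show ?thesis by - (rule of_nat_mult_cancel_FG[of m], simp_all)
  qed (simp add: op_exp_0 F0)
qed

lemma op_exp_add: "op_exp A m (u + v) = op_exp A m u + op_exp A m v"
  by (rule op_exp_unique)
    (simp_all only: op_exp_0 distrib_left op_exp_rec linear_FG_add[OF lin] sum.distrib)

lemma op_exp_scalar: "op_exp A m (scalar c * u) = scalar c * op_exp A m u"
proof (rule op_exp_unique)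
  fix m :: nat
  have "of_nat m * (scalar c * op_exp A m u) = scalar c * (of_nat m * op_exp A m u)"
    by (rule mult.left_commute)
  also have "\<dots> = (\<Sum>i=1..m. of_nat i * A i (scalar c * op_exp A (m - i) u))"
    unfolding op_exp_rec sum_distrib_left linear_FG_scalar[OF lin]
    by (intro sum.cong refl mult.left_commute)
  finally show "of_nat m * (scalar c * op_exp A m u) =
      (\<Sum>i=1..m. of_nat i * A i (scalar c * op_exp A (m - i) u))" .
qed (simp add: op_exp_0)

lemma linear_op_exp: "linear_FG (op_exp A m)"
  by (simp add: linear_FG_def op_exp_add op_exp_scalar)

lemma op_exp_commute_with:
  assumes F: "linear_FG F" "\<And>i v. F (A i v) = A i (F v)"
  shows "F (op_exp A m v) = op_exp A m (F v)"
proof -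
  have "op_exp A m (F v) = F (op_exp A m v)"
  proof (rule op_exp_unique)
    fix m :: nat
    have "of_nat m * F (op_exp A m v) = F (of_nat m * op_exp A m v)"
      by (simp only: linear_FG_of_nat[OF F(1)])
    also have "\<dots> = (\<Sum>i=1..m. of_nat i * A i (F (op_exp A (m - i) v)))"
      unfolding op_exp_rec by (simp only: linear_FG_of_nat[OF F(1)] linear_FG_sum[OF F(1)] F(2))
    finally show "of_nat m * F (op_exp A m v) = (\<Sum>i=1..m. of_nat i * A i (F (op_exp A (m - i) v)))" .
  qed (simp add: op_exp_0)
  then show ?thesis ..
qed

lemma op_exp_commute: "op_exp A i (op_exp A j v) = op_exp A j (op_exp A i v)"
  by (rule op_exp_commute_with[OF linear_op_exp]) (rule op_exp_commute_with[OF lin commute, symmetric])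

end

lemma op_exp_eq_0:
  assumes "commuting_series A" "\<And>i. i \<ge> 1 \<Longrightarrow> A i v = 0" "m \<ge> 1"
  shows "op_exp A m v = 0"
proof -
  interpret commuting_series A by fact
  have "op_exp A m v = (if m = 0 then v else 0)"
  proof (rule op_exp_unique)
    fix m :: nat assume m: "m \<ge> 1"
    have "of_nat i * A i (if m - i = 0 then v else 0) = 0" if "i \<in> {1..m}" for i
      using that assms(2)[of i] by (simp add: linear_FG_0[OF lin])
    then show "of_nat m * (if m = 0 then v else 0) = (\<Sum>i=1..m. of_nat i * A i (if m - i = 0 then v else 0))"
      using m by (simp add: sum.neutral del: One_nat_def)
  qed simp
  with assms(3) show ?thesis by simp
qed

lemma commuting_series_mult: "commuting_series (\<lambda>i v. a i * v)"
  by unfold_locales (simp_all add: linear_FG_mult mult.left_commute)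

text \<open>Newton's recursion: the generating function of h is the exponential of the sum of c_i
  t^i / i. Written without denominators, it makes sense in every commutative ring and is preserved
  by ring homomorphisms.\<close>

definition exp_seq :: "(nat \<Rightarrow> 'r :: comm_ring_1) \<Rightarrow> (nat \<Rightarrow> 'r) \<Rightarrow> bool" where
  "exp_seq c h \<longleftrightarrow> h 0 = 1 \<and> (\<forall>m\<ge>1. of_nat m * h m = (\<Sum>i=1..m. c i * h (m - i)))"

lemma exp_seq_hom:
  assumes F: "ring_hom_fun F" and h: "exp_seq c h"
  shows "exp_seq (\<lambda>i. F (c i)) (\<lambda>i. F (h i))"
proof -
  have "F (of_nat m * h m) = F (\<Sum>i=1..m. c i * h (m - i))" if "m \<ge> 1" for m
    using h that by (simp add: exp_seq_def)
  moreover have mult: "F (x * y) = F x * F y" for x y using F by (simp add: ring_hom_fun_def)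
  ultimately have "of_nat m * F (h m) = (\<Sum>i=1..m. F (c i) * F (h (m - i)))" if "m \<ge> 1" for m
    using that by (simp only: mult ring_hom_fun_sum[OF F] ring_hom_fun_of_nat[OF F])
  then show ?thesis using F h by (simp add: exp_seq_def ring_hom_fun_def)
qed

definition exp_coeff :: "(nat \<Rightarrow> 'a :: {field, finite} FG) \<Rightarrow> nat \<Rightarrow> 'a FG" where
  "exp_coeff a m = op_exp (\<lambda>i v. a i * v) m 1"

lemma exp_seq_exp_coeff: "exp_seq (\<lambda>i. of_nat i * a i) (exp_coeff a)"
proof -
  interpret commuting_series "\<lambda>i v. a i * v" by (rule commuting_series_mult)
  show ?thesis
    unfolding exp_seq_def exp_coeff_def op_exp_rec by (simp add: op_exp_0 mult.assoc)
qed

lemma exp_coeff_0: "exp_coeff a 0 = 1"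
  and exp_coeff_rec: "of_nat m * exp_coeff a m = (\<Sum>i=1..m. of_nat i * a i * exp_coeff a (m - i))"
proof -
  show "exp_coeff a 0 = 1" using exp_seq_exp_coeff[of a] by (simp add: exp_seq_def)
  show "of_nat m * exp_coeff a m = (\<Sum>i=1..m. of_nat i * a i * exp_coeff a (m - i))"
    using exp_seq_exp_coeff[of a] unfolding exp_seq_def by (cases "m = 0") auto
qed

lemma op_exp_mult: "op_exp (\<lambda>i v. a i * v) m v = exp_coeff a m * v"
proof -
  interpret commuting_series "\<lambda>i v. a i * v" by (rule commuting_series_mult)
  show ?thesis
    by (rule op_exp_unique)
      (simp_all add: exp_coeff_0 mult.assoc[symmetric] exp_coeff_rec sum_distrib_right)
qed

locale derivation_series = commuting_series B for B :: "nat \<Rightarrow> 'a :: {field, finite} FG \<Rightarrow> 'a FG" +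
  assumes derivation: "derivation_FG (B i)"
begin

text \<open>The exponential of a series of commuting derivations is multiplicative; in coefficients
  this is a convolution, which satisfies the recursion by the Leibniz rule.\<close>

lemma op_exp_product: "op_exp B k (u * v) = (\<Sum>j=0..k. op_exp B j u * op_exp B (k - j) v)"
proof (rule op_exp_unique)
  fix k :: nat assume "k \<ge> 1"
  let ?E = "op_exp B"
  have "of_nat k * (\<Sum>j=0..k. ?E j u * ?E (k - j) v) =
      (\<Sum>j=0..k. (of_nat j * ?E j u) * ?E (k - j) v + ?E j u * (of_nat (k - j) * ?E (k - j) v))"
    unfolding sum_distrib_left
  proof (rule sum.cong[OF refl])
    fix j assume "j \<in> {0..k}"
    then have "of_nat k = (of_nat j + of_nat (k - j) :: 'a FG)" by (simp flip: of_nat_add)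
    then show "of_nat k * (?E j u * ?E (k - j) v) =
        (of_nat j * ?E j u) * ?E (k - j) v + ?E j u * (of_nat (k - j) * ?E (k - j) v)"
      by (simp add: algebra_simps)
  qed
  also have "\<dots> = (\<Sum>j=0..k. \<Sum>i=1..j. of_nat i * B i (?E (j - i) u) * ?E (k - i - (j - i)) v) +
      (\<Sum>j=0..k. \<Sum>i=1..k - j. ?E j u * (of_nat i * B i (?E (k - i - j) v)))"
    unfolding op_exp_rec sum.distrib sum_distrib_left sum_distrib_right
    by (intro arg_cong2[where f = "(+)"] sum.cong refl) (auto simp: diff_commute add.commute)
  also have "\<dots> = (\<Sum>i=1..k. \<Sum>j=0..k - i. of_nat i * B i (?E j u) * ?E (k - i - j) v) +
      (\<Sum>i=1..k. \<Sum>j=0..k - i. ?E j u * (of_nat i * B i (?E (k - i - j) v)))"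
    by (simp only: sum_triangle_diag[where f = "\<lambda>i j. of_nat i * B i (?E j u) * ?E (k - i - j) v"]
        sum_triangle_diag')
  also have "\<dots> = (\<Sum>i=1..k. of_nat i * B i (\<Sum>j=0..k - i. ?E j u * ?E (k - i - j) v))"
    unfolding linear_FG_sum[OF lin] derivation_mult[OF derivation] sum.distrib[symmetric] sum_distrib_left
    by (intro sum.cong refl) (simp add: algebra_simps)
  finally show "of_nat k * (\<Sum>j=0..k. ?E j u * ?E (k - j) v) =
      (\<Sum>i=1..k. of_nat i * B i (\<Sum>j=0..k - i. ?E j u * ?E (k - i - j) v))" .
qed (simp add: op_exp_0)

lemma op_exp_const: "(\<And>i. i \<ge> 1 \<Longrightarrow> B i v = 0) \<Longrightarrow> op_exp B m v = (if m = 0 then v else 0)"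
  using op_exp_eq_0[OF commuting_series_axioms, of v m] by (simp add: op_exp_0)

lemma op_exp_const_mult:
  assumes "\<And>i. i \<ge> 1 \<Longrightarrow> B i c = 0"
  shows "op_exp B k (c * v) = c * op_exp B k v"
proof -
  have E: "op_exp B m c = (if m = 0 then c else 0)" for m
    by (rule op_exp_const) (rule assms)
  show ?thesis
    unfolding op_exp_product[of k c v] E by (subst sum.remove[of _ 0]) auto
qed

text \<open>On an element with scalar derivatives the exponential acts as translation by the series
  with coefficients b_k: second derivatives vanish.\<close>

lemma op_exp_generator:
  assumes "\<And>i. i \<ge> 1 \<Longrightarrow> B i p = scalar (b i)"
  shows "op_exp B k p = (if k = 0 then p else scalar (b k))"
proof (rule op_exp_unique)
  fix m :: nat assume m: "m \<ge> 1"
  have "(\<Sum>i=1..m. of_nat i * B i (if m - i = 0 then p else scalar (b (m - i)))) =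
      (\<Sum>i\<in>{m}. of_nat i * B i (if m - i = 0 then p else scalar (b (m - i))))"
    by (rule sum.mono_neutral_right) (use m in \<open>auto simp: derivation_scalar[OF derivation]\<close>)
  also have "\<dots> = of_nat m * scalar (b m)"
    using assms[OF m] m by simp
  finally show "of_nat m * (if m = 0 then p else scalar (b m)) =
      (\<Sum>i=1..m. of_nat i * B i (if m - i = 0 then p else scalar (b (m - i))))"
    using m by simp
qed simp

text \<open>Normal ordering of two exponentials: the translation sends a_i to a_i + b_i t^i, so the
  exponential of the sum of a_i z^i is multiplied by the scalar series \<beta> in t z. In the proof
  by the recursion for \<open>exp_coeff\<close>, a product with a_i splits into two terms because
  only the orders 0 and i are nonzero on a_i.\<close>

lemma op_exp_exp_coeff:
  assumes a: "\<And>i j. i \<ge> 1 \<Longrightarrow> j \<ge> 1 \<Longrightarrow> B i (a j) = (if i = j then scalar (b i) else 0)"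
    and \<beta>: "exp_seq (\<lambda>i. of_nat i * b i) \<beta>"
  shows "op_exp B k (exp_coeff a m) = (if k \<le> m then scalar (\<beta> k) * exp_coeff a (m - k) else 0)"
proof (induction m arbitrary: k rule: less_induct)
  case (less m)
  let ?E = "op_exp B" and ?h = "exp_coeff a"
  have B1: "B i 1 = 0" for i by (rule derivation_1[OF derivation])
  show ?case
  proof (cases "m = 0")
    case True
    then show ?thesis
      using \<beta> by (simp add: exp_coeff_0 op_exp_const[OF B1] exp_seq_def)
  next
    case False
    have gen: "?E r (a j) = (if r = 0 then a j else if r = j then scalar (b j) else 0)" if "j \<ge> 1" for r j
    proof -
      have "B i (a j) = scalar (if i = j then b j else 0)" if "i \<ge> 1" for i
        using a[OF that \<open>j \<ge> 1\<close>] by simp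
      from op_exp_generator[OF this, of r] show ?thesis by simp
    qed
    have split: "?E k (a i * v) = a i * ?E k v + (if i \<le> k then scalar (b i) * ?E (k - i) v else 0)"
      if i: "i \<ge> 1" for i v
    proof -
      have "?E k (a i * v) = (\<Sum>r=0..k. ?E r (a i) * ?E (k - r) v)"
        by (rule op_exp_product)
      also have "\<dots> = ?E 0 (a i) * ?E (k - 0) v + (\<Sum>r\<in>{0..k} - {0}. ?E r (a i) * ?E (k - r) v)"
        by (rule sum.remove) auto
      also have "(\<Sum>r\<in>{0..k} - {0}. ?E r (a i) * ?E (k - r) v) =
          (\<Sum>r\<in>(if i \<le> k then {i} else {}). ?E r (a i) * ?E (k - r) v)"
        by (rule sum.mono_neutral_right) (use i in \<open>auto simp: gen\<close>)
      finally show ?thesis using i by (simp add: gen)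
    qed
    have "of_nat m * ?E k (?h m) = ?E k (of_nat m * ?h m)"
      by (simp add: linear_FG_of_nat[OF linear_op_exp])
    also have "\<dots> = (\<Sum>i=1..m. of_nat i * ?E k (a i * ?h (m - i)))"
      unfolding exp_coeff_rec
      by (simp add: linear_FG_sum[OF linear_op_exp] linear_FG_of_nat[OF linear_op_exp] mult.assoc)
    also have "\<dots> = (\<Sum>i=1..m. of_nat i * (a i * ?E k (?h (m - i)))) +
        (\<Sum>i=1..m. of_nat i * (if i \<le> k then scalar (b i) * ?E (k - i) (?h (m - i)) else 0))"
      by (simp add: split distrib_left sum.distrib)
    also have "(\<Sum>i=1..m. of_nat i * (a i * ?E k (?h (m - i)))) =
        (if k \<le> m then scalar (\<beta> k) * (of_nat (m - k) * ?h (m - k)) else 0)"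
    proof -
      have "(\<Sum>i=1..m. of_nat i * (a i * ?E k (?h (m - i)))) =
          (\<Sum>i=1..m. if k \<le> m - i then of_nat i * (a i * (scalar (\<beta> k) * ?h (m - i - k))) else 0)"
      proof (rule sum.cong[OF refl])
        fix i assume "i \<in> {1..m}"
        then have "m - i < m" by auto
        from less[OF this] show "of_nat i * (a i * ?E k (?h (m - i))) =
            (if k \<le> m - i then of_nat i * (a i * (scalar (\<beta> k) * ?h (m - i - k))) else 0)"
          by simp
      qed
      also have "\<dots> = (\<Sum>i=1..m - k. of_nat i * (a i * (scalar (\<beta> k) * ?h (m - i - k))))"
        by (rule sum.mono_neutral_cong_right) auto
      also have "\<dots> = scalar (\<beta> k) * (of_nat (m - k) * ?h (m - k))"
        unfolding exp_coeff_rec sum_distrib_left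
        by (intro sum.cong refl) (simp add: mult_ac add.commute)
      finally show ?thesis by (cases "k \<le> m") auto
    qed
    also have "(\<Sum>i=1..m. of_nat i * (if i \<le> k then scalar (b i) * ?E (k - i) (?h (m - i)) else 0)) =
        (if k \<le> m then (\<Sum>i=1..k. of_nat i * (scalar (b i) * (scalar (\<beta> (k - i)) * ?h (m - k)))) else 0)"
    proof -
      have "(\<Sum>i=1..m. of_nat i * (if i \<le> k then scalar (b i) * ?E (k - i) (?h (m - i)) else 0)) =
          (\<Sum>i=1..m. if i \<le> k \<and> k \<le> m then of_nat i * (scalar (b i) * (scalar (\<beta> (k - i)) * ?h (m - k))) else 0)"
      proof (rule sum.cong[OF refl])
        fix i assume i: "i \<in> {1..m}"
        then have "m - i < m" by auto
        from less[OF this] i show "of_nat i * (if i \<le> k then scalar (b i) * ?E (k - i) (?h (m - i)) else 0) =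
            (if i \<le> k \<and> k \<le> m then of_nat i * (scalar (b i) * (scalar (\<beta> (k - i)) * ?h (m - k))) else 0)"
          by auto
      qed
      also have "\<dots> = (if k \<le> m then (\<Sum>i=1..k. of_nat i * (scalar (b i) * (scalar (\<beta> (k - i)) * ?h (m - k)))) else 0)"
      proof (cases "k \<le> m")
        case True
        then show ?thesis by (simp only: simp_thms if_True) (rule sum.mono_neutral_cong_right, auto)
      qed simp
      finally show ?thesis .
    qed
    also have "(if k \<le> m then scalar (\<beta> k) * (of_nat (m - k) * ?h (m - k)) else 0) +
        (if k \<le> m then (\<Sum>i=1..k. of_nat i * (scalar (b i) * (scalar (\<beta> (k - i)) * ?h (m - k)))) else 0) =
        of_nat m * (if k \<le> m then scalar (\<beta> k) * ?h (m - k) else 0)"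
    proof (cases "k \<le> m")
      case True
      have "(\<Sum>i=1..k. of_nat i * (scalar (b i) * (scalar (\<beta> (k - i)) * ?h (m - k)))) =
          scalar (\<Sum>i=1..k. of_nat i * b i * \<beta> (k - i)) * ?h (m - k)"
        by (simp only: scalar_sum scalar_mult scalar_of_nat sum_distrib_right mult.assoc)
      also have "(\<Sum>i=1..k. of_nat i * b i * \<beta> (k - i)) = of_nat k * \<beta> k"
        using \<beta> by (cases "k = 0") (auto simp: exp_seq_def)
      finally have *: "(\<Sum>i=1..k. of_nat i * (scalar (b i) * (scalar (\<beta> (k - i)) * ?h (m - k)))) =
          of_nat k * (scalar (\<beta> k) * ?h (m - k))"
        by (simp only: scalar_mult scalar_of_nat mult.assoc)
      have "of_nat m = (of_nat (m - k) + of_nat k :: 'a FG)"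
        using True by (simp flip: of_nat_add)
      with True show ?thesis unfolding * by (simp add: algebra_simps)
    qed simp
    finally show ?thesis
      using False by - (rule of_nat_mult_cancel_FG[of m], simp_all)
  qed
qed

end

section \<open>The operators of one colour\<close>

lemma commuting_series_derivation:
  assumes "\<And>i. derivation_FG (B i)" "\<And>i n \<phi>. n \<ge> 1 \<Longrightarrow> \<exists>c. B i (p_gen n \<phi>) = scalar c"
  shows "derivation_series B"
proof
  show "linear_FG (B i)" for i by (rule linear_FG_derivation) (rule assms)
  show "B i (B j v) = B j (B i v)" for i j v
    by (rule derivation_commute) (use assms in auto)
qed (rule assms)

lemma derivation_series_dp: "derivation_series (\<lambda>n v. - dp n \<phi> v)"
proof (rule commuting_series_derivation)
  show "derivation_FG (\<lambda>v. - dp i \<phi> v)" for i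
    by (rule derivation_FG_minus) (rule derivation_dp)
  show "\<exists>c. - dp i \<phi> (p_gen n \<psi>) = scalar c" if "n \<ge> 1" for i n \<psi>
    using that by (auto simp: dp_p_gen intro: exI[of _ "- 1"] exI[of _ 0] simp: scalar_minus)
qed

definition h_col :: "'a :: {field, finite} phistar \<Rightarrow> int \<Rightarrow> 'a FG" where
  "h_col \<phi> m = (if m < 0 then 0 else exp_coeff (\<lambda>n. scalar (1 / of_nat n) * p_gen n \<phi>) (nat m))"

definition T_col :: "'a :: {field, finite} phistar \<Rightarrow> nat \<Rightarrow> 'a FG \<Rightarrow> 'a FG" where
  "T_col \<phi> = op_exp (\<lambda>n v. - dp n \<phi> v)"

lemma T_col_p_gen:
  assumes "m \<ge> 1"
  shows "T_col \<phi> k (p_gen m \<psi>) =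
    (if k = 0 then p_gen m \<psi> else if k = m \<and> \<psi> = \<phi> then - 1 else 0)"
proof -
  interpret derivation_series "\<lambda>n v. - dp n \<phi> v" by (rule derivation_series_dp)
  have "- dp i \<phi> (p_gen m \<psi>) = scalar (if i = m \<and> \<psi> = \<phi> then - 1 else 0)" for i
    using assms by (simp add: dp_p_gen scalar_minus)
  from op_exp_generator[OF this, of k] show ?thesis
    by (simp add: T_col_def scalar_minus)
qed

lemma T_col_product: "T_col \<phi> k (u * v) = (\<Sum>j=0..k. T_col \<phi> j u * T_col \<phi> (k - j) v)"
  unfolding T_col_def by (rule derivation_series.op_exp_product[OF derivation_series_dp])

lemma T_col_scalar: "T_col \<phi> k (scalar c) = (if k = 0 then scalar c else 0)"
  unfolding T_col_def
  by (rule derivation_series.op_exp_const[OF derivation_series_dp])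
    (simp add: derivation_scalar[OF derivation_dp])

lemma T_col_add: "T_col \<phi> k (u + v) = T_col \<phi> k u + T_col \<phi> k v"
proof -
  interpret derivation_series "\<lambda>n v. - dp n \<phi> v" by (rule derivation_series_dp)
  show ?thesis unfolding T_col_def by (rule op_exp_add)
qed

lemma T_col_finite: "\<exists>N. \<forall>k>N. T_col \<phi> k v = 0"
proof (induction v rule: FG_induct)
  case (scalar c)
  then show ?case by (auto simp: T_col_scalar)
next
  case (add u v)
  then obtain N M where "\<forall>k>N. T_col \<phi> k u = 0" "\<forall>k>M. T_col \<phi> k v = 0" by blast
  then show ?case by (intro exI[of _ "max N M"]) (simp add: T_col_add)
next
  case (p_gen n \<psi> u)
  then obtain N where N: "\<forall>k>N. T_col \<phi> k u = 0" by blast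
  have "T_col \<phi> k (p_gen n \<psi> * u) = 0" if "k > N + n" for k
    unfolding T_col_product using that N p_gen(1)
    by (intro sum.neutral) (auto simp: T_col_p_gen)
  then show ?case by blast
qed

text \<open>The identity exp(- sum of t^i / i) = 1 - t; hence \<open>T_col\<close> is nonzero on h_m
  only for the orders 0 and 1.\<close>

lemma exp_seq_minus_one:
  "exp_seq (\<lambda>i. of_nat i * (- 1 / of_nat i)) (\<lambda>k. if k = 0 then 1 else if k = 1 then - 1 else 0 :: complex)"
  unfolding exp_seq_def
proof (intro conjI allI impI)
  fix m :: nat assume m: "m \<ge> 1"
  have "(\<Sum>i=1..m. of_nat i * (- 1 / of_nat i) *
      (if m - i = 0 then 1 else if m - i = 1 then - 1 else 0 :: complex)) =
      (\<Sum>i\<in>{1..m} \<inter> {m - 1, m}. if i = m then - 1 else 1)"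
    by (rule sum.mono_neutral_cong_right) auto
  also have "\<dots> = (if m = 1 then - 1 else 0)"
  proof (cases "m = 1")
    case False
    then have "{1..m} \<inter> {m - 1, m} = {m - 1, m}" using m by auto
    then show ?thesis using False m by auto
  qed auto
  finally show "of_nat m * (if m = 0 then 1 else if m = 1 then - 1 else 0 :: complex) =
      (\<Sum>i=1..m. of_nat i * (- 1 / of_nat i) * (if m - i = 0 then 1 else if m - i = 1 then - 1 else 0))"
    using m by simp
qed simp

lemma T_col_h_col: "T_col \<phi> k (h_col \<phi> m) =
    (if k = 0 then h_col \<phi> m else if k = 1 then - h_col \<phi> (m - 1) else 0)"
proof (cases "m < 0")
  case True
  then show ?thesis using T_col_scalar[of \<phi> k 0] by (simp add: h_col_def)
next
  case False
  interpret derivation_series "\<lambda>n v. - dp n \<phi> v" by (rule derivation_series_dp)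
  let ?a = "\<lambda>n. scalar (1 / of_nat n) * p_gen n \<phi>"
  have a: "- dp i \<phi> (?a j) = (if i = j then scalar (- 1 / of_nat i) else 0)" if "i \<ge> 1" "j \<ge> 1" for i j
    using that by (simp add: derivation_scalar_mult[OF derivation_dp] dp_p_gen flip: scalar_minus)
  show ?thesis
    using op_exp_exp_coeff[of ?a "\<lambda>i. - 1 / of_nat i", OF a exp_seq_minus_one, of k "nat m"] False
    by (auto simp: T_col_def h_col_def nat_diff_distrib scalar_minus Suc_le_eq)
qed

interpretation col: bernstein "h_col \<phi>" "T_col \<phi>" for \<phi> :: "'a :: {field, finite} phistar"
proof
  interpret derivation_series "\<lambda>n v. - dp n \<phi> v" by (rule derivation_series_dp)
  show "h_col \<phi> m = 0" if "m < 0" for m using that by (simp add: h_col_def)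
  show "h_col \<phi> 0 = 1" by (simp add: h_col_def exp_coeff_0)
  show "T_col \<phi> k (u + v) = T_col \<phi> k u + T_col \<phi> k v" for k u v by (rule T_col_add)
  show "T_col \<phi> i (T_col \<phi> j v) = T_col \<phi> j (T_col \<phi> i v)" for i j v
    unfolding T_col_def by (rule op_exp_commute)
  show "T_col \<phi> 0 v = v" for v unfolding T_col_def by (rule op_exp_0)
  show "T_col \<phi> k 1 = 0" if "k > 0" for k using T_col_scalar[of \<phi> k 1] that by simp
  show "\<exists>N. \<forall>k>N. T_col \<phi> k v = 0" for v by (rule T_col_finite)
  show "x = 0" if "x + x = 0" for x :: "'a FG"
    by (rule of_nat_mult_cancel_FG[of 2]) (use that in simp_all)
  show "T_col \<phi> k (h_col \<phi> m * v) =
      h_col \<phi> m * T_col \<phi> k v - (if k = 0 then 0 else h_col \<phi> (m - 1) * T_col \<phi> (k - 1) v)" for k m v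
  proof (cases "k = 0")
    case True
    then show ?thesis unfolding T_col_def by (simp add: op_exp_0)
  next
    case False
    have "T_col \<phi> k (h_col \<phi> m * v) = (\<Sum>j\<in>{0, 1}. T_col \<phi> j (h_col \<phi> m) * T_col \<phi> (k - j) v)"
      unfolding T_col_product by (rule sum.mono_neutral_right) (use False in \<open>auto simp: T_col_h_col\<close>)
    with False show ?thesis by (simp add: T_col_h_col)
  qed
qed

lemma S_op_eq: "S_op \<phi> a v = col.S \<phi> a v"
proof -
  have eq: "(if a + int j \<ge> 0 then op_exp (\<lambda>n v. scalar (1 / of_nat n) * p_gen n \<phi> * v) (nat (a + int j))
      (op_exp (\<lambda>n v. - partial UNIV p_gen n \<phi> v) j v) else 0) = h_col \<phi> (a + int j) * T_col \<phi> j v" for j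
    by (simp add: op_exp_mult h_col_def T_col_def partial_p_gen not_less)
  obtain N where N: "\<And>k. k > N \<Longrightarrow> T_col \<phi> k v = 0" using T_col_finite[of \<phi> v] by blast
  have "S_op \<phi> a v = Sum_any (\<lambda>j. h_col \<phi> (a + int j) * T_col \<phi> j v)"
    by (simp only: S_op_def vertex_op_def eq)
  also have "\<dots> = (\<Sum>j\<le>N. h_col \<phi> (a + int j) * T_col \<phi> j v)"
    by (rule Sum_any.expand_superset) (use N in \<open>auto simp: not_less[symmetric]\<close>)
  also have "\<dots> = col.S \<phi> a v"
    unfolding col.S_def by (rule col.W_eq[OF N, symmetric])
  finally show ?thesis .
qed

lemma T_const_scalar: "col.T_const \<phi> (scalar c)"
  unfolding col.T_const_def
  using commuting_series.op_exp_scalar[OF derivation_series.axioms(1)[OF derivation_series_dp]]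
  by (simp only: T_col_def) blast

section \<open>The subalgebra of a single colour and products over colours\<close>

inductive colored :: "'a :: {field, finite} phistar \<Rightarrow> 'a FG \<Rightarrow> bool" for \<phi> where
  colored_scalar: "colored \<phi> (scalar c)"
| colored_p_gen: "n \<ge> 1 \<Longrightarrow> colored \<phi> (p_gen n \<phi>)"
| colored_add: "colored \<phi> u \<Longrightarrow> colored \<phi> v \<Longrightarrow> colored \<phi> (u + v)"
| colored_mult: "colored \<phi> u \<Longrightarrow> colored \<phi> v \<Longrightarrow> colored \<phi> (u * v)"

lemma colored_0: "colored \<phi> 0" and colored_1: "colored \<phi> 1"
  using colored_scalar[of \<phi> 0] colored_scalar[of \<phi> 1] by simp_all

lemma colored_sum: "(\<And>x. x \<in> A \<Longrightarrow> colored \<phi> (f x)) \<Longrightarrow> colored \<phi> (sum f A)"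
  by (induction A rule: infinite_finite_induct) (auto intro: colored_0 colored_add)

lemma colored_T_col: "colored \<phi> v \<Longrightarrow> colored \<phi> (T_col \<phi> k v)"
proof (induction v arbitrary: k rule: colored.induct)
  case (colored_p_gen n)
  have "colored \<phi> (- 1)" using colored_scalar[of \<phi> "- 1"] by (simp add: scalar_minus)
  with colored_p_gen show ?case
    by (auto simp: T_col_p_gen intro: colored.intros colored_0)
qed (auto simp: T_col_scalar T_col_add T_col_product intro!: colored_scalar colored_0 colored_add
    colored_sum colored_mult)

lemma cancel_of_nat_mult:
  assumes "m \<ge> 1" shows "scalar (1 / of_nat m) * (of_nat m * u) = (u :: 'a :: {field, finite} FG)"
  using assms by (simp add: mult.assoc[symmetric] scalar_of_nat[symmetric] scalar_mult[symmetric])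

lemma exp_coeff_unfold:
  "m \<ge> 1 \<Longrightarrow> exp_coeff a m = scalar (1 / of_nat m) * (\<Sum>i=1..m. of_nat i * a i * exp_coeff a (m - i))"
  using cancel_of_nat_mult[of m "exp_coeff a m"] by (simp only: exp_coeff_rec)

lemma colored_exp_coeff:
  assumes "\<And>n. n \<ge> 1 \<Longrightarrow> colored \<phi> (a n)"
  shows "colored \<phi> (exp_coeff a m)"
proof (induction m rule: less_induct)
  case (less m)
  have of_nat: "colored \<phi> (of_nat i)" for i
    using colored_scalar[of \<phi> "of_nat i"] by (simp add: scalar_of_nat)
  show ?case
  proof (cases "m = 0")
    case False
    then show ?thesis
      by (subst exp_coeff_unfold)
        (auto intro!: colored_mult colored_scalar colored_sum less of_nat assms)
  qed (simp add: exp_coeff_0 colored_1)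
qed

lemma colored_h_col: "colored \<phi> (h_col \<phi> m)"
  unfolding h_col_def by (auto intro!: colored_0 colored_exp_coeff colored_mult colored_scalar colored_p_gen)

lemma colored_S: "colored \<phi> v \<Longrightarrow> colored \<phi> (col.S \<phi> a v)"
  unfolding col.S_def col.W_def by (intro colored_sum colored_mult colored_h_col colored_T_col)

lemma colored_s: "colored \<phi> (col.s \<phi> \<alpha>)"
  by (induction \<alpha>) (auto simp: col.s_Cons colored_1 intro: colored_S)

text \<open>The derivations of colour \<phi> vanish on the generators p_n(\<psi>), so their
  exponential passes over factors of colour \<psi>.\<close>

lemma T_const_colored:
  assumes "colored \<psi> u" "\<psi> \<noteq> \<phi>"
  shows "col.T_const \<phi> u"
  using assms(1)
proof induction
  case (colored_p_gen n)
  interpret derivation_series "\<lambda>n v. - dp n \<phi> v" by (rule derivation_series_dp)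
  show ?case
    unfolding col.T_const_def
    by (simp only: T_col_def, intro allI op_exp_const_mult)
      (use colored_p_gen assms(2) in \<open>simp add: dp_p_gen\<close>)
qed (auto intro: T_const_scalar col.T_const_add col.T_const_mult)

lemma T_const_prod:
  assumes "\<And>\<psi>. \<psi> \<in> A \<Longrightarrow> colored \<psi> (u \<psi>)" "\<phi> \<notin> A"
  shows "col.T_const \<phi> (\<Prod>\<psi>\<in>A. u \<psi>)"
  using assms
proof (induction A rule: infinite_finite_induct)
  case (insert \<psi> A)
  then show ?case using T_const_colored[of \<psi> "u \<psi>" \<phi>] by (auto intro!: col.T_const_mult)
qed (auto intro: col.T_const_1)

text \<open>The fold is followed along \<open>fold_graph\<close> starting from 1: every intermediate
  value is a product of Schur functions of the colours already treated and is constant for the next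
  colour. Thus every order of the colours leads to the same product.\<close>

lemma S_vec_eq_prod:
  assumes "finite {\<phi>. \<alpha> \<phi> \<noteq> []}"
  shows "S_vec \<alpha> = (\<Prod>\<phi> | \<alpha> \<phi> \<noteq> []. col.s \<phi> (\<alpha> \<phi>))"
proof -
  let ?f = "\<lambda>\<phi>. foldr (S_op \<phi>) (\<alpha> \<phi>)"
  have foldr_const: "foldr (S_op \<phi>) \<beta> c = c * col.s \<phi> \<beta>" if "col.T_const \<phi> c" for \<phi> \<beta> c
    by (induction \<beta>) (simp_all add: S_op_eq col.S_const[OF that] col.s_Cons)
  have graph_finite: "finite A" if "fold_graph ?f 1 A y" for A y
    using that by induction auto
  have graph: "y = (\<Prod>\<phi>\<in>A. col.s \<phi> (\<alpha> \<phi>))" if "fold_graph ?f 1 A y" for A y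
    using that
  proof induction
    case (insertI \<phi> A y)
    have "finite A" using insertI.hyps(2) by (rule graph_finite)
    moreover have "col.T_const \<phi> y"
      unfolding insertI.IH by (rule T_const_prod) (use insertI.hyps in \<open>auto intro: colored_s\<close>)
    ultimately show ?case
      using insertI.hyps insertI.IH by (simp add: foldr_const mult.commute)
  qed simp
  from finite_imp_fold_graph[OF assms, of ?f 1] obtain y where y: "fold_graph ?f 1 {\<phi>. \<alpha> \<phi> \<noteq> []} y" ..
  then have "S_vec \<alpha> = y"
    unfolding S_vec_def Finite_Set.fold_def using assms the_equality[of "fold_graph ?f 1 _", OF y] graph
    by (metis (mono_tags, lifting))
  then show ?thesis using graph[OF y] by simp
qed

lemma S_vec_eq_prod_superset:
  assumes "finite A" "{\<phi>. \<alpha> \<phi> \<noteq> []} \<subseteq> A"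
  shows "S_vec \<alpha> = (\<Prod>\<phi>\<in>A. col.s \<phi> (\<alpha> \<phi>))"
  by (subst S_vec_eq_prod, rule finite_subset[OF assms(2,1)], rule prod.mono_neutral_left)
    (use assms in auto)

text \<open>The weight of the coloured partition that a monomial encodes; the variable with index i
  counts as a part i + 1.\<close>

definition mdeg :: "(('a :: {field, finite} phistar \<times> nat) \<Rightarrow>\<^sub>0 nat) \<Rightarrow> nat" where
  "mdeg m = (\<Sum>x\<in>Poly_Mapping.keys m. phistar_size (fst x) * Suc (snd x) * Poly_Mapping.lookup m x)"

lemma mdeg_superset:
  assumes "finite A" "Poly_Mapping.keys m \<subseteq> A"
  shows "mdeg m = (\<Sum>x\<in>A. phistar_size (fst x) * Suc (snd x) * Poly_Mapping.lookup m x)"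
  unfolding mdeg_def by (rule sum.mono_neutral_left) (use assms in \<open>auto simp: in_keys_iff\<close>)

lemma mdeg_0 [simp]: "mdeg 0 = 0" by (simp add: mdeg_def)

lemma mdeg_add: "mdeg (m + m') = mdeg m + mdeg m'"
  using keys_add[of m m']
  by (subst (1 2 3) mdeg_superset[of "Poly_Mapping.keys m \<union> Poly_Mapping.keys m'"])
    (auto simp: lookup_add algebra_simps sum.distrib)

lemma mdeg_single: "mdeg (Poly_Mapping.single x k) = phistar_size (fst x) * Suc (snd x) * k"
  by (subst mdeg_superset[of "{x}"]) (auto split: if_splits)

text \<open>Degrees are integers, so that lowering operators carry no side condition and an element
  of negative degree is 0.\<close>

definition homog :: "int \<Rightarrow> 'a :: {field, finite} FG \<Rightarrow> bool" where
  "homog d v \<longleftrightarrow> (\<forall>m\<in>Poly_Mapping.keys v. int (mdeg m) = d)"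

lemma homog_0: "homog d 0" by (simp add: homog_def)

lemma homog_scalar: "homog 0 (scalar c)"
  by (auto simp: homog_def scalar_def split: if_splits)

lemma homog_1: "homog 0 1" using homog_scalar[of 1] by simp

lemma homog_p_gen: "n \<ge> 1 \<Longrightarrow> homog (int (phistar_size \<phi> * n)) (p_gen n \<phi>)"
  by (auto simp: homog_def p_gen_def mdeg_single)

lemma homog_add: "homog d u \<Longrightarrow> homog d v \<Longrightarrow> homog d (u + v)"
  using keys_add[of u v] by (auto simp: homog_def)

lemma homog_mult: "homog d u \<Longrightarrow> homog e v \<Longrightarrow> homog (d + e) (u * v)"
  using keys_mult[of u v] by (fastforce simp: homog_def mdeg_add)

lemma homog_scalar_mult: "homog d v \<Longrightarrow> homog d (scalar c * v)"
  using homog_mult[OF homog_scalar, of d v c] by simp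

lemma homog_minus: "homog d v \<Longrightarrow> homog d (- v)"
  by (simp add: homog_def)

lemma homog_sum: "(\<And>x. x \<in> A \<Longrightarrow> homog d (f x)) \<Longrightarrow> homog d (sum f A)"
  by (induction A rule: infinite_finite_induct) (auto intro: homog_0 homog_add)

lemma homog_prod: "(\<And>x. x \<in> A \<Longrightarrow> homog (d x) (f x)) \<Longrightarrow> homog (sum d A) (prod f A)"
  by (induction A rule: infinite_finite_induct) (auto intro: homog_1 homog_mult)

lemma homog_neg: "homog d v \<Longrightarrow> d < 0 \<Longrightarrow> v = 0"
  by (auto simp: homog_def simp flip: keys_eq_empty)

lemma homog_unique: "homog d v \<Longrightarrow> homog e v \<Longrightarrow> v \<noteq> 0 \<Longrightarrow> d = e"
  by (metis homog_def keys_eq_empty all_not_in_conv)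

lemma homog_dp:
  assumes n: "n \<ge> 1" and v: "homog d v"
  shows "homog (d - int (phistar_size \<phi> * n)) (dp n \<phi> v)"
proof (rule FG_monomial_induct[where u = v and Q = "\<lambda>v. homog (d - int (phistar_size \<phi> * n)) (dp n \<phi> v)"])
  fix m c assume m: "m \<in> Poly_Mapping.keys v"
  have "homog (int (mdeg m) - int (phistar_size \<phi> * n)) (dp n \<phi> (Poly_Mapping.single m c))" for m c
  proof (induction m arbitrary: c rule: monomial_induct)
    case zero
    then show ?case
      using derivation_scalar[OF derivation_dp, of n \<phi> c] by (simp add: scalar_def homog_0)
  next
    case (plus x m)
    obtain \<psi> i where x: "x = (\<psi>, i)" by (cases x)
    have 1: "homog (int (mdeg (Poly_Mapping.single x 1 + m)) - int (phistar_size \<phi> * n))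
        (dp n \<phi> (p_gen (Suc i) \<psi>) * Poly_Mapping.single m c)"
      by (auto simp: dp_p_gen homog_0 homog_def mdeg_add mdeg_single x algebra_simps split: if_splits)
    have 2: "homog (int (mdeg (Poly_Mapping.single x 1 + m)) - int (phistar_size \<phi> * n))
        (p_gen (Suc i) \<psi> * dp n \<phi> (Poly_Mapping.single m c))"
      using homog_mult[OF homog_p_gen[of "Suc i" \<psi>] plus, of c] by (simp add: x mdeg_add mdeg_single algebra_simps)
    show ?case
      using homog_add[OF 1 2] unfolding derivation_mult[OF derivation_dp, symmetric] p_gen_single x .
  qed
  from this[of m c] show "homog (d - int (phistar_size \<phi> * n)) (dp n \<phi> (Poly_Mapping.single m c))"
    using m v by (simp add: homog_def)
qed (auto simp: derivation_0[OF derivation_dp] derivation_add[OF derivation_dp] homog_0 intro: homog_add)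

lemma T_col_unfold:
  assumes "k \<ge> 1"
  shows "T_col \<phi> k v = scalar (1 / of_nat k) * (\<Sum>i=1..k. of_nat i * - dp i \<phi> (T_col \<phi> (k - i) v))"
  using cancel_of_nat_mult[OF assms, of "T_col \<phi> k v"]
    commuting_series.op_exp_rec[OF derivation_series.axioms(1)[OF derivation_series_dp], of k \<phi> v]
  by (simp only: T_col_def)

lemma homog_of_nat_mult: "homog d v \<Longrightarrow> homog d (of_nat i * v)"
  using homog_scalar_mult[of d v "of_nat i"] by (simp add: scalar_of_nat)

lemma homog_T_col: "homog d v \<Longrightarrow> homog (d - int (phistar_size \<phi> * k)) (T_col \<phi> k v)"
proof (induction k rule: less_induct)
  case (less k)
  show ?case
  proof (cases "k = 0")
    case False
    have "homog (d - int (phistar_size \<phi> * k)) (of_nat i * - dp i \<phi> (T_col \<phi> (k - i) v))"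
      if i: "i \<in> {1..k}" for i
    proof -
      have "homog (d - int (phistar_size \<phi> * (k - i)) - int (phistar_size \<phi> * i)) (dp i \<phi> (T_col \<phi> (k - i) v))"
        using i by (intro homog_dp less) auto
      also have "d - int (phistar_size \<phi> * (k - i)) - int (phistar_size \<phi> * i) = d - int (phistar_size \<phi> * k)"
        using i by (auto simp: algebra_simps of_nat_diff)
      finally show ?thesis by (intro homog_of_nat_mult homog_minus)
    qed
    then show ?thesis
      using False by (subst T_col_unfold) (auto intro!: homog_scalar_mult homog_sum)
  qed (use less in \<open>simp add: col.T_0\<close>)
qed

lemma homog_exp_coeff:
  assumes "\<And>n. n \<ge> 1 \<Longrightarrow> homog (int (d * n)) (a n)"
  shows "homog (int (d * m)) (exp_coeff a m)"
proof (induction m rule: less_induct)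
  case (less m)
  show ?case
  proof (cases "m = 0")
    case False
    have "homog (int (d * m)) (of_nat i * a i * exp_coeff a (m - i))" if i: "i \<in> {1..m}" for i
    proof -
      have "homog (int (d * i) + int (d * (m - i))) (of_nat i * a i * exp_coeff a (m - i))"
        using i by (intro homog_mult homog_of_nat_mult assms less) auto
      also have "int (d * i) + int (d * (m - i)) = int (d * m)"
        using i by (auto simp: algebra_simps of_nat_diff)
      finally show ?thesis .
    qed
    then show ?thesis
      using False by (subst exp_coeff_unfold) (auto intro!: homog_scalar_mult homog_sum)
  qed (simp add: exp_coeff_0 homog_1)
qed

lemma homog_h_col: "homog (int (phistar_size \<phi>) * m) (h_col \<phi> m)"
proof (cases "m < 0")
  case False
  have "homog (int (phistar_size \<phi> * nat m)) (exp_coeff (\<lambda>n. scalar (1 / of_nat n) * p_gen n \<phi>) (nat m))"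
    by (intro homog_exp_coeff homog_scalar_mult homog_p_gen)
  with False show ?thesis by (simp add: h_col_def)
qed (simp add: h_col_def homog_0)

lemma homog_S: "homog d v \<Longrightarrow> homog (d + int (phistar_size \<phi>) * a) (col.S \<phi> a v)"
proof -
  assume v: "homog d v"
  have "homog (d + int (phistar_size \<phi>) * a) (h_col \<phi> (a + int i) * T_col \<phi> i v)" for i
    using homog_mult[OF homog_h_col[of \<phi> "a + int i"] homog_T_col[OF v, of \<phi> i]] by (simp add: algebra_simps)
  then show ?thesis unfolding col.S_def col.W_def by (intro homog_sum)
qed

lemma homog_s: "homog (int (phistar_size \<phi>) * sum_list \<alpha>) (col.s \<phi> \<alpha>)"
proof (induction \<alpha>)
  case (Cons a \<alpha>)
  then show ?case using homog_S[OF Cons, of \<phi> a] by (simp add: col.s_Cons algebra_simps)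
qed (simp add: homog_1)

lemma col_s_neg: "sum_list \<alpha> < 0 \<Longrightarrow> col.s \<phi> \<alpha> = 0"
  using homog_neg[OF homog_s[of \<phi> \<alpha>]] phistar_size_pos[of \<phi>] by (simp add: mult_pos_neg)

text \<open>A bound by degree, complementing the bound by the number of letters in
  \<open>T_s_vanish\<close>.\<close>

lemma T_col_s_vanish: "int k > sum_list \<alpha> \<Longrightarrow> T_col \<phi> k (col.s \<phi> \<alpha>) = 0"
proof -
  assume k: "int k > sum_list \<alpha>"
  have "int (phistar_size \<phi>) * sum_list \<alpha> - int (phistar_size \<phi> * k) =
      int (phistar_size \<phi>) * (sum_list \<alpha> - int k)" by (simp add: algebra_simps)
  also have "\<dots> < 0" using k phistar_size_pos[of \<phi>] by (simp add: mult_pos_neg)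
  finally show ?thesis using homog_neg[OF homog_T_col[OF homog_s]] by blast
qed

section \<open>Principal specialization and the hook formula\<close>

text \<open>The recursion as the differential equation X H' = C H, from which products of solutions
  are seen to add their exponents.\<close>

lemma exp_seq_iff_fps:
  "exp_seq c h \<longleftrightarrow> h 0 = 1 \<and>
    fps_X * fps_deriv (Abs_fps h) = Abs_fps (\<lambda>i. if i = 0 then 0 else c i) * Abs_fps h"
proof -
  have *: "(\<Sum>i=1..m. c i * h (m - i)) =
      fps_nth (Abs_fps (\<lambda>i. if i = 0 then 0 else c i) * Abs_fps h) m" if "m \<ge> 1" for m
    using that by (simp add: fps_mult_nth sum.atLeast_Suc_atMost[of 0 m])
  have "fps_nth (fps_X * fps_deriv (Abs_fps h)) m = of_nat m * h m" for m
    by (cases m) (simp_all add: fps_X_mult_nth)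
  then have "fps_X * fps_deriv (Abs_fps h) = Abs_fps (\<lambda>i. if i = 0 then 0 else c i) * Abs_fps h \<longleftrightarrow>
      (\<forall>m. of_nat m * h m = fps_nth (Abs_fps (\<lambda>i. if i = 0 then 0 else c i) * Abs_fps h) m)"
    by (simp only: fps_eq_iff)
  also have "\<dots> \<longleftrightarrow>
      (\<forall>m\<ge>1. of_nat m * h m = fps_nth (Abs_fps (\<lambda>i. if i = 0 then 0 else c i) * Abs_fps h) m)"
    (is "(\<forall>m. ?P m) \<longleftrightarrow> _")
  proof -
    have "?P 0" by simp
    then show ?thesis by (metis less_one not_le)
  qed
  also have "\<dots> \<longleftrightarrow> (\<forall>m\<ge>1. of_nat m * h m = (\<Sum>i=1..m. c i * h (m - i)))"
    by (intro arg_cong[where f = All] ext imp_cong refl) (simp only: *)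
  finally show ?thesis unfolding exp_seq_def by blast
qed

lemma exp_seq_mult:
  assumes "exp_seq c (fps_nth F)" "exp_seq d (fps_nth G)"
  shows "exp_seq (\<lambda>i. c i + d i) (fps_nth (F * G))"
proof -
  let ?C = "\<lambda>c. Abs_fps (\<lambda>i. if i = 0 then 0 else c i)"
  have "?C (\<lambda>i. c i + d i) = ?C c + ?C d" by (simp add: fps_eq_iff)
  moreover have "fps_X * fps_deriv (F * G) = (fps_X * fps_deriv F) * G + F * (fps_X * fps_deriv G)"
    by (simp add: algebra_simps)
  ultimately show ?thesis
    using assms unfolding exp_seq_iff_fps fps_nth_inverse by (simp add: distrib_left distrib_right mult_ac)
qed

lemma exp_seq_one: "exp_seq (\<lambda>_. 0) (fps_nth (1 :: 'a :: comm_ring_1 fps))"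
  by (simp add: exp_seq_def)

lemma exp_seq_prod:
  "(\<And>x. x \<in> A \<Longrightarrow> exp_seq (c x) (fps_nth (F x))) \<Longrightarrow>
    exp_seq (\<lambda>i. \<Sum>x\<in>A. c x i) (fps_nth (\<Prod>x\<in>A. F x))"
  by (induction A rule: infinite_finite_induct) (auto intro: exp_seq_mult exp_seq_one)

text \<open>Only c_1, ..., c_n enter h_m for m \<le> n; this is what allows a product over all
  colours to be replaced by a finite one.\<close>

lemma exp_seq_unique:
  assumes "exp_seq c h" "exp_seq d g" "\<And>i. 1 \<le> i \<Longrightarrow> i \<le> n \<Longrightarrow> c i = d i" "m \<le> n"
  shows "h m = (g m :: 'a :: {idom, ring_char_0})"
  using assms(4)
proof (induction m rule: less_induct)
  case (less m)
  show ?case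
  proof (cases "m = 0")
    case True
    then show ?thesis using assms by (simp add: exp_seq_def)
  next
    case False
    have "of_nat m * h m = (\<Sum>i=1..m. c i * h (m - i))"
      using assms(1) False by (simp add: exp_seq_def)
    also have "\<dots> = (\<Sum>i=1..m. d i * g (m - i))"
      using less assms(3) by (intro sum.cong refl) auto
    also have "\<dots> = of_nat m * g m"
      using assms(2) False by (simp add: exp_seq_def)
    finally show ?thesis using False by simp
  qed
qed

lemma exp_seq_geometric: "exp_seq (\<lambda>i. x ^ i) (\<lambda>i. x ^ i :: 'a :: comm_ring_1)"
  by (simp add: exp_seq_def flip: power_add)

lemma exp_seq_scale: "exp_seq c h \<Longrightarrow> exp_seq (\<lambda>i. x ^ i * c i) (\<lambda>i. x ^ i * h i :: 'a :: comm_ring_1)"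
  unfolding exp_seq_def
proof (intro conjI allI impI)
  fix m :: nat
  assume *: "h 0 = 1 \<and> (\<forall>m\<ge>1. of_nat m * h m = (\<Sum>i=1..m. c i * h (m - i)))" and m: "m \<ge> 1"
  have "of_nat m * (x ^ m * h m) = x ^ m * (\<Sum>i=1..m. c i * h (m - i))"
    using * m by (simp add: mult.left_commute[of _ "x ^ m"])
  also have "\<dots> = (\<Sum>i=1..m. x ^ i * c i * (x ^ (m - i) * h (m - i)))"
    unfolding sum_distrib_left
  proof (rule sum.cong[OF refl])
    fix i assume "i \<in> {1..m}"
    then have "x ^ m = x ^ i * x ^ (m - i)" by (simp flip: power_add)
    then show "x ^ m * (c i * h (m - i)) = x ^ i * c i * (x ^ (m - i) * h (m - i))"
      by (simp add: mult_ac)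
  qed
  finally show "of_nat m * (x ^ m * h m) = (\<Sum>i=1..m. x ^ i * c i * (x ^ (m - i) * h (m - i)))" .
qed simp

text \<open>Since x^i/(x^i - 1) = 1/(x^i - 1) + 1, the generating function satisfies H(x t) =
  H(t)/(1 - t); comparing two consecutive coefficients gives the recursion.\<close>

lemma exp_seq_q_recursion:
  fixes h :: "nat \<Rightarrow> complex"
  assumes h: "exp_seq (\<lambda>i. 1 / (x ^ i - 1)) h" and x: "\<And>i. i \<ge> 1 \<Longrightarrow> x ^ i \<noteq> 1"
  shows "(x ^ Suc m - 1) * h (Suc m) = x ^ m * h m"
proof -
  have 1: "exp_seq (\<lambda>i. x ^ i * (1 / (x ^ i - 1))) (\<lambda>i. x ^ i * h i)"
    by (rule exp_seq_scale[OF h])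
  have 2: "exp_seq (\<lambda>i. 1 / (x ^ i - 1) + 1 ^ i) (fps_nth (Abs_fps h * Abs_fps (\<lambda>i. 1 ^ i)))"
  proof (rule exp_seq_mult)
    have e: "fps_nth (Abs_fps f) = f" for f :: "nat \<Rightarrow> complex" by (rule ext) simp
    show "exp_seq (\<lambda>i. 1 / (x ^ i - 1)) (fps_nth (Abs_fps h))" unfolding e by (rule h)
    show "exp_seq (\<lambda>i. 1 ^ i) (fps_nth (Abs_fps (\<lambda>i. 1 ^ i :: complex)))" unfolding e by (rule exp_seq_geometric)
  qed
  have eq: "x ^ m * h m = (\<Sum>i=0..m. h i)" for m
    using exp_seq_unique[OF 1 2, of m m] x by (simp add: fps_mult_nth field_simps)
  show ?thesis
    using eq[of "Suc m"] eq[of m] by (simp add: algebra_simps)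
qed

definition qphi :: "'a :: {field, finite} phistar \<Rightarrow> complex" where
  "qphi \<phi> = of_nat CARD('a) ^ phistar_size \<phi>"

lemma of_nat_CARD_power_neq_1: "i \<ge> 1 \<Longrightarrow> (of_nat CARD('a :: {field, finite}) :: complex) ^ i \<noteq> 1"
  using M_order_pos[of i, where 'a = 'a] of_nat_M_order[of i, where 'a = 'a]
  by (metis eq_iff_diff_eq_0 neq0_conv of_nat_eq_0_iff)

lemma of_nat_CARD_neq_0: "(of_nat CARD('a :: {field, finite}) :: complex) \<noteq> 0"
  using CARD_ge_2[where 'a = 'a] by simp

lemma qphi_power: "qphi (\<phi> :: 'a :: {field, finite} phistar) ^ i = of_nat CARD('a) ^ (phistar_size \<phi> * i)"
  by (simp add: qphi_def power_mult)

lemma qphi_power_neq_1: "i \<ge> 1 \<Longrightarrow> qphi (\<phi> :: 'a :: {field, finite} phistar) ^ i \<noteq> 1"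
  unfolding qphi_power using phistar_size_pos[of \<phi>]
  by (intro of_nat_CARD_power_neq_1) (simp add: Suc_le_eq)

lemma qphi_neq_0: "qphi (\<phi> :: 'a :: {field, finite} phistar) \<noteq> 0"
  using CARD_ge_2[where 'a = 'a] by (simp add: qphi_def)

text \<open>The principal specialization of colour \<phi> at the variables q_\<phi>^-1, q_\<phi>^-2,
  ...: the power sum p_m becomes the geometric series with value 1/(q_\<phi>^m - 1).\<close>

definition spec :: "'a :: {field, finite} FG \<Rightarrow> complex" where
  "spec = eval_FG (\<lambda>c. c) (\<lambda>m \<phi>. 1 / (qphi \<phi> ^ m - 1))"

lemma ring_hom_id: "ring_hom_fun (\<lambda>c. c)"
  by (simp add: ring_hom_fun_def)

lemma ring_hom_spec: "ring_hom_fun spec"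
  unfolding spec_def by (rule ring_hom_eval_FG[OF ring_hom_id])

lemma spec_1: "spec 1 = 1"
  using ring_hom_spec unfolding ring_hom_fun_def by blast

lemma spec_add: "spec (u + v) = spec u + spec v" and spec_mult: "spec (u * v) = spec u * spec v"
  using ring_hom_spec unfolding ring_hom_fun_def by blast+

lemmas spec_0 = ring_hom_fun_0[OF ring_hom_spec]
  and spec_sum = ring_hom_fun_sum[OF ring_hom_spec]
  and spec_prod = ring_hom_fun_prod[OF ring_hom_spec]

lemma spec_scalar: "spec (scalar c) = c"
  by (simp add: spec_def eval_FG_scalar[OF ring_hom_id])

lemma spec_p_gen: "m \<ge> 1 \<Longrightarrow> spec (p_gen m \<phi>) = 1 / (qphi \<phi> ^ m - 1)"
  by (simp add: spec_def eval_FG_p_gen[OF ring_hom_id])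

lemma exp_seq_cong: "(\<And>i. i \<ge> 1 \<Longrightarrow> c i = d i) \<Longrightarrow> exp_seq c h = exp_seq d h"
  unfolding exp_seq_def by (auto cong: sum.cong_simp)

lemma exp_seq_spec_h_col: "exp_seq (\<lambda>i. 1 / (qphi \<phi> ^ i - 1)) (\<lambda>m. spec (h_col \<phi> (int m)))"
proof -
  have "exp_seq (\<lambda>i. spec (of_nat i * (scalar (1 / of_nat i) * p_gen i \<phi>)))
      (\<lambda>i. spec (exp_coeff (\<lambda>n. scalar (1 / of_nat n) * p_gen n \<phi>) i))"
    by (rule exp_seq_hom[OF ring_hom_spec exp_seq_exp_coeff])
  also have "(\<lambda>i. spec (exp_coeff (\<lambda>n. scalar (1 / of_nat n) * p_gen n \<phi>) i)) = (\<lambda>m. spec (h_col \<phi> (int m)))"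
    by (simp add: h_col_def)
  also have "exp_seq (\<lambda>i. spec (of_nat i * (scalar (1 / of_nat i) * p_gen i \<phi>))) \<dots> =
      exp_seq (\<lambda>i. 1 / (qphi \<phi> ^ i - 1)) \<dots>"
    by (rule exp_seq_cong) (simp add: spec_mult spec_scalar spec_p_gen ring_hom_fun_of_nat[OF ring_hom_spec])
  finally show ?thesis .
qed

lemma spec_h_col_Suc:
  "(qphi \<phi> ^ Suc m - 1) * spec (h_col \<phi> (int (Suc m))) = qphi \<phi> ^ m * spec (h_col \<phi> (int m))"
  by (rule exp_seq_q_recursion[OF exp_seq_spec_h_col qphi_power_neq_1])

lemma spec_h_col_0: "spec (h_col \<phi> 0) = 1"
  by (simp add: col.h_0 spec_1)

definition qfact :: "complex \<Rightarrow> nat \<Rightarrow> complex" where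
  "qfact x m = (\<Prod>i=1..m. x ^ i - 1)"

lemma qfact_Suc: "qfact x (Suc m) = qfact x m * (x ^ Suc m - 1)"
  by (simp add: qfact_def)

lemma qfact_neq_0: "qfact (qphi \<phi>) m \<noteq> 0"
  by (simp add: qfact_def qphi_power_neq_1)

lemma Suc_choose_two: "Suc m choose 2 = (m choose 2) + m"
  by (simp add: numeral_2_eq_2)

lemma spec_h_col: "spec (h_col \<phi> (int m)) = qphi \<phi> ^ (m choose 2) / qfact (qphi \<phi>) m"
proof (induction m)
  case (Suc m)
  have "spec (h_col \<phi> (int (Suc m))) = qphi \<phi> ^ m * spec (h_col \<phi> (int m)) / (qphi \<phi> ^ Suc m - 1)"
    using spec_h_col_Suc[of \<phi> m] qphi_power_neq_1[of "Suc m" \<phi>] by (simp add: field_simps del: power_Suc)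
  then show ?case
    unfolding Suc qfact_Suc Suc_choose_two power_add by (simp add: field_simps del: power_Suc)
qed (simp add: spec_h_col_0 qfact_def binomial_eq_0)

text \<open>As a function of \<open>x = q\<^sup>-\<^sup>L\<close>, the specialization of \<open>h\<^sub>L\<^sub>-\<^sub>k\<close> is that of \<open>h\<^sub>L\<close> times a polynomial of
  degree \<open>k\<close>.\<close>

definition lower_poly :: "complex \<Rightarrow> nat \<Rightarrow> complex poly" where
  "lower_poly Q k = smult (Q ^ k) (\<Prod>r<k. [:1, - (Q ^ r):])"

lemma degree_lower_poly: "degree (lower_poly Q k) \<le> k"
proof -
  have "degree (\<Prod>r<k. [:1, - (Q ^ r):]) \<le> (\<Sum>r<k. degree [:1, - (Q ^ r):])"
    by (rule order_trans[OF degree_prod_sum_le]) simp_all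
  also have "\<dots> \<le> (\<Sum>r<k. 1)" by (intro sum_mono) simp
  finally show ?thesis
    unfolding lower_poly_def by (intro order_trans[OF degree_smult_le]) simp
qed

lemma coeff_lower_poly: "coeff (lower_poly Q k) k = (-1) ^ k * Q ^ k * Q ^ (k choose 2)"
proof -
  have deg: "degree (\<Prod>r<k. [:1, - (Q ^ r):]) \<le> k" for k
  proof -
    have "degree (\<Prod>r<k. [:1, - (Q ^ r):]) \<le> (\<Sum>r<k. degree [:1, - (Q ^ r):])"
      by (rule order_trans[OF degree_prod_sum_le]) simp_all
    also have "\<dots> \<le> (\<Sum>r<k. 1)" by (intro sum_mono) simp
    finally show ?thesis by simp
  qed
  have "coeff (\<Prod>r<k. [:1, - (Q ^ r):]) k = (-1) ^ k * Q ^ (k choose 2)"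
  proof (induction k)
    case (Suc k)
    have "coeff (\<Prod>r<k. [:1, - (Q ^ r):]) (Suc k) = 0"
      using deg[of k] by (intro coeff_eq_0) simp
    then show ?case
      using Suc by (simp add: mult.commute[of _ "[:1, - (Q ^ k):]"] Suc_choose_two power_add)
  qed (simp add: binomial_eq_0)
  then show ?thesis by (simp add: lower_poly_def)
qed

lemma spec_h_col_lower:
  "spec (h_col \<phi> (int L - int k)) = spec (h_col \<phi> (int L)) * poly (lower_poly (qphi \<phi>) k) (inverse (qphi \<phi>) ^ L)"
proof (induction k)
  case (Suc k)
  let ?Q = "qphi \<phi>" and ?x = "inverse (qphi \<phi>) ^ L"
  have *: "spec (h_col \<phi> (int L - int (Suc k))) =
      spec (h_col \<phi> (int L - int k)) * (?Q * (1 - ?Q ^ k * ?x))"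
  proof (cases "k < L")
    case True
    define m where "m = L - Suc k"
    have L: "L = Suc m + k" using True by (simp add: m_def)
    have "spec (h_col \<phi> (int m)) = spec (h_col \<phi> (int (Suc m))) * ((?Q ^ Suc m - 1) / ?Q ^ m)"
      using spec_h_col_Suc[of \<phi> m] qphi_neq_0[of \<phi>] by (simp add: field_simps del: power_Suc)
    also have "(?Q ^ Suc m - 1) / ?Q ^ m = ?Q * (1 - ?Q ^ k * ?x)"
      using qphi_neq_0[of \<phi>] unfolding L by (simp add: field_simps power_add)
    finally show ?thesis by (simp add: L)
  next
    case False
    then show ?thesis
    \<comment> \<open>At k = L the factor 1 - q_\<phi>^k q_\<phi>^-L is zero, in accordance with
      h_-1 = 0; for larger k both sides are already 0.\<close>
    proof (cases "k = L")
      case True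
      then show ?thesis using qphi_neq_0[of \<phi>] by (simp add: col.h_neg spec_0 power_inverse)
    next
      case False
      with \<open>\<not> k < L\<close> show ?thesis by (simp add: col.h_neg spec_0)
    qed
  qed
  show ?case
    unfolding * Suc by (simp add: lower_poly_def algebra_simps)
qed (simp add: lower_poly_def)

lemma poly_eq_prod_roots:
  fixes V :: "'a :: field poly"
  assumes "degree V \<le> l" "finite R" "card R = l" "\<And>x. x \<in> R \<Longrightarrow> poly V x = 0"
  shows "poly V x = coeff V l * (\<Prod>r\<in>R. x - r)"
proof -
  define W where "W = (\<Prod>r\<in>R. [:- r, 1:])"
  have deg: "degree W = l"
    unfolding W_def using assms by (subst degree_prod_sum_eq) auto
  have "lead_coeff W = 1"
    unfolding W_def by (subst lead_coeff_prod) simp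
  then have lc: "coeff W l = 1" by (simp add: deg)
  define D where "D = V - smult (coeff V l) W"
  have "D = 0"
  proof (rule ccontr)
    assume "D \<noteq> 0"
    have "R \<subseteq> {x. poly D x = 0}"
      using assms by (auto simp: D_def W_def poly_prod prod_zero_iff intro!: bexI)
    then have "l \<le> card {x. poly D x = 0}"
      using assms(3) card_mono[OF poly_roots_finite[OF \<open>D \<noteq> 0\<close>]] by blast
    also have "\<dots> \<le> degree D" by (rule card_poly_roots_bound) fact
    finally have "l \<le> degree D" .
    moreover have "degree D \<le> l"
      unfolding D_def using assms(1) deg by (intro degree_diff_le) (auto intro: order_trans[OF degree_smult_le])
    ultimately have "coeff D l \<noteq> 0" using \<open>D \<noteq> 0\<close> by (metis antisym leading_coeff_0_iff)
    then show False by (simp add: D_def lc)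
  qed
  then have "V = smult (coeff V l) W" by (simp add: D_def)
  then have "poly V x = coeff V l * poly W x" by (metis poly_smult)
  then show ?thesis by (simp add: W_def poly_prod)
qed

lemma s_Cons_eq_sum: "col.s \<phi> (a # \<alpha>) = (\<Sum>i\<le>length \<alpha>. h_col \<phi> (a + int i) * T_col \<phi> i (col.s \<phi> \<alpha>))"
  unfolding col.s_Cons col.S_def by (rule col.W_eq) (rule col.T_s_vanish)

text \<open>The specialization of \<open>s\<^bsub>(L-l, \<alpha>)\<^esub>\<close> is a polynomial of degree \<open>l\<close> in \<open>q\<^sup>-\<^sup>L\<close> that vanishes
  whenever \<open>L\<close> is one of the \<open>l\<close> shifted parts \<open>b i\<close> of \<open>\<alpha>\<close>.\<close>

lemma spec_s_Cons:
  fixes b :: "nat \<Rightarrow> nat"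
  assumes b: "\<And>i. i < length \<alpha> \<Longrightarrow> int (b i) = \<alpha> ! i + int (length \<alpha>) - 1 - int i"
    and inj: "inj_on b {..<length \<alpha>}"
  shows "spec (col.s \<phi> ((int L - int (length \<alpha>)) # \<alpha>)) =
    spec (h_col \<phi> (int L)) * ((-1) ^ length \<alpha> * qphi \<phi> ^ length \<alpha> * qphi \<phi> ^ (length \<alpha> choose 2)) *
    spec (col.s \<phi> \<alpha>) * (\<Prod>i<length \<alpha>. inverse (qphi \<phi>) ^ L - inverse (qphi \<phi>) ^ b i)"
proof -
  define l where "l = length \<alpha>"
  let ?Q = "qphi \<phi>"
  define z where "z j = spec (T_col \<phi> j (col.s \<phi> \<alpha>))" for j
  define V where "V = (\<Sum>k\<le>l. smult (z (l - k)) (lower_poly ?Q k))"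
  have V: "spec (col.s \<phi> ((int L - int l) # \<alpha>)) = spec (h_col \<phi> (int L)) * poly V (inverse ?Q ^ L)" for L
  proof -
    have "spec (col.s \<phi> ((int L - int l) # \<alpha>)) = (\<Sum>i\<le>l. spec (h_col \<phi> (int L - int l + int i)) * z i)"
      by (simp add: s_Cons_eq_sum spec_sum spec_mult z_def flip: l_def)
    also have "\<dots> = (\<Sum>k\<le>l. spec (h_col \<phi> (int L - int k)) * z (l - k))"
      by (rule sum.reindex_bij_witness[of _ "\<lambda>k. l - k" "\<lambda>k. l - k"]) (auto simp: of_nat_diff algebra_simps)
    also have "\<dots> = spec (h_col \<phi> (int L)) * poly V (inverse ?Q ^ L)"
      by (simp add: spec_h_col_lower V_def poly_sum sum_distrib_left mult_ac)
    finally show ?thesis .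
  qed
  have degV: "degree V \<le> l"
    unfolding V_def
    by (rule degree_sum_le) (auto intro: order_trans[OF degree_smult_le] order_trans[OF degree_lower_poly])
  \<comment> \<open>Only the summand k = l reaches degree l, and there the skewing has order 0 and
    is the identity.\<close>
  have "coeff V l = (\<Sum>k\<le>l. z (l - k) * coeff (lower_poly ?Q k) l)"
    by (simp add: V_def coeff_sum)
  also have "\<dots> = (\<Sum>k\<in>{l}. z (l - k) * coeff (lower_poly ?Q k) l)"
  proof (rule sum.mono_neutral_right)
    have "coeff (lower_poly ?Q k) l = 0" if "k < l" for k
      using degree_lower_poly[of ?Q k] that by (intro coeff_eq_0) simp
    then show "\<forall>k\<in>{..l} - {l}. z (l - k) * coeff (lower_poly ?Q k) l = 0" by auto
  qed auto
  also have "\<dots> = spec (col.s \<phi> \<alpha>) * ((-1) ^ l * ?Q ^ l * ?Q ^ (l choose 2))"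
    by (simp add: z_def col.T_0 coeff_lower_poly)
  finally have coeffV: "coeff V l = spec (col.s \<phi> \<alpha>) * ((-1) ^ l * ?Q ^ l * ?Q ^ (l choose 2))" .
  have inj_Q: "m = n" if "inverse ?Q ^ m = inverse ?Q ^ n" for m n
  proof (rule ccontr)
    have *: False if "m < n" "?Q ^ m = ?Q ^ n" for m n
    proof -
      have "?Q ^ n = ?Q ^ m * ?Q ^ (n - m)" using that(1) by (simp flip: power_add)
      then have "?Q ^ (n - m) = 1" using that(2) qphi_neq_0[of \<phi>] by simp
      then show False using qphi_power_neq_1[of "n - m" \<phi>] that(1) by simp
    qed
    assume "m \<noteq> n"
    moreover have "?Q ^ m = ?Q ^ n" using that by (simp add: power_inverse)
    ultimately show False using *[of m n] *[of n m] by (metis nat_neq_iff)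
  qed
  define R where "R = (\<lambda>i. inverse ?Q ^ b i) ` {..<l}"
  have injR: "inj_on (\<lambda>i. inverse ?Q ^ b i) {..<l}"
    using inj inj_Q unfolding inj_on_def l_def by blast
  have "poly V (inverse ?Q ^ L) = coeff V l * (\<Prod>r\<in>R. inverse ?Q ^ L - r)"
  proof (rule poly_eq_prod_roots[OF degV])
    show "finite R" by (simp add: R_def)
    show "card R = l" using injR by (simp add: R_def card_image)
    fix x assume "x \<in> R"
    then obtain i where i: "i < l" "x = inverse ?Q ^ b i" by (auto simp: R_def)
    \<comment> \<open>For L = b i the first letter and the i-th letter of \<alpha> have equal
      shifted parts. As h_L specializes to a nonzero number, the polynomial itself must
      vanish.\<close>
    have "col.s \<phi> ((int (b i) - int l) # \<alpha>) = 0"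
      by (rule col.s_repeated[of i]) (use i b[of i] in \<open>auto simp: l_def\<close>)
    then have "spec (h_col \<phi> (int (b i))) * poly V x = 0"
      using V[of "b i"] by (simp add: i spec_0)
    moreover have "spec (h_col \<phi> (int (b i))) \<noteq> 0"
      by (simp add: spec_h_col qfact_neq_0 qphi_neq_0)
    ultimately show "poly V x = 0" by simp
  qed
  also have "(\<Prod>r\<in>R. inverse ?Q ^ L - r) = (\<Prod>i<l. inverse ?Q ^ L - inverse ?Q ^ b i)"
    unfolding R_def by (subst prod.reindex[OF injR]) simp
  finally show ?thesis
    using V[of L] unfolding coeffV by (simp only: l_def mult_ac)
qed

text \<open>Splits off the first row: each root factor becomes q_\<phi> to a difference of shifted
  parts, minus 1; the signs and powers of q_\<phi> taken out combine with those of
  \<open>spec_s_Cons\<close>.\<close>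

lemma spec_s_partition_Cons:
  assumes "is_partition (a # \<nu>)"
  shows "spec (col.s \<phi> (map int (a # \<nu>))) = qphi \<phi> ^ (a choose 2) *
    (\<Prod>i<length \<nu>. qphi \<phi> ^ (a + Suc i - \<nu> ! i) - 1) / qfact (qphi \<phi>) (a + length \<nu>) *
    spec (col.s \<phi> (map int \<nu>))"
proof -
  let ?Q = "qphi \<phi>"
  define l where "l = length \<nu>"
  define L where "L = a + l"
  define b where "b i = \<nu> ! i + l - 1 - i" for i
  have sorted: "\<nu> ! j \<le> \<nu> ! i" if "i < j" "j < l" for i j
  proof -
    have "sorted_wrt (\<ge>) \<nu>" using assms by (simp add: is_partition_def)
    then show ?thesis using that unfolding sorted_wrt_iff_nth_less l_def by blast
  qed
  have le: "\<nu> ! i \<le> a" if "i < l" for i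
    using assms that by (auto simp: is_partition_def l_def)
  have b_less: "b j < b i" if "i < j" "j < l" for i j
    using sorted[OF that] that by (simp add: b_def)
  have inj: "inj_on b {..<l}"
    by (rule linorder_inj_onI) (use b_less in fastforce)+
  have spec: "spec (col.s \<phi> (map int (a # \<nu>))) =
      spec (h_col \<phi> (int L)) * ((-1) ^ l * ?Q ^ l * ?Q ^ (l choose 2)) *
      spec (col.s \<phi> (map int \<nu>)) * (\<Prod>i<l. inverse ?Q ^ L - inverse ?Q ^ b i)"
    using spec_s_Cons[of "map int \<nu>" b \<phi> L] inj
    by (simp add: l_def[symmetric] L_def b_def)
  have "inverse ?Q ^ L - inverse ?Q ^ b i = - (inverse ?Q ^ L * (?Q ^ (a + Suc i - \<nu> ! i) - 1))" if i: "i < l" for i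
  proof -
    have "L = b i + (a + Suc i - \<nu> ! i)"
      using i le[OF i] by (simp add: L_def b_def)
    then have "inverse ?Q ^ L * ?Q ^ (a + Suc i - \<nu> ! i) = inverse ?Q ^ b i"
      using qphi_neq_0[of \<phi>] by (simp add: power_add power_inverse)
    then show ?thesis by (simp add: algebra_simps)
  qed
  then have "(\<Prod>i<l. inverse ?Q ^ L - inverse ?Q ^ b i) =
      (\<Prod>i<l. (- 1) * (inverse ?Q ^ L * (?Q ^ (a + Suc i - \<nu> ! i) - 1)))"
    by (intro prod.cong) auto
  also have "\<dots> = (-1) ^ l * inverse ?Q ^ (L * l) * (\<Prod>i<l. ?Q ^ (a + Suc i - \<nu> ! i) - 1)"
    by (simp only: prod.distrib prod_constant card_lessThan power_mult mult.assoc)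
  finally have prod: "(\<Prod>i<l. inverse ?Q ^ L - inverse ?Q ^ b i) = \<dots>" .
  \<comment> \<open>The powers of q_\<phi> from h_L, from the leading coefficient and from the l
    extracted factors collapse to a(a-1)/2, the contribution of the first row to n of the conjugate
    partition.\<close>
  have "(L choose 2) + l + (l choose 2) = (a choose 2) + L * l"
  proof -
    have 1: "(a + l choose 2) = (a choose 2) + a * l + (l choose 2)" for l
      by (induction l) (simp_all add: Suc_choose_two)
    have 2: "2 * (l choose 2) + l = l * l" for l
      by (induction l) (simp_all add: Suc_choose_two)
    show ?thesis unfolding L_def add_mult_distrib using 1[of l] 2[of l] by linarith
  qed
  then have "?Q ^ (L choose 2) * ?Q ^ l * ?Q ^ (l choose 2) = ?Q ^ (a choose 2) * ?Q ^ (L * l)"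
    by (simp flip: power_add)
  then have exps: "?Q ^ (L choose 2) * ?Q ^ l * ?Q ^ (l choose 2) * inverse ?Q ^ (L * l) = ?Q ^ (a choose 2)"
    using qphi_neq_0[of \<phi>] by (simp add: power_inverse)
  have sign: "(-1) ^ l * (-1) ^ l = (1 :: complex)" by (simp flip: power_mult_distrib)
  have "spec (col.s \<phi> (map int (a # \<nu>))) = ((-1) ^ l * (-1) ^ l) *
      (?Q ^ (L choose 2) * ?Q ^ l * ?Q ^ (l choose 2) * inverse ?Q ^ (L * l)) *
      (\<Prod>i<l. ?Q ^ (a + Suc i - \<nu> ! i) - 1) / qfact ?Q L * spec (col.s \<phi> (map int \<nu>))"
    unfolding spec prod spec_h_col by (simp add: mult_ac)
  then show ?thesis
    unfolding exps sign by (simp add: L_def l_def)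
qed

text \<open>The length of column j, equal to 0 for columns beyond the first row, where
  \<open>conj_part\<close> has no entry.\<close>

definition num_gt :: "nat list \<Rightarrow> nat \<Rightarrow> nat" where
  "num_gt \<nu> j = length (filter (\<lambda>x. j < x) \<nu>)"

lemma num_gt_Cons: "num_gt (a # \<nu>) j = (if j < a then 1 else 0) + num_gt \<nu> j"
  by (simp add: num_gt_def)

lemma conj_part_nth: "j < hd \<nu> \<Longrightarrow> \<nu> \<noteq> [] \<Longrightarrow> conj_part \<nu> ! j = num_gt \<nu> j"
  by (simp add: conj_part_def num_gt_def)

lemma partition_nth_le_hd:
  assumes "is_partition \<nu>" "i < length \<nu>"
  shows "\<nu> ! i \<le> hd \<nu>"
proof (cases \<nu>)
  case (Cons a \<nu>')
  then show ?thesis using assms by (cases i) (auto simp: is_partition_def)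
qed (use assms in simp)

lemma num_gt_eq_0: "is_partition \<nu> \<Longrightarrow> (\<nu> \<noteq> [] \<Longrightarrow> hd \<nu> \<le> j) \<Longrightarrow> num_gt \<nu> j = 0"
  using partition_nth_le_hd[of \<nu>] unfolding num_gt_def length_0_conv filter_empty_conv
  by (metis in_set_conv_nth length_greater_0_conv less_nat_zero_code list.size(3) not_le order_trans)

lemma is_partition_Cons: "is_partition (a # \<nu>) \<Longrightarrow> is_partition \<nu>"
  by (simp add: is_partition_def)

lemma hook_Cons_Suc:
  assumes "is_partition (a # \<nu>)" "i < length \<nu>" "j < \<nu> ! i"
  shows "hook (a # \<nu>) (Suc i, j) = hook \<nu> (i, j)"
proof -
  have "\<nu> ! i \<le> a" using assms by (auto simp: is_partition_def)
  moreover have "j < hd \<nu>"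
    using partition_nth_le_hd[OF is_partition_Cons[OF assms(1)] assms(2)] assms(3) by simp
  moreover have "\<nu> \<noteq> []" using assms(2) by auto
  ultimately show ?thesis
    using assms by (simp add: hook_def conj_part_nth num_gt_Cons)
qed

lemma hook_first_row:
  assumes "is_partition (a # \<nu>)" "j < a"
  shows "hook (a # \<nu>) (0, j) = a + num_gt \<nu> j - j"
  using assms by (simp add: hook_def conj_part_nth num_gt_Cons)

lemma nodes_Cons: "nodes (a # \<nu>) = (\<lambda>j. (0, j)) ` {..<a} \<union> (\<lambda>(i, j). (Suc i, j)) ` nodes \<nu>"
proof -
  have "(i, j) \<in> nodes (a # \<nu>) \<longleftrightarrow> (i, j) \<in> (\<lambda>j. (0, j)) ` {..<a} \<union> (\<lambda>(i, j). (Suc i, j)) ` nodes \<nu>" for i j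
    by (cases i) (auto simp: nodes_def)
  then show ?thesis by auto
qed

lemma finite_nodes: "finite (nodes \<nu>)"
  by (induction \<nu>) (simp_all add: nodes_Cons, simp add: nodes_def)

lemma n_part_conj_Cons:
  assumes "is_partition (a # \<nu>)"
  shows "n_part (conj_part (a # \<nu>)) = (a choose 2) + n_part (conj_part \<nu>)"
proof -
  have n_part: "n_part (conj_part \<nu>) = (\<Sum>j<N. j * num_gt \<nu> j)"
    if \<nu>: "is_partition \<nu>" "\<nu> \<noteq> [] \<Longrightarrow> hd \<nu> \<le> N" for \<nu> N
  proof -
    have "n_part (conj_part \<nu>) = (\<Sum>j<(if \<nu> = [] then 0 else hd \<nu>). j * num_gt \<nu> j)"
      by (auto simp: n_part_def conj_part_def num_gt_def)
    also have "\<dots> = (\<Sum>j<N. j * num_gt \<nu> j)"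
      by (rule sum.mono_neutral_left) (use \<nu> num_gt_eq_0[OF \<nu>(1)] in \<open>auto simp: not_less\<close>)
    finally show ?thesis .
  qed
  have "\<nu> \<noteq> [] \<Longrightarrow> hd \<nu> \<le> a"
    using assms by (auto simp: is_partition_def)
  then have "n_part (conj_part \<nu>) = (\<Sum>j<a. j * num_gt \<nu> j)"
    by (rule n_part[OF is_partition_Cons[OF assms]])
  moreover have "n_part (conj_part (a # \<nu>)) = (\<Sum>j<a. j * num_gt (a # \<nu>) j)"
    by (rule n_part[OF assms]) simp
  moreover have "(\<Sum>j<a. j) = a choose 2"
    by (induction a) (simp_all add: Suc_choose_two binomial_eq_0)
  ultimately show ?thesis
    by (simp add: num_gt_Cons distrib_left sum.distrib)
qed

text \<open>The hook lengths of the first row are the complement in \<open>{1..a + length \<nu>}\<close> of the differences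
  between the first and the other shifted parts.\<close>

lemma prod_first_row_hooks:
  fixes f :: "nat \<Rightarrow> complex"
  assumes "is_partition (a # \<nu>)"
  shows "(\<Prod>i<length \<nu>. f (a + Suc i - \<nu> ! i)) * (\<Prod>j<a. f (a + num_gt \<nu> j - j)) =
    (\<Prod>i=1..a + length \<nu>. f i)"
proof -
  define l where "l = length \<nu>"
  define A where "A = (\<lambda>i. a + Suc i - \<nu> ! i) ` {..<l}"
  define H where "H = (\<lambda>j. a + num_gt \<nu> j - j) ` {..<a}"
  have mono: "\<nu> ! j \<le> \<nu> ! i" if "i < j" "j < l" for i j
  proof -
    have "sorted_wrt (\<ge>) \<nu>" using assms by (simp add: is_partition_def)
    then show ?thesis using that unfolding sorted_wrt_iff_nth_less l_def by blast
  qed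
  have le: "\<nu> ! i \<le> a" if "i < l" for i
    using assms that by (auto simp: is_partition_def l_def)
  have num_le: "num_gt \<nu> j \<le> l" for j
    by (simp add: num_gt_def l_def)
  have anti: "num_gt \<nu> k \<le> num_gt \<nu> j" if "j \<le> k" for j k
    unfolding num_gt_def by (induction \<nu>) (use that in auto)
  have num_gt_gt: "num_gt \<nu> j \<ge> Suc i" if "i < l" "j < \<nu> ! i" for i j
  proof -
    have "{..i} \<subseteq> {k. k < length \<nu> \<and> j < \<nu> ! k}"
    proof
      fix k assume "k \<in> {..i}"
      then have "k = i \<or> k < i" by auto
      then show "k \<in> {k. k < length \<nu> \<and> j < \<nu> ! k}"
        using that mono[of k i] by (auto simp: l_def)
    qed
    then have "card {..i} \<le> card {k. k < length \<nu> \<and> j < \<nu> ! k}"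
      by (intro card_mono) auto
    then show ?thesis by (simp add: num_gt_def length_filter_conv_card)
  qed
  have num_gt_le: "num_gt \<nu> j \<le> i" if "i < l" "\<nu> ! i \<le> j" for i j
  proof -
    have "{k. k < length \<nu> \<and> j < \<nu> ! k} \<subseteq> {..<i}"
    proof
      fix k assume "k \<in> {k. k < length \<nu> \<and> j < \<nu> ! k}"
      then show "k \<in> {..<i}"
        using that mono[of i k] by (cases "k < i"; cases "k = i") (auto simp: l_def)
    qed
    then have "card {k. k < length \<nu> \<and> j < \<nu> ! k} \<le> card {..<i}"
      by (intro card_mono) auto
    then show ?thesis by (simp add: num_gt_def length_filter_conv_card)
  qed
  have injA: "inj_on (\<lambda>i. a + Suc i - \<nu> ! i) {..<l}"
  proof (rule linorder_inj_onI)
    fix i j assume "i < j" "i \<in> {..<l}" "j \<in> {..<l}"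
    then show "a + Suc i - \<nu> ! i \<noteq> a + Suc j - \<nu> ! j"
      using mono[of i j] le[of i] by auto
  qed auto
  have injH: "inj_on (\<lambda>j. a + num_gt \<nu> j - j) {..<a}"
  proof (rule linorder_inj_onI)
    fix j k assume "j < k" "j \<in> {..<a}" "k \<in> {..<a}"
    then show "a + num_gt \<nu> j - j \<noteq> a + num_gt \<nu> k - k"
      using anti[of j k] by auto
  qed auto
  have disj: "A \<inter> H = {}"
  proof -
    have "a + Suc i - \<nu> ! i \<noteq> a + num_gt \<nu> j - j" if "i < l" "j < a" for i j
      using that le[of i] num_gt_gt[of i j] num_gt_le[of i j] by (cases "j < \<nu> ! i") auto
    then show ?thesis by (auto simp: A_def H_def)
  qed
  have "A \<union> H \<subseteq> {1..a + l}"
  proof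
    fix x assume "x \<in> A \<union> H"
    then consider i where "i < l" "x = a + Suc i - \<nu> ! i" | j where "j < a" "x = a + num_gt \<nu> j - j"
      by (auto simp: A_def H_def)
    then show "x \<in> {1..a + l}"
    proof cases
      case (1 i)
      then have "1 \<le> x" "x \<le> a + l" using le[of i] by linarith+
      then show ?thesis by simp
    next
      case (2 j)
      then have "1 \<le> x" "x \<le> a + l" using num_le[of j] by linarith+
      then show ?thesis by simp
    qed
  qed
  moreover have "card (A \<union> H) = a + l"
    using disj injA injH by (subst card_Un_disjoint) (auto simp: A_def H_def card_image)
  ultimately have "A \<union> H = {1..a + l}"
    by (intro card_subset_eq) auto
  then have "(\<Prod>i=1..a + l. f i) = prod f A * prod f H"
    using disj by (subst prod.union_disjoint[symmetric]) (auto simp: A_def H_def)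
  also have "\<dots> = (\<Prod>i<l. f (a + Suc i - \<nu> ! i)) * (\<Prod>j<a. f (a + num_gt \<nu> j - j))"
    unfolding A_def H_def prod.reindex[OF injA] prod.reindex[OF injH] o_def ..
  finally show ?thesis by (simp add: l_def)
qed

text \<open>Row by row: \<open>prod_first_row_hooks\<close> cancels the numerator of
  \<open>spec_s_partition_Cons\<close> against the q-factorial and leaves the hooks of the first
  row, while hooks in lower rows do not change when a row is added on top.\<close>

lemma spec_s_partition:
  assumes "is_partition \<nu>"
  shows "spec (col.s \<phi> (map int \<nu>)) =
    qphi \<phi> ^ n_part (conj_part \<nu>) / (\<Prod>x\<in>nodes \<nu>. qphi \<phi> ^ hook \<nu> x - 1)"
  using assms
proof (induction \<nu>)
  case Nil
  then show ?case by (simp add: spec_1 nodes_def n_part_def conj_part_def)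
next
  case (Cons a \<nu>)
  let ?Q = "qphi \<phi>"
  note \<nu> = is_partition_Cons[OF Cons.prems]
  have "(\<Prod>x\<in>nodes (a # \<nu>). ?Q ^ hook (a # \<nu>) x - 1) =
      (\<Prod>x\<in>(\<lambda>j. (0, j)) ` {..<a}. ?Q ^ hook (a # \<nu>) x - 1) *
      (\<Prod>x\<in>(\<lambda>(i, j). (Suc i, j)) ` nodes \<nu>. ?Q ^ hook (a # \<nu>) x - 1)"
    unfolding nodes_Cons by (rule prod.union_disjoint) (auto simp: finite_nodes)
  also have "(\<Prod>x\<in>(\<lambda>j. (0 :: nat, j)) ` {..<a}. ?Q ^ hook (a # \<nu>) x - 1) =
      (\<Prod>j<a. ?Q ^ (a + num_gt \<nu> j - j) - 1)"
    by (subst prod.reindex) (auto simp: inj_on_def hook_first_row[OF Cons.prems])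
  also have "(\<Prod>x\<in>(\<lambda>(i, j). (Suc i, j)) ` nodes \<nu>. ?Q ^ hook (a # \<nu>) x - 1) =
      (\<Prod>x\<in>nodes \<nu>. ?Q ^ hook \<nu> x - 1)"
    by (subst prod.reindex) (auto simp: inj_on_def nodes_def hook_Cons_Suc[OF Cons.prems] intro!: prod.cong)
  finally have nodes: "(\<Prod>x\<in>nodes (a # \<nu>). ?Q ^ hook (a # \<nu>) x - 1) =
      (\<Prod>j<a. ?Q ^ (a + num_gt \<nu> j - j) - 1) * (\<Prod>x\<in>nodes \<nu>. ?Q ^ hook \<nu> x - 1)" .
  have qfact: "qfact ?Q (a + length \<nu>) =
      (\<Prod>i<length \<nu>. ?Q ^ (a + Suc i - \<nu> ! i) - 1) * (\<Prod>j<a. ?Q ^ (a + num_gt \<nu> j - j) - 1)"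
    unfolding qfact_def using prod_first_row_hooks[OF Cons.prems, of "\<lambda>i. ?Q ^ i - 1"] by simp
  have "(\<Prod>i<length \<nu>. ?Q ^ (a + Suc i - \<nu> ! i) - 1) \<noteq> 0"
    using qfact_neq_0[of \<phi> "a + length \<nu>"] unfolding qfact by simp
  then show ?case
    unfolding spec_s_partition_Cons[OF Cons.prems] nodes qfact Cons.IH[OF \<nu>]
      n_part_conj_Cons[OF Cons.prems] power_add by (simp add: field_simps)
qed

text \<open>In each weight the degree is thus a linear functional of the product of Schur functions,
  which is why it is compatible with straightening.\<close>

lemma degree_part_eq:
  fixes \<nu> :: "'a :: {field, finite} phistar \<Rightarrow> nat list"
  assumes "cpartition \<nu>"
  shows "degree_part \<nu> = qfact (of_nat CARD('a)) (cweight \<nu>) * spec (S_vec (\<lambda>\<phi>. map int (\<nu> \<phi>)))"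
proof -
  have "finite {\<phi>. map int (\<nu> \<phi>) \<noteq> []}" using assms by (simp add: cpartition_def)
  then have "spec (S_vec (\<lambda>\<phi>. map int (\<nu> \<phi>))) = (\<Prod>\<phi> | \<nu> \<phi> \<noteq> []. spec (col.s \<phi> (map int (\<nu> \<phi>))))"
    by (simp add: S_vec_eq_prod spec_prod)
  also have "\<dots> = (\<Prod>\<phi> | \<nu> \<phi> \<noteq> []. qphi \<phi> ^ n_part (conj_part (\<nu> \<phi>)) /
      (\<Prod>x\<in>nodes (\<nu> \<phi>). qphi \<phi> ^ hook (\<nu> \<phi>) x - 1))"
    using assms by (intro prod.cong refl spec_s_partition) (simp add: cpartition_def)
  finally show ?thesis
    by (simp add: degree_part_def qfact_def qphi_def Let_def)
qed

section \<open>Degrees of coloured integer sequences\<close>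

definition weight_seq :: "('a :: {field, finite} phistar \<Rightarrow> int list) \<Rightarrow> int" where
  "weight_seq \<alpha> = (\<Sum>\<phi> | \<alpha> \<phi> \<noteq> []. int (phistar_size \<phi>) * sum_list (\<alpha> \<phi>))"

lemma homog_S_vec:
  assumes "finite {\<phi>. \<alpha> \<phi> \<noteq> []}"
  shows "homog (weight_seq \<alpha>) (S_vec \<alpha>)"
  unfolding S_vec_eq_prod[OF assms] weight_seq_def by (intro homog_prod homog_s)

lemma sum_list_map_int: "sum_list (map int xs) = int (sum_list xs)"
  by (induction xs) auto

lemma weight_seq_map_int: "weight_seq (\<lambda>\<phi>. map int (\<nu> \<phi>)) = int (cweight \<nu>)"
  by (simp add: weight_seq_def cweight_def sum_list_map_int)

lemma straighten_S_vec:
  assumes fin: "finite {\<phi> :: 'a :: {field, finite} phistar. \<alpha> \<phi> \<noteq> []}" and nz: "S_vec \<alpha> \<noteq> 0"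
  shows "\<exists>\<epsilon>\<in>{1, - 1}. \<exists>\<nu>. cpartition \<nu> \<and> S_vec \<alpha> = scalar \<epsilon> * S_vec (\<lambda>\<phi>. map int (\<nu> \<phi>))"
proof -
  let ?A = "{\<phi>. \<alpha> \<phi> \<noteq> []}"
  have "\<exists>\<epsilon> \<nu>. \<epsilon> \<in> {1, - 1} \<and> is_partition \<nu> \<and> col.s \<phi> (\<alpha> \<phi>) = scalar \<epsilon> * col.s \<phi> (map int \<nu>)"
    if "\<phi> \<in> ?A" for \<phi>
  proof -
    have "col.s \<phi> (\<alpha> \<phi>) \<noteq> 0"
    proof
      assume "col.s \<phi> (\<alpha> \<phi>) = 0"
      then have "S_vec \<alpha> = 0"
        unfolding S_vec_eq_prod[OF fin] by (intro prod_zero[OF fin] bexI[OF _ that])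
      with nz show False ..
    qed
    then obtain \<epsilon> \<nu> where *: "\<epsilon> \<in> {1, - 1}" "is_partition \<nu>" "col.s \<phi> (\<alpha> \<phi>) = \<epsilon> * col.s \<phi> (map int \<nu>)"
      using col.straighten[of \<phi> "\<alpha> \<phi>"] by blast
    then show ?thesis
      by (intro exI[of _ "if \<epsilon> = 1 then 1 else - 1"] exI[of _ \<nu>]) (auto simp: scalar_minus)
  qed
  then have "\<forall>\<phi>. \<exists>\<epsilon> \<nu>. \<phi> \<in> ?A \<longrightarrow> \<epsilon> \<in> {1, - 1} \<and> is_partition \<nu> \<and>
      col.s \<phi> (\<alpha> \<phi>) = scalar \<epsilon> * col.s \<phi> (map int \<nu>)"
    by blast
  from choice[OF this] obtain \<epsilon> where "\<forall>\<phi>. \<exists>\<nu>. \<phi> \<in> ?A \<longrightarrow> \<epsilon> \<phi> \<in> {1, - 1} \<and> is_partition \<nu> \<and>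
      col.s \<phi> (\<alpha> \<phi>) = scalar (\<epsilon> \<phi>) * col.s \<phi> (map int \<nu>)" ..
  from choice[OF this] obtain \<nu> where *: "\<And>\<phi>. \<phi> \<in> ?A \<Longrightarrow> \<epsilon> \<phi> \<in> {1, - 1} \<and> is_partition (\<nu> \<phi>) \<and>
      col.s \<phi> (\<alpha> \<phi>) = scalar (\<epsilon> \<phi>) * col.s \<phi> (map int (\<nu> \<phi>))"
    by blast
  define \<nu>' where "\<nu>' \<phi> = (if \<phi> \<in> ?A then \<nu> \<phi> else [])" for \<phi>
  have sub: "{\<phi>. \<nu>' \<phi> \<noteq> []} \<subseteq> ?A" by (auto simp: \<nu>'_def)
  have part: "cpartition \<nu>'"
    unfolding cpartition_def
    using * finite_subset[OF sub fin] by (auto simp: \<nu>'_def is_partition_def)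
  have "S_vec \<alpha> = (\<Prod>\<phi>\<in>?A. scalar (\<epsilon> \<phi>) * col.s \<phi> (map int (\<nu>' \<phi>)))"
    unfolding S_vec_eq_prod[OF fin] by (intro prod.cong refl) (use * in \<open>simp add: \<nu>'_def\<close>)
  also have "\<dots> = scalar (\<Prod>\<phi>\<in>?A. \<epsilon> \<phi>) * (\<Prod>\<phi>\<in>?A. col.s \<phi> (map int (\<nu>' \<phi>)))"
    by (simp add: prod.distrib ring_hom_fun_prod[OF ring_hom_scalar])
  also have "(\<Prod>\<phi>\<in>?A. col.s \<phi> (map int (\<nu>' \<phi>))) = S_vec (\<lambda>\<phi>. map int (\<nu>' \<phi>))"
    by (rule S_vec_eq_prod_superset[symmetric]) (use fin sub in auto)
  finally have eq: "S_vec \<alpha> = scalar (\<Prod>\<phi>\<in>?A. \<epsilon> \<phi>) * S_vec (\<lambda>\<phi>. map int (\<nu>' \<phi>))" .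
  have "prod \<epsilon> B \<in> {1, - 1}" if "B \<subseteq> ?A" for B
    using finite_subset[OF that fin] that
  proof (induction B rule: finite_induct)
    case (insert \<phi> B)
    then have "prod \<epsilon> B \<in> {1, - 1}" "\<epsilon> \<phi> \<in> {1, - 1}" using *[of \<phi>] by auto
    then show ?case using insert.hyps by auto
  qed simp
  from this[OF order_refl] show ?thesis
    by (intro bexI[of _ "prod \<epsilon> ?A"] exI[of _ \<nu>'] conjI part eq)
qed

text \<open>Every straightened form has the weight of \<alpha>, because
  \<open>S_vec \<alpha>\<close> is nonzero and homogeneous, and its signed degree is the same linear
  functional at \<open>S_vec \<alpha>\<close>. Hence all straightened forms give one value, and the
  definite description is met.\<close>

lemma degree_seq_eq:
  fixes \<alpha> :: "'a :: {field, finite} phistar \<Rightarrow> int list"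
  assumes fin: "finite {\<phi>. \<alpha> \<phi> \<noteq> []}" and weight: "weight_seq \<alpha> = int N"
  shows "degree_seq \<alpha> = qfact (of_nat CARD('a)) N * spec (S_vec \<alpha>)"
proof (cases "S_vec \<alpha> = 0")
  case True
  then show ?thesis by (simp add: degree_seq_def spec_0)
next
  case False
  have eq: "\<epsilon> * degree_part \<nu> = qfact (of_nat CARD('a)) N * spec (S_vec \<alpha>)"
    if \<epsilon>: "\<epsilon> \<in> {1, - 1}" and \<nu>: "cpartition \<nu>" and S: "S_vec \<alpha> = scalar \<epsilon> * S_vec (\<lambda>\<phi>. map int (\<nu> \<phi>))" for \<epsilon> \<nu>
  proof -
    have "homog (int (cweight \<nu>)) (S_vec (\<lambda>\<phi>. map int (\<nu> \<phi>)))"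
      using homog_S_vec[of "\<lambda>\<phi>. map int (\<nu> \<phi>)"] \<nu> by (simp add: weight_seq_map_int cpartition_def)
    then have "homog (int (cweight \<nu>)) (S_vec \<alpha>)"
      unfolding S by (rule homog_scalar_mult)
    moreover have "homog (int N) (S_vec \<alpha>)"
      using homog_S_vec[OF fin] weight by simp
    ultimately have "cweight \<nu> = N" using homog_unique False by fastforce
    then show ?thesis
      unfolding degree_part_eq[OF \<nu>] S by (simp add: spec_mult spec_scalar)
  qed
  have "(THE d. \<exists>\<epsilon>\<in>{1, - 1}. \<exists>\<nu>. cpartition \<nu> \<and>
      S_vec \<alpha> = scalar \<epsilon> * S_vec (\<lambda>\<phi>. map int (\<nu> \<phi>)) \<and> d = \<epsilon> * degree_part \<nu>) =
      qfact (of_nat CARD('a)) N * spec (S_vec \<alpha>)"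
  proof (rule the_equality)
    obtain \<epsilon> \<nu> where *: "\<epsilon> \<in> {1, - 1}" "cpartition \<nu>" "S_vec \<alpha> = scalar \<epsilon> * S_vec (\<lambda>\<phi>. map int (\<nu> \<phi>))"
      using straighten_S_vec[OF fin False] by blast
    show "\<exists>\<epsilon>\<in>{1, - 1}. \<exists>\<nu>. cpartition \<nu> \<and>
      S_vec \<alpha> = scalar \<epsilon> * S_vec (\<lambda>\<phi>. map int (\<nu> \<phi>)) \<and>
      qfact (of_nat CARD('a)) N * spec (S_vec \<alpha>) = \<epsilon> * degree_part \<nu>"
      by (intro bexI[of _ \<epsilon>] exI[of _ \<nu>] conjI) (use * eq[OF *] in simp_all)
  next
    fix d assume "\<exists>\<epsilon>\<in>{1, - 1}. \<exists>\<nu>. cpartition \<nu> \<and>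
      S_vec \<alpha> = scalar \<epsilon> * S_vec (\<lambda>\<phi>. map int (\<nu> \<phi>)) \<and> d = \<epsilon> * degree_part \<nu>"
    then obtain \<epsilon> \<nu> where "\<epsilon> \<in> {1, - 1}" "cpartition \<nu>"
      "S_vec \<alpha> = scalar \<epsilon> * S_vec (\<lambda>\<phi>. map int (\<nu> \<phi>))" "d = \<epsilon> * degree_part \<nu>" by blast
    with eq show "d = qfact (of_nat CARD('a)) N * spec (S_vec \<alpha>)" by simp
  qed
  with False show ?thesis by (simp add: degree_seq_def)
qed

section \<open>The generators indexed by conjugacy classes\<close>

lemma f1_eq: "f1 = {1}"
  by (auto simp: f1_def poly_orbit_def map_poly_pCons)

text \<open>The Fourier sum without its normalization, indexed by a field element instead of an
  orbit. It is constant on Frobenius orbits in M_N, so the choice of a root in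
  \<open>p_class\<close> does not matter.\<close>

definition p_chars :: "nat \<Rightarrow> 'a :: {field, finite} alg_closure \<Rightarrow> 'a FG" where
  "p_chars N x = (\<Sum>\<xi>\<in>M_chars N. scalar (cnj (\<xi> x)) *
     p_gen (N div phistar_size (orbit_of_char N \<xi>)) (orbit_of_char N \<xi>))"

lemma p_class_eq: "p_class n f = scalar ((-1) ^ (n * card f - 1) / (of_nat CARD('a) ^ (n * card f) - 1)) *
    p_chars (n * card f) (SOME x. x \<in> (f :: 'a :: {field, finite} alg_closure set))"
  by (simp add: p_class_def p_chars_def Let_def)

text \<open>Replacing \<xi> by \<xi>^q permutes the characters of M_N and keeps each one in its
  orbit.\<close>

lemma p_chars_frobenius:
  assumes N: "N \<ge> 1" and x: "x \<in> M_units N"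
  shows "p_chars N (x ^ CARD('a)) = p_chars N (x :: 'a :: {field, finite} alg_closure)"
proof -
  have q: "CARD('a) \<ge> 1" using CARD_ge_2[where 'a = 'a] by simp
  have pow: "(c ^ CARD('a)) ^ (CARD('a) ^ (N - 1)) = c ^ (CARD('a) ^ N)"
    "(c ^ (CARD('a) ^ (N - 1))) ^ CARD('a) = c ^ (CARD('a) ^ N)" for c :: complex
    using N by (cases N; simp add: power_mult[symmetric] mult.commute)+
  show ?thesis
    unfolding p_chars_def
  proof (rule sum.reindex_bij_witness[of _ "\<lambda>\<xi> x. \<xi> x ^ (CARD('a) ^ (N - 1))" "\<lambda>\<xi> x. \<xi> x ^ CARD('a)"])
    fix \<xi> :: "'a alg_closure \<Rightarrow> complex" assume \<xi>: "\<xi> \<in> M_chars N"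
    show "(\<lambda>x. \<xi> x ^ CARD('a)) \<in> M_chars N" by (rule M_chars_power[OF \<xi> q])
    show "(\<lambda>x. \<xi> x ^ (CARD('a) ^ (N - 1))) \<in> M_chars N" by (rule M_chars_power[OF \<xi>]) (use q in simp)
    show "(\<lambda>x. (\<xi> x ^ CARD('a)) ^ (CARD('a) ^ (N - 1))) = \<xi>"
      unfolding pow M_chars_frobenius_periodic[OF N \<xi>] ..
    show "(\<lambda>x. (\<xi> x ^ (CARD('a) ^ (N - 1))) ^ CARD('a)) = \<xi>"
      unfolding pow M_chars_frobenius_periodic[OF N \<xi>] ..
    show "scalar (cnj (\<xi> x ^ CARD('a))) *
         p_gen (N div phistar_size (orbit_of_char N (\<lambda>x. \<xi> x ^ CARD('a)))) (orbit_of_char N (\<lambda>x. \<xi> x ^ CARD('a))) =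
         scalar (cnj (\<xi> (x ^ CARD('a)))) * p_gen (N div phistar_size (orbit_of_char N \<xi>)) (orbit_of_char N \<xi>)"
      by (simp only: orbit_of_char_frobenius[OF N \<xi>] M_chars_power_arg[OF \<xi> x])
  qed
qed

lemma p_chars_frobenius_power:
  assumes N: "N \<ge> 1" and x: "x \<in> M_units N"
  shows "p_chars N (x ^ (CARD('a) ^ i)) = p_chars N (x :: 'a :: {field, finite} alg_closure)"
proof (induction i)
  case (Suc i)
  have "x ^ (CARD('a) ^ Suc i) = (x ^ (CARD('a) ^ i)) ^ CARD('a)"
    by (simp add: power_mult[symmetric] mult.commute)
  then show ?case
    using p_chars_frobenius[OF N M_units_power[OF x]] Suc by simp
qed simp

text \<open>Infinite orbits are retained as a case: there \<open>card j = 0\<close>, the denominator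
  q^0 - 1 is 0 and \<open>p_class\<close> is 0. A finite orbit is periodic because Frobenius is
  injective, and its elements lie in M at the level of its size.\<close>

lemma Phi_cases:
  assumes "j \<in> (Phi :: 'a :: {field, finite} alg_closure set set)"
  obtains (infinite) "infinite j"
  | (finite) "finite j" "card j \<ge> 1" "\<And>y. y \<in> j \<Longrightarrow> y \<in> M_units (card j)"
    "\<And>y. y \<in> j \<Longrightarrow> {y ^ (CARD('a) ^ i) | i. True} = j" "j \<noteq> {}"
proof (cases "finite j")
  case True
  let ?F = "\<lambda>x :: 'a alg_closure. x ^ CARD('a)"
  obtain x where x: "x \<noteq> 0" "j = {x ^ (CARD('a) ^ i) | i. True}"
    using assms by (auto simp: Phi_def)
  then have j: "j = {(?F ^^ i) x | i. True}" by (simp add: funpow_power)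
  have "\<not> inj (\<lambda>i. (?F ^^ i) x)"
  proof
    assume "inj (\<lambda>i. (?F ^^ i) x)"
    then have "infinite (range (\<lambda>i. (?F ^^ i) x))" by (rule range_inj_infinite)
    moreover have "range (\<lambda>i. (?F ^^ i) x) = j" by (auto simp: j)
    ultimately show False using True by simp
  qed
  then obtain a b where ab: "a < b" "(?F ^^ a) x = (?F ^^ b) x"
    unfolding inj_def by (metis nat_neq_iff)
  have inj: "inj ?F" by (rule injI) (rule frobenius_inj)
  have "(?F ^^ a) ((?F ^^ (b - a)) x) = (?F ^^ (a + (b - a))) x" by (simp only: funpow_add o_def)
  also have "\<dots> = (?F ^^ a) x" using ab by simp
  finally have per: "(?F ^^ (b - a)) x = x" by (rule funpow_inj[OF inj])
  have pos: "b - a \<ge> 1" using ab by simp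
  note orb = orbit_periodic[OF per pos, folded j]
  show ?thesis
  proof (rule finite)
    show "finite j" "card j \<ge> 1" by (rule orb)+
    show "y \<in> M_units (card j)" if "y \<in> j" for y
      using orb(4)[OF that] that x by (auto simp: M_units_def funpow_power)
    show "{y ^ (CARD('a) ^ i) | i. True} = j" if "y \<in> j" for y
      using orb(5)[OF that] by (simp add: funpow_power)
    show "j \<noteq> {}" using orb(2) by auto
  qed
qed (rule infinite)

lemma M_units_mult_level: "x \<in> M_units d \<Longrightarrow> x \<in> M_units (m * d)"
  for x :: "'a :: {field, finite} alg_closure"
proof -
  assume x: "x \<in> M_units d"
  have "x ^ (CARD('a) ^ (m * d)) = x"
  proof (induction m)
    case (Suc m)
    have "x ^ (CARD('a) ^ (Suc m * d)) = (x ^ (CARD('a) ^ d)) ^ (CARD('a) ^ (m * d))"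
      by (simp add: power_add power_mult)
    with Suc x show ?case by (simp add: M_units_def)
  qed simp
  with x show ?thesis by (simp add: M_units_def)
qed

text \<open>Fourier inversion on M_N: it expresses the generators p_n(\<phi>) through the sums
  attached to field elements.\<close>

lemma p_chars_inversion:
  assumes N: "N \<ge> 1" and \<chi>: "\<chi> \<in> M_chars N"
  shows "(\<Sum>x\<in>M_units N. scalar (\<chi> x) * p_chars N x) =
    scalar (of_nat CARD('a) ^ N - 1) *
    (p_gen (N div phistar_size (orbit_of_char N \<chi>)) (orbit_of_char N \<chi>) :: 'a :: {field, finite} FG)"
proof -
  let ?p = "\<lambda>\<xi>. p_gen (N div phistar_size (orbit_of_char N \<xi>)) (orbit_of_char N \<xi>) :: 'a FG"
  have "(\<Sum>x\<in>M_units N. scalar (\<chi> x) * p_chars N x) =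
      (\<Sum>\<xi>\<in>M_chars N. \<Sum>x\<in>M_units N. scalar (\<chi> x) * (scalar (cnj (\<xi> x)) * ?p \<xi>))"
    unfolding p_chars_def sum_distrib_left by (rule sum.swap)
  also have "\<dots> = (\<Sum>\<xi>\<in>M_chars N. scalar (\<Sum>x\<in>M_units N. \<chi> x * cnj (\<xi> x)) * ?p \<xi>)"
    by (simp only: scalar_sum scalar_mult sum_distrib_right mult.assoc)
  also have "\<dots> = (\<Sum>\<xi>\<in>M_chars N. if \<chi> = \<xi> then scalar (of_nat CARD('a) ^ N - 1) * ?p \<xi> else 0)"
    by (intro sum.cong refl) (simp add: sum_M_units[OF N \<chi>])
  also have "\<dots> = scalar (of_nat CARD('a) ^ N - 1) * ?p \<chi>"
    using \<chi> finite_card_M_chars(1)[OF N, where 'a = 'a] by (subst sum.delta') auto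
  finally show ?thesis .
qed

lemma div_ge_1: "d dvd N \<Longrightarrow> N \<ge> 1 \<Longrightarrow> N div d \<ge> (1 :: nat)"
proof -
  assume *: "d dvd N" "N \<ge> 1"
  then have "d > 0" by (intro Nat.gr0I) auto
  moreover have "d \<le> N" using * by (intro dvd_imp_le) auto
  ultimately have "0 < N div d" by (simp add: div_greater_zero_iff)
  then show ?thesis by linarith
qed

text \<open>The p_n(f) generate the algebra: each p_m(\<phi>) is a combination of Fourier sums over
  M_N with N = m |\<phi>|, and the sum at x is a nonzero multiple of p_n(f) for the orbit f of x and
  n = N/|f|. This yields the uniqueness demanded by \<open>partial\<close> for the generators
  indexed by \<open>Phi\<close>.\<close>

lemma derivation_eqI_p_class:
  fixes D D' :: "'a :: {field, finite} FG \<Rightarrow> 'a FG"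
  assumes D: "derivation_FG D" and D': "derivation_FG D'"
    and eq: "\<And>m j. m \<ge> 1 \<Longrightarrow> j \<in> Phi \<Longrightarrow> D (p_class m j) = D' (p_class m j)"
  shows "D = D'"
proof (rule derivation_eqI[OF D D'])
  fix m :: nat and \<phi> :: "'a phistar" assume m: "m \<ge> 1"
  define N where "N = m * phistar_size \<phi>"
  have N: "N \<ge> 1" "phistar_size \<phi> dvd N" "N div phistar_size \<phi> = m"
    using m phistar_size_pos[of \<phi>] by (auto simp: N_def Suc_le_eq)
  obtain \<chi> where \<chi>: "\<chi> \<in> M_chars N" "orbit_of_char N \<chi> = \<phi>"
    using orbit_of_char_exists[OF N(1,2)] by blast
  have q0: "(of_nat CARD('a) ^ N - 1 :: complex) \<noteq> 0"
    using of_nat_CARD_power_neq_1[OF N(1), where 'a = 'a] by simp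
  have chars: "D (p_chars N x) = D' (p_chars N x)" if x: "x \<in> M_units N" for x
  proof -
    define j where "j = {x ^ (CARD('a) ^ i) | i. True}"
    have x0: "x \<noteq> 0" using x by (simp add: M_units_def)
    then have j: "j \<in> Phi" unfolding Phi_def j_def by blast
    have per: "((\<lambda>x. x ^ CARD('a)) ^^ N) x = x"
      using x by (simp add: funpow_power M_units_def)
    note orb = orbit_periodic[OF per N(1), unfolded funpow_power, folded j_def]
    define m' where "m' = N div card j"
    have m': "m' * card j = N" "m' \<ge> 1"
      unfolding m'_def by (rule dvd_div_mult_self[OF orb(3)], rule div_ge_1[OF orb(3) N(1)])
    have "x ^ (CARD('a) ^ 0) \<in> j" unfolding j_def by blast
    then have "(SOME y. y \<in> j) \<in> j" by (rule someI)
    then obtain i where "(SOME y. y \<in> j) = x ^ (CARD('a) ^ i)" by (auto simp: j_def)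
    then have "p_class m' j = scalar ((-1) ^ (N - 1) / (of_nat CARD('a) ^ N - 1)) * p_chars N x"
      by (simp add: p_class_eq m' p_chars_frobenius_power[OF N(1) x])
    then have "scalar ((-1) ^ (N - 1) / (of_nat CARD('a) ^ N - 1)) * D (p_chars N x) =
        scalar ((-1) ^ (N - 1) / (of_nat CARD('a) ^ N - 1)) * D' (p_chars N x)"
      using eq[OF m'(2) j] by (simp add: derivation_scalar_mult[OF D] derivation_scalar_mult[OF D'])
    then have "scalar ((of_nat CARD('a) ^ N - 1) * (-1) ^ (N - 1)) *
        (scalar ((-1) ^ (N - 1) / (of_nat CARD('a) ^ N - 1)) * D (p_chars N x)) =
        scalar ((of_nat CARD('a) ^ N - 1) * (-1) ^ (N - 1)) *
        (scalar ((-1) ^ (N - 1) / (of_nat CARD('a) ^ N - 1)) * D' (p_chars N x))" by simp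
    moreover have "(of_nat CARD('a) ^ N - 1) * (-1) ^ (N - 1) *
        ((-1) ^ (N - 1) / (of_nat CARD('a) ^ N - 1)) = (1 :: complex)"
      using q0 by (simp add: field_simps flip: power_mult_distrib)
    ultimately show ?thesis
      by (simp only: mult.assoc[symmetric] scalar_mult[symmetric]) simp
  qed
  have "scalar (of_nat CARD('a) ^ N - 1) * D (p_gen m \<phi>) = scalar (of_nat CARD('a) ^ N - 1) * D' (p_gen m \<phi>)"
  proof -
    have inv: "(\<Sum>x\<in>M_units N. scalar (\<chi> x) * p_chars N x) = scalar (of_nat CARD('a) ^ N - 1) * p_gen m \<phi>"
      using p_chars_inversion[OF N(1) \<chi>(1)] by (simp add: \<chi>(2) N(3))
    have sum: "\<Delta> (\<Sum>x\<in>M_units N. scalar (\<chi> x) * p_chars N x) = (\<Sum>x\<in>M_units N. scalar (\<chi> x) * \<Delta> (p_chars N x))"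
      if "derivation_FG \<Delta>" for \<Delta>
      by (simp only: derivation_sum[OF that] derivation_scalar_mult[OF that])
    have "D (\<Sum>x\<in>M_units N. scalar (\<chi> x) * p_chars N x) = D' (\<Sum>x\<in>M_units N. scalar (\<chi> x) * p_chars N x)"
      unfolding sum[OF D] sum[OF D'] using chars by (intro sum.cong refl) simp
    then show ?thesis
      unfolding inv derivation_scalar_mult[OF D] derivation_scalar_mult[OF D'] .
  qed
  then have "scalar (1 / (of_nat CARD('a) ^ N - 1)) * (scalar (of_nat CARD('a) ^ N - 1) * D (p_gen m \<phi>)) =
      scalar (1 / (of_nat CARD('a) ^ N - 1)) * (scalar (of_nat CARD('a) ^ N - 1) * D' (p_gen m \<phi>))"
    by simp
  then show "D (p_gen m \<phi>) = D' (p_gen m \<phi>)"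
    using q0 by (simp only: mult.assoc[symmetric] scalar_mult[symmetric]) simp
qed

text \<open>This is d/dp_n(f_1) written on the generators p_m(\<phi>): Fourier inversion at level N
  = m |\<phi>| gives p_m(\<phi>) the coefficient (-1)^(N-1) at p_N(f_1), and no other p_n(f_1)
  occurs.\<close>

definition dQ :: "nat \<Rightarrow> 'a :: {field, finite} FG \<Rightarrow> 'a FG" where
  "dQ n = der_FG (\<lambda>m \<phi>. if m * phistar_size \<phi> = n then scalar ((-1) ^ (n - 1)) else 0)"

lemma derivation_dQ: "derivation_FG (dQ n)"
  unfolding dQ_def by (rule derivation_der_FG)

lemma dQ_p_gen: "m \<ge> 1 \<Longrightarrow>
    dQ n (p_gen m \<phi>) = (if m * phistar_size \<phi> = n then scalar ((-1) ^ (n - 1)) else 0)"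
  by (simp add: dQ_def der_FG_p_gen)

lemma orbit_level:
  assumes "N \<ge> 1" "\<xi> \<in> M_chars N"
  shows "N div phistar_size (orbit_of_char N \<xi>) \<ge> 1"
    "N div phistar_size (orbit_of_char N \<xi>) * phistar_size (orbit_of_char N \<xi>) = N"
  by (rule div_ge_1[OF phistar_size_dvd[OF assms] assms(1)])
    (rule dvd_div_mult_self[OF phistar_size_dvd[OF assms]])

text \<open>All generators of level N have the same derivative, so a sum of character values
  remains, which vanishes unless x = 1.\<close>

lemma dQ_p_chars:
  assumes N: "N \<ge> 1" and x: "x \<in> M_units N"
  shows "dQ n (p_chars N (x :: 'a :: {field, finite} alg_closure)) =
    (if N = n \<and> x = 1 then scalar ((-1) ^ (n - 1) * (of_nat CARD('a) ^ N - 1)) else 0)"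
proof -
  have "dQ n (p_chars N x) = (\<Sum>\<xi>\<in>M_chars N. scalar (cnj (\<xi> x)) *
      (if N = n then scalar ((-1) ^ (n - 1)) else 0))"
    unfolding p_chars_def derivation_sum[OF derivation_dQ] derivation_scalar_mult[OF derivation_dQ]
  proof (rule sum.cong[OF refl])
    fix \<xi> :: "'a alg_closure \<Rightarrow> complex" assume \<xi>: "\<xi> \<in> M_chars N"
    show "scalar (cnj (\<xi> x)) * dQ n (p_gen (N div phistar_size (orbit_of_char N \<xi>)) (orbit_of_char N \<xi>)) =
        scalar (cnj (\<xi> x)) * (if N = n then scalar ((-1) ^ (n - 1)) else 0)"
      unfolding dQ_p_gen[OF orbit_level(1)[OF N \<xi>]] orbit_level(2)[OF N \<xi>] ..
  qed
  also have "\<dots> = scalar (\<Sum>\<xi>\<in>M_chars N. cnj (\<xi> x)) * (if N = n then scalar ((-1) ^ (n - 1)) else 0)"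
    by (simp only: scalar_sum sum_distrib_right)
  finally show ?thesis
    by (simp add: sum_M_chars[OF N x] scalar_mult mult.commute)
qed

lemma dQ_p_class:
  assumes m: "m \<ge> 1" and j: "j \<in> Phi"
  shows "dQ n (p_class m j :: 'a :: {field, finite} FG) = (if m = n \<and> j = f1 then 1 else 0)"
  using j
proof (cases rule: Phi_cases)
  case infinite
  then have "j \<noteq> f1" by (auto simp: f1_eq)
  moreover have "p_class m j = 0" using infinite by (simp add: p_class_eq)
  ultimately show ?thesis by (simp add: derivation_0[OF derivation_dQ])
next
  case finite
  define y where "y = (SOME x. x \<in> j)"
  have y: "y \<in> j" unfolding y_def some_in_eq by (rule finite(5))
  define N where "N = m * card j"
  have N: "N \<ge> 1" using m finite(2) by (simp add: N_def Suc_le_eq)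
  have yN: "y \<in> M_units N" unfolding N_def by (rule M_units_mult_level[OF finite(3)[OF y]])
  have y1: "y = 1 \<longleftrightarrow> j = f1"
  proof
    assume "y = 1"
    then show "j = f1" unfolding finite(4)[OF y, symmetric] f1_eq by auto
  next
    assume "j = f1"
    then show "y = 1" using y by (simp add: f1_eq)
  qed
  have q0: "(of_nat CARD('a) ^ N - 1 :: complex) \<noteq> 0"
    using of_nat_CARD_power_neq_1[OF N, where 'a = 'a] by simp
  have "c / d * (c * d) = c * c" if "d \<noteq> 0" for c d :: complex using that by simp
  from this[OF q0] have sign: "(-1) ^ k / (of_nat CARD('a) ^ N - 1) *
      ((-1) ^ k * (of_nat CARD('a) ^ N - 1)) = (1 :: complex)" for k
    by (simp only: power_mult_distrib[symmetric]) simp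
  have "dQ n (p_class m j) = scalar ((-1) ^ (N - 1) / (of_nat CARD('a) ^ N - 1)) *
      (if N = n \<and> y = 1 then scalar ((-1) ^ (n - 1) * (of_nat CARD('a) ^ N - 1)) else 0)"
    unfolding p_class_eq derivation_scalar_mult[OF derivation_dQ] N_def[symmetric] y_def[symmetric]
      dQ_p_chars[OF N yN] ..
  also have "\<dots> = (if N = n \<and> y = 1 then 1 else 0)"
  proof (cases "N = n \<and> y = 1")
    case True
    then have "n = N" by simp
    then show ?thesis unfolding if_P[OF True] by (simp only: scalar_mult[symmetric] sign scalar_1)
  next
    case False
    show ?thesis unfolding if_not_P[OF False] by simp
  qed
  also have "(N = n \<and> y = 1) = (m = n \<and> j = f1)"
  proof (cases "j = f1")
    case True
    then show ?thesis by (simp add: y1 N_def f1_eq)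
  qed (simp add: y1)
  finally show ?thesis .
qed

lemma partial_p_class: "partial Phi p_class n f1 = (dQ n :: 'a :: {field, finite} FG \<Rightarrow> 'a FG)"
proof (rule partial_eqI[OF derivation_dQ dQ_p_class])
  fix D' :: "'a FG \<Rightarrow> 'a FG"
  assume D': "derivation_FG D'"
    and eq: "\<And>m j. m \<ge> 1 \<Longrightarrow> j \<in> Phi \<Longrightarrow> D' (p_class m j) = (if m = n \<and> j = f1 then 1 else 0)"
  show "D' = dQ n"
    by (rule derivation_eqI_p_class[OF D' derivation_dQ]) (simp only: eq dQ_p_class)
qed

lemma p_class_f1:
  assumes n: "n \<ge> 1"
  shows "p_class n f1 = scalar ((-1) ^ (n - 1) / (of_nat CARD('a) ^ n - 1)) *
    (\<Sum>\<phi> :: 'a :: {field, finite} phistar | phistar_size \<phi> dvd n.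
      of_nat (phistar_size \<phi>) * p_gen (n div phistar_size \<phi>) \<phi>)"
proof -
  have "p_chars n (1 :: 'a alg_closure) = (\<Sum>\<xi>\<in>M_chars n. (\<lambda>\<phi>. p_gen (n div phistar_size \<phi>) \<phi>) (orbit_of_char n \<xi>))"
    unfolding p_chars_def by (intro sum.cong refl) (simp add: M_chars_one)
  also have "\<dots> = (\<Sum>\<phi> | phistar_size \<phi> dvd n. of_nat (phistar_size \<phi>) * p_gen (n div phistar_size \<phi>) \<phi>)"
    by (rule sum_orbit_of_char[OF n])
  finally show ?thesis by (simp add: p_class_eq f1_eq)
qed

section \<open>The functions \<open>Q\<^sub>\<mu>\<close> and their pairing\<close>

definition q_ser :: "nat \<Rightarrow> 'a :: {field, finite} FG" where
  "q_ser = exp_coeff (\<lambda>n. scalar ((of_nat CARD('a) ^ n - 1) / of_nat n) * p_class n f1)"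

definition e_ser :: "nat \<Rightarrow> 'a :: {field, finite} FG" where
  "e_ser = exp_coeff (\<lambda>n. scalar ((-1) ^ (n - 1) / of_nat n) * p_class n f1)"

lemma derivation_series_dQ:
  "derivation_series (\<lambda>n v. - (scalar (1 / of_nat CARD('a :: {field, finite}) ^ n) * dQ n (v :: 'a FG)))"
proof (rule commuting_series_derivation)
  show "derivation_FG (\<lambda>v :: 'a FG. - (scalar (1 / of_nat CARD('a) ^ i) * dQ i v))" for i
    by (intro derivation_FG_minus derivation_FG_scalar_mult derivation_dQ)
  show "\<exists>c. - (scalar (1 / of_nat CARD('a) ^ i) * dQ i (p_gen n \<phi> :: 'a FG)) = scalar c"
    if "n \<ge> 1" for i n \<phi>
  proof -
    have "- (scalar (1 / of_nat CARD('a) ^ i) * dQ i (p_gen n \<phi> :: 'a FG)) =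
        scalar (- (1 / of_nat CARD('a) ^ i * (if n * phistar_size \<phi> = i then (-1) ^ (i - 1) else 0)))"
      using that by (simp only: dQ_p_gen scalar_minus scalar_mult) simp
    then show ?thesis ..
  qed
qed

lemma f1_in_Phi: "f1 \<in> (Phi :: 'a :: {field, finite} alg_closure set set)"
  unfolding f1_eq Phi_def by (rule CollectI, rule exI[of _ 1]) auto

lemma dQ_p_class_f1: "j \<ge> 1 \<Longrightarrow> dQ i (p_class j f1 :: 'a :: {field, finite} FG) = (if i = j then 1 else 0)"
  by (simp add: dQ_p_class f1_in_Phi eq_commute)

lemma minus_one_power_pred: "j \<ge> 1 \<Longrightarrow> - ((-1) ^ (j - 1)) = ((-1) ^ j :: complex)"
  by (cases j) auto

text \<open>The annihilation exponential translates p_n(f_1) by -q^-n, so the series of the e_N is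
  multiplied by the exponential of the sum of (-1/q)^i t^i / i, a geometric series.\<close>

lemma op_exp_dQ_e_ser:
  "op_exp (\<lambda>n v. - (scalar (1 / of_nat CARD('a) ^ n) * dQ n v)) j (e_ser N :: 'a :: {field, finite} FG) =
    (if j \<le> N then scalar ((- 1 / of_nat CARD('a)) ^ j) * e_ser (N - j) else 0)"
proof -
  interpret derivation_series "\<lambda>n v :: 'a FG. - (scalar (1 / of_nat CARD('a) ^ n) * dQ n v)"
    by (rule derivation_series_dQ)
  let ?a = "\<lambda>n. scalar ((-1) ^ (n - 1) / of_nat n) * p_class n f1 :: 'a FG"
  let ?b = "\<lambda>i. (- 1 / of_nat CARD('a)) ^ i / of_nat i :: complex"
  have a: "- (scalar (1 / of_nat CARD('a) ^ i) * dQ i (?a j)) = (if i = j then scalar (?b i) else 0)"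
    if "i \<ge> 1" "j \<ge> 1" for i j
  proof (cases "i = j")
    case True
    have "?b i = - (1 / of_nat CARD('a) ^ i * ((-1) ^ (i - 1) / of_nat i))"
      unfolding power_divide[of "- 1"] minus_one_power_pred[OF that(1), symmetric] by simp
    with True that show ?thesis
      by (simp only: derivation_scalar_mult[OF derivation_dQ] dQ_p_class_f1 scalar_minus scalar_mult) simp
  next
    case False
    with that show ?thesis
      by (simp add: derivation_scalar_mult[OF derivation_dQ] dQ_p_class_f1)
  qed
  have \<beta>: "exp_seq (\<lambda>i. of_nat i * ?b i) (\<lambda>i. (- 1 / of_nat CARD('a)) ^ i)"
    using exp_seq_geometric[of "- 1 / of_nat CARD('a) :: complex"] by (rule iffD1[OF exp_seq_cong, rotated]) simp
  show ?thesis
    unfolding e_ser_def by (rule op_exp_exp_coeff[OF a \<beta>])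
qed

lemma Q_op_e_ser:
  "Q_op (int k) (scalar c * e_ser N :: 'a :: {field, finite} FG) =
    scalar c * (\<Sum>j\<le>N. scalar ((- 1 / of_nat CARD('a)) ^ j) * (q_ser (k + j) * e_ser (N - j)))"
proof -
  interpret derivation_series "\<lambda>n v :: 'a FG. - (scalar (1 / of_nat CARD('a) ^ n) * dQ n v)"
    by (rule derivation_series_dQ)
  let ?g = "\<lambda>j. q_ser (k + j) * (scalar c * (if j \<le> N then scalar ((- 1 / of_nat CARD('a)) ^ j) * e_ser (N - j) else 0))
    :: 'a FG"
  have "Q_op (int k) (scalar c * e_ser N :: 'a FG) = Sum_any ?g"
    unfolding Q_op_def vertex_op_def partial_p_class op_exp_scalar op_exp_dQ_e_ser op_exp_mult
    by (simp add: q_ser_def nat_add_distrib)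
  also have "\<dots> = (\<Sum>j\<le>N. ?g j)"
    by (rule Sum_any.expand_superset) (auto simp: not_le[symmetric])
  finally show ?thesis
    by (simp add: sum_distrib_left mult_ac)
qed

lemma exp_seq_unique_FG:
  fixes h g :: "nat \<Rightarrow> 'a :: {field, finite} FG"
  assumes "exp_seq c h" "exp_seq d g" "\<And>i. i \<ge> 1 \<Longrightarrow> c i = d i"
  shows "h m = g m"
proof (induction m rule: less_induct)
  case (less m)
  show ?case
  proof (cases "m = 0")
    case True
    then show ?thesis using assms by (simp add: exp_seq_def)
  next
    case False
    have "of_nat m * h m = (\<Sum>i=1..m. c i * h (m - i))"
      using assms(1) False by (simp add: exp_seq_def)
    also have "\<dots> = (\<Sum>i=1..m. d i * g (m - i))"
      using less assms(3) by (intro sum.cong refl) auto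
    also have "\<dots> = of_nat m * g m"
      using assms(2) False by (simp add: exp_seq_def)
    finally show ?thesis using False by - (rule of_nat_mult_cancel_FG[of m], simp_all)
  qed
qed

text \<open>The coefficient of z^m in Q(z) E(-q z) = E(-z), where Q and E generate the q_i and the
  e_i: on the level of exponents, (q^i - 1) + (-q)^i (-1)^(i-1) = -1.\<close>

lemma q_ser_e_ser_convolution:
  "(\<Sum>i=0..m. q_ser i * (scalar ((- of_nat CARD('a)) ^ (m - i)) * e_ser (m - i))) =
    scalar ((-1) ^ m) * (e_ser m :: 'a :: {field, finite} FG)"
proof -
  let ?q = "of_nat CARD('a) :: complex"
  let ?p = "\<lambda>i. p_class i f1 :: 'a FG"
  have fa: "fps_nth (Abs_fps f) = f" for f :: "nat \<Rightarrow> 'a FG" by (rule ext) simp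
  have q: "exp_seq (\<lambda>i. of_nat i * (scalar ((?q ^ i - 1) / of_nat i) * ?p i)) q_ser"
    unfolding q_ser_def by (rule exp_seq_exp_coeff)
  have e: "exp_seq (\<lambda>i. of_nat i * (scalar ((-1) ^ (i - 1) / of_nat i) * ?p i)) e_ser"
    unfolding e_ser_def by (rule exp_seq_exp_coeff)
  have e': "exp_seq (\<lambda>i. scalar x ^ i * (of_nat i * (scalar ((-1) ^ (i - 1) / of_nat i) * ?p i)))
      (\<lambda>i. scalar x ^ i * e_ser i)" for x
    by (rule exp_seq_scale[OF e])
  have of_nat: "of_nat i * (scalar (c / of_nat i) * u) = scalar c * u" if "i \<ge> 1" for i c and u :: "'a FG"
    using that by (simp only: scalar_of_nat[symmetric] mult.assoc[symmetric] scalar_mult[symmetric]) simp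
  have prod: "exp_seq (\<lambda>i. of_nat i * (scalar ((?q ^ i - 1) / of_nat i) * ?p i) +
      scalar (- ?q) ^ i * (of_nat i * (scalar ((-1) ^ (i - 1) / of_nat i) * ?p i)))
      (fps_nth (Abs_fps q_ser * Abs_fps (\<lambda>i. scalar (- ?q) ^ i * e_ser i)))"
    by (rule exp_seq_mult; unfold fa; rule q e')
  have eq: "of_nat i * (scalar ((?q ^ i - 1) / of_nat i) * ?p i) +
      scalar (- ?q) ^ i * (of_nat i * (scalar ((-1) ^ (i - 1) / of_nat i) * ?p i)) =
      scalar (- 1) ^ i * (of_nat i * (scalar ((-1) ^ (i - 1) / of_nat i) * ?p i))" if i: "i \<ge> 1" for i
  proof -
    have sgn: "x ^ i * (-1) ^ (i - 1) = - ((- x) ^ i)" for x :: complex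
      using minus_one_power_pred[OF i] by (metis minus_minus mult_minus_right mult_minus1_right power_mult_distrib)
    have "(?q ^ i - 1) + (- ?q) ^ i * (-1) ^ (i - 1) = (- 1) ^ i * (-1) ^ (i - 1)"
      unfolding sgn by simp
    then have "scalar (?q ^ i - 1) * ?p i + scalar ((- ?q) ^ i * (-1) ^ (i - 1)) * ?p i =
        scalar ((- 1) ^ i * (-1) ^ (i - 1)) * ?p i"
      by (simp only: distrib_right[symmetric] scalar_add[symmetric])
    then show ?thesis
      by (simp only: of_nat[OF i] scalar_power scalar_mult mult.assoc)
  qed
  have "fps_nth (Abs_fps q_ser * Abs_fps (\<lambda>i. scalar (- ?q) ^ i * e_ser i)) m = scalar (- 1) ^ m * (e_ser m :: 'a FG)"
    using exp_seq_unique_FG[OF prod e'[of "- 1"] eq, of m] by simp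
  then show ?thesis by (simp add: fps_mult_nth scalar_power)
qed

text \<open>For k = 1 the sum in \<open>Q_op_e_ser\<close> is, up to a scalar, the convolution at N
  + 1 without its first term, and so it closes up to a multiple of e_(N+1).\<close>

lemma Q_op_1_e_ser:
  "Q_op 1 (scalar c * e_ser N :: 'a :: {field, finite} FG) =
    scalar (c * (of_nat CARD('a) ^ Suc N - 1) / of_nat CARD('a) ^ N) * e_ser (Suc N)"
proof -
  let ?q = "of_nat CARD('a) :: complex"
  have q0: "?q \<noteq> 0" by (rule of_nat_CARD_neq_0)
  have q_ser_0: "q_ser 0 = (1 :: 'a FG)" by (simp add: q_ser_def exp_coeff_0)
  have conv: "(\<Sum>j\<le>N. q_ser (Suc j) * (scalar ((- ?q) ^ (N - j)) * e_ser (N - j))) =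
      scalar ((-1) ^ Suc N - (- ?q) ^ Suc N) * (e_ser (Suc N) :: 'a FG)"
  proof -
    have "(\<Sum>i=0..Suc N. q_ser i * (scalar ((- ?q) ^ (Suc N - i)) * e_ser (Suc N - i))) =
        scalar ((- ?q) ^ Suc N) * e_ser (Suc N) +
        (\<Sum>j\<le>N. q_ser (Suc j) * (scalar ((- ?q) ^ (N - j)) * (e_ser (N - j) :: 'a FG)))"
      unfolding atLeast0AtMost sum.atMost_Suc_shift by (simp add: q_ser_0)
    then show ?thesis
      using q_ser_e_ser_convolution[of "Suc N", where 'a = 'a]
      by (simp only: scalar_diff left_diff_distrib) (simp add: eq_diff_eq add.commute)
  qed
  have pow: "(- 1 / ?q) ^ j = (- 1 / ?q) ^ N * (- ?q) ^ (N - j)" if "j \<le> N" for j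
  proof -
    have "(- 1 / ?q) ^ N = (- 1 / ?q) ^ j * (- 1 / ?q) ^ (N - j)"
      using that by (simp flip: power_add)
    moreover have "(- 1 / ?q) ^ (N - j) * (- ?q) ^ (N - j) = 1"
      using q0 by (simp flip: power_mult_distrib)
    ultimately show ?thesis by simp
  qed
  have "Q_op 1 (scalar c * e_ser N :: 'a FG) =
      scalar c * (\<Sum>j\<le>N. scalar ((- 1 / ?q) ^ j) * (q_ser (Suc j) * e_ser (N - j)))"
    using Q_op_e_ser[of 1 c N, where 'a = 'a] by simp
  also have "\<dots> = scalar c * (\<Sum>j\<le>N. scalar ((- 1 / ?q) ^ N * (- ?q) ^ (N - j)) * (q_ser (Suc j) * e_ser (N - j)))"
    by (intro arg_cong2[where f = "(*)"] sum.cong refl arg_cong[where f = scalar] pow) simp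
  also have "\<dots> = scalar c * (scalar ((- 1 / ?q) ^ N) *
      (\<Sum>j\<le>N. q_ser (Suc j) * (scalar ((- ?q) ^ (N - j)) * e_ser (N - j))))"
    by (simp only: sum_distrib_left scalar_mult mult_ac)
  also have "\<dots> = scalar (c * ((- 1 / ?q) ^ N * ((-1) ^ Suc N - (- ?q) ^ Suc N))) * e_ser (Suc N)"
    unfolding conv by (simp only: scalar_mult mult.assoc)
  also have "(- 1 / ?q) ^ N * ((-1) ^ Suc N - (- ?q) ^ Suc N) = (?q ^ Suc N - 1) / ?q ^ N"
  proof -
    have "(-1 :: complex) ^ N * (-1) ^ N = 1" by (simp flip: power_mult_distrib)
    moreover have "(-1 :: complex) ^ Suc N - (- ?q) ^ Suc N = (-1) ^ N * (?q ^ Suc N - 1)"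
      by (simp add: power_minus[of ?q] algebra_simps)
    moreover have "(- 1 / ?q) ^ N = (-1) ^ N / ?q ^ N" by (rule power_divide)
    ultimately show ?thesis by (simp add: mult.assoc[symmetric])
  qed
  finally show ?thesis by simp
qed

lemma Q_vec_column:
  "Q_vec (replicate N 1) =
    scalar (qfact (of_nat CARD('a)) N / of_nat CARD('a) ^ (N choose 2)) * (e_ser N :: 'a :: {field, finite} FG)"
proof (induction N)
  case 0
  show ?case by (simp add: Q_vec_def e_ser_def exp_coeff_0 qfact_def binomial_eq_0)
next
  case (Suc N)
  have "Q_vec (replicate (Suc N) 1) = Q_op 1 (Q_vec (replicate N 1) :: 'a FG)"
    by (simp add: Q_vec_def)
  then show ?case
    unfolding Suc Q_op_1_e_ser qfact_Suc Suc_choose_two power_add by (simp add: mult.commute)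
qed

lemma Q_vec_hook:
  "Q_vec (k # replicate N 1) =
    scalar (qfact (of_nat CARD('a)) N / of_nat CARD('a) ^ (N choose 2)) *
    (\<Sum>j\<le>N. scalar ((- 1 / of_nat CARD('a)) ^ j) * (q_ser (k + j) * (e_ser (N - j) :: 'a :: {field, finite} FG)))"
proof -
  have "Q_vec (k # replicate N 1) = Q_op (int k) (Q_vec (replicate N 1) :: 'a FG)"
    by (simp add: Q_vec_def)
  then show ?thesis unfolding Q_vec_column Q_op_e_ser .
qed

section \<open>The inner product and the adjoints of multiplication\<close>

lemma inner_FG_superset:
  assumes "finite A" "Poly_Mapping.keys u \<subseteq> A"
  shows "inner_FG u v = (\<Sum>m\<in>A. Poly_Mapping.lookup u m * cnj (Poly_Mapping.lookup v m) * of_nat (z_monom m))"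
  unfolding inner_FG_def by (rule sum.mono_neutral_left) (use assms in \<open>auto simp: in_keys_iff\<close>)

lemma inner_FG_add_left: "inner_FG (u + u') v = inner_FG u v + inner_FG u' v"
  using keys_add[of u u']
  by (subst (1 2 3) inner_FG_superset[of "Poly_Mapping.keys u \<union> Poly_Mapping.keys u'"])
    (auto simp: lookup_add algebra_simps sum.distrib)

lemma inner_FG_zero_left: "inner_FG 0 v = 0"
  by (simp add: inner_FG_def)

lemma inner_FG_add_right: "inner_FG u (v + v') = inner_FG u v + inner_FG u v'"
  by (simp add: inner_FG_def lookup_add algebra_simps sum.distrib)

lemma inner_FG_zero_right: "inner_FG u 0 = 0"
  by (simp add: inner_FG_def)

lemma inner_FG_sum_right: "inner_FG u (sum f A) = (\<Sum>x\<in>A. inner_FG u (f x))"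
  by (induction A rule: infinite_finite_induct) (auto simp: inner_FG_add_right inner_FG_zero_right)

lemma inner_FG_scalar_right: "inner_FG u (scalar c * v) = cnj c * inner_FG u v"
  unfolding inner_FG_def lookup_scalar_mult sum_distrib_left by (simp add: mult_ac)

lemma inner_FG_single: "inner_FG (Poly_Mapping.single m c) v = c * cnj (Poly_Mapping.lookup v m) * of_nat (z_monom m)"
  by (subst inner_FG_superset[of "{m}"]) (auto split: if_splits)

text \<open>When the generator does not occur in the monomial, the truncated subtraction of
  exponents is harmless because the coefficient is 0.\<close>

lemma dp_single:
  "dp (Suc i) \<phi> (Poly_Mapping.single m c) =
    Poly_Mapping.single (m - Poly_Mapping.single (\<phi>, i) 1) (c * of_nat (Poly_Mapping.lookup m (\<phi>, i)))"
proof (induction m arbitrary: c rule: monomial_induct)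
  case zero
  then show ?case
    using derivation_scalar[OF derivation_dp, of "Suc i" \<phi> c] by (simp add: scalar_def)
next
  case (plus x m)
  obtain \<psi> j where x: "x = (\<psi>, j)" by (cases x)
  let ?y = "(\<phi>, i)"
  have D: "dp (Suc i) \<phi> (Poly_Mapping.single (Poly_Mapping.single x 1 + m) c) =
      (if x = ?y then Poly_Mapping.single m c else 0) +
      p_gen (Suc j) \<psi> * Poly_Mapping.single (m - Poly_Mapping.single ?y 1) (c * of_nat (Poly_Mapping.lookup m ?y))"
    unfolding x p_gen_single[symmetric] derivation_mult[OF derivation_dp] plus by (auto simp: dp_p_gen)
  show ?case
  proof (cases "x = ?y")
    case False
    have "Poly_Mapping.single x 1 + (m - Poly_Mapping.single ?y 1) = Poly_Mapping.single x 1 + m - Poly_Mapping.single ?y 1"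
      using False by (intro poly_mapping_eqI) (auto simp: lookup_add lookup_minus lookup_single when_def)
    moreover have "Poly_Mapping.lookup (Poly_Mapping.single x (1 :: nat)) ?y = 0"
      using False by (simp add: lookup_single_not_eq)
    ultimately show ?thesis
      unfolding D if_not_P[OF False] by (simp add: x p_gen_single lookup_add)
  next
    case True
    then have jx: "j = i" "\<psi> = \<phi>" by (simp_all add: x)
    show ?thesis
    proof (cases "Poly_Mapping.lookup m ?y = 0")
      case True
      then show ?thesis unfolding D by (simp add: x jx lookup_add)
    next
      case False
      then have "Poly_Mapping.single ?y 1 + (m - Poly_Mapping.single ?y 1) = m"
        by (intro poly_mapping_eqI) (auto simp: lookup_add lookup_minus lookup_single when_def)
      then show ?thesis
        unfolding D by (simp add: x jx p_gen_single lookup_add algebra_simps flip: single_add)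
    qed
  qed
qed

lemma lookup_dp:
  "Poly_Mapping.lookup (dp (Suc i) \<phi> w) m =
    of_nat (Suc (Poly_Mapping.lookup m (\<phi>, i))) *
    Poly_Mapping.lookup w (Poly_Mapping.single (\<phi>, i) 1 + m)"
proof (induction w rule: FG_monomial_induct)
  case (monomial m' c)
  let ?y = "Poly_Mapping.single (\<phi>, i) (1 :: nat)"
  show ?case
  proof (cases "m' = ?y + m")
    case True
    then show ?thesis by (simp add: dp_single lookup_add mult.commute)
  next
    case False
    have "m' - ?y \<noteq> m \<or> Poly_Mapping.lookup m' (\<phi>, i) = 0"
    proof (rule ccontr)
      assume "\<not> ?thesis"
      then have m: "m = m' - ?y" and "Poly_Mapping.lookup m' (\<phi>, i) \<noteq> 0" by auto
      then have "?y + m = m'"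
        by (intro poly_mapping_eqI) (auto simp: lookup_add lookup_minus lookup_single when_def)
      with False show False by simp
    qed
    with False show ?thesis by (auto simp: dp_single lookup_single)
  qed
qed (simp_all add: derivation_0[OF derivation_dp] derivation_add[OF derivation_dp] lookup_add algebra_simps)

lemma z_monom_superset:
  assumes "finite A" "Poly_Mapping.keys m \<subseteq> A"
  shows "z_monom m = (\<Prod>x\<in>A. (snd x + 1) ^ Poly_Mapping.lookup m x * fact (Poly_Mapping.lookup m x))"
proof -
  have "z_monom m = (\<Prod>x\<in>Poly_Mapping.keys m. (snd x + 1) ^ Poly_Mapping.lookup m x * fact (Poly_Mapping.lookup m x))"
    unfolding z_monom_def by (intro prod.cong) auto
  also have "\<dots> = (\<Prod>x\<in>A. (snd x + 1) ^ Poly_Mapping.lookup m x * fact (Poly_Mapping.lookup m x))"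
    by (rule prod.mono_neutral_left) (use assms in \<open>auto simp: in_keys_iff\<close>)
  finally show ?thesis .
qed

lemma z_monom_plus:
  "z_monom (Poly_Mapping.single (\<phi>, i) 1 + m) = Suc i * Suc (Poly_Mapping.lookup m (\<phi>, i)) * z_monom m"
proof -
  let ?x = "(\<phi>, i)"
  let ?A = "insert ?x (Poly_Mapping.keys m)"
  let ?f = "\<lambda>k x. (snd x + 1) ^ Poly_Mapping.lookup k x * fact (Poly_Mapping.lookup k x) :: nat"
  have sub: "Poly_Mapping.keys (Poly_Mapping.single ?x 1 + m) \<subseteq> ?A"
    using keys_add[of "Poly_Mapping.single ?x 1" m] by auto
  have "z_monom (Poly_Mapping.single ?x 1 + m) = (\<Prod>x\<in>?A. ?f (Poly_Mapping.single ?x 1 + m) x)"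
    by (rule z_monom_superset[OF _ sub]) simp
  also have "\<dots> = ?f (Poly_Mapping.single ?x 1 + m) ?x * (\<Prod>x\<in>?A - {?x}. ?f (Poly_Mapping.single ?x 1 + m) x)"
    by (rule prod.remove) auto
  also have "(\<Prod>x\<in>?A - {?x}. ?f (Poly_Mapping.single ?x 1 + m) x) = (\<Prod>x\<in>?A - {?x}. ?f m x)"
  proof (rule prod.cong[OF refl])
    fix x assume "x \<in> ?A - {?x}"
    then have "Poly_Mapping.lookup (Poly_Mapping.single ?x (1 :: nat)) x = 0"
      by (intro lookup_single_not_eq) blast
    then show "?f (Poly_Mapping.single ?x 1 + m) x = ?f m x"
      by (simp only: lookup_add add_0)
  qed
  also have "?f (Poly_Mapping.single ?x 1 + m) ?x = Suc i * Suc (Poly_Mapping.lookup m ?x) * ?f m ?x"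
    by (simp add: lookup_add algebra_simps)
  also have "Suc i * Suc (Poly_Mapping.lookup m ?x) * ?f m ?x * (\<Prod>x\<in>?A - {?x}. ?f m x) =
      Suc i * Suc (Poly_Mapping.lookup m ?x) * (\<Prod>x\<in>?A. ?f m x)"
  proof -
    have split: "(\<Prod>x\<in>?A. ?f m x) = ?f m ?x * (\<Prod>x\<in>?A - {?x}. ?f m x)"
      by (rule prod.remove) auto
    show ?thesis unfolding split by (simp only: mult.assoc)
  qed
  also have "(\<Prod>x\<in>?A. ?f m x) = z_monom m"
    by (rule z_monom_superset[symmetric]) auto
  finally show ?thesis .
qed

text \<open>Multiplication by p_n(\<phi>) is adjoint to n d/dp_n(\<phi>): raising one exponent
  multiplies z by n times the new multiplicity, and that multiplicity is what the derivative
  produces.\<close>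

lemma inner_FG_p_gen:
  assumes "n \<ge> 1"
  shows "inner_FG (p_gen n \<phi> * Poly_Mapping.single m c) w = of_nat n * inner_FG (Poly_Mapping.single m c) (dp n \<phi> w)"
proof -
  obtain i where n: "n = Suc i" using assms by (cases n) auto
  show ?thesis
    unfolding n p_gen_single inner_FG_single lookup_dp z_monom_plus
    by (simp add: algebra_simps)
qed

text \<open>Logarithmic derivative: the exponent changes only in degree d, so the exponential of the
  sum of a_j z^j is multiplied by c z^d.\<close>

lemma derivation_exp_coeff:
  assumes D: "derivation_FG D" and a: "\<And>j. j \<ge> 1 \<Longrightarrow> D (a j) = (if j = d then scalar c else 0)" and d: "d \<ge> 1"
  shows "D (exp_coeff a m) = (if d \<le> m then scalar c * exp_coeff a (m - d) else 0)"
proof (induction m rule: less_induct)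
  case (less m)
  show ?case
  proof (cases "m = 0")
    case True
    then show ?thesis using d by (simp add: exp_coeff_0 derivation_1[OF D])
  next
    case False
    have "of_nat m * D (exp_coeff a m) = (\<Sum>i=1..m. D (of_nat i * (a i * exp_coeff a (m - i))))"
      unfolding derivation_of_nat_mult[OF D, symmetric] exp_coeff_rec derivation_sum[OF D] by (simp add: mult.assoc)
    also have "\<dots> = (\<Sum>i=1..m. of_nat i * (D (a i) * exp_coeff a (m - i))) +
        (\<Sum>i=1..m. of_nat i * (a i * D (exp_coeff a (m - i))))"
      unfolding derivation_of_nat_mult[OF D] unfolding derivation_mult[OF D] distrib_left sum.distrib ..
    also have "(\<Sum>i=1..m. of_nat i * (D (a i) * exp_coeff a (m - i))) =
        (\<Sum>i=1..m. if i = d then of_nat d * (scalar c * exp_coeff a (m - d)) else 0)"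
      by (rule sum.cong[OF refl]) (simp add: a)
    also have "\<dots> = (if d \<le> m then of_nat d * (scalar c * exp_coeff a (m - d)) else 0)"
      using d by (simp add: sum.delta)
    also have "(\<Sum>i=1..m. of_nat i * (a i * D (exp_coeff a (m - i)))) =
        (if d \<le> m then of_nat (m - d) * (scalar c * exp_coeff a (m - d)) else 0)"
    proof -
      have "(\<Sum>i=1..m. of_nat i * (a i * D (exp_coeff a (m - i)))) =
          (\<Sum>i=1..m. if d \<le> m - i then scalar c * (of_nat i * a i * exp_coeff a (m - d - i)) else 0)"
      proof (rule sum.cong[OF refl])
        fix i assume "i \<in> {1..m}"
        then have "m - i < m" by auto
        from less[OF this] show "of_nat i * (a i * D (exp_coeff a (m - i))) =
            (if d \<le> m - i then scalar c * (of_nat i * a i * exp_coeff a (m - d - i)) else 0)"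
          by (simp add: algebra_simps diff_commute[of m d])
      qed
      also have "\<dots> = (\<Sum>i=1..m - d. scalar c * (of_nat i * a i * exp_coeff a (m - d - i)))"
        by (rule sum.mono_neutral_cong_right) (use d in auto)
      also have "\<dots> = scalar c * (of_nat (m - d) * exp_coeff a (m - d))"
        unfolding exp_coeff_rec sum_distrib_left ..
      finally show ?thesis by (auto simp: mult.left_commute)
    qed
    also have "(if d \<le> m then of_nat d * (scalar c * exp_coeff a (m - d)) else 0) +
        (if d \<le> m then of_nat (m - d) * (scalar c * exp_coeff a (m - d)) else 0) =
        of_nat m * (if d \<le> m then scalar c * exp_coeff a (m - d) else 0)"
    proof (cases "d \<le> m")
      case True
      then have "of_nat m = (of_nat d + of_nat (m - d) :: 'a FG)" by (simp flip: of_nat_add)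
      with True show ?thesis by (simp add: distrib_right del: of_nat_diff)
    qed simp
    finally show ?thesis using False by - (rule of_nat_mult_cancel_FG[of m], simp_all)
  qed
qed

text \<open>The two summands are m times the logarithmic derivatives by p_m(\<phi>) of the series of
  the e_b and of the q_a, with the variable of the former set to X and that of the latter to 1. The
  homogeneous degree recovers a from b.\<close>

definition rho :: "'a :: {field, finite} FG \<Rightarrow> complex fps" where
  "rho = eval_FG fps_const (\<lambda>m \<phi>. fps_const (1 / (qphi \<phi> ^ m - 1)) * fps_X ^ (phistar_size \<phi> * m) -
     fps_const ((-1) ^ (phistar_size \<phi> * m)))"

lemma ring_hom_fps_const: "ring_hom_fun (fps_const :: complex \<Rightarrow> complex fps)"
  by (simp add: ring_hom_fun_def)

lemma ring_hom_rho: "ring_hom_fun rho"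
  unfolding rho_def by (rule ring_hom_eval_FG[OF ring_hom_fps_const])

lemma rho_add: "rho (u + v) = rho u + rho v" and rho_mult: "rho (u * v) = rho u * rho v"
  using ring_hom_rho unfolding ring_hom_fun_def by blast+

lemmas rho_0 = ring_hom_fun_0[OF ring_hom_rho]
  and rho_prod = ring_hom_fun_prod[OF ring_hom_rho]

lemma rho_scalar: "rho (scalar c) = fps_const c"
  by (simp add: rho_def eval_FG_scalar[OF ring_hom_fps_const])

lemma rho_p_gen: "m \<ge> 1 \<Longrightarrow> rho (p_gen m \<phi>) =
    fps_const (1 / (qphi \<phi> ^ m - 1)) * fps_X ^ (phistar_size \<phi> * m) - fps_const ((-1) ^ (phistar_size \<phi> * m))"
  by (simp add: rho_def eval_FG_p_gen[OF ring_hom_fps_const])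

lemma dp_p_class_f1:
  assumes n: "n \<ge> 1" and j: "j \<ge> 1"
  shows "dp n \<phi> (p_class j f1 :: 'a :: {field, finite} FG) =
    (if j = phistar_size \<phi> * n then scalar ((-1) ^ (j - 1) / (of_nat CARD('a) ^ j - 1) * of_nat (phistar_size \<phi>)) else 0)"
proof -
  have div: "j div phistar_size \<psi> \<ge> 1" if "phistar_size \<psi> dvd j" for \<psi> :: "'a phistar"
    by (rule div_ge_1[OF that j])
  have "dp n \<phi> (\<Sum>\<psi> | phistar_size \<psi> dvd j. of_nat (phistar_size \<psi>) * p_gen (j div phistar_size \<psi>) \<psi>) =
      (\<Sum>\<psi> | phistar_size \<psi> dvd j. if \<psi> = \<phi> then (if j div phistar_size \<phi> = n then of_nat (phistar_size \<phi>) else 0) else 0)"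
    unfolding derivation_sum[OF derivation_dp] derivation_of_nat_mult[OF derivation_dp]
    by (intro sum.cong refl) (use div in \<open>auto simp: dp_p_gen\<close>)
  also have "\<dots> = (if phistar_size \<phi> dvd j \<and> j div phistar_size \<phi> = n then of_nat (phistar_size \<phi>) else 0)"
    using finite_phistar_size_dvd[OF j, where 'a = 'a] by (subst sum.delta) auto
  also have "(phistar_size \<phi> dvd j \<and> j div phistar_size \<phi> = n) = (j = phistar_size \<phi> * n)"
    using phistar_size_pos[of \<phi>] by auto
  finally have sum: "dp n \<phi> (\<Sum>\<psi> | phistar_size \<psi> dvd j. of_nat (phistar_size \<psi>) * p_gen (j div phistar_size \<psi>) \<psi>) =
      (if j = phistar_size \<phi> * n then of_nat (phistar_size \<phi>) else 0 :: 'a FG)" .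
  show ?thesis
    unfolding p_class_f1[OF j] derivation_scalar_mult[OF derivation_dp] sum
    by (cases "j = phistar_size \<phi> * n")
      (simp_all only: if_True if_False mult_zero_right scalar_mult scalar_of_nat simp_thms)
qed

text \<open>The factor q^j - 1 in the creation exponent cancels the denominator of p_j(f_1); for
  \<open>e_ser\<close> that denominator survives as q_\<phi>^n - 1.\<close>

lemma dp_q_ser:
  assumes n: "n \<ge> 1"
  shows "dp n \<phi> (q_ser a :: 'a :: {field, finite} FG) = (if phistar_size \<phi> * n \<le> a
    then scalar (- ((-1) ^ (phistar_size \<phi> * n)) / of_nat n) * q_ser (a - phistar_size \<phi> * n) else 0)"
  unfolding q_ser_def
proof (rule derivation_exp_coeff[OF derivation_dp])
  show d: "phistar_size \<phi> * n \<ge> 1" using n phistar_size_pos[of \<phi>] by (simp add: Suc_le_eq)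
  fix j :: nat assume j: "j \<ge> 1"
  show "dp n \<phi> (scalar ((of_nat CARD('a) ^ j - 1) / of_nat j) * p_class j f1 :: 'a FG) =
      (if j = phistar_size \<phi> * n then scalar (- ((-1) ^ (phistar_size \<phi> * n)) / of_nat n) else 0)"
  proof (cases "j = phistar_size \<phi> * n")
    case True
    have "(of_nat CARD('a) ^ j - 1) / of_nat j * ((-1) ^ (j - 1) / (of_nat CARD('a) ^ j - 1) * of_nat (phistar_size \<phi>)) =
        (-1) ^ (j - 1) / (of_nat n :: complex)"
      using of_nat_CARD_power_neq_1[OF j, where 'a = 'a] phistar_size_pos[of \<phi>] n by (simp add: True field_simps)
    also have "\<dots> = - ((-1) ^ (phistar_size \<phi> * n)) / of_nat n"
      unfolding True[symmetric] minus_one_power_pred[OF j, symmetric] by simp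
    finally have c: "(of_nat CARD('a) ^ j - 1) / of_nat j * ((-1) ^ (j - 1) / (of_nat CARD('a) ^ j - 1) * of_nat (phistar_size \<phi>)) =
        - ((-1) ^ (phistar_size \<phi> * n)) / (of_nat n :: complex)" .
    show ?thesis
      unfolding derivation_scalar_mult[OF derivation_dp] dp_p_class_f1[OF n j] if_P[OF True] scalar_mult[symmetric] c ..
  qed (simp add: derivation_scalar_mult[OF derivation_dp] dp_p_class_f1[OF n j])
qed

lemma dp_e_ser:
  assumes n: "n \<ge> 1"
  shows "dp n \<phi> (e_ser b :: 'a :: {field, finite} FG) = (if phistar_size \<phi> * n \<le> b
    then scalar (1 / (qphi \<phi> ^ n - 1) / of_nat n) * e_ser (b - phistar_size \<phi> * n) else 0)"
  unfolding e_ser_def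
proof (rule derivation_exp_coeff[OF derivation_dp])
  show d: "phistar_size \<phi> * n \<ge> 1" using n phistar_size_pos[of \<phi>] by (simp add: Suc_le_eq)
  fix j :: nat assume j: "j \<ge> 1"
  show "dp n \<phi> (scalar ((-1) ^ (j - 1) / of_nat j) * p_class j f1 :: 'a FG) =
      (if j = phistar_size \<phi> * n then scalar (1 / (qphi \<phi> ^ n - 1) / of_nat n) else 0)"
  proof (cases "j = phistar_size \<phi> * n")
    case True
    have sq: "(-1) ^ (j - 1) * (-1) ^ (j - 1) = (1 :: complex)" by (simp flip: power_mult_distrib)
    have "(-1) ^ (j - 1) / of_nat j * ((-1) ^ (j - 1) / (of_nat CARD('a) ^ j - 1) * of_nat (phistar_size \<phi>)) =
        ((-1) ^ (j - 1) * (-1) ^ (j - 1)) * of_nat (phistar_size \<phi>) / (of_nat j * (of_nat CARD('a) ^ j - 1) :: complex)"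
      by simp
    also have "\<dots> = 1 / (qphi \<phi> ^ n - 1) / (of_nat n :: complex)"
      unfolding sq using phistar_size_pos[of \<phi>] n by (simp add: True qphi_power)
    finally have c: "(-1) ^ (j - 1) / of_nat j * ((-1) ^ (j - 1) / (of_nat CARD('a) ^ j - 1) * of_nat (phistar_size \<phi>)) =
        1 / (qphi \<phi> ^ n - 1) / (of_nat n :: complex)" .
    show ?thesis
      unfolding derivation_scalar_mult[OF derivation_dp] dp_p_class_f1[OF n j] if_P[OF True] scalar_mult[symmetric] c ..
  qed (simp add: derivation_scalar_mult[OF derivation_dp] dp_p_class_f1[OF n j])
qed

lemma homog_p_class_f1:
  assumes n: "n \<ge> 1"
  shows "homog (int n) (p_class n f1 :: 'a :: {field, finite} FG)"
proof -
  have "homog (int n) (of_nat (phistar_size \<phi>) * p_gen (n div phistar_size \<phi>) \<phi>)"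
    if "phistar_size \<phi> dvd n" for \<phi> :: "'a phistar"
    using homog_p_gen[OF div_ge_1[OF that n], of \<phi>] that by (intro homog_of_nat_mult) simp
  then show ?thesis
    unfolding p_class_f1[OF n] by (intro homog_scalar_mult homog_sum) simp
qed

lemma homog_exp_p_class: "homog (int a) (exp_coeff (\<lambda>n. scalar (c n) * p_class n f1) a)"
  using homog_exp_coeff[of 1 "\<lambda>n. scalar (c n) * p_class n f1" a]
  by (simp add: homog_scalar_mult homog_p_class_f1)

lemma homog_q_ser: "homog (int a) (q_ser a)" and homog_e_ser: "homog (int a) (e_ser a)"
  unfolding q_ser_def e_ser_def by (rule homog_exp_p_class)+

text \<open>The generating function of the \<open>q\<^sub>a e\<^sub>b\<close> is the exponential of a linear form, so that pairing
  with it is a ring homomorphism.\<close>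

lemma inner_FG_q_e_monomial:
  fixes m :: "('a :: {field, finite} phistar \<times> nat) \<Rightarrow>\<^sub>0 nat"
  shows "(\<forall>a b. inner_FG (Poly_Mapping.single m c) (q_ser a * e_ser b) =
      (if a + b = mdeg m then fps_nth (rho (Poly_Mapping.single m c)) b else 0)) \<and>
    (\<forall>b>mdeg m. fps_nth (rho (Poly_Mapping.single m c)) b = 0)"
proof (induction m rule: monomial_induct)
  case zero
  have z: "z_monom (0 :: ('a phistar \<times> nat) \<Rightarrow>\<^sub>0 nat) = 1" by (simp add: z_monom_def)
  have "Poly_Mapping.lookup (q_ser a * e_ser b :: 'a FG) 0 = (if a + b = 0 then 1 else 0)" for a b
  proof (cases "a + b = 0")
    case True
    then show ?thesis by (simp add: q_ser_def e_ser_def exp_coeff_0)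
  next
    case False
    have "homog (int a + int b) (q_ser a * e_ser b :: 'a FG)"
      by (rule homog_mult[OF homog_q_ser homog_e_ser])
    then have "0 \<notin> Poly_Mapping.keys (q_ser a * e_ser b :: 'a FG)"
      using False unfolding homog_def by force
    with False show ?thesis by (simp add: in_keys_iff)
  qed
  moreover have "rho (Poly_Mapping.single 0 c :: 'a FG) = fps_const c"
    using rho_scalar[of c, where 'a = 'a] by (simp add: scalar_def)
  ultimately show ?case
    by (simp add: inner_FG_single z)
next
  case (plus x m)
  obtain \<phi> i where x: "x = (\<phi>, i)" by (cases x)
  define n where "n = Suc i"
  have n: "n \<ge> 1" by (simp add: n_def)
  define d where "d = phistar_size \<phi> * n"
  let ?u = "Poly_Mapping.single m c :: 'a FG"
  have u: "Poly_Mapping.single (Poly_Mapping.single x 1 + m) c = p_gen n \<phi> * ?u"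
    by (simp only: x n_def p_gen_single)
  have deg: "mdeg (Poly_Mapping.single x 1 + m) = mdeg m + d"
    by (simp add: mdeg_add mdeg_single x d_def n_def)
  have rho: "fps_nth (rho (p_gen n \<phi> * ?u)) b =
      (if d \<le> b then 1 / (qphi \<phi> ^ n - 1) * fps_nth (rho ?u) (b - d) else 0) - (-1) ^ d * fps_nth (rho ?u) b" for b
    unfolding rho_mult rho_p_gen[OF n] d_def[symmetric]
    by (simp add: left_diff_distrib mult.assoc fps_X_power_mult_nth not_le)
  have IH1: "inner_FG ?u (q_ser a * e_ser b) = (if a + b = mdeg m then fps_nth (rho ?u) b else 0)" for a b
    using plus by blast
  have IH2: "fps_nth (rho ?u) b = 0" if "b > mdeg m" for b
    using plus that by blast
  \<comment> \<open>The coefficients are real, so the conjugation in the inner product has no effect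
    on them.\<close>
  have cnj1: "cnj (- ((-1) ^ d) / of_nat n) = - ((-1) ^ d) / of_nat n" by simp
  have cnj2: "cnj (1 / (qphi \<phi> ^ n - 1) / of_nat n) = 1 / (qphi \<phi> ^ n - 1) / of_nat n"
    by (simp add: qphi_def)
  have inner: "inner_FG (p_gen n \<phi> * ?u) (q_ser a * e_ser b) =
      (if d \<le> b \<and> a + (b - d) = mdeg m then 1 / (qphi \<phi> ^ n - 1) * fps_nth (rho ?u) (b - d) else 0) -
      (if d \<le> a \<and> (a - d) + b = mdeg m then (-1) ^ d * fps_nth (rho ?u) b else 0)" for a b
  proof -
    have "dp n \<phi> (q_ser a * e_ser b :: 'a FG) =
        (if d \<le> a then scalar (- ((-1) ^ d) / of_nat n) * (q_ser (a - d) * e_ser b) else 0) +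
        (if d \<le> b then scalar (1 / (qphi \<phi> ^ n - 1) / of_nat n) * (q_ser a * e_ser (b - d)) else 0)"
      unfolding derivation_mult[OF derivation_dp] dp_q_ser[OF n] dp_e_ser[OF n] d_def[symmetric]
      by (simp add: mult_ac)
    then have "inner_FG (p_gen n \<phi> * ?u) (q_ser a * e_ser b) = of_nat n *
        ((if d \<le> a then - ((-1) ^ d) / of_nat n * inner_FG ?u (q_ser (a - d) * e_ser b) else 0) +
        (if d \<le> b then 1 / (qphi \<phi> ^ n - 1) / of_nat n * inner_FG ?u (q_ser a * e_ser (b - d)) else 0))"
      unfolding inner_FG_p_gen[OF n]
      by (simp only: inner_FG_add_right if_distrib[of "inner_FG ?u"] inner_FG_scalar_right inner_FG_zero_right cnj1 cnj2)
    then show ?thesis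
      unfolding IH1 using n by (simp add: distrib_left)
  qed
  show ?case
    unfolding u deg
  proof (intro conjI allI impI)
    fix a b
    show "inner_FG (p_gen n \<phi> * ?u) (q_ser a * e_ser b) =
        (if a + b = mdeg m + d then fps_nth (rho (p_gen n \<phi> * ?u)) b else 0)"
    proof (cases "a + b = mdeg m + d")
      case True
      then have 1: "a + (b - d) = mdeg m" if "d \<le> b" using that by simp
      have 2: "(a - d) + b = mdeg m" if "d \<le> a" using that True by simp
      \<comment> \<open>If a < d, then b exceeds the degree of m, and the degree bound removes the
        term of \<open>rho\<close> that has no counterpart in the pairing.\<close>
      have 3: "fps_nth (rho ?u) b = 0" if "\<not> d \<le> a" using that True by (intro IH2) simp
      show ?thesis
        unfolding inner rho if_P[OF True] using 1 2 3 by (cases "d \<le> a"; cases "d \<le> b") simp_all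
    next
      case False
      then have "\<not> (d \<le> b \<and> a + (b - d) = mdeg m)" "\<not> (d \<le> a \<and> (a - d) + b = mdeg m)" by auto
      then show ?thesis unfolding inner if_not_P[OF False] by (simp only: if_False) simp
    qed
  next
    fix b assume "b > mdeg m + d"
    then show "fps_nth (rho (p_gen n \<phi> * ?u)) b = 0"
      unfolding rho using IH2[of b] IH2[of "b - d"] by simp
  qed
qed

lemma inner_FG_q_e:
  assumes "homog (int (a + b)) u"
  shows "inner_FG u (q_ser a * e_ser b) = fps_nth (rho u) b"
proof (rule FG_monomial_induct[where u = u and Q = "\<lambda>u. inner_FG u (q_ser a * e_ser b) = fps_nth (rho u) b"])
  fix m c assume "m \<in> Poly_Mapping.keys u"
  then have "mdeg m = a + b" using assms by (auto simp: homog_def)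
  then show "inner_FG (Poly_Mapping.single m c) (q_ser a * e_ser b) = fps_nth (rho (Poly_Mapping.single m c)) b"
    using inner_FG_q_e_monomial[of m c] by simp
qed (simp_all add: inner_FG_zero_left inner_FG_add_left rho_0 rho_add)

text \<open>\<open>spec\<close> with the degree recorded as the exponent of X; on generators it
  differs from \<open>rho\<close> by a constant.\<close>

definition spec_grade :: "'a :: {field, finite} FG \<Rightarrow> complex fps" where
  "spec_grade = eval_FG fps_const (\<lambda>m \<phi>. fps_const (1 / (qphi \<phi> ^ m - 1)) * fps_X ^ (phistar_size \<phi> * m))"

lemma ring_hom_spec_grade: "ring_hom_fun spec_grade"
  unfolding spec_grade_def by (rule ring_hom_eval_FG[OF ring_hom_fps_const])

lemma spec_grade_add: "spec_grade (u + v) = spec_grade u + spec_grade v"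
  and spec_grade_mult: "spec_grade (u * v) = spec_grade u * spec_grade v"
  using ring_hom_spec_grade unfolding ring_hom_fun_def by blast+

lemma spec_grade_scalar: "spec_grade (scalar c) = fps_const c"
  by (simp add: spec_grade_def eval_FG_scalar[OF ring_hom_fps_const])

lemma spec_grade_p_gen: "m \<ge> 1 \<Longrightarrow> spec_grade (p_gen m \<phi>) =
    fps_const (1 / (qphi \<phi> ^ m - 1)) * fps_X ^ (phistar_size \<phi> * m)"
  by (simp add: spec_grade_def eval_FG_p_gen[OF ring_hom_fps_const])

lemma spec_grade_homog:
  fixes u :: "'a :: {field, finite} FG"
  assumes "homog (int d) u"
  shows "spec_grade u = fps_const (spec u) * fps_X ^ d"
proof (rule FG_monomial_induct[where u = u and Q = "\<lambda>u. spec_grade u = fps_const (spec u) * fps_X ^ d"])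
  fix m c assume "m \<in> Poly_Mapping.keys u"
  then have "mdeg m = d" using assms by (auto simp: homog_def)
  moreover have "spec_grade (Poly_Mapping.single m c) = fps_const (spec (Poly_Mapping.single m c)) * fps_X ^ mdeg m"
    for m :: "('a phistar \<times> nat) \<Rightarrow>\<^sub>0 nat" and c
  proof (induction m rule: monomial_induct)
    case zero
    have "Poly_Mapping.single 0 c = (scalar c :: 'a FG)" by (simp add: scalar_def)
    then show ?case by (simp add: spec_grade_scalar spec_scalar)
  next
    case (plus x m)
    obtain \<phi> i where x: "x = (\<phi>, i)" by (cases x)
    have u: "Poly_Mapping.single (Poly_Mapping.single x 1 + m) c = p_gen (Suc i) \<phi> * Poly_Mapping.single m c"
      by (simp only: x p_gen_single)
    have deg: "mdeg (Poly_Mapping.single x 1 + m) = phistar_size \<phi> * Suc i + mdeg m"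
      by (simp add: mdeg_add mdeg_single x)
    show ?case
      unfolding u deg spec_grade_mult spec_mult plus power_add fps_const_mult[symmetric]
      by (subst spec_grade_p_gen, simp, subst spec_p_gen, simp) (simp only: mult_ac)
  qed
  ultimately show "spec_grade (Poly_Mapping.single m c) = fps_const (spec (Poly_Mapping.single m c)) * fps_X ^ d"
    by blast
qed (simp_all add: ring_hom_fun_0[OF ring_hom_spec_grade] spec_0 spec_grade_add spec_add distrib_right
    flip: fps_const_add)

lemma sum_square_triangle:
  fixes f :: "nat \<Rightarrow> nat \<Rightarrow> 'b :: comm_monoid_add"
  assumes "\<And>i j. i > N \<or> j > N \<Longrightarrow> f i j = 0"
  shows "(\<Sum>k\<le>2 * N. \<Sum>j=0..k. f j (k - j)) = (\<Sum>i\<le>N. \<Sum>j\<le>N. f i j)"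
proof -
  have "(\<Sum>k\<le>2 * N. \<Sum>j=0..k. f j (k - j)) = (\<Sum>(k, j)\<in>(SIGMA k:{..2 * N}. {0..k}). f j (k - j))"
    by (simp add: sum.Sigma)
  also have "\<dots> = (\<Sum>(i, j)\<in>{(i, j). i + j \<le> 2 * N}. f i j)"
    by (rule sum.reindex_bij_witness[of _ "\<lambda>(i, j). (i + j, i)" "\<lambda>(k, j). (j, k - j)"]) auto
  also have "(\<Sum>(i, j)\<in>{(i, j). i + j \<le> 2 * N}. f i j) = (\<Sum>(i, j)\<in>{..N} \<times> {..N}. f i j)"
  proof -
    have nonzero: "i \<le> N \<and> j \<le> N" if "f i j \<noteq> 0" for i j
    proof (rule ccontr)
      assume "\<not> (i \<le> N \<and> j \<le> N)"
      then have "i > N \<or> j > N" by auto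
      from assms[OF this] that show False by simp
    qed
    have "finite {(i, j). i + j \<le> 2 * N}"
      by (rule finite_subset[of _ "{..2 * N} \<times> {..2 * N}"]) auto
    then show ?thesis
      by (rule sum.mono_neutral_right) (auto dest: nonzero)
  qed
  finally show ?thesis by (simp add: sum.cartesian_product)
qed

text \<open>With c_(i+j) = c_i c_j, the sum of the c_k T_k inherits multiplicativity from the
  convolution rule for \<open>T_col\<close>.\<close>

lemma W_multiplicative:
  fixes c :: "nat \<Rightarrow> 'a :: {field, finite} FG"
  assumes c: "\<And>i j. c (i + j) = c i * c j"
  shows "col.W \<phi> c (u * v) = col.W \<phi> c u * col.W \<phi> c v"
proof -
  obtain N1 N2 where N12: "\<forall>k>N1. T_col \<phi> k u = 0" "\<forall>k>N2. T_col \<phi> k v = 0"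
    using T_col_finite by meson
  define N where "N = max N1 N2"
  have u: "T_col \<phi> k u = 0" and v: "T_col \<phi> k v = 0" if "k > N" for k
    using N12 that by (auto simp: N_def)
  have "col.W \<phi> c (u * v) = (\<Sum>k\<le>2 * N. c k * T_col \<phi> k (u * v))"
  proof (rule col.W_eq)
    fix k assume k: "k > 2 * N"
    have "T_col \<phi> j u * T_col \<phi> (k - j) v = 0" if "j \<in> {0..k}" for j
      using u[of j] v[of "k - j"] k that by (cases "j > N") auto
    then show "T_col \<phi> k (u * v) = 0" unfolding T_col_product by (intro sum.neutral) blast
  qed
  also have "\<dots> = (\<Sum>k\<le>2 * N. \<Sum>j=0..k. (c j * T_col \<phi> j u) * (c (k - j) * T_col \<phi> (k - j) v))"
    unfolding T_col_product sum_distrib_left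
  proof (intro sum.cong refl)
    fix k j :: nat assume "j \<in> {0..k}"
    then have "c k = c j * c (k - j)" using c[of j "k - j"] by simp
    then show "c k * (T_col \<phi> j u * T_col \<phi> (k - j) v) = c j * T_col \<phi> j u * (c (k - j) * T_col \<phi> (k - j) v)"
      by (simp add: mult_ac)
  qed
  also have "\<dots> = (\<Sum>i\<le>N. \<Sum>j\<le>N. (c i * T_col \<phi> i u) * (c j * T_col \<phi> j v))"
    by (rule sum_square_triangle) (use u v in auto)
  also have "\<dots> = col.W \<phi> c u * col.W \<phi> c v"
  proof -
    have "col.W \<phi> c u = (\<Sum>i\<le>N. c i * T_col \<phi> i u)" "col.W \<phi> c v = (\<Sum>j\<le>N. c j * T_col \<phi> j v)"
      by (rule col.W_eq, erule u) (rule col.W_eq, erule v)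
    then show ?thesis by (simp only: sum_product)
  qed
  finally show ?thesis .
qed

text \<open>The series of the T_k t^k translates p_n(\<phi>) by -t^n; at t = (-1)^|\<phi>| this is
  the constant by which \<open>rho\<close> differs from \<open>spec_grade\<close>. Pairing thus
  becomes skewing followed by specialization.\<close>

lemma rho_colored:
  assumes "colored \<phi> v"
  shows "rho v = spec_grade (col.W \<phi> (\<lambda>k. scalar ((-1) ^ (phistar_size \<phi> * k))) v)"
  using assms
proof induction
  case (colored_scalar c)
  have "col.W \<phi> (\<lambda>k. scalar ((-1) ^ (phistar_size \<phi> * k))) (scalar c) = scalar c"
    using col.W_const[OF T_const_scalar, of \<phi> "\<lambda>k. scalar ((-1) ^ (phistar_size \<phi> * k))" c 1]
    by (simp add: col.W_one)
  then show ?case by (simp add: rho_scalar spec_grade_scalar)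
next
  case (colored_p_gen n)
  have "col.W \<phi> (\<lambda>k. scalar ((-1) ^ (phistar_size \<phi> * k))) (p_gen n \<phi>) =
      (\<Sum>k\<le>n. scalar ((-1) ^ (phistar_size \<phi> * k)) * T_col \<phi> k (p_gen n \<phi>))"
    by (rule col.W_eq) (use colored_p_gen in \<open>simp add: T_col_p_gen\<close>)
  also have "\<dots> = (\<Sum>k\<in>{0, n}. scalar ((-1) ^ (phistar_size \<phi> * k)) * T_col \<phi> k (p_gen n \<phi>))"
    by (rule sum.mono_neutral_right) (use colored_p_gen in \<open>auto simp: T_col_p_gen\<close>)
  also have "\<dots> = p_gen n \<phi> + scalar (- ((-1) ^ (phistar_size \<phi> * n)))"
    using colored_p_gen by (simp add: T_col_p_gen scalar_minus)
  finally show ?case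
    using colored_p_gen
    by (simp add: rho_p_gen spec_grade_add spec_grade_p_gen spec_grade_scalar diff_conv_add_uminus del: add_uminus_conv_diff)
next
  case (colored_mult u v)
  have "col.W \<phi> (\<lambda>k. scalar ((-1) ^ (phistar_size \<phi> * k))) (u * v) =
      col.W \<phi> (\<lambda>k. scalar ((-1) ^ (phistar_size \<phi> * k))) u * col.W \<phi> (\<lambda>k. scalar ((-1) ^ (phistar_size \<phi> * k))) v"
    by (rule W_multiplicative) (simp add: distrib_left power_add scalar_mult)
  with colored_mult show ?case by (simp add: rho_mult spec_grade_mult)
qed (simp add: rho_add spec_grade_add col.W_add)

lemma rho_s:
  assumes l: "sum_list \<alpha> = int l"
  shows "rho (col.s \<phi> \<alpha>) = (\<Sum>k\<le>l. fps_const ((-1) ^ (phistar_size \<phi> * k) * spec (T_col \<phi> k (col.s \<phi> \<alpha>))) *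
    fps_X ^ (phistar_size \<phi> * (l - k)))"
proof -
  let ?s = "col.s \<phi> \<alpha>"
  have "col.W \<phi> (\<lambda>k. scalar ((-1) ^ (phistar_size \<phi> * k))) ?s =
      (\<Sum>k\<le>l. scalar ((-1) ^ (phistar_size \<phi> * k)) * T_col \<phi> k ?s)"
    by (rule col.W_eq) (use l in \<open>simp add: T_col_s_vanish\<close>)
  then have "rho ?s = (\<Sum>k\<le>l. spec_grade (scalar ((-1) ^ (phistar_size \<phi> * k)) * T_col \<phi> k ?s))"
    by (simp only: rho_colored[OF colored_s] ring_hom_fun_sum[OF ring_hom_spec_grade])
  also have "\<dots> = (\<Sum>k\<le>l. fps_const ((-1) ^ (phistar_size \<phi> * k) * spec (T_col \<phi> k ?s)) * fps_X ^ (phistar_size \<phi> * (l - k)))"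
  proof (rule sum.cong[OF refl])
    fix k assume k: "k \<in> {..l}"
    have "int (phistar_size \<phi>) * sum_list \<alpha> - int (phistar_size \<phi> * k) = int (phistar_size \<phi> * (l - k))"
      using k by (simp add: l of_nat_diff algebra_simps)
    moreover have "homog (int (phistar_size \<phi>) * sum_list \<alpha> - int (phistar_size \<phi> * k)) (T_col \<phi> k ?s)"
      by (rule homog_T_col[OF homog_s])
    ultimately have "homog (int (phistar_size \<phi> * (l - k))) (T_col \<phi> k ?s)" by simp
    then show "spec_grade (scalar ((-1) ^ (phistar_size \<phi> * k)) * T_col \<phi> k ?s) =
        fps_const ((-1) ^ (phistar_size \<phi> * k) * spec (T_col \<phi> k ?s)) * fps_X ^ (phistar_size \<phi> * (l - k))"
      by (simp only: spec_grade_mult spec_grade_scalar spec_grade_homog fps_const_mult[symmetric] mult.assoc)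
  qed
  finally show ?thesis .
qed

section \<open>The hook character formula\<close>

text \<open>For each colour, \<open>A_col\<close> is the generating function of the specialized \<open>h\<^sub>i\<close>; all of them
  together give the geometric series produced by \<open>Q\<^sub>k\<close> acting on \<open>e\<^sub>N\<close>.\<close>

definition A_col :: "'a :: {field, finite} phistar \<Rightarrow> complex fps" where
  "A_col \<phi> = Abs_fps (\<lambda>N. if phistar_size \<phi> dvd N
     then (-1) ^ N * inverse (qphi \<phi>) ^ (N div phistar_size \<phi>) * spec (h_col \<phi> (int (N div phistar_size \<phi>)))
     else 0)"

text \<open>Substitutes t^d for t; the logarithmic derivative t H'/H acquires the factor d.\<close>

lemma exp_seq_dilate:
  fixes h :: "nat \<Rightarrow> complex"
  assumes h: "exp_seq c h" and d: "d \<ge> 1"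
  shows "exp_seq (\<lambda>N. if d dvd N then of_nat d * c (N div d) else 0) (\<lambda>N. if d dvd N then h (N div d) else 0)"
  unfolding exp_seq_def
proof (intro conjI allI impI)
  fix N :: nat assume N: "N \<ge> 1"
  show "of_nat N * (if d dvd N then h (N div d) else 0) = (\<Sum>i=1..N. (if d dvd i then of_nat d * c (i div d) else 0) *
      (if d dvd N - i then h ((N - i) div d) else 0))"
  proof (cases "d dvd N")
    case False
    have "(if d dvd i then of_nat d * c (i div d) else 0) * (if d dvd N - i then h ((N - i) div d) else 0) = 0"
      if "i \<in> {1..N}" for i
    proof -
      have "\<not> (d dvd i \<and> d dvd N - i)"
        using False that dvd_add[of d i "N - i"] by auto
      then show ?thesis by auto
    qed
    then have "(\<Sum>i=1..N. (if d dvd i then of_nat d * c (i div d) else 0) *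
        (if d dvd N - i then h ((N - i) div d) else 0)) = 0"
      by (rule sum.neutral[OF ballI])
    with False show ?thesis by simp
  next
    case True
    then obtain m where m: "N = d * m" by (elim dvdE)
    have m1: "m \<ge> 1" using N d unfolding m by (cases m) auto
    have "(\<Sum>i=1..N. (if d dvd i then of_nat d * c (i div d) else 0) *
        (if d dvd N - i then h ((N - i) div d) else 0)) =
        (\<Sum>i\<in>(\<lambda>j. d * j) ` {1..m}. (if d dvd i then of_nat d * c (i div d) else 0) *
        (if d dvd N - i then h ((N - i) div d) else 0))"
    proof (rule sum.mono_neutral_right)
      show "(\<lambda>j. d * j) ` {1..m} \<subseteq> {1..N}" using d by (auto simp: m Suc_le_eq)
      show "\<forall>i\<in>{1..N} - (\<lambda>j. d * j) ` {1..m}. (if d dvd i then of_nat d * c (i div d) else 0) *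
        (if d dvd N - i then h ((N - i) div d) else 0) = 0"
      proof
        fix i assume i: "i \<in> {1..N} - (\<lambda>j. d * j) ` {1..m}"
        have "\<not> d dvd i"
        proof
          assume "d dvd i"
          then obtain j where "i = d * j" by (elim dvdE)
          have "j \<noteq> 0" using i unfolding \<open>i = d * j\<close> by (cases j) auto
          moreover have "j \<le> m" using i d unfolding \<open>i = d * j\<close> m by auto
          ultimately have "i \<in> (\<lambda>j. d * j) ` {1..m}" using \<open>i = d * j\<close> by auto
          with i show False by blast
        qed
        then show "(if d dvd i then of_nat d * c (i div d) else 0) *
          (if d dvd N - i then h ((N - i) div d) else 0) = 0" by simp
      qed
    qed simp
    also have "\<dots> = (\<Sum>j=1..m. of_nat d * (c j * h (m - j)))"
    proof (subst sum.reindex)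
      show "inj_on (\<lambda>j. d * j) {1..m}" using d by (auto simp: inj_on_def)
      have "d * m - d * j = d * (m - j)" for j by (simp add: diff_mult_distrib2)
      then show "sum ((\<lambda>i. (if d dvd i then of_nat d * c (i div d) else 0) *
          (if d dvd N - i then h ((N - i) div d) else 0)) \<circ> (\<lambda>j. d * j)) {1..m} =
          (\<Sum>j=1..m. of_nat d * (c j * h (m - j)))"
        using d by (intro sum.cong refl) (simp add: m)
    qed
    also have "\<dots> = of_nat d * (of_nat m * h m)"
      using h m1 unfolding exp_seq_def sum_distrib_left[symmetric] by simp
    finally show ?thesis using d by (simp add: m)
  qed
qed (use h in \<open>simp add: exp_seq_def\<close>)

text \<open>\<open>A_col\<close> arises from the specialized generating function of the h_i by
  scaling with (-1)^|\<phi>| q_\<phi>^-1 and dilating by |\<phi>|.\<close>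

lemma exp_seq_A_col:
  fixes \<phi> :: "'a :: {field, finite} phistar"
  shows "exp_seq (\<lambda>N. if phistar_size \<phi> dvd N then of_nat (phistar_size \<phi>) * (- 1 / of_nat CARD('a)) ^ N / (of_nat CARD('a) ^ N - 1) else 0)
    (fps_nth (A_col \<phi>))"
proof -
  let ?d = "phistar_size \<phi>" and ?x = "(-1) ^ phistar_size \<phi> * inverse (qphi \<phi>)"
  have 1: "exp_seq (\<lambda>i. ?x ^ i * (1 / (qphi \<phi> ^ i - 1))) (\<lambda>i. ?x ^ i * spec (h_col \<phi> (int i)))"
    by (rule exp_seq_scale[OF exp_seq_spec_h_col])
  have 2: "exp_seq (\<lambda>N. if ?d dvd N then of_nat ?d * (?x ^ (N div ?d) * (1 / (qphi \<phi> ^ (N div ?d) - 1))) else 0)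
      (\<lambda>N. if ?d dvd N then ?x ^ (N div ?d) * spec (h_col \<phi> (int (N div ?d))) else 0)"
    by (rule exp_seq_dilate[OF 1 phistar_size_pos])
  have x: "?x ^ (N div ?d) = (-1) ^ N * inverse (qphi \<phi>) ^ (N div ?d)" if "?d dvd N" for N
    using that by (simp add: power_mult_distrib power_mult[symmetric])
  have q: "qphi \<phi> ^ (N div ?d) = of_nat CARD('a) ^ N" if "?d dvd N" for N
    using that by (simp add: qphi_power)
  have "(\<lambda>N. if ?d dvd N then ?x ^ (N div ?d) * spec (h_col \<phi> (int (N div ?d))) else 0) = fps_nth (A_col \<phi>)"
    by (auto simp: A_col_def fun_eq_iff x)
  moreover have "(if ?d dvd N then of_nat ?d * (?x ^ (N div ?d) * (1 / (qphi \<phi> ^ (N div ?d) - 1))) else 0) =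
      (if ?d dvd N then of_nat ?d * (- 1 / of_nat CARD('a)) ^ N / (of_nat CARD('a) ^ N - 1) else 0)" for N
    unfolding power_divide[of "- 1"] by (simp add: x q power_inverse divide_inverse)
  ultimately show ?thesis using 2 by simp
qed

text \<open>The exponents add up: in degree i the orbit sizes sum to q^i - 1, which cancels the
  denominator and leaves (-1/q)^i. Up to degree n only colours of size at most n matter.\<close>

lemma prod_A_col:
  fixes \<Psi> :: "'a :: {field, finite} phistar set"
  assumes "finite \<Psi>" "\<And>\<phi>. phistar_size \<phi> \<le> n \<Longrightarrow> \<phi> \<in> \<Psi>" "N \<le> n"
  shows "fps_nth (\<Prod>\<phi>\<in>\<Psi>. A_col \<phi>) N = (- 1 / of_nat CARD('a)) ^ N"
proof (rule exp_seq_unique[OF exp_seq_prod[OF exp_seq_A_col] exp_seq_geometric _ assms(3)])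
  let ?q = "of_nat CARD('a) :: complex"
  fix i assume i: "1 \<le> i" "i \<le> n"
  have "(\<Sum>\<phi>\<in>\<Psi>. if phistar_size \<phi> dvd i then of_nat (phistar_size \<phi>) * (- 1 / ?q) ^ i / (?q ^ i - 1) else 0) =
      (\<Sum>\<phi> | phistar_size \<phi> dvd i. of_nat (phistar_size (\<phi> :: 'a phistar)) * ((- 1 / ?q) ^ i / (?q ^ i - 1)))"
  proof (rule sum.mono_neutral_cong_right)
    show "{\<phi>. phistar_size \<phi> dvd i} \<subseteq> \<Psi>"
    proof
      fix \<phi> :: "'a phistar" assume "\<phi> \<in> {\<phi>. phistar_size \<phi> dvd i}"
      then have "phistar_size \<phi> \<le> i" using i by (auto dest: dvd_imp_le)
      then show "\<phi> \<in> \<Psi>" using i by (intro assms(2)) simp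
    qed
  qed (use assms in auto)
  also have "\<dots> = (- 1 / ?q) ^ i"
    unfolding sum_distrib_right[symmetric] sum_phistar_size[OF i(1)]
    using of_nat_CARD_power_neq_1[OF i(1), where 'a = 'a] by simp
  finally show "(\<Sum>\<phi>\<in>\<Psi>. if phistar_size \<phi> dvd i then of_nat (phistar_size \<phi>) * (- 1 / ?q) ^ i / (?q ^ i - 1) else 0) =
      (- 1 / ?q) ^ i" .
qed

lemma fps_mult_cong_upto:
  assumes "\<And>i. i \<le> n \<Longrightarrow> fps_nth F i = fps_nth F' i" "\<And>i. i \<le> n \<Longrightarrow> fps_nth G i = fps_nth G' i" "N \<le> n"
  shows "fps_nth (F * G) N = fps_nth (F' * G') N"
  unfolding fps_mult_nth by (intro sum.cong refl) (use assms in auto)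

lemma fps_prod_cong_upto:
  assumes "\<And>x i. x \<in> A \<Longrightarrow> i \<le> n \<Longrightarrow> fps_nth (F x) i = fps_nth (G x) i" "N \<le> n"
  shows "fps_nth (\<Prod>x\<in>A. F x) N = fps_nth (\<Prod>x\<in>A. G x :: 'b :: comm_ring_1 fps) N"
  using assms
proof (induction A arbitrary: N rule: infinite_finite_induct)
  case (insert x A)
  show ?case
    unfolding prod.insert[OF insert.hyps(1,2)]
    by (rule fps_mult_cong_upto[where n = n]) (use insert in auto)
qed auto

text \<open>The contribution of one \<tau>, still indexed by the degree that the pairing extracts:
  the last letter is |\<tau>| - l + N/|\<phi>|, where l is the sum of \<alpha>.\<close>

definition C_ser :: "'a :: {field, finite} phistar \<Rightarrow> nat \<Rightarrow> int list \<Rightarrow> nat list \<Rightarrow> complex fps" where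
  "C_ser \<phi> l \<alpha> \<tau> = Abs_fps (\<lambda>N. if phistar_size \<phi> dvd N
     then (-1) ^ (phistar_size \<phi> * l + N) * qphi \<phi> ^ l * inverse (qphi \<phi>) ^ (N div phistar_size \<phi>) *
       spec (col.s \<phi> (map2 (\<lambda>a t. a - int t) \<alpha> \<tau> @ [int (sum_list \<tau>) - int l + int (N div phistar_size \<phi>)]))
     else 0)"

text \<open>The same contribution indexed by the last letter itself, which becomes the part of
  \<rho>(\<phi>).\<close>

definition R_ser :: "'a :: {field, finite} phistar \<Rightarrow> int list \<Rightarrow> nat list \<Rightarrow> complex fps" where
  "R_ser \<phi> \<alpha> \<tau> = Abs_fps (\<lambda>N. if phistar_size \<phi> dvd N
     then (-1) ^ (phistar_size \<phi> * sum_list \<tau> + N) * qphi \<phi> ^ sum_list \<tau> * inverse (qphi \<phi>) ^ (N div phistar_size \<phi>) *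
       spec (col.s \<phi> (map2 (\<lambda>a t. a - int t) \<alpha> \<tau> @ [int (N div phistar_size \<phi>)]))
     else 0)"

text \<open>The coefficient of X^(|\<phi>| m) is, up to a sign and a power of q_\<phi>, the
  specialization of \<open>XO\<close> with c = q_\<phi>^-1 and index l - m applied to s_\<alpha>;
  \<open>XO_s\<close> expands it.\<close>

lemma A_col_mult_rho:
  fixes \<phi> :: "'a :: {field, finite} phistar"
  assumes l: "sum_list \<alpha> = int l" and \<alpha>: "\<forall>a\<in>set \<alpha>. a \<ge> 0"
  shows "A_col \<phi> * rho (col.s \<phi> \<alpha>) =
    (\<Sum>\<tau>\<in>lowerings \<alpha>. fps_const (prod_list (map (B_factor (qphi \<phi>)) \<tau>)) * C_ser \<phi> l \<alpha> \<tau>)"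
proof (rule fps_ext)
  fix N
  let ?d = "phistar_size \<phi>" and ?Q = "qphi \<phi>" and ?s = "col.s \<phi> \<alpha>"
  let ?z = "\<lambda>k. spec (T_col \<phi> k ?s)"
  have d: "?d \<ge> 1" by (rule phistar_size_pos)
  have lhs: "fps_nth (A_col \<phi> * rho ?s) N =
      (\<Sum>k\<le>l. (-1) ^ (?d * k) * ?z k * (if N < ?d * (l - k) then 0 else fps_nth (A_col \<phi>) (N - ?d * (l - k))))"
    unfolding rho_s[OF l] sum_distrib_left fps_sum_nth
    by (intro sum.cong refl) (simp add: mult.left_commute[of "A_col \<phi>"] mult.assoc fps_X_power_mult_right_nth)
  show "fps_nth (A_col \<phi> * rho ?s) N =
      fps_nth (\<Sum>\<tau>\<in>lowerings \<alpha>. fps_const (prod_list (map (B_factor ?Q) \<tau>)) * C_ser \<phi> l \<alpha> \<tau>) N"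
  proof (cases "?d dvd N")
    case False
    have "\<not> ?d dvd N - ?d * (l - k)" if "\<not> N < ?d * (l - k)" for k
      using False that dvd_diffD[of ?d N "?d * (l - k)"] by auto
    then have "fps_nth (A_col \<phi> * rho ?s) N = 0"
      unfolding lhs by (intro sum.neutral ballI) (auto simp: A_col_def)
    moreover have "fps_nth (\<Sum>\<tau>\<in>lowerings \<alpha>. fps_const (prod_list (map (B_factor ?Q) \<tau>)) * C_ser \<phi> l \<alpha> \<tau>) N = 0"
      unfolding fps_sum_nth using False by (intro sum.neutral ballI) (simp add: C_ser_def)
    ultimately show ?thesis by simp
  next
    case True
    then obtain m where N: "N = ?d * m" by (elim dvdE)
    have Q0: "?Q \<noteq> 0" by (rule qphi_neq_0)
    \<comment> \<open>With j = m - (l - k), the sign depends only on the parity of |\<phi>| l + N,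
      and q_\<phi>^-j equals q_\<phi>^(l-m) q_\<phi>^-k; so c^k with c = q_\<phi>^-1 is the only
      scalar factor outside the specializations that varies with k.\<close>
    have summand: "(-1) ^ (?d * k) * ?z k * (if N < ?d * (l - k) then 0 else fps_nth (A_col \<phi>) (N - ?d * (l - k))) =
        (-1) ^ (?d * l + N) * ?Q ^ l * inverse ?Q ^ m * (inverse ?Q ^ k * spec (h_col \<phi> (int k - (int l - int m))) * ?z k)"
      if k: "k \<le> l" for k
    proof (cases "m < l - k")
      case True
      then have "N < ?d * (l - k)" using d by (simp add: N)
      moreover have "h_col \<phi> (int k - (int l - int m)) = 0"
        by (rule col.h_neg) (use True in linarith)
      ultimately show ?thesis by (simp add: spec_0)
    next
      case False
      define j where "j = m - (l - k)"
      have j: "m + k = j + l" using False k by (simp add: j_def)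
      have sub: "N - ?d * (l - k) = ?d * j" by (simp add: N j_def diff_mult_distrib2)
      have "\<not> N < ?d * (l - k)" using False d by (simp add: N)
      moreover have "fps_nth (A_col \<phi>) (?d * j) = (-1) ^ (?d * j) * inverse ?Q ^ j * spec (h_col \<phi> (int j))"
        using d by (simp add: A_col_def)
      moreover have "int j = int k - (int l - int m)" using j by linarith
      moreover have "(-1) ^ (?d * k) * (-1) ^ (?d * j) = ((-1) ^ (?d * l + N) :: complex)"
      proof -
        have "even (?d * k + ?d * j) = even (?d * l + N)"
        proof -
          have "?d * k + ?d * j + (?d * l + N) = ?d * (2 * (k + m))"
            unfolding N distrib_left[symmetric] using j by simp
          then have "even (?d * k + ?d * j + (?d * l + N))" by simp
          then show ?thesis by (simp add: even_add)
        qed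
        then show ?thesis unfolding power_add[symmetric] by (simp only: minus_one_power_iff)
      qed
      moreover have "inverse ?Q ^ j = ?Q ^ l * inverse ?Q ^ m * inverse ?Q ^ k"
      proof -
        have "?Q ^ l * inverse ?Q ^ m * inverse ?Q ^ k = ?Q ^ l * inverse ?Q ^ (j + l)"
          by (simp add: mult.assoc flip: power_add j)
        also have "\<dots> = inverse ?Q ^ j" using Q0 by (simp add: power_add power_inverse)
        finally show ?thesis ..
      qed
      ultimately show ?thesis unfolding sub by (simp add: mult_ac)
    qed
    have W: "col.XO \<phi> (scalar (inverse ?Q)) (int l - int m) ?s =
        (\<Sum>k\<le>l. scalar (inverse ?Q) ^ k * h_col \<phi> (int k - (int l - int m)) * T_col \<phi> k ?s)"
      unfolding col.XO_def by (rule col.W_eq) (use l in \<open>simp add: T_col_s_vanish\<close>)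
    have "(\<Sum>k\<le>l. inverse ?Q ^ k * spec (h_col \<phi> (int k - (int l - int m))) * ?z k) =
        spec (col.XO \<phi> (scalar (inverse ?Q)) (int l - int m) ?s)"
      unfolding W by (simp add: spec_sum spec_mult spec_scalar flip: scalar_power)
    also have "\<dots> = (\<Sum>\<tau>\<in>lowerings \<alpha>. prod_list (map (B_factor ?Q) \<tau>) *
        spec (col.s \<phi> (map2 (\<lambda>a t. a - int t) \<alpha> \<tau> @ [int (sum_list \<tau>) - int l + int m])))"
    proof -
      have B: "spec (prod_list (map (col.B (scalar (inverse ?Q) :: 'a FG)) \<tau>)) = prod_list (map (B_factor ?Q) \<tau>)" for \<tau>
      proof (induction \<tau>)
        case (Cons t \<tau>)
        have "spec (col.B (scalar (inverse ?Q) :: 'a FG) t) = B_factor ?Q t"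
          by (simp add: col.B_def B_factor_def flip: scalar_1 scalar_minus scalar_diff) (simp add: spec_scalar flip: scalar_1 scalar_minus)
        with Cons show ?case by (simp add: spec_mult)
      qed (simp add: spec_1)
      show ?thesis
        unfolding col.XO_s[OF T_const_scalar \<alpha>] spec_sum spec_mult B by (simp add: algebra_simps)
    qed
    finally have X: "(\<Sum>k\<le>l. inverse ?Q ^ k * spec (h_col \<phi> (int k - (int l - int m))) * ?z k) = \<dots>" .
    have "fps_nth (A_col \<phi> * rho ?s) N = (-1) ^ (?d * l + N) * ?Q ^ l * inverse ?Q ^ m *
        (\<Sum>k\<le>l. inverse ?Q ^ k * spec (h_col \<phi> (int k - (int l - int m))) * ?z k)"
      unfolding lhs sum_distrib_left by (intro sum.cong refl summand) simp
    then show ?thesis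
      unfolding X sum_distrib_left fps_sum_nth using d by (simp add: N C_ser_def mult_ac)
  qed
qed

text \<open>Both sides list the same terms by the exponent |\<phi>| x, where x - l is the last
  letter. Terms that only one side can contain vanish: a negative last letter kills 1, and a product
  of negative total degree is 0.\<close>

lemma C_ser_eq_R_ser:
  assumes l: "sum_list \<alpha> = int l" and len: "length \<tau> = length \<alpha>"
  shows "fps_X ^ (phistar_size \<phi> * sum_list \<tau>) * C_ser \<phi> l \<alpha> \<tau> = fps_X ^ (phistar_size \<phi> * l) * R_ser \<phi> \<alpha> \<tau>"
proof (rule fps_ext)
  fix N
  let ?d = "phistar_size \<phi>" and ?Q = "qphi \<phi>" and ?t = "sum_list \<tau>"
  have d: "?d \<ge> 1" by (rule phistar_size_pos)
  have Q0: "?Q \<noteq> 0" by (rule qphi_neq_0)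
  have sum: "sum_list (map2 (\<lambda>a t. a - int t) \<alpha> \<tau>) = int l - int ?t"
    using len unfolding l[symmetric] by (induction \<tau> \<alpha> rule: list_induct2) auto
  show "fps_nth (fps_X ^ (?d * ?t) * C_ser \<phi> l \<alpha> \<tau>) N = fps_nth (fps_X ^ (?d * l) * R_ser \<phi> \<alpha> \<tau>) N"
  proof (cases "?d dvd N")
    case False
    then have "\<not> ?d dvd N - ?d * k" if "\<not> N < ?d * k" for k
      using that dvd_diffD[of ?d N "?d * k"] by auto
    then show ?thesis by (simp add: fps_X_power_mult_nth C_ser_def R_ser_def)
  next
    case True
    then obtain x where N: "N = ?d * x" by (elim dvdE)
    have less: "N < ?d * k \<longleftrightarrow> x < k" for k using d by (simp add: N)
    have sub: "N - ?d * k = ?d * (x - k)" for k by (simp add: N diff_mult_distrib2)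
    have C: "fps_nth (C_ser \<phi> l \<alpha> \<tau>) (?d * y) = (-1) ^ (?d * l + ?d * y) * ?Q ^ l * inverse ?Q ^ y *
       spec (col.s \<phi> (map2 (\<lambda>a t. a - int t) \<alpha> \<tau> @ [int ?t - int l + int y]))" for y
      using d by (simp add: C_ser_def)
    have R: "fps_nth (R_ser \<phi> \<alpha> \<tau>) (?d * y) = (-1) ^ (?d * ?t + ?d * y) * ?Q ^ ?t * inverse ?Q ^ y *
       spec (col.s \<phi> (map2 (\<lambda>a t. a - int t) \<alpha> \<tau> @ [int y]))" for y
      using d by (simp add: R_ser_def)
    consider "x < ?t" "x < l" | "x < ?t" "\<not> x < l" | "\<not> x < ?t" "x < l" | "\<not> x < ?t" "\<not> x < l" by blast
    then show ?thesis
    proof cases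
      case 2
      have "col.s \<phi> (map2 (\<lambda>a t. a - int t) \<alpha> \<tau> @ [int (x - l)]) = 0"
        by (rule col_s_neg) (use 2 sum in simp)
      with 2 show ?thesis by (simp add: fps_X_power_mult_nth less sub R spec_0)
    next
      case 3
      have "col.s \<phi> (map2 (\<lambda>a t. a - int t) \<alpha> \<tau> @ [int ?t - int l + int (x - ?t)]) = 0"
        by (rule col.s_snoc_neg) (use 3 in simp)
      with 3 show ?thesis by (simp add: fps_X_power_mult_nth less sub C spec_0)
    next
      case 4
      have idx: "int ?t - int l + int (x - ?t) = int (x - l)" using 4 by simp
      have "even (?d * l + ?d * (x - ?t)) = even (?d * ?t + ?d * (x - l))"
      proof -
        have "(l + (x - ?t)) + (?t + (x - l)) = 2 * x" using 4 by simp
        then have "even ((l + (x - ?t)) + (?t + (x - l)))" by simp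
        then have "even (l + (x - ?t)) = even (?t + (x - l))" by (simp only: even_add)
        then show ?thesis by (simp only: distrib_left[symmetric] even_mult_iff)
      qed
      then have sign: "(-1) ^ (?d * l + ?d * (x - ?t)) = ((-1) ^ (?d * ?t + ?d * (x - l)) :: complex)"
        by (simp add: minus_one_power_iff)
      have pow: "?Q ^ l * inverse ?Q ^ (x - ?t) = ?Q ^ ?t * inverse ?Q ^ (x - l)"
      proof -
        have 1: "?Q ^ k * inverse ?Q ^ k = 1" for k using Q0 by (simp add: power_inverse)
        have "inverse ?Q ^ x = inverse ?Q ^ (x - ?t) * inverse ?Q ^ ?t" "inverse ?Q ^ x = inverse ?Q ^ (x - l) * inverse ?Q ^ l"
          using 4 by (simp_all flip: power_add)
        then have "inverse ?Q ^ (x - ?t) * inverse ?Q ^ ?t * (?Q ^ l * ?Q ^ ?t) = inverse ?Q ^ (x - l) * inverse ?Q ^ l * (?Q ^ l * ?Q ^ ?t)"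
          by simp
        moreover have "inverse ?Q ^ (x - ?t) * inverse ?Q ^ ?t * (?Q ^ l * ?Q ^ ?t) = ?Q ^ l * inverse ?Q ^ (x - ?t) * (?Q ^ ?t * inverse ?Q ^ ?t)"
          by (simp only: mult_ac)
        moreover have "inverse ?Q ^ (x - l) * inverse ?Q ^ l * (?Q ^ l * ?Q ^ ?t) = ?Q ^ ?t * inverse ?Q ^ (x - l) * (?Q ^ l * inverse ?Q ^ l)"
          by (simp only: mult_ac)
        ultimately show ?thesis unfolding 1 by simp
      qed
      show ?thesis
        using 4 by (simp add: fps_X_power_mult_nth less sub C R idx sign pow)
    qed (simp add: fps_X_power_mult_nth less)
  qed
qed

text \<open>The choice of one number g(\<phi>) per colour is a coloured partition \<rho> with at
  most one row per colour. Signs and powers of q_\<phi> combine because their exponents add up to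
  total weights.\<close>

lemma prod_R_ser_nth:
  fixes \<Psi> :: "'a :: {field, finite} phistar set" and \<alpha> :: "'a phistar \<Rightarrow> int list" and \<tau> :: "'a phistar \<Rightarrow> nat list"
  assumes fin: "finite \<Psi>"
  shows "fps_nth (\<Prod>\<phi>\<in>\<Psi>. R_ser \<phi> (\<alpha> \<phi>) (\<tau> \<phi>)) M =
    (\<Sum>g | g \<in> PiE \<Psi> (\<lambda>_. {..M}) \<and> (\<Sum>\<phi>\<in>\<Psi>. phistar_size \<phi> * g \<phi>) = M.
      (-1) ^ ((\<Sum>\<phi>\<in>\<Psi>. phistar_size \<phi> * sum_list (\<tau> \<phi>)) + M) *
      of_nat CARD('a) ^ (\<Sum>\<phi>\<in>\<Psi>. phistar_size \<phi> * sum_list (\<tau> \<phi>)) * inverse (of_nat CARD('a)) ^ M *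
      (\<Prod>\<phi>\<in>\<Psi>. spec (col.s \<phi> (map2 (\<lambda>a t. a - int t) (\<alpha> \<phi>) (\<tau> \<phi>) @ [int (g \<phi>)]))))"
proof -
  let ?q = "of_nat CARD('a) :: complex"
  let ?d = "phistar_size :: 'a phistar \<Rightarrow> nat"
  define c where "c \<phi> r = (-1) ^ (?d \<phi> * sum_list (\<tau> \<phi>) + ?d \<phi> * r) * qphi \<phi> ^ sum_list (\<tau> \<phi>) * inverse (qphi \<phi>) ^ r *
       spec (col.s \<phi> (map2 (\<lambda>a t. a - int t) (\<alpha> \<phi>) (\<tau> \<phi>) @ [int r]))" for \<phi> :: "'a phistar" and r
  define W where "W = (\<Sum>\<phi>\<in>\<Psi>. ?d \<phi> * sum_list (\<tau> \<phi>))"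
  \<comment> \<open>Up to degree M each factor may be truncated to a finite sum, so that the product
    of sums can be expanded.\<close>
  have "fps_nth (\<Prod>\<phi>\<in>\<Psi>. R_ser \<phi> (\<alpha> \<phi>) (\<tau> \<phi>)) M =
      fps_nth (\<Prod>\<phi>\<in>\<Psi>. \<Sum>r\<in>{..M}. fps_const (c \<phi> r) * fps_X ^ (?d \<phi> * r)) M"
  proof (rule fps_prod_cong_upto[where n = M])
    fix \<phi> i assume i: "i \<le> M"
    have d: "?d \<phi> \<ge> 1" by (rule phistar_size_pos)
    show "fps_nth (R_ser \<phi> (\<alpha> \<phi>) (\<tau> \<phi>)) i = fps_nth (\<Sum>r\<in>{..M}. fps_const (c \<phi> r) * fps_X ^ (?d \<phi> * r)) i"
    proof (cases "?d \<phi> dvd i")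
      case False
      then have "i \<noteq> ?d \<phi> * r" for r by auto
      with False show ?thesis by (simp add: R_ser_def fps_sum_nth fps_X_power_nth)
    next
      case True
      then obtain r where r: "i = ?d \<phi> * r" by (elim dvdE)
      have "r \<le> ?d \<phi> * r" using d by simp
      from order_trans[OF this i[unfolded r]] have "r \<in> {..M}" by simp
      have "fps_nth (\<Sum>r\<in>{..M}. fps_const (c \<phi> r) * fps_X ^ (?d \<phi> * r)) i = (\<Sum>r'\<in>{..M}. if r' = r then c \<phi> r else 0)"
        unfolding fps_sum_nth by (intro sum.cong refl) (use d in \<open>auto simp: fps_X_power_nth r\<close>)
      also have "\<dots> = c \<phi> r" using \<open>r \<in> {..M}\<close> by simp
      finally show ?thesis using d by (simp add: R_ser_def r c_def)
    qed
  qed simp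
  also have "\<dots> = fps_nth (\<Sum>g\<in>PiE \<Psi> (\<lambda>_. {..M}). \<Prod>\<phi>\<in>\<Psi>. fps_const (c \<phi> (g \<phi>)) * fps_X ^ (?d \<phi> * g \<phi>)) M"
    using fin by (subst prod_sum_PiE) auto
  also have "\<dots> = (\<Sum>g\<in>PiE \<Psi> (\<lambda>_. {..M}). if (\<Sum>\<phi>\<in>\<Psi>. ?d \<phi> * g \<phi>) = M then \<Prod>\<phi>\<in>\<Psi>. c \<phi> (g \<phi>) else 0)"
    unfolding fps_sum_nth
  proof (rule sum.cong[OF refl])
    fix g
    have "(\<Prod>\<phi>\<in>\<Psi>. fps_const (c \<phi> (g \<phi>)) * fps_X ^ (?d \<phi> * g \<phi>)) =
        fps_const (\<Prod>\<phi>\<in>\<Psi>. c \<phi> (g \<phi>)) * fps_X ^ (\<Sum>\<phi>\<in>\<Psi>. ?d \<phi> * g \<phi>)"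
      by (simp add: prod.distrib power_sum ring_hom_fun_prod[OF ring_hom_fps_const])
    then show "fps_nth (\<Prod>\<phi>\<in>\<Psi>. fps_const (c \<phi> (g \<phi>)) * fps_X ^ (?d \<phi> * g \<phi>)) M =
        (if (\<Sum>\<phi>\<in>\<Psi>. ?d \<phi> * g \<phi>) = M then \<Prod>\<phi>\<in>\<Psi>. c \<phi> (g \<phi>) else 0)"
      by (auto simp: fps_X_power_nth)
  qed
  also have "\<dots> = (\<Sum>g | g \<in> PiE \<Psi> (\<lambda>_. {..M}) \<and> (\<Sum>\<phi>\<in>\<Psi>. ?d \<phi> * g \<phi>) = M. \<Prod>\<phi>\<in>\<Psi>. c \<phi> (g \<phi>))"
    using fin by (subst sum.inter_filter[symmetric]) (auto intro: finite_PiE)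
  also have "\<dots> = (\<Sum>g | g \<in> PiE \<Psi> (\<lambda>_. {..M}) \<and> (\<Sum>\<phi>\<in>\<Psi>. ?d \<phi> * g \<phi>) = M.
      (-1) ^ (W + M) * ?q ^ W * inverse ?q ^ M *
      (\<Prod>\<phi>\<in>\<Psi>. spec (col.s \<phi> (map2 (\<lambda>a t. a - int t) (\<alpha> \<phi>) (\<tau> \<phi>) @ [int (g \<phi>)]))))"
  proof (rule sum.cong[OF refl])
    fix g assume "g \<in> {g. g \<in> PiE \<Psi> (\<lambda>_. {..M}) \<and> (\<Sum>\<phi>\<in>\<Psi>. ?d \<phi> * g \<phi>) = M}"
    then have M: "(\<Sum>\<phi>\<in>\<Psi>. ?d \<phi> * g \<phi>) = M" by simp
    have inv: "inverse (qphi \<phi>) ^ r = inverse ?q ^ (?d \<phi> * r)" for \<phi> :: "'a phistar" and r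
      by (simp add: qphi_def power_inverse power_mult)
    have "(\<Prod>\<phi>\<in>\<Psi>. (-1) ^ (?d \<phi> * sum_list (\<tau> \<phi>) + ?d \<phi> * g \<phi>)) = ((-1) ^ (W + M) :: complex)"
      unfolding power_sum[symmetric] sum.distrib W_def M ..
    moreover have "(\<Prod>\<phi>\<in>\<Psi>. qphi \<phi> ^ sum_list (\<tau> \<phi>)) = ?q ^ W"
      unfolding qphi_power power_sum[symmetric] W_def ..
    moreover have "(\<Prod>\<phi>\<in>\<Psi>. inverse (qphi \<phi>) ^ g \<phi>) = inverse ?q ^ M"
      unfolding inv power_sum[symmetric] M ..
    ultimately show "(\<Prod>\<phi>\<in>\<Psi>. c \<phi> (g \<phi>)) = (-1) ^ (W + M) * ?q ^ W * inverse ?q ^ M *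
      (\<Prod>\<phi>\<in>\<Psi>. spec (col.s \<phi> (map2 (\<lambda>a t. a - int t) (\<alpha> \<phi>) (\<tau> \<phi>) @ [int (g \<phi>)])))"
      unfolding c_def prod.distrib by simp
  qed
  finally show ?thesis unfolding W_def .
qed

lemma cweight_superset:
  assumes "finite \<Psi>" "{\<phi>. la \<phi> \<noteq> []} \<subseteq> \<Psi>"
  shows "cweight la = (\<Sum>\<phi>\<in>\<Psi>. phistar_size \<phi> * sum_list (la \<phi>))"
  unfolding cweight_def by (rule sum.mono_neutral_left) (use assms in auto)

lemma weight_seq_superset:
  assumes "finite \<Psi>" "{\<phi>. \<alpha> \<phi> \<noteq> []} \<subseteq> \<Psi>"
  shows "weight_seq \<alpha> = (\<Sum>\<phi>\<in>\<Psi>. int (phistar_size \<phi>) * sum_list (\<alpha> \<phi>))"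
  unfolding weight_seq_def by (rule sum.mono_neutral_left) (use assms in auto)

lemma phistar_size_le_cweight:
  assumes "finite {\<phi>. la \<phi> \<noteq> []}" "la \<phi> \<noteq> []" "0 \<notin> set (la \<phi>)"
  shows "phistar_size \<phi> \<le> cweight la"
proof -
  have "sum_list (la \<phi>) \<ge> 1" using assms(2,3) by (cases "la \<phi>") auto
  then have "phistar_size \<phi> \<le> phistar_size \<phi> * sum_list (la \<phi>)" by simp
  also have "\<dots> \<le> cweight la"
    unfolding cweight_def by (rule member_le_sum) (use assms in auto)
  finally show ?thesis .
qed

lemma n_part_hook: "n_part (k # replicate N 1) = Suc N choose 2"
proof -
  have "n_part (k # replicate N 1) = (\<Sum>i<N. Suc i * replicate N 1 ! i)"
    by (simp add: n_part_def sum.lessThan_Suc_shift del: sum.lessThan_Suc)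
  also have "\<dots> = (\<Sum>i<N. Suc i)" by (rule sum.cong) auto
  also have "\<dots> = Suc N choose 2" by (induction N) (simp_all add: Suc_choose_two binomial_eq_0)
  finally show ?thesis .
qed

text \<open>The weights (-1/q)^j from \<open>Q_vec_hook\<close> are the coefficients of the product
  of the \<open>A_col\<close>, so the sum over j is a coefficient of a product that splits over the
  colours. The factor q^(n-k) is what q to the power n(\<mu>) leaves after the denominator of the
  column function is cancelled.\<close>

lemma unipotent_char_hook_fps:
  fixes lam :: "'a :: {field, finite} phistar \<Rightarrow> nat list"
  assumes k: "k \<le> n" and lam: "lam \<in> cpartitions n"
    and \<Psi>: "finite \<Psi>" "\<And>\<phi>. phistar_size \<phi> \<le> n \<Longrightarrow> \<phi> \<in> \<Psi>"
  shows "unipotent_char lam (k # replicate (n - k) 1) =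
    of_nat CARD('a) ^ (n - k) * qfact (of_nat CARD('a)) (n - k) *
    fps_nth (\<Prod>\<phi>\<in>\<Psi>. A_col \<phi> * rho (col.s \<phi> (map int (lam \<phi>)))) (n - k)"
proof -
  define N where "N = n - k"
  let ?q = "of_nat CARD('a) :: complex"
  let ?\<alpha> = "\<lambda>\<phi>. map int (lam \<phi>)"
  let ?S = "S_vec ?\<alpha>"
  have fin: "finite {\<phi>. lam \<phi> \<noteq> []}" and weight: "cweight lam = n" and part: "0 \<notin> set (lam \<phi>)" for \<phi>
    using lam by (auto simp: cpartitions_def cpartition_def is_partition_def)
  have sub: "{\<phi>. ?\<alpha> \<phi> \<noteq> []} \<subseteq> \<Psi>"
    using phistar_size_le_cweight[OF fin _ part] by (auto simp: weight intro!: \<Psi>(2))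
  have hom: "homog (int n) ?S"
    using homog_S_vec[of ?\<alpha>] fin by (simp add: weight_seq_map_int weight)
  have real: "cnj (qfact ?q N / ?q ^ (N choose 2)) = qfact ?q N / ?q ^ (N choose 2)"
    "cnj ((- 1 / ?q) ^ j) = (- 1 / ?q) ^ j" for j
    by (simp_all add: qfact_def)
  have "inner_FG ?S (q_ser (k + j) * e_ser (N - j)) = fps_nth (rho ?S) (N - j)" if "j \<le> N" for j
  proof (rule inner_FG_q_e)
    have "k + j + (N - j) = n" using that k by (simp add: N_def)
    then show "homog (int (k + j + (N - j))) ?S" using hom by simp
  qed
  then have "inner_FG ?S (Q_vec (k # replicate N 1)) =
      qfact ?q N / ?q ^ (N choose 2) * (\<Sum>j\<le>N. (- 1 / ?q) ^ j * fps_nth (rho ?S) (N - j))"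
    unfolding Q_vec_hook inner_FG_scalar_right inner_FG_sum_right real by (simp cong: sum.cong_simp)
  also have "(\<Sum>j\<le>N. (- 1 / ?q) ^ j * fps_nth (rho ?S) (N - j)) = fps_nth ((\<Prod>\<phi>\<in>\<Psi>. A_col \<phi>) * rho ?S) N"
    unfolding fps_mult_nth atLeast0AtMost
    by (intro sum.cong refl) (use prod_A_col[OF \<Psi>, of _] in \<open>simp add: N_def\<close>)
  also have "(\<Prod>\<phi>\<in>\<Psi>. A_col \<phi>) * rho ?S = (\<Prod>\<phi>\<in>\<Psi>. A_col \<phi> * rho (col.s \<phi> (?\<alpha> \<phi>)))"
    unfolding S_vec_eq_prod_superset[OF \<Psi>(1) sub] rho_prod prod.distrib ..
  finally have inner: "inner_FG ?S (Q_vec (k # replicate N 1)) = qfact ?q N / ?q ^ (N choose 2) *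
      fps_nth (\<Prod>\<phi>\<in>\<Psi>. A_col \<phi> * rho (col.s \<phi> (?\<alpha> \<phi>))) N" .
  have "?q ^ (Suc N choose 2) = ?q ^ N * ?q ^ (N choose 2)"
    by (simp add: Suc_choose_two power_add)
  then show ?thesis
    unfolding unipotent_char_def N_def[symmetric] n_part_hook inner
    using of_nat_CARD_neq_0[where 'a = 'a] by simp
qed

text \<open>The shifts by X^W and X^n turn the coefficient of X^(n-k) into that of X^(W-k) in the
  product of the \<open>R_ser\<close>. There the sign exponent W + (W - k) has the parity of k, and
  q^W q^-(W-k) = q^k completes q^(n-k) to q^n.\<close>

lemma prod_C_ser_nth:
  fixes \<Psi> :: "'a :: {field, finite} phistar set" and \<alpha> :: "'a phistar \<Rightarrow> int list"
    and \<tau> :: "'a phistar \<Rightarrow> nat list"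
  assumes fin: "finite \<Psi>" and l: "\<And>\<phi>. sum_list (\<alpha> \<phi>) = int (l \<phi>)"
    and len: "\<And>\<phi>. \<phi> \<in> \<Psi> \<Longrightarrow> length (\<tau> \<phi>) = length (\<alpha> \<phi>)"
    and n: "(\<Sum>\<phi>\<in>\<Psi>. phistar_size \<phi> * l \<phi>) = n" and W: "(\<Sum>\<phi>\<in>\<Psi>. phistar_size \<phi> * sum_list (\<tau> \<phi>)) = W"
    and k: "k \<le> n"
  shows "of_nat CARD('a) ^ (n - k) * fps_nth (\<Prod>\<phi>\<in>\<Psi>. C_ser \<phi> (l \<phi>) (\<alpha> \<phi>) (\<tau> \<phi>)) (n - k) =
    (-1) ^ k * of_nat CARD('a) ^ n * (if W < k then 0 else
    (\<Sum>g | g \<in> PiE \<Psi> (\<lambda>_. {..W - k}) \<and> (\<Sum>\<phi>\<in>\<Psi>. phistar_size \<phi> * g \<phi>) = W - k.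
      (\<Prod>\<phi>\<in>\<Psi>. spec (col.s \<phi> (map2 (\<lambda>a t. a - int t) (\<alpha> \<phi>) (\<tau> \<phi>) @ [int (g \<phi>)])))))"
proof -
  let ?q = "of_nat CARD('a) :: complex"
  let ?C = "\<Prod>\<phi>\<in>\<Psi>. C_ser \<phi> (l \<phi>) (\<alpha> \<phi>) (\<tau> \<phi>)" and ?R = "\<Prod>\<phi>\<in>\<Psi>. R_ser \<phi> (\<alpha> \<phi>) (\<tau> \<phi>)"
  have "(\<Prod>\<phi>\<in>\<Psi>. fps_X ^ (phistar_size \<phi> * sum_list (\<tau> \<phi>)) * C_ser \<phi> (l \<phi>) (\<alpha> \<phi>) (\<tau> \<phi>)) =
      (\<Prod>\<phi>\<in>\<Psi>. fps_X ^ (phistar_size \<phi> * l \<phi>) * R_ser \<phi> (\<alpha> \<phi>) (\<tau> \<phi>))"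
    by (intro prod.cong refl C_ser_eq_R_ser l len)
  then have "fps_X ^ W * ?C = fps_X ^ n * ?R"
    unfolding prod.distrib power_sum[symmetric] n W .
  \<comment> \<open>The position W + (n - k) equals n + (W - k) when k \<le> W; for W < k it lies
    below n, and the coefficient on the right is 0.\<close>
  then have "fps_nth (fps_X ^ W * ?C) (W + (n - k)) = fps_nth (fps_X ^ n * ?R) (W + (n - k))"
    by (rule arg_cong)
  moreover have "fps_nth ?C (n - k) = (if W < k then 0 else fps_nth ?R (W - k))"
    if "fps_nth (fps_X ^ W * ?C) (W + (n - k)) = fps_nth (fps_X ^ n * ?R) (W + (n - k))"
  proof -
    have "W + (n - k) - W = n - k" "\<not> W + (n - k) < W" "W + (n - k) < n \<longleftrightarrow> W < k" "W + (n - k) - n = W - k"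
      using k by arith+
    then show ?thesis using that by (simp only: fps_X_power_mult_nth if_False)
  qed
  ultimately have C: "fps_nth ?C (n - k) = (if W < k then 0 else fps_nth ?R (W - k))" by blast
  show ?thesis
  proof (cases "W < k")
    case True
    then show ?thesis by (simp add: C)
  next
    case False
    then have Wk: "k \<le> W" by simp
    have q: "?q ^ W * inverse ?q ^ (W - k) = ?q ^ k"
    proof -
      have "?q ^ W * inverse ?q ^ (W - k) = ?q ^ k * (?q ^ (W - k) * inverse ?q ^ (W - k))"
        using Wk by (simp flip: power_add mult.assoc)
      also have "?q ^ (W - k) * inverse ?q ^ (W - k) = 1"
        unfolding power_mult_distrib[symmetric] using of_nat_CARD_neq_0[where 'a = 'a] by simp
      finally show ?thesis by simp
    qed
    have "even (W + (W - k)) = even k" using Wk by (simp add: even_diff_nat)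
    then have sign: "(-1) ^ (W + (W - k)) = ((-1) ^ k :: complex)"
      by (simp only: minus_one_power_iff)
    have "?q ^ n = ?q ^ (n - k) * ?q ^ k" using k by (simp flip: power_add)
    then show ?thesis
      unfolding C if_not_P[OF False] prod_R_ser_nth[OF fin] W sign mult.assoc[of "(-1) ^ k"] q
        sum_distrib_left[symmetric] by simp
  qed
qed

text \<open>The formula over a finite set of colours, with the degrees still written as
  specializations.\<close>

lemma hook_expansion:
  fixes lam :: "'a :: {field, finite} phistar \<Rightarrow> nat list" and k n :: nat and \<Psi> :: "'a phistar set"
  defines "L \<equiv> \<lambda>\<phi>. lowerings (map int (lam \<phi>))"
  defines "W \<equiv> \<lambda>\<tau>. \<Sum>\<phi>\<in>\<Psi>. phistar_size \<phi> * sum_list (\<tau> \<phi>)"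
  assumes k: "k \<le> n" and lam: "lam \<in> cpartitions n"
    and \<Psi>: "finite \<Psi>" "\<And>\<phi>. phistar_size \<phi> \<le> n \<Longrightarrow> \<phi> \<in> \<Psi>"
  shows "unipotent_char lam (k # replicate (n - k) 1) =
    (-1) ^ k * of_nat CARD('a) ^ n *
    (\<Sum>\<tau>\<in>PiE \<Psi> L. (\<Prod>\<phi>\<in>\<Psi>. prod_list (map (B_factor (qphi \<phi>)) (\<tau> \<phi>))) * (if W \<tau> < k then 0 else
      (\<Sum>g | g \<in> PiE \<Psi> (\<lambda>_. {..W \<tau> - k}) \<and> (\<Sum>\<phi>\<in>\<Psi>. phistar_size \<phi> * g \<phi>) = W \<tau> - k.
      qfact (of_nat CARD('a)) (n - k) *
      (\<Prod>\<phi>\<in>\<Psi>. spec (col.s \<phi> (map2 (\<lambda>a t. a - int t) (map int (lam \<phi>)) (\<tau> \<phi>) @ [int (g \<phi>)]))))))"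
proof -
  let ?q = "of_nat CARD('a) :: complex"
  let ?\<alpha> = "\<lambda>\<phi>. map int (lam \<phi>)"
  let ?b = "\<lambda>\<tau>. \<Prod>\<phi>\<in>\<Psi>. prod_list (map (B_factor (qphi \<phi>)) (\<tau> \<phi>))"
  let ?C = "\<lambda>\<tau>. \<Prod>\<phi>\<in>\<Psi>. C_ser \<phi> (sum_list (lam \<phi>)) (?\<alpha> \<phi>) (\<tau> \<phi>)"
  have fin: "finite {\<phi>. lam \<phi> \<noteq> []}" and weight: "cweight lam = n" and part: "0 \<notin> set (lam \<phi>)" for \<phi>
    using lam by (auto simp: cpartitions_def cpartition_def is_partition_def)
  have sub: "{\<phi>. lam \<phi> \<noteq> []} \<subseteq> \<Psi>"
    using phistar_size_le_cweight[OF fin _ part] by (auto simp: weight intro!: \<Psi>(2))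
  have n: "(\<Sum>\<phi>\<in>\<Psi>. phistar_size \<phi> * sum_list (lam \<phi>)) = n"
    using cweight_superset[OF \<Psi>(1) sub] weight by simp
  have "(\<Prod>\<phi>\<in>\<Psi>. A_col \<phi> * rho (col.s \<phi> (?\<alpha> \<phi>))) =
      (\<Prod>\<phi>\<in>\<Psi>. \<Sum>\<tau>\<in>L \<phi>. fps_const (prod_list (map (B_factor (qphi \<phi>)) \<tau>)) * C_ser \<phi> (sum_list (lam \<phi>)) (?\<alpha> \<phi>) \<tau>)"
    unfolding L_def by (intro prod.cong refl A_col_mult_rho) (auto simp: sum_list_map_int)
  also have "\<dots> = (\<Sum>\<tau>\<in>PiE \<Psi> L. \<Prod>\<phi>\<in>\<Psi>. fps_const (prod_list (map (B_factor (qphi \<phi>)) (\<tau> \<phi>))) *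
      C_ser \<phi> (sum_list (lam \<phi>)) (?\<alpha> \<phi>) (\<tau> \<phi>))"
    by (rule prod_sum_PiE) (auto simp: \<Psi>(1) L_def finite_lowerings)
  also have "\<dots> = (\<Sum>\<tau>\<in>PiE \<Psi> L. fps_const (?b \<tau>) * ?C \<tau>)"
    unfolding prod.distrib ring_hom_fun_prod[OF ring_hom_fps_const] ..
  finally have P: "(\<Prod>\<phi>\<in>\<Psi>. A_col \<phi> * rho (col.s \<phi> (?\<alpha> \<phi>))) = (\<Sum>\<tau>\<in>PiE \<Psi> L. fps_const (?b \<tau>) * ?C \<tau>)" .
  have "unipotent_char lam (k # replicate (n - k) 1) = ?q ^ (n - k) * qfact ?q (n - k) *
      fps_nth (\<Sum>\<tau>\<in>PiE \<Psi> L. fps_const (?b \<tau>) * ?C \<tau>) (n - k)"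
    unfolding P[symmetric] by (rule unipotent_char_hook_fps[OF k lam \<Psi>])
  also have "\<dots> = (\<Sum>\<tau>\<in>PiE \<Psi> L. qfact ?q (n - k) * ?b \<tau> * (?q ^ (n - k) * fps_nth (?C \<tau>) (n - k)))"
    unfolding fps_sum_nth fps_mult_left_const_nth sum_distrib_left
    by (simp only: mult_ac)
  also have "\<dots> = (\<Sum>\<tau>\<in>PiE \<Psi> L. qfact ?q (n - k) * ?b \<tau> * ((-1) ^ k * ?q ^ n * (if W \<tau> < k then 0 else
      (\<Sum>g | g \<in> PiE \<Psi> (\<lambda>_. {..W \<tau> - k}) \<and> (\<Sum>\<phi>\<in>\<Psi>. phistar_size \<phi> * g \<phi>) = W \<tau> - k.
      (\<Prod>\<phi>\<in>\<Psi>. spec (col.s \<phi> (map2 (\<lambda>a t. a - int t) (?\<alpha> \<phi>) (\<tau> \<phi>) @ [int (g \<phi>)])))))))"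
  proof (rule sum.cong[OF refl], subst prod_C_ser_nth[OF \<Psi>(1) _ _ n _ k])
    show "sum_list (?\<alpha> \<phi>) = int (sum_list (lam \<phi>))" for \<phi> by (rule sum_list_map_int)
    show "(\<Sum>\<phi>\<in>\<Psi>. phistar_size \<phi> * sum_list (\<tau> \<phi>)) = W \<tau>" for \<tau> by (simp add: W_def)
    show "length (\<tau> \<phi>) = length (?\<alpha> \<phi>)" if "\<tau> \<in> PiE \<Psi> L" "\<phi> \<in> \<Psi>" for \<tau> \<phi>
      using that by (auto simp: L_def lowerings_def dest: PiE_mem)
  qed simp
  also have "\<dots> = (-1) ^ k * ?q ^ n * (\<Sum>\<tau>\<in>PiE \<Psi> L. ?b \<tau> * (if W \<tau> < k then 0 else
      (\<Sum>g | g \<in> PiE \<Psi> (\<lambda>_. {..W \<tau> - k}) \<and> (\<Sum>\<phi>\<in>\<Psi>. phistar_size \<phi> * g \<phi>) = W \<tau> - k. qfact ?q (n - k) *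
      (\<Prod>\<phi>\<in>\<Psi>. spec (col.s \<phi> (map2 (\<lambda>a t. a - int t) (?\<alpha> \<phi>) (\<tau> \<phi>) @ [int (g \<phi>)]))))))"
    unfolding sum_distrib_left[of "(-1) ^ k * ?q ^ n"] sum_distrib_left[of "qfact ?q (n - k)", symmetric]
    by (rule sum.cong[OF refl]) (simp add: mult_ac)
  finally show ?thesis .
qed

section \<open>From functions on finitely many colours back to coloured compositions\<close>

lemma list_all2_le_sum_list: "list_all2 (\<le>) xs ys \<Longrightarrow> sum_list xs \<le> sum_list (ys :: nat list)"
  by (induction rule: list_all2_induct) auto

lemma lowerings_map_int:
  "\<tau> \<in> lowerings (map int xs) \<longleftrightarrow> length \<tau> = length xs \<and> 0 \<notin> set \<tau> \<and> list_all2 (\<le>) \<tau> (underline xs)"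
proof (cases "length \<tau> = length xs")
  case True
  have "(\<forall>i<length xs. 1 \<le> \<tau> ! i) \<longleftrightarrow> 0 \<notin> set \<tau>"
    using True by (metis in_set_conv_nth less_one not_le)
  moreover have "int (\<tau> ! i) \<le> map int xs ! i + int (length xs - i) \<longleftrightarrow> \<tau> ! i \<le> underline xs ! i"
    if "i < length xs" for i
    using that by (simp add: underline_def) arith
  ultimately show ?thesis
    using True by (auto simp: lowerings_def list_all2_conv_all_nth underline_def)
qed (simp add: lowerings_def)

lemma subcompositions_eq:
  "subcompositions lam = {\<tau>. \<forall>\<phi>. \<tau> \<phi> \<in> lowerings (map int (lam \<phi>))}"
  by (simp add: subcompositions_def lowerings_map_int)

lemma subcomposition_Nil_iff: "\<tau> \<in> subcompositions lam \<Longrightarrow> \<tau> \<phi> = [] \<longleftrightarrow> lam \<phi> = []"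
  unfolding subcompositions_def by (metis (mono_tags, lifting) length_0_conv mem_Collect_eq)

text \<open>Bounds the weights of all \<tau>, and hence of all \<rho>, so that one finite set of
  colours serves the whole double sum.\<close>

lemma cweight_subcomposition_le:
  assumes "finite {\<phi>. lam \<phi> \<noteq> []}" "\<tau> \<in> subcompositions lam"
  shows "cweight \<tau> \<le> cweight (\<lambda>\<phi>. underline (lam \<phi>))"
proof -
  have "{\<phi>. \<tau> \<phi> \<noteq> []} \<subseteq> {\<phi>. lam \<phi> \<noteq> []}" "{\<phi>. underline (lam \<phi>) \<noteq> []} \<subseteq> {\<phi>. lam \<phi> \<noteq> []}"
    by (auto simp: subcomposition_Nil_iff[OF assms(2)] underline_def)
  then show ?thesis
    using assms by (auto simp: cweight_superset[OF assms(1)] subcompositions_def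
        intro!: sum_mono list_all2_le_sum_list)
qed

lemma B_coeff_superset:
  fixes \<tau> :: "'a :: {field, finite} phistar \<Rightarrow> nat list"
  assumes "finite \<Psi>" "{\<phi>. \<tau> \<phi> \<noteq> []} \<subseteq> \<Psi>"
  shows "B_coeff \<tau> = (\<Prod>\<phi>\<in>\<Psi>. prod_list (map (B_factor (qphi \<phi>)) (\<tau> \<phi>)))"
proof -
  have "(\<Prod>i<length xs. f (xs ! i)) = prod_list (map f xs)" for f :: "nat \<Rightarrow> complex" and xs
    by (induction xs) (simp_all add: prod.lessThan_Suc_shift del: prod.lessThan_Suc)
  then have "B_coeff \<tau> = (\<Prod>\<phi> | \<tau> \<phi> \<noteq> []. prod_list (map (B_factor (qphi \<phi>)) (\<tau> \<phi>)))"
    unfolding B_coeff_def qphi_def by simp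
  also have "\<dots> = (\<Prod>\<phi>\<in>\<Psi>. prod_list (map (B_factor (qphi \<phi>)) (\<tau> \<phi>)))"
    by (rule prod.mono_neutral_left) (use assms in auto)
  finally show ?thesis .
qed

text \<open>The weight of the sequence is n - ||\<tau>|| + ||\<rho>|| = n - k, the same for all
  \<tau> and \<rho>. Where \<rho>(\<phi>) is empty, the letter 0 may be appended without effect, so
  that every colour has exactly one last letter.\<close>

lemma degree_seq_rho_prime:
  fixes lam \<tau> \<rho> :: "'a :: {field, finite} phistar \<Rightarrow> nat list"
  assumes \<Psi>: "finite \<Psi>" and supp: "{\<phi>. lam \<phi> \<noteq> []} \<subseteq> \<Psi>" "{\<phi>. \<rho> \<phi> \<noteq> []} \<subseteq> \<Psi>"
    and \<tau>: "\<tau> \<in> subcompositions lam" and k: "k \<le> cweight lam"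
    and weight: "cweight \<rho> + k = cweight \<tau>" and len: "\<And>\<phi>. length (\<rho> \<phi>) \<le> 1"
  shows "degree_seq (rho_prime lam \<tau> \<rho>) = qfact (of_nat CARD('a)) (cweight lam - k) *
    (\<Prod>\<phi>\<in>\<Psi>. spec (col.s \<phi> (map2 (\<lambda>a t. a - int t) (map int (lam \<phi>)) (\<tau> \<phi>) @ [int (sum_list (\<rho> \<phi>))])))"
proof -
  have len\<tau>: "length (\<tau> \<phi>) = length (lam \<phi>)" for \<phi>
    using \<tau> by (simp add: subcompositions_def)
  have supp\<tau>: "{\<phi>. \<tau> \<phi> \<noteq> []} \<subseteq> \<Psi>"
    using supp(1) by (simp add: subcomposition_Nil_iff[OF \<tau>])
  have map2: "map2 (\<lambda>a b. int a - int b) xs ys = map2 (\<lambda>a t. a - int t) (map int xs) ys" for xs ys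
    by (auto simp: zip_map1)
  have suppr: "{\<phi>. rho_prime lam \<tau> \<rho> \<phi> \<noteq> []} \<subseteq> \<Psi>"
    using supp by (auto simp: rho_prime_def)
  then have finr: "finite {\<phi>. rho_prime lam \<tau> \<rho> \<phi> \<noteq> []}"
    using \<Psi> by (rule finite_subset)
  have s: "col.s \<phi> (rho_prime lam \<tau> \<rho> \<phi>) =
      col.s \<phi> (map2 (\<lambda>a t. a - int t) (map int (lam \<phi>)) (\<tau> \<phi>) @ [int (sum_list (\<rho> \<phi>))])" for \<phi>
    using len[of \<phi>] unfolding rho_prime_def map2
    by (cases "\<rho> \<phi>") (auto simp: col.s_snoc_zero)
  have sum: "sum_list (rho_prime lam \<tau> \<rho> \<phi>) =
      int (sum_list (lam \<phi>)) - int (sum_list (\<tau> \<phi>)) + int (sum_list (\<rho> \<phi>))" for \<phi>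
  proof -
    have "sum_list (map2 (\<lambda>a b. int a - int b) xs ys) = int (sum_list xs) - int (sum_list ys)"
      if "length ys = length xs" for xs ys :: "nat list"
      using that by (induction ys xs rule: list_induct2) auto
    then show ?thesis using len\<tau> by (simp add: rho_prime_def sum_list_map_int)
  qed
  have "weight_seq (rho_prime lam \<tau> \<rho>) = int (cweight lam) - int (cweight \<tau>) + int (cweight \<rho>)"
    unfolding weight_seq_superset[OF \<Psi> suppr] cweight_superset[OF \<Psi> supp(1)]
      cweight_superset[OF \<Psi> supp(2)] cweight_superset[OF \<Psi> supp\<tau>] sum
    by (simp add: sum.distrib sum_subtractf algebra_simps)
  also have "\<dots> = int (cweight lam - k)"
    using weight k by linarith
  finally have "degree_seq (rho_prime lam \<tau> \<rho>) =
      qfact (of_nat CARD('a)) (cweight lam - k) * spec (S_vec (rho_prime lam \<tau> \<rho>))"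
    by (rule degree_seq_eq[OF finr])
  then show ?thesis
    unfolding S_vec_eq_prod_superset[OF \<Psi> suppr] spec_prod s .
qed

theorem proposition3p11:
  fixes lam :: "'a :: {field, finite} phistar \<Rightarrow> nat list" and k n :: nat
  assumes "1 \<le> k" and "k \<le> n" and "lam \<in> cpartitions n"
  shows "unipotent_char lam (k # replicate (n - k) 1) =
    (-1) ^ k * of_nat CARD('a) ^ n *
    (\<Sum>\<tau>\<in>subcompositions lam. B_coeff \<tau> *
      (\<Sum>\<rho> | cpartition \<rho> \<and> cweight \<rho> + k = cweight \<tau> \<and> (\<forall>\<phi>. length (\<rho> \<phi>) \<le> 1).
        degree_seq (rho_prime lam \<tau> \<rho>)))"
proof -
  let ?q = "of_nat CARD('a) :: complex"
  define L where "L = (\<lambda>\<phi>. lowerings (map int (lam \<phi>)))"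
  \<comment> \<open>Large enough to contain the colours of \<open>lam\<close> and of every \<rho>
    that can occur, whose weight is at most that of some \<tau>.\<close>
  define \<Psi> where "\<Psi> = {\<phi> :: 'a phistar. phistar_size \<phi> \<le> n + cweight (\<lambda>\<phi>. underline (lam \<phi>))}"
  define W where "W = (\<lambda>\<tau> :: 'a phistar \<Rightarrow> nat list. \<Sum>\<phi>\<in>\<Psi>. phistar_size \<phi> * sum_list (\<tau> \<phi>))"
  define G where "G = (\<lambda>M. {g. g \<in> PiE \<Psi> (\<lambda>_. {..M}) \<and> (\<Sum>\<phi>\<in>\<Psi>. phistar_size \<phi> * g \<phi>) = M})"
  define D where "D = (\<lambda>\<tau> g. \<Prod>\<phi>\<in>\<Psi>. spec (col.s \<phi>
    (map2 (\<lambda>a t. a - int t) (map int (lam \<phi>)) (\<tau> \<phi>) @ [int (g \<phi>)])))"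
  define b where "b = (\<lambda>\<tau>. \<Prod>\<phi>\<in>\<Psi>. prod_list (map (B_factor (qphi \<phi>)) (\<tau> \<phi>)))"
  have fin\<Psi>: "finite \<Psi>" unfolding \<Psi>_def by (rule finite_phistar_size_le)
  have fin: "finite {\<phi>. lam \<phi> \<noteq> []}" and weight: "cweight lam = n" and part: "0 \<notin> set (lam \<phi>)" for \<phi>
    using assms(3) by (auto simp: cpartitions_def cpartition_def is_partition_def)
  have sub: "{\<phi>. lam \<phi> \<noteq> []} \<subseteq> \<Psi>"
    using phistar_size_le_cweight[OF fin _ part] by (auto simp: weight \<Psi>_def intro: trans_le_add1)
  have sub\<tau>: "{\<phi>. \<tau> \<phi> \<noteq> []} \<subseteq> \<Psi>" if "\<tau> \<in> subcompositions lam" for \<tau>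
  proof
    fix \<phi> assume "\<phi> \<in> {\<phi>. \<tau> \<phi> \<noteq> []}"
    then have "lam \<phi> \<noteq> []" by (simp add: subcomposition_Nil_iff[OF that])
    then show "\<phi> \<in> \<Psi>" using sub by blast
  qed
  have inner: "(\<Sum>\<rho> | cpartition \<rho> \<and> cweight \<rho> + k = cweight \<tau> \<and> (\<forall>\<phi>. length (\<rho> \<phi>) \<le> 1).
      degree_seq (rho_prime lam \<tau> \<rho>)) = (if W \<tau> < k then 0 else (\<Sum>g\<in>G (W \<tau> - k). qfact ?q (n - k) * D \<tau> g))"
    if \<tau>: "\<tau> \<in> subcompositions lam" for \<tau>
  proof -
    let ?R = "{\<rho> :: 'a phistar \<Rightarrow> nat list. cpartition \<rho> \<and> cweight \<rho> + k = cweight \<tau> \<and> (\<forall>\<phi>. length (\<rho> \<phi>) \<le> 1)}"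
    have W: "cweight \<tau> = W \<tau>"
      unfolding W_def by (rule cweight_superset[OF fin\<Psi> sub\<tau>[OF \<tau>]])
    have sub\<rho>: "{\<phi>. \<rho> \<phi> \<noteq> []} \<subseteq> \<Psi>" if "\<rho> \<in> ?R" for \<rho>
    proof
      fix \<phi> assume "\<phi> \<in> {\<phi>. \<rho> \<phi> \<noteq> []}"
      then have "phistar_size \<phi> \<le> cweight \<rho>"
        using that by (intro phistar_size_le_cweight) (auto simp: cpartition_def is_partition_def)
      also have "\<dots> \<le> cweight \<tau>" using that by auto
      also have "\<dots> \<le> cweight (\<lambda>\<phi>. underline (lam \<phi>))" by (rule cweight_subcomposition_le[OF fin \<tau>])
      finally show "\<phi> \<in> \<Psi>" by (simp add: \<Psi>_def)
    qed
    show ?thesis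
    proof (cases "W \<tau> < k")
      case True
      then have "?R = {}" by (auto simp: W)
      with True show ?thesis by (simp only: sum.empty if_True)
    next
      case False
      have "(\<Sum>\<rho>\<in>?R. degree_seq (rho_prime lam \<tau> \<rho>)) = (\<Sum>g\<in>G (W \<tau> - k). qfact ?q (n - k) * D \<tau> g)"
      \<comment> \<open>A \<rho> with at most one part per colour corresponds to its function of
        part sizes; the empty partition corresponds to 0, which cannot be a part.\<close>
      proof (rule sum.reindex_bij_witness[where j = "\<lambda>\<rho>. restrict (\<lambda>\<phi>. sum_list (\<rho> \<phi>)) \<Psi>"
            and i = "\<lambda>g \<phi>. if \<phi> \<in> \<Psi> \<and> g \<phi> \<noteq> 0 then [g \<phi>] else []"])
        fix \<rho> assume \<rho>: "\<rho> \<in> ?R"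
        have single: "\<rho> \<phi> = (if sum_list (\<rho> \<phi>) \<noteq> 0 then [sum_list (\<rho> \<phi>)] else [])" for \<phi>
        proof -
          have "length (\<rho> \<phi>) \<le> 1" "0 \<notin> set (\<rho> \<phi>)"
            using \<rho> by (auto simp: cpartition_def is_partition_def)
          then show ?thesis by (cases "\<rho> \<phi>") auto
        qed
        show "(\<lambda>\<phi>. if \<phi> \<in> \<Psi> \<and> restrict (\<lambda>\<phi>. sum_list (\<rho> \<phi>)) \<Psi> \<phi> \<noteq> 0
            then [restrict (\<lambda>\<phi>. sum_list (\<rho> \<phi>)) \<Psi> \<phi>] else []) = \<rho>"
        proof
          fix \<phi>
          show "(if \<phi> \<in> \<Psi> \<and> restrict (\<lambda>\<phi>. sum_list (\<rho> \<phi>)) \<Psi> \<phi> \<noteq> 0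
            then [restrict (\<lambda>\<phi>. sum_list (\<rho> \<phi>)) \<Psi> \<phi>] else []) = \<rho> \<phi>"
          proof (cases "\<phi> \<in> \<Psi>")
            case True
            then show ?thesis using single[of \<phi>, symmetric] by (simp only: restrict_apply if_True simp_thms)
          next
            case False
            then have "\<rho> \<phi> = []" using sub\<rho>[OF \<rho>] by blast
            with False show ?thesis by simp
          qed
        qed
        have M: "(\<Sum>\<phi>\<in>\<Psi>. phistar_size \<phi> * sum_list (\<rho> \<phi>)) = W \<tau> - k"
        proof -
          have "cweight \<rho> + k = W \<tau>" using \<rho> W by simp
          then show ?thesis using cweight_superset[OF fin\<Psi> sub\<rho>[OF \<rho>]] by linarith
        qed
        have "sum_list (\<rho> \<phi>) \<le> W \<tau> - k" if "\<phi> \<in> \<Psi>" for \<phi>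
        proof -
          have "sum_list (\<rho> \<phi>) \<le> phistar_size \<phi> * sum_list (\<rho> \<phi>)"
            using phistar_size_pos[of \<phi>] by simp
          also have "\<dots> \<le> W \<tau> - k"
            unfolding M[symmetric] by (rule member_le_sum) (use that fin\<Psi> in auto)
          finally show ?thesis .
        qed
        then show "restrict (\<lambda>\<phi>. sum_list (\<rho> \<phi>)) \<Psi> \<in> G (W \<tau> - k)"
          using M by (auto simp: G_def)
        have "degree_seq (rho_prime lam \<tau> \<rho>) = qfact ?q (n - k) * D \<tau> (\<lambda>\<phi>. sum_list (\<rho> \<phi>))"
          unfolding D_def weight[symmetric]
          by (rule degree_seq_rho_prime[OF fin\<Psi> sub sub\<rho>[OF \<rho>] \<tau>]) (use \<rho> assms weight in auto)
        then show "qfact ?q (n - k) * D \<tau> (restrict (\<lambda>\<phi>. sum_list (\<rho> \<phi>)) \<Psi>) = degree_seq (rho_prime lam \<tau> \<rho>)"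
          by (simp add: D_def)
      next
        fix g assume g: "g \<in> G (W \<tau> - k)"
        let ?\<rho> = "\<lambda>\<phi>. if \<phi> \<in> \<Psi> \<and> g \<phi> \<noteq> 0 then [g \<phi>] else []"
        have sum: "sum_list (?\<rho> \<phi>) = g \<phi>" if "\<phi> \<in> \<Psi>" for \<phi> using that by simp
        have supp: "{\<phi>. ?\<rho> \<phi> \<noteq> []} \<subseteq> \<Psi>" by auto
        then have "finite {\<phi>. ?\<rho> \<phi> \<noteq> []}" using fin\<Psi> by (rule finite_subset)
        moreover have "cweight ?\<rho> = W \<tau> - k"
        proof -
          have "cweight ?\<rho> = (\<Sum>\<phi>\<in>\<Psi>. phistar_size \<phi> * g \<phi>)"
            unfolding cweight_superset[OF fin\<Psi> supp] by (intro sum.cong refl arg_cong2[where f = "(*)"] sum)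
          then show ?thesis using g by (simp add: G_def)
        qed
        ultimately show "?\<rho> \<in> ?R"
          using False by (simp add: cpartition_def is_partition_def W)
        show "restrict (\<lambda>\<phi>. sum_list (?\<rho> \<phi>)) \<Psi> = g"
          using g by (intro ext) (auto simp: G_def PiE_def extensional_def)
      qed
      then show ?thesis using False by simp
    qed
  qed
  have "(\<Sum>\<tau>\<in>subcompositions lam. B_coeff \<tau> *
      (\<Sum>\<rho> | cpartition \<rho> \<and> cweight \<rho> + k = cweight \<tau> \<and> (\<forall>\<phi>. length (\<rho> \<phi>) \<le> 1).
        degree_seq (rho_prime lam \<tau> \<rho>))) =
      (\<Sum>\<tau>\<in>subcompositions lam. b \<tau> * (if W \<tau> < k then 0 else (\<Sum>g\<in>G (W \<tau> - k). qfact ?q (n - k) * D \<tau> g)))"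
    by (intro sum.cong refl) (simp only: inner B_coeff_superset[OF fin\<Psi> sub\<tau>] b_def)
  also have "\<dots> = (\<Sum>\<tau>\<in>PiE \<Psi> L. b \<tau> * (if W \<tau> < k then 0 else (\<Sum>g\<in>G (W \<tau> - k). qfact ?q (n - k) * D \<tau> g)))"
  \<comment> \<open>Outside \<Psi> both \<open>lam\<close> and \<tau> are empty, so \<tau> is
    determined by its restriction.\<close>
  proof (rule sum.reindex_bij_witness[where j = "\<lambda>\<tau>. restrict \<tau> \<Psi>"
        and i = "\<lambda>\<tau> \<phi>. if \<phi> \<in> \<Psi> then \<tau> \<phi> else []"])
    fix \<tau> assume \<tau>: "\<tau> \<in> subcompositions lam"
    show "(\<lambda>\<phi>. if \<phi> \<in> \<Psi> then restrict \<tau> \<Psi> \<phi> else []) = \<tau>"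
    proof
      fix \<phi>
      have "\<tau> \<phi> = []" if "\<phi> \<notin> \<Psi>" using sub\<tau>[OF \<tau>] that by blast
      then show "(if \<phi> \<in> \<Psi> then restrict \<tau> \<Psi> \<phi> else []) = \<tau> \<phi>" by (cases "\<phi> \<in> \<Psi>") simp_all
    qed
    show "restrict \<tau> \<Psi> \<in> PiE \<Psi> L"
      using \<tau> by (auto simp: subcompositions_eq L_def)
    have "b (restrict \<tau> \<Psi>) = b \<tau>" "W (restrict \<tau> \<Psi>) = W \<tau>" "D (restrict \<tau> \<Psi>) g = D \<tau> g" for g
      by (simp_all add: b_def W_def D_def)
    then show "b (restrict \<tau> \<Psi>) * (if W (restrict \<tau> \<Psi>) < k then 0
        else (\<Sum>g\<in>G (W (restrict \<tau> \<Psi>) - k). qfact ?q (n - k) * D (restrict \<tau> \<Psi>) g)) =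
      b \<tau> * (if W \<tau> < k then 0 else (\<Sum>g\<in>G (W \<tau> - k). qfact ?q (n - k) * D \<tau> g))"
      by (simp only:)
  next
    fix \<tau> assume \<tau>: "\<tau> \<in> PiE \<Psi> L"
    show "restrict (\<lambda>\<phi>. if \<phi> \<in> \<Psi> then \<tau> \<phi> else []) \<Psi> = \<tau>"
      using \<tau> by (intro ext) (auto simp: PiE_def extensional_def)
    have "lam \<phi> = []" if "\<phi> \<notin> \<Psi>" for \<phi> using sub that by blast
    then show "(\<lambda>\<phi>. if \<phi> \<in> \<Psi> then \<tau> \<phi> else []) \<in> subcompositions lam"
      using \<tau> by (auto simp: subcompositions_eq L_def lowerings_Nil dest: PiE_mem)
  qed
  also have "(-1) ^ k * ?q ^ n * \<dots> = unipotent_char lam (k # replicate (n - k) 1)"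
    unfolding b_def W_def G_def D_def L_def
    by (rule hook_expansion[OF assms(2,3) fin\<Psi>, symmetric]) (simp add: \<Psi>_def)
  finally show ?thesis ..
qed

end
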